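(* Let $E$ be a finite dimensional Hopf algebra over a field $k$, $A$ an $E$-module algebra, $B=A\ast E$, and $J\in E^*\otimes E^*\subset D\otimes D$ an invertible dual cocycle. (1) There is an equality of $HH^\bullet(A)$-bimodules $HH^\bullet(A,B_J)=HH^\bullet(A,B)$, which also holds at the cochain level. (2) There is an equality of dg algebras $C^\bullet(A,B)_J=C^\bullet(A,B_J)$ and also an equality of Hochschild cohomology rings $HH^\bullet(A,B)_J=HH^\bullet(A,B_J)$. (3) The equality of (2) gives the Hochschild cohomology $HH^\bullet(A,B_J)$ the natural structure of an object in the category $\mathrm{dg}D^J\mathrm{mod}$.
   Context: $k$ is a field, Sweedler notation. $B=A\ast E$ is the smash product, an algebra in the category $YD^E_E$ of right Yetter-Drinfeld modules via $b\cdot w=S(w_1)bw_2$ and coaction $aw\mapsto aw_1\otimes w_2$. $YD^E_E=D\mathrm{mod}$, $D$ the Drinfeld double, a quasitriangular Hopf algebra containing $E^{op}$ and $E^*$ as Hopf subalgebras, with $R=r_j\otimes r^j$ (sum suppressed), $\{r_j\}$ a basis of $E$ and $\{r^j\}$ the dual basis; $w\in E^{op}$ acts by $w\cdot m=m\cdot w$ and $\xi\in E^*$ by $\xi\cdot m=m_0\xi(m_1)$. An invertible dual cocycle (twist) is an invertible $J=J_l\otimes J^l\in E^*\otimes E^*$ (sum suppressed) with $(\Delta\otimes id)(J)(J\otimes1)=(id\otimes\Delta)(J)(1\otimes J)$ and $(\epsilon\otimes id)(J)=(id\otimes\epsilon)(J)=1$. For a (dg) algebra $\Omega$ in $D\mathrm{mod}$,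 $\Omega_J$ is $\Omega$ with new product $\omega\cdot_J\omega'=(J_l\cdot\omega)(J^l\cdot\omega')$. It is a (dg) algebra in modules over $D^J$, the Hopf algebra $D$ with coproduct $\Delta^J(h)=J^{-1}\Delta(h)J$, which is quasitriangular with $R$-matrix $J_{21}^{-1}RJ$. $\mathrm{dg}D^J\mathrm{mod}$ is the category of complexes of $D^J$-modules. $C^\bullet(A,M)$ is the usual Hochschild cochain complex, $C^n(A,M)=\mathrm{Hom}_k(A^{\otimes n},M)$; when $M\supset A$ is an algebra it is a dg algebra under the cup product. $HH^\bullet(A)$ (and $C^\bullet(A)=C^\bullet(A,A)$) acts by cup product. $C^\bullet(A,B)$ is a dg algebra in $YD^E_E$ by transport along the restriction isomorphism $C^\bullet_{c,E}(B)\cong C^\bullet(A,B)$, where $C^n_{c,E}(B)$ is the space of right $E$-linear maps $B^{\otimes_En}\to B$ ($B^{\otimes_E 0}=E$) with $D$-action $(h\cdot f)(x)=h_1\cdot f(S(h_2)\cdot x)$, and restriction is along $A^{\otimes n}\to B^{\otimes_En}$. In particular $(\xi\cdot f)(x)=\xi\cdot(f(x))$ for $\xi\in E^*$, $f\in C^\bullet(A,B)$. *)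

theory Defs
  imports HOL.Vector_Spaces "HOL-Library.Function_Algebras"
begin

text \<open>Vector spaces are subspaces \<open>carrier V\<close> of an ambient space with scalar multiplication
  \<open>scale V\<close>.  Function types carry the pointwise addition of \<^theory>\<open>HOL-Library.Function_Algebras\<close>.\<close>

section \<open>Vector spaces, tensor products, Hopf algebras\<close>

record ('k, 'v) vspace =
  carrier :: "'v set"
  scale :: "'k \<Rightarrow> 'v \<Rightarrow> 'v"

record ('k, 'v) alg = "('k, 'v) vspace" +
  mult :: "'v \<Rightarrow> 'v \<Rightarrow> 'v"  (infixl \<open>\<cdot>\<index>\<close> 70)
  unity :: "'v"

definition vec_space :: "('k::field, 'v::ab_group_add, 'z) vspace_scheme \<Rightarrow> bool" where
  "vec_space V \<longleftrightarrow> vector_space (scale V) \<and> module.subspace (scale V) (carrier V)"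

definition finite_dim :: "('k::field, 'v::ab_group_add, 'z) vspace_scheme \<Rightarrow> bool" where
  "finite_dim V \<longleftrightarrow>
     (\<exists>S. finite S \<and> S \<subseteq> carrier V \<and> module.span (scale V) S = carrier V)"

definition linear_on ::
  "('k::field, 'v::ab_group_add, 'y) vspace_scheme \<Rightarrow> ('k, 'w::ab_group_add, 'z) vspace_scheme
    \<Rightarrow> ('v \<Rightarrow> 'w) \<Rightarrow> bool" where
  "linear_on V W f \<longleftrightarrow>
     (\<forall>x\<in>carrier V. f x \<in> carrier W) \<and>
     (\<forall>x\<in>carrier V. \<forall>y\<in>carrier V. f (x + y) = f x + f y) \<and>
     (\<forall>c. \<forall>x\<in>carrier V. f (scale V c x) = scale W c (f x))"

definition bilinear_on ::
  "('k::field, 'u::ab_group_add, 'x) vspace_scheme \<Rightarrow> ('k, 'v::ab_group_add, 'y) vspace_scheme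
    \<Rightarrow> ('k, 'w::ab_group_add, 'z) vspace_scheme \<Rightarrow> ('u \<Rightarrow> 'v \<Rightarrow> 'w) \<Rightarrow> bool" where
  "bilinear_on U V W f \<longleftrightarrow>
     (\<forall>u\<in>carrier U. linear_on V W (f u)) \<and>
     (\<forall>v\<in>carrier V. linear_on U W (\<lambda>u. f u v))"

definition ground :: "('k::field, 'k) vspace" where
  "ground = \<lparr>carrier = UNIV, scale = (*)\<rparr>"

definition fscale :: "'k::field \<Rightarrow> ('x \<Rightarrow> 'k) \<Rightarrow> 'x \<Rightarrow> 'k" where
  "fscale c f = (\<lambda>x. c * f x)"

definition restr :: "'v set \<Rightarrow> ('v \<Rightarrow> 'w::zero) \<Rightarrow> 'v \<Rightarrow> 'w" where
  "restr X f = (\<lambda>x. if x \<in> X then f x else 0)"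

text \<open>Over a field, bilinear forms separate the points of \<open>V \<otimes> W\<close>.  So the tensor product is
  realized as the span of the evaluation functionals \<open>v \<otimes> w\<close> on the space of bilinear forms.\<close>

type_synonym ('k, 'v, 'w) tensor = "('v \<Rightarrow> 'w \<Rightarrow> 'k) \<Rightarrow> 'k"

definition tens ::
  "('k::field, 'v::ab_group_add, 'y) vspace_scheme \<Rightarrow> ('k, 'w::ab_group_add, 'z) vspace_scheme
    \<Rightarrow> 'v \<Rightarrow> 'w \<Rightarrow> ('k, 'v, 'w) tensor" where
  "tens V W v w = (\<lambda>\<beta>. if bilinear_on V W ground \<beta> then \<beta> v w else 0)"

definition tens_carrier ::
  "('k::field, 'v::ab_group_add, 'y) vspace_scheme \<Rightarrow> ('k, 'w::ab_group_add, 'z) vspace_scheme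
    \<Rightarrow> ('k, 'v, 'w) tensor set" where
  "tens_carrier V W = module.span fscale {tens V W v w | v w. v \<in> carrier V \<and> w \<in> carrier W}"

definition tens_space ::
  "('k::field, 'v::ab_group_add, 'y) vspace_scheme \<Rightarrow> ('k, 'w::ab_group_add, 'z) vspace_scheme
    \<Rightarrow> ('k, ('k, 'v, 'w) tensor) vspace" where
  "tens_space V W = \<lparr>carrier = tens_carrier V W, scale = fscale\<rparr>"

text \<open>The value at \<open>t\<close> of the linear map \<open>v \<otimes> w \<mapsto> \<phi> v w\<close> induced by a bilinear map \<open>\<phi>\<close>: if
  \<open>t = (\<Sum>i. v\<^sub>i \<otimes> w\<^sub>i)\<close>, it is \<open>\<Sum>i. \<phi> v\<^sub>i w\<^sub>i\<close>.  With \<open>t\<close> a coproduct of \<open>x\<close> this is Sweedler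
  notation \<open>\<phi> x\<^sub>1 x\<^sub>2\<close>.  The first version has explicit addition and zero of the target, for
  targets such as quotient spaces.  The value has no meaning if \<open>\<phi>\<close> is not bilinear.\<close>

definition lift_into ::
  "('u \<Rightarrow> 'u \<Rightarrow> 'u) \<Rightarrow> 'u \<Rightarrow> ('k::field, 'v::ab_group_add, 'y) vspace_scheme
    \<Rightarrow> ('k, 'w::ab_group_add, 'z) vspace_scheme \<Rightarrow> ('v \<Rightarrow> 'w \<Rightarrow> 'u) \<Rightarrow> ('k, 'v, 'w) tensor \<Rightarrow> 'u" where
  "lift_into add zero V W \<phi> t =
     (THE u. \<exists>ps. set ps \<subseteq> carrier V \<times> carrier W \<and>
        t = (\<Sum>(v, w)\<leftarrow>ps. tens V W v w) \<and>
        u = foldr (\<lambda>(v, w). add (\<phi> v w)) ps zero)"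

definition lift ::
  "('k::field, 'v::ab_group_add, 'y) vspace_scheme \<Rightarrow> ('k, 'w::ab_group_add, 'z) vspace_scheme
    \<Rightarrow> ('v \<Rightarrow> 'w \<Rightarrow> 'u::ab_group_add) \<Rightarrow> ('k, 'v, 'w) tensor \<Rightarrow> 'u" where
  "lift = lift_into (+) 0"

definition algebra :: "('k::field, 'v::ab_group_add, 'z) alg_scheme \<Rightarrow> bool" where
  "algebra A \<longleftrightarrow>
     vec_space A \<and> bilinear_on A A A (mult A) \<and> unity A \<in> carrier A \<and>
     (\<forall>x\<in>carrier A. \<forall>y\<in>carrier A. \<forall>z\<in>carrier A. x \<cdot>\<^bsub>A\<^esub> y \<cdot>\<^bsub>A\<^esub> z = x \<cdot>\<^bsub>A\<^esub> (y \<cdot>\<^bsub>A\<^esub> z)) \<and>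
     (\<forall>x\<in>carrier A. unity A \<cdot>\<^bsub>A\<^esub> x = x \<and> x \<cdot>\<^bsub>A\<^esub> unity A = x)"

definition tens_alg ::
  "('k::field, 'v::ab_group_add, 'y) alg_scheme \<Rightarrow> ('k, 'w::ab_group_add, 'z) alg_scheme
    \<Rightarrow> ('k, ('k, 'v, 'w) tensor) alg" where
  "tens_alg A B =
     \<lparr>carrier = tens_carrier A B, scale = fscale,
      mult = (\<lambda>s t. lift A B (\<lambda>a b. lift A B (\<lambda>a' b'. tens A B (a \<cdot>\<^bsub>A\<^esub> a') (b \<cdot>\<^bsub>B\<^esub> b')) t) s),
      unity = tens A B (unity A) (unity B)\<rparr>"

definition inverse_in :: "('k, 'v, 'z) alg_scheme \<Rightarrow> 'v \<Rightarrow> 'v \<Rightarrow> bool" where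
  "inverse_in A x y \<longleftrightarrow> y \<in> carrier A \<and> x \<cdot>\<^bsub>A\<^esub> y = unity A \<and> y \<cdot>\<^bsub>A\<^esub> x = unity A"

record ('k, 'v) hopf = "('k, 'v) alg" +
  comult :: "'v \<Rightarrow> ('k, 'v, 'v) tensor"
  counit :: "'v \<Rightarrow> 'k"
  antipode :: "'v \<Rightarrow> 'v"

text \<open>Triple tensors are bracketed to the left: \<open>id \<otimes> \<Delta>\<close> is composed with the associator.\<close>

definition comult_left ::
  "('k::field, 'v::ab_group_add, 'z) hopf_scheme \<Rightarrow> ('k, 'v, 'v) tensor
    \<Rightarrow> ('k, ('k, 'v, 'v) tensor, 'v) tensor" where
  "comult_left H t = lift H H (\<lambda>x y. tens (tens_space H H) H (comult H x) y) t"

definition comult_right ::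
  "('k::field, 'v::ab_group_add, 'z) hopf_scheme \<Rightarrow> ('k, 'v, 'v) tensor
    \<Rightarrow> ('k, ('k, 'v, 'v) tensor, 'v) tensor" where
  "comult_right H t =
     lift H H (\<lambda>x y. lift H H (\<lambda>y\<^sub>1 y\<^sub>2. tens (tens_space H H) H (tens H H x y\<^sub>1) y\<^sub>2) (comult H y)) t"

definition hopf_algebra :: "('k::field, 'v::ab_group_add, 'z) hopf_scheme \<Rightarrow> bool" where
  "hopf_algebra H \<longleftrightarrow>
     algebra H \<and> linear_on H (tens_space H H) (comult H) \<and> linear_on H ground (counit H) \<and>
     linear_on H H (antipode H) \<and>
     (\<forall>x\<in>carrier H.
        comult_left H (comult H x) = comult_right H (comult H x) \<and>
        lift H H (\<lambda>x\<^sub>1 x\<^sub>2. scale H (counit H x\<^sub>1) x\<^sub>2) (comult H x) = x \<and>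
        lift H H (\<lambda>x\<^sub>1 x\<^sub>2. scale H (counit H x\<^sub>2) x\<^sub>1) (comult H x) = x \<and>
        lift H H (\<lambda>x\<^sub>1 x\<^sub>2. antipode H x\<^sub>1 \<cdot>\<^bsub>H\<^esub> x\<^sub>2) (comult H x) = scale H (counit H x) (unity H) \<and>
        lift H H (\<lambda>x\<^sub>1 x\<^sub>2. x\<^sub>1 \<cdot>\<^bsub>H\<^esub> antipode H x\<^sub>2) (comult H x) = scale H (counit H x) (unity H)) \<and>
     (\<forall>x\<in>carrier H. \<forall>y\<in>carrier H.
        comult H (x \<cdot>\<^bsub>H\<^esub> y) = comult H x \<cdot>\<^bsub>tens_alg H H\<^esub> comult H y \<and>
        counit H (x \<cdot>\<^bsub>H\<^esub> y) = counit H x * counit H y) \<and>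
     comult H (unity H) = unity (tens_alg H H) \<and> counit H (unity H) = 1"

section \<open>Dual, Drinfeld double, twists\<close>

text \<open>Functionals on \<open>E\<close> are extended by \<open>0\<close> outside \<open>carrier E\<close>.  \<open>E\<close> is finite dimensional.\<close>

definition dual_space ::
  "('k::field, 'e::ab_group_add, 'z) vspace_scheme \<Rightarrow> ('k, 'e \<Rightarrow> 'k) vspace" where
  "dual_space E =
     \<lparr>carrier = {\<xi>. linear_on E ground \<xi> \<and> (\<forall>x. x \<notin> carrier E \<longrightarrow> \<xi> x = 0)}, scale = fscale\<rparr>"

definition dual_hopf ::
  "('k::field, 'e::ab_group_add, 'z) hopf_scheme \<Rightarrow> ('k, 'e \<Rightarrow> 'k) hopf" where
  "dual_hopf E =
     \<lparr>carrier = carrier (dual_space E), scale = fscale,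
      mult = (\<lambda>\<xi> \<eta>. restr (carrier E) (\<lambda>x. lift E E (\<lambda>x\<^sub>1 x\<^sub>2. \<xi> x\<^sub>1 * \<eta> x\<^sub>2) (comult E x))),
      unity = restr (carrier E) (counit E),
      comult = (\<lambda>\<xi>. THE t. t \<in> tens_carrier (dual_space E) (dual_space E) \<and>
         (\<forall>x\<in>carrier E. \<forall>y\<in>carrier E.
            lift (dual_space E) (dual_space E) (\<lambda>\<xi>\<^sub>1 \<xi>\<^sub>2. \<xi>\<^sub>1 x * \<xi>\<^sub>2 y) t = \<xi> (x \<cdot>\<^bsub>E\<^esub> y))),
      counit = (\<lambda>\<xi>. \<xi> (unity E)),
      antipode = (\<lambda>\<xi>. restr (carrier E) (\<lambda>x. \<xi> (antipode E x)))\<rparr>"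

text \<open>The Drinfeld double \<open>D\<close> is \<open>E\<^sup>o\<^sup>p \<otimes> E\<^sup>*\<close> as a coalgebra, with \<open>w \<otimes> \<xi>\<close> standing for the
  product \<open>w\<xi>\<close> in \<open>D\<close>.  For a right Yetter-Drinfeld module \<open>M\<close>, i.e. one with
  \<open>(m\<cdot>w)\<^sub>0 \<otimes> (m\<cdot>w)\<^sub>1 = m\<^sub>0\<cdot>w\<^sub>2 \<otimes> S(w\<^sub>1)m\<^sub>1w\<^sub>3\<close>, the actions \<open>w\<cdot>m = m\<cdot>w\<close> and \<open>\<xi>\<cdot>m = m\<^sub>0 \<xi>(m\<^sub>1)\<close> satisfy
  \<open>\<xi>\<cdot>(w\<cdot>m) = w\<^sub>2\<cdot>(\<xi>(S(w\<^sub>1)_w\<^sub>3)\<cdot>m)\<close>.  This gives the commutation rule \<open>\<xi>w = w\<^sub>2 \<xi>(S(w\<^sub>1)_w\<^sub>3)\<close> in \<open>D\<close>.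
  The antipode of \<open>E\<^sup>o\<^sup>p\<close> is the inverse of \<open>S\<close>, and \<open>S\<^sub>D(w\<xi>) = S\<^sub>D(\<xi>) S\<^sub>D(w)\<close>.\<close>

definition double_mult ::
  "('k::field, 'e::ab_group_add, 'z) hopf_scheme
    \<Rightarrow> ('k, 'e, 'e \<Rightarrow> 'k) tensor \<Rightarrow> ('k, 'e, 'e \<Rightarrow> 'k) tensor \<Rightarrow> ('k, 'e, 'e \<Rightarrow> 'k) tensor" where
  "double_mult E s t = (let E' = dual_hopf E in
     lift E E' (\<lambda>w \<xi>. lift E E' (\<lambda>v \<eta>.
       lift E E (\<lambda>v\<^sub>1 u. lift E E (\<lambda>v\<^sub>2 v\<^sub>3.
         tens E E' (v\<^sub>2 \<cdot>\<^bsub>E\<^esub> w)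
           (restr (carrier E) (\<lambda>x. \<xi> (antipode E v\<^sub>1 \<cdot>\<^bsub>E\<^esub> x \<cdot>\<^bsub>E\<^esub> v\<^sub>3)) \<cdot>\<^bsub>E'\<^esub> \<eta>))
         (comult E u)) (comult E v)) t) s)"

definition drinfeld_double ::
  "('k::field, 'e::ab_group_add, 'z) hopf_scheme \<Rightarrow> ('k, ('k, 'e, 'e \<Rightarrow> 'k) tensor) hopf" where
  "drinfeld_double E = (let E' = dual_hopf E; T = tens_space E E' in
     \<lparr>carrier = tens_carrier E E', scale = fscale,
      mult = double_mult E,
      unity = tens E E' (unity E) (unity E'),
      comult = lift E E' (\<lambda>w \<xi>. lift E E (\<lambda>w\<^sub>1 w\<^sub>2. lift E' E' (\<lambda>\<xi>\<^sub>1 \<xi>\<^sub>2.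
         tens T T (tens E E' w\<^sub>1 \<xi>\<^sub>1) (tens E E' w\<^sub>2 \<xi>\<^sub>2)) (comult E' \<xi>)) (comult E w)),
      counit = lift E E' (\<lambda>w \<xi>. counit E w * counit E' \<xi>),
      antipode = lift E E' (\<lambda>w \<xi>. double_mult E
         (tens E E' (unity E) (antipode E' \<xi>))
         (tens E E' (inv_into (carrier E) (antipode E) w) (unity E')))\<rparr>)"

text \<open>The image in \<open>D \<otimes> D\<close> of an element of \<open>E\<^sup>* \<otimes> E\<^sup>*\<close>.\<close>

definition embed_dual2 ::
  "('k::field, 'e::ab_group_add, 'z) hopf_scheme \<Rightarrow> ('k, 'e \<Rightarrow> 'k, 'e \<Rightarrow> 'k) tensor
    \<Rightarrow> ('k, ('k, 'e, 'e \<Rightarrow> 'k) tensor, ('k, 'e, 'e \<Rightarrow> 'k) tensor) tensor" where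
  "embed_dual2 E J = (let E' = dual_hopf E; D = drinfeld_double E in
     lift E' E' (\<lambda>\<xi> \<eta>. tens D D (tens E E' (unity E) \<xi>) (tens E E' (unity E) \<eta>)) J)"

text \<open>Used with \<open>K = E\<^sup>*\<close>, so that \<open>J \<in> E\<^sup>* \<otimes> E\<^sup>*\<close>.\<close>

definition invertible_dual_cocycle ::
  "('k::field, 'v::ab_group_add, 'z) hopf_scheme \<Rightarrow> ('k, 'v, 'v) tensor \<Rightarrow> bool" where
  "invertible_dual_cocycle K J \<longleftrightarrow> (let K2 = tens_alg K K; K3 = tens_alg K2 K in
     J \<in> carrier K2 \<and> (\<exists>J'. inverse_in K2 J J') \<and>
     comult_left K J \<cdot>\<^bsub>K3\<^esub> tens K2 K J (unity K) =
     comult_right K J \<cdot>\<^bsub>K3\<^esub> lift K K (\<lambda>\<xi> \<eta>. tens K2 K (tens K K (unity K) \<xi>) \<eta>) J \<and>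
     lift K K (\<lambda>\<xi> \<eta>. scale K (counit K \<xi>) \<eta>) J = unity K \<and>
     lift K K (\<lambda>\<xi> \<eta>. scale K (counit K \<eta>) \<xi>) J = unity K)"

text \<open>\<open>H\<^sup>F\<close> has coproduct \<open>F\<^sup>-\<^sup>1 \<Delta>(h) F\<close>.  This forces the antipode \<open>U S(h) U\<^sup>-\<^sup>1\<close>, where
  \<open>U = K\<^sub>l S(K\<^sup>l)\<close> for \<open>K = F\<^sup>-\<^sup>1\<close>, and \<open>U\<^sup>-\<^sup>1 = S(F\<^sub>l) F\<^sup>l\<close>.\<close>

definition twist_hopf ::
  "('k::field, 'h::ab_group_add) hopf \<Rightarrow> ('k, 'h, 'h) tensor \<Rightarrow> ('k, 'h) hopf" where
  "twist_hopf H F = (let K = (THE K. inverse_in (tens_alg H H) F K) in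
     H\<lparr>comult := (\<lambda>h. K \<cdot>\<^bsub>tens_alg H H\<^esub> comult H h \<cdot>\<^bsub>tens_alg H H\<^esub> F),
       antipode := (\<lambda>h. lift H H (\<lambda>x y. x \<cdot>\<^bsub>H\<^esub> antipode H y) K \<cdot>\<^bsub>H\<^esub> antipode H h \<cdot>\<^bsub>H\<^esub>
                        lift H H (\<lambda>x y. antipode H x \<cdot>\<^bsub>H\<^esub> y) F)\<rparr>)"

definition twisted_product ::
  "('u \<Rightarrow> 'u \<Rightarrow> 'u) \<Rightarrow> 'u \<Rightarrow> ('k::field, 'h::ab_group_add, 'z) hopf_scheme \<Rightarrow> ('k, 'h, 'h) tensor
    \<Rightarrow> ('v \<Rightarrow> 'w \<Rightarrow> 'u) \<Rightarrow> ('h \<Rightarrow> 'v \<Rightarrow> 'v) \<Rightarrow> ('h \<Rightarrow> 'w \<Rightarrow> 'w) \<Rightarrow> 'v \<Rightarrow> 'w \<Rightarrow> 'u" where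
  "twisted_product add zero H F mul act act' x y =
     lift_into add zero H H (\<lambda>h h'. mul (act h x) (act' h' y)) F"

section \<open>The smash product and its Yetter-Drinfeld structure\<close>

definition module_algebra ::
  "('k::field, 'e::ab_group_add, 'y) hopf_scheme \<Rightarrow> ('k, 'a::ab_group_add, 'z) alg_scheme
    \<Rightarrow> ('e \<Rightarrow> 'a \<Rightarrow> 'a) \<Rightarrow> bool" where
  "module_algebra E A act \<longleftrightarrow>
     algebra A \<and> bilinear_on E A A act \<and>
     (\<forall>a\<in>carrier A. act (unity E) a = a) \<and>
     (\<forall>v\<in>carrier E. \<forall>w\<in>carrier E. \<forall>a\<in>carrier A. act (v \<cdot>\<^bsub>E\<^esub> w) a = act v (act w a)) \<and>
     (\<forall>w\<in>carrier E. act w (unity A) = scale A (counit E w) (unity A)) \<and>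
     (\<forall>w\<in>carrier E. \<forall>a\<in>carrier A. \<forall>b\<in>carrier A.
        act w (a \<cdot>\<^bsub>A\<^esub> b) = lift E E (\<lambda>w\<^sub>1 w\<^sub>2. act w\<^sub>1 a \<cdot>\<^bsub>A\<^esub> act w\<^sub>2 b) (comult E w))"

text \<open>\<open>A \<ast> E\<close> is \<open>A \<otimes> E\<close> with \<open>(aw)(a'w') = a(w\<^sub>1\<cdot>a') w\<^sub>2w'\<close>.\<close>

definition smash ::
  "('k::field, 'e::ab_group_add) hopf \<Rightarrow> ('k, 'a::ab_group_add) alg \<Rightarrow> ('e \<Rightarrow> 'a \<Rightarrow> 'a)
    \<Rightarrow> ('k, ('k, 'a, 'e) tensor) alg" where
  "smash E A act =
     \<lparr>carrier = tens_carrier A E, scale = fscale,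
      mult = (\<lambda>s t. lift A E (\<lambda>a w. lift A E (\<lambda>a' w'. lift E E (\<lambda>w\<^sub>1 w\<^sub>2.
         tens A E (a \<cdot>\<^bsub>A\<^esub> act w\<^sub>1 a') (w\<^sub>2 \<cdot>\<^bsub>E\<^esub> w')) (comult E w)) t) s),
      unity = tens A E (unity A) (unity E)\<rparr>"

definition incl_A ::
  "('k::field, 'e::ab_group_add) hopf \<Rightarrow> ('k, 'a::ab_group_add) alg \<Rightarrow> 'a \<Rightarrow> ('k, 'a, 'e) tensor" where
  "incl_A E A a = tens A E a (unity E)"

definition incl_E ::
  "('k::field, 'e::ab_group_add) hopf \<Rightarrow> ('k, 'a::ab_group_add) alg \<Rightarrow> 'e \<Rightarrow> ('k, 'a, 'e) tensor" where
  "incl_E E A w = tens A E (unity A) w"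

definition smash_ract ::
  "('k::field, 'e::ab_group_add) hopf \<Rightarrow> ('k, 'a::ab_group_add) alg \<Rightarrow> ('e \<Rightarrow> 'a \<Rightarrow> 'a)
    \<Rightarrow> ('k, 'a, 'e) tensor \<Rightarrow> 'e \<Rightarrow> ('k, 'a, 'e) tensor" where
  "smash_ract E A act b w = (let B = smash E A act in
     lift E E (\<lambda>w\<^sub>1 w\<^sub>2. incl_E E A (antipode E w\<^sub>1) \<cdot>\<^bsub>B\<^esub> b \<cdot>\<^bsub>B\<^esub> incl_E E A w\<^sub>2) (comult E w))"

definition smash_coact ::
  "('k::field, 'e::ab_group_add) hopf \<Rightarrow> ('k, 'a::ab_group_add) alg
    \<Rightarrow> ('k, 'a, 'e) tensor \<Rightarrow> ('k, ('k, 'a, 'e) tensor, 'e) tensor" where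
  "smash_coact E A b =
     lift A E (\<lambda>a w. lift E E (\<lambda>w\<^sub>1 w\<^sub>2. tens (tens_space A E) E (tens A E a w\<^sub>1) w\<^sub>2) (comult E w)) b"

text \<open>The action of \<open>D\<close> on \<open>A \<ast> E\<close>: \<open>(w\<xi>)\<cdot>b = (b\<^sub>0 \<xi>(b\<^sub>1))\<cdot>w\<close>.\<close>

definition smash_dact ::
  "('k::field, 'e::ab_group_add) hopf \<Rightarrow> ('k, 'a::ab_group_add) alg \<Rightarrow> ('e \<Rightarrow> 'a \<Rightarrow> 'a)
    \<Rightarrow> ('k, 'e, 'e \<Rightarrow> 'k) tensor \<Rightarrow> ('k, 'a, 'e) tensor \<Rightarrow> ('k, 'a, 'e) tensor" where
  "smash_dact E A act h b =
     lift E (dual_hopf E) (\<lambda>w \<xi>.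
       smash_ract E A act
         (lift (tens_space A E) E (\<lambda>b\<^sub>0 b\<^sub>1. fscale (\<xi> b\<^sub>1) b\<^sub>0) (smash_coact E A b)) w) h"

definition smash_twist ::
  "('k::field, 'e::ab_group_add) hopf \<Rightarrow> ('k, 'a::ab_group_add) alg \<Rightarrow> ('e \<Rightarrow> 'a \<Rightarrow> 'a)
    \<Rightarrow> ('k, 'e \<Rightarrow> 'k, 'e \<Rightarrow> 'k) tensor \<Rightarrow> ('k, ('k, 'a, 'e) tensor) alg" where
  "smash_twist E A act J = (let B = smash E A act in
     B\<lparr>mult := twisted_product (+) 0 (drinfeld_double E) (embed_dual2 E J) (mult B)
                 (smash_dact E A act) (smash_dact E A act)\<rparr>)"

section \<open>Complexes, dg algebras, dg bimodules and their cohomology\<close>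

text \<open>Addition and zero are explicit because the elements of cohomology are cosets.\<close>

record ('k, 'c) cpx =
  gcar :: "nat \<Rightarrow> 'c set"
  gadd :: "nat \<Rightarrow> 'c \<Rightarrow> 'c \<Rightarrow> 'c"
  gzero :: "nat \<Rightarrow> 'c"
  gscale :: "nat \<Rightarrow> 'k \<Rightarrow> 'c \<Rightarrow> 'c"
  gdiff :: "nat \<Rightarrow> 'c \<Rightarrow> 'c"

text \<open>\<open>gmult X m n\<close> multiplies degree \<open>m\<close> by degree \<open>n\<close>.  In \<open>lact X m n\<close> and \<open>ract X m n\<close> the
  first degree and the first argument belong to the ring, the second ones to the bimodule.\<close>

record ('k, 'c) dgalg = "('k, 'c) cpx" +
  gmult :: "nat \<Rightarrow> nat \<Rightarrow> 'c \<Rightarrow> 'c \<Rightarrow> 'c"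
  gunit :: "'c"

record ('k, 'r, 'c) dgbimod = "('k, 'c) cpx" +
  lact :: "nat \<Rightarrow> nat \<Rightarrow> 'r \<Rightarrow> 'c \<Rightarrow> 'c"
  ract :: "nat \<Rightarrow> nat \<Rightarrow> 'r \<Rightarrow> 'c \<Rightarrow> 'c"

text \<open>Equality of structures: equal carriers, and operations that agree on the carriers (their values
  elsewhere have no meaning).\<close>

definition cpx_eq :: "('k, 'c, 'y) cpx_scheme \<Rightarrow> ('k, 'c, 'z) cpx_scheme \<Rightarrow> bool" where
  "cpx_eq X Y \<longleftrightarrow>
     (\<forall>n. gcar X n = gcar Y n \<and> gzero X n = gzero Y n \<and>
       (\<forall>x\<in>gcar X n. \<forall>y\<in>gcar X n. gadd X n x y = gadd Y n x y) \<and>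
       (\<forall>c. \<forall>x\<in>gcar X n. gscale X n c x = gscale Y n c x) \<and>
       (\<forall>x\<in>gcar X n. gdiff X n x = gdiff Y n x))"

definition dgalg_eq :: "('k, 'c, 'y) dgalg_scheme \<Rightarrow> ('k, 'c, 'z) dgalg_scheme \<Rightarrow> bool" where
  "dgalg_eq X Y \<longleftrightarrow>
     cpx_eq X Y \<and> gunit X = gunit Y \<and>
     (\<forall>m n. \<forall>x\<in>gcar X m. \<forall>y\<in>gcar X n. gmult X m n x y = gmult Y m n x y)"

definition dgbimod_eq ::
  "('k, 'r, 'x) cpx_scheme \<Rightarrow> ('k, 'r, 'c, 'y) dgbimod_scheme \<Rightarrow> ('k, 'r, 'c, 'z) dgbimod_scheme
    \<Rightarrow> bool" where
  "dgbimod_eq R X Y \<longleftrightarrow>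
     cpx_eq X Y \<and>
     (\<forall>m n. \<forall>r\<in>gcar R m. \<forall>x\<in>gcar X n.
        lact X m n r x = lact Y m n r x \<and> ract X m n r x = ract Y m n r x)"

definition cocycles :: "('k, 'c, 'z) cpx_scheme \<Rightarrow> nat \<Rightarrow> 'c set" where
  "cocycles X n = {x \<in> gcar X n. gdiff X n x = gzero X (Suc n)}"

definition coboundaries :: "('k, 'c, 'z) cpx_scheme \<Rightarrow> nat \<Rightarrow> 'c set" where
  "coboundaries X n = (case n of 0 \<Rightarrow> {gzero X 0} | Suc m \<Rightarrow> gdiff X m ` gcar X m)"

definition class_of :: "('k, 'c, 'z) cpx_scheme \<Rightarrow> nat \<Rightarrow> 'c \<Rightarrow> 'c set" where
  "class_of X n x = gadd X n x ` coboundaries X n"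

definition coh :: "('k, 'c, 'z) cpx_scheme \<Rightarrow> ('k, 'c set) cpx" where
  "coh X =
     \<lparr>gcar = (\<lambda>n. class_of X n ` cocycles X n),
      gadd = (\<lambda>n P Q. \<Union>p\<in>P. \<Union>q\<in>Q. class_of X n (gadd X n p q)),
      gzero = (\<lambda>n. class_of X n (gzero X n)),
      gscale = (\<lambda>n c P. \<Union>p\<in>P. class_of X n (gscale X n c p)),
      gdiff = (\<lambda>n P. class_of X (Suc n) (gzero X (Suc n)))\<rparr>"

definition coh_alg :: "('k, 'c, 'z) dgalg_scheme \<Rightarrow> ('k, 'c set) dgalg" where
  "coh_alg X = cpx.extend (coh X) (dgalg.fields
     (\<lambda>m n P Q. \<Union>p\<in>P. \<Union>q\<in>Q. class_of X (m + n) (gmult X m n p q))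
     (class_of X 0 (gunit X)))"

definition coh_bimod :: "('k, 'r, 'c, 'z) dgbimod_scheme \<Rightarrow> ('k, 'r set, 'c set) dgbimod" where
  "coh_bimod X = cpx.extend (coh X) (dgbimod.fields
     (\<lambda>m n R P. \<Union>r\<in>R. \<Union>p\<in>P. class_of X (m + n) (lact X m n r p))
     (\<lambda>m n R P. \<Union>r\<in>R. \<Union>p\<in>P. class_of X (m + n) (ract X m n r p)))"

definition coh_act ::
  "('k, 'c, 'z) cpx_scheme \<Rightarrow> (nat \<Rightarrow> 'h \<Rightarrow> 'c \<Rightarrow> 'c) \<Rightarrow> nat \<Rightarrow> 'h \<Rightarrow> 'c set \<Rightarrow> 'c set" where
  "coh_act X act n h P = (\<Union>p\<in>P. class_of X n (act n h p))"

definition dg_twist ::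
  "('k::field, 'h::ab_group_add, 'z) hopf_scheme \<Rightarrow> ('k, 'h, 'h) tensor \<Rightarrow> ('k, 'c) dgalg
    \<Rightarrow> (nat \<Rightarrow> 'h \<Rightarrow> 'c \<Rightarrow> 'c) \<Rightarrow> ('k, 'c) dgalg" where
  "dg_twist H F X act =
     X\<lparr>gmult := (\<lambda>m n. twisted_product (gadd X (m + n)) (gzero X (m + n)) H F
                   (gmult X m n) (act m) (act n))\<rparr>"

definition is_complex :: "('k::field, 'c, 'z) cpx_scheme \<Rightarrow> bool" where
  "is_complex X \<longleftrightarrow> (\<forall>n.
     gzero X n \<in> gcar X n \<and>
     (\<forall>x\<in>gcar X n. \<forall>y\<in>gcar X n. gadd X n x y \<in> gcar X n \<and> gadd X n x y = gadd X n y x) \<and>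
     (\<forall>x\<in>gcar X n. \<forall>y\<in>gcar X n. \<forall>z\<in>gcar X n.
        gadd X n (gadd X n x y) z = gadd X n x (gadd X n y z)) \<and>
     (\<forall>x\<in>gcar X n. gadd X n (gzero X n) x = x \<and> (\<exists>y\<in>gcar X n. gadd X n x y = gzero X n)) \<and>
     (\<forall>c. \<forall>x\<in>gcar X n. gscale X n c x \<in> gcar X n) \<and>
     (\<forall>c. \<forall>x\<in>gcar X n. \<forall>y\<in>gcar X n.
        gscale X n c (gadd X n x y) = gadd X n (gscale X n c x) (gscale X n c y)) \<and>
     (\<forall>c d. \<forall>x\<in>gcar X n.
        gscale X n (c + d) x = gadd X n (gscale X n c x) (gscale X n d x) \<and>
        gscale X n (c * d) x = gscale X n c (gscale X n d x)) \<and>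
     (\<forall>x\<in>gcar X n. gscale X n 1 x = x) \<and>
     (\<forall>x\<in>gcar X n. gdiff X n x \<in> gcar X (Suc n) \<and>
        gdiff X (Suc n) (gdiff X n x) = gzero X (Suc (Suc n))) \<and>
     (\<forall>x\<in>gcar X n. \<forall>y\<in>gcar X n.
        gdiff X n (gadd X n x y) = gadd X (Suc n) (gdiff X n x) (gdiff X n y)) \<and>
     (\<forall>c. \<forall>x\<in>gcar X n. gdiff X n (gscale X n c x) = gscale X (Suc n) c (gdiff X n x)))"

text \<open>Objects of the category of complexes of \<open>H\<close>-modules.\<close>

definition is_dg_module ::
  "('k::field, 'h::ab_group_add, 'y) hopf_scheme \<Rightarrow> ('k, 'c, 'z) cpx_scheme
    \<Rightarrow> (nat \<Rightarrow> 'h \<Rightarrow> 'c \<Rightarrow> 'c) \<Rightarrow> bool" where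
  "is_dg_module H X act \<longleftrightarrow> is_complex X \<and> (\<forall>n.
     (\<forall>h\<in>carrier H. \<forall>x\<in>gcar X n. act n h x \<in> gcar X n) \<and>
     (\<forall>h\<in>carrier H. \<forall>x\<in>gcar X n. \<forall>y\<in>gcar X n.
        act n h (gadd X n x y) = gadd X n (act n h x) (act n h y)) \<and>
     (\<forall>h\<in>carrier H. \<forall>g\<in>carrier H. \<forall>x\<in>gcar X n.
        act n (h + g) x = gadd X n (act n h x) (act n g x) \<and>
        act n (h \<cdot>\<^bsub>H\<^esub> g) x = act n h (act n g x)) \<and>
     (\<forall>c. \<forall>h\<in>carrier H. \<forall>x\<in>gcar X n.
        act n h (gscale X n c x) = gscale X n c (act n h x) \<and>
        act n (scale H c h) x = gscale X n c (act n h x)) \<and>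
     (\<forall>x\<in>gcar X n. act n (unity H) x = x) \<and>
     (\<forall>h\<in>carrier H. \<forall>x\<in>gcar X n. gdiff X n (act n h x) = act (Suc n) h (gdiff X n x)))"

definition is_dg_algebra :: "('k::field, 'c, 'z) dgalg_scheme \<Rightarrow> bool" where
  "is_dg_algebra X \<longleftrightarrow> is_complex X \<and>
     gunit X \<in> gcar X 0 \<and>
     (\<forall>n. \<forall>x\<in>gcar X n. gmult X 0 n (gunit X) x = x \<and> gmult X n 0 x (gunit X) = x) \<and>
     (\<forall>m n. \<forall>x\<in>gcar X m. \<forall>y\<in>gcar X n. gmult X m n x y \<in> gcar X (m + n) \<and>
        gdiff X (m + n) (gmult X m n x y) =
          gadd X (Suc (m + n)) (gmult X (Suc m) n (gdiff X m x) y)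
            (gscale X (Suc (m + n)) ((-1) ^ m) (gmult X m (Suc n) x (gdiff X n y)))) \<and>
     (\<forall>m n. \<forall>x\<in>gcar X m. \<forall>x'\<in>gcar X m. \<forall>y\<in>gcar X n. \<forall>y'\<in>gcar X n.
        gmult X m n (gadd X m x x') y = gadd X (m + n) (gmult X m n x y) (gmult X m n x' y) \<and>
        gmult X m n x (gadd X n y y') = gadd X (m + n) (gmult X m n x y) (gmult X m n x y')) \<and>
     (\<forall>c. \<forall>m n. \<forall>x\<in>gcar X m. \<forall>y\<in>gcar X n.
        gmult X m n (gscale X m c x) y = gscale X (m + n) c (gmult X m n x y) \<and>
        gmult X m n x (gscale X n c y) = gscale X (m + n) c (gmult X m n x y)) \<and>
     (\<forall>l m n. \<forall>x\<in>gcar X l. \<forall>y\<in>gcar X m. \<forall>z\<in>gcar X n.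
        gmult X (l + m) n (gmult X l m x y) z = gmult X l (m + n) x (gmult X m n y z))"

definition is_dg_module_algebra ::
  "('k::field, 'h::ab_group_add, 'y) hopf_scheme \<Rightarrow> ('k, 'c, 'z) dgalg_scheme
    \<Rightarrow> (nat \<Rightarrow> 'h \<Rightarrow> 'c \<Rightarrow> 'c) \<Rightarrow> bool" where
  "is_dg_module_algebra H X act \<longleftrightarrow>
     is_dg_module H X act \<and> is_dg_algebra X \<and>
     (\<forall>h\<in>carrier H. act 0 h (gunit X) = gscale X 0 (counit H h) (gunit X)) \<and>
     (\<forall>m n. \<forall>h\<in>carrier H. \<forall>x\<in>gcar X m. \<forall>y\<in>gcar X n.
        act (m + n) h (gmult X m n x y) =
        twisted_product (gadd X (m + n)) (gzero X (m + n)) H (comult H h)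
          (gmult X m n) (act m) (act n) x y)"

section \<open>Hochschild cochains\<close>

text \<open>Linear maps \<open>V\<^sup>\<otimes>\<^sup>n \<rightarrow> W\<close> are multilinear maps on lists of length \<open>n\<close>, extended by \<open>0\<close>.\<close>

definition tuples :: "('k, 'v, 'z) vspace_scheme \<Rightarrow> nat \<Rightarrow> 'v list set" where
  "tuples V n = {xs. length xs = n \<and> set xs \<subseteq> carrier V}"

definition multilinear_maps ::
  "('k::field, 'v::ab_group_add, 'y) vspace_scheme \<Rightarrow> ('k, 'w::ab_group_add, 'z) vspace_scheme
    \<Rightarrow> nat \<Rightarrow> ('v list \<Rightarrow> 'w) set" where
  "multilinear_maps V W n =
     {f. (\<forall>xs. xs \<notin> tuples V n \<longrightarrow> f xs = 0) \<and>
         (\<forall>xs\<in>tuples V n. f xs \<in> carrier W \<and> (\<forall>i<n. linear_on V W (\<lambda>x. f (xs[i := x]))))}"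

definition hoch_diff ::
  "('k::field, 'a::ab_group_add, 'y) alg_scheme \<Rightarrow> ('k, 'm::ab_group_add, 'z) alg_scheme
    \<Rightarrow> ('a \<Rightarrow> 'm) \<Rightarrow> nat \<Rightarrow> ('a list \<Rightarrow> 'm) \<Rightarrow> 'a list \<Rightarrow> 'm" where
  "hoch_diff A M \<iota> n f = restr (tuples A (Suc n)) (\<lambda>as.
     \<iota> (hd as) \<cdot>\<^bsub>M\<^esub> f (tl as) +
     (\<Sum>i<n. scale M ((-1) ^ Suc i) (f (take i as @ [as ! i \<cdot>\<^bsub>A\<^esub> as ! Suc i] @ drop (i + 2) as))) +
     scale M ((-1) ^ Suc n) (f (butlast as) \<cdot>\<^bsub>M\<^esub> \<iota> (last as)))"

definition cup ::
  "('k, 'a, 'z) vspace_scheme \<Rightarrow> ('m \<Rightarrow> 'm' \<Rightarrow> 'm''::zero) \<Rightarrow> nat \<Rightarrow> nat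
    \<Rightarrow> ('a list \<Rightarrow> 'm) \<Rightarrow> ('a list \<Rightarrow> 'm') \<Rightarrow> 'a list \<Rightarrow> 'm''" where
  "cup A \<mu> m n f g = restr (tuples A (m + n)) (\<lambda>as. \<mu> (f (take m as)) (g (drop m as)))"

text \<open>Coefficients in an algebra \<open>M\<close> that contains \<open>A\<close> by way of \<open>\<iota>\<close>.\<close>

definition hoch_cpx ::
  "('k::field, 'a::ab_group_add, 'y) alg_scheme \<Rightarrow> ('k, 'm::ab_group_add, 'z) alg_scheme
    \<Rightarrow> ('a \<Rightarrow> 'm) \<Rightarrow> ('k, 'a list \<Rightarrow> 'm) cpx" where
  "hoch_cpx A M \<iota> =
     \<lparr>gcar = multilinear_maps A M,
      gadd = (\<lambda>n. (+)), gzero = (\<lambda>n. 0), gscale = (\<lambda>n c f as. scale M c (f as)),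
      gdiff = hoch_diff A M \<iota>\<rparr>"

definition hoch_alg ::
  "('k::field, 'a::ab_group_add, 'y) alg_scheme \<Rightarrow> ('k, 'm::ab_group_add, 'z) alg_scheme
    \<Rightarrow> ('a \<Rightarrow> 'm) \<Rightarrow> ('k, 'a list \<Rightarrow> 'm) dgalg" where
  "hoch_alg A M \<iota> = cpx.extend (hoch_cpx A M \<iota>) (dgalg.fields
     (cup A (mult M)) (restr (tuples A 0) (\<lambda>_. unity M)))"

definition hoch_bimod ::
  "('k::field, 'a::ab_group_add, 'y) alg_scheme \<Rightarrow> ('k, 'm::ab_group_add, 'z) alg_scheme
    \<Rightarrow> ('a \<Rightarrow> 'm) \<Rightarrow> ('k, 'a list \<Rightarrow> 'a, 'a list \<Rightarrow> 'm) dgbimod" where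
  "hoch_bimod A M \<iota> = cpx.extend (hoch_cpx A M \<iota>) (dgbimod.fields
     (\<lambda>m n g f. cup A (\<lambda>a x. \<iota> a \<cdot>\<^bsub>M\<^esub> x) m n g f)
     (\<lambda>m n g f. cup A (\<lambda>x a. x \<cdot>\<^bsub>M\<^esub> \<iota> a) n m f g))"

section \<open>The action of the double on Hochschild cochains\<close>

text \<open>\<open>B\<^sup>\<otimes>\<^sup>E\<^sup>n\<close> is generated by lists of length \<open>n\<close> over \<open>B\<close> if \<open>n > 0\<close>, and \<open>B\<^sup>\<otimes>\<^sup>E\<^sup>0 = E\<close> by lists of
  length \<open>1\<close> over the subspace \<open>E \<subseteq> B\<close>.  Linear maps on \<open>B\<^sup>\<otimes>\<^sup>E\<^sup>n\<close> are \<open>E\<close>-balanced multilinear maps.\<close>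

definition rel_slot ::
  "('k::field, 'e::ab_group_add) hopf \<Rightarrow> ('k, 'a::ab_group_add) alg \<Rightarrow> nat
    \<Rightarrow> ('k, ('k, 'a, 'e) tensor) vspace" where
  "rel_slot E A n =
     \<lparr>carrier = (if n = 0 then incl_E E A ` carrier E else tens_carrier A E), scale = fscale\<rparr>"

definition rel_length :: "nat \<Rightarrow> nat" where
  "rel_length n = (if n = 0 then 1 else n)"

definition rel_cochains ::
  "('k::field, 'e::ab_group_add) hopf \<Rightarrow> ('k, 'a::ab_group_add) alg \<Rightarrow> ('e \<Rightarrow> 'a \<Rightarrow> 'a) \<Rightarrow> nat
    \<Rightarrow> (('k, 'a, 'e) tensor list \<Rightarrow> ('k, 'a, 'e) tensor) set" where
  "rel_cochains E A act n = (let B = smash E A act; l = rel_length n in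
     {f \<in> multilinear_maps (rel_slot E A n) B l.
        \<forall>bs\<in>tuples (rel_slot E A n) l. \<forall>w\<in>carrier E.
          (\<forall>i. Suc i < l \<longrightarrow>
             f (bs[i := bs ! i \<cdot>\<^bsub>B\<^esub> incl_E E A w]) = f (bs[Suc i := incl_E E A w \<cdot>\<^bsub>B\<^esub> bs ! Suc i])) \<and>
          f (bs[l - 1 := last bs \<cdot>\<^bsub>B\<^esub> incl_E E A w]) = f bs \<cdot>\<^bsub>B\<^esub> incl_E E A w})"

text \<open>The value \<open>f(h\<cdot>x)\<close> for \<open>h\<close> acting diagonally on \<open>x = x\<^sub>1 \<otimes> \<dots> \<otimes> x\<^sub>n\<close>.\<close>

primrec eval_diag ::
  "('k::field, 'h::ab_group_add, 'y) hopf_scheme \<Rightarrow> ('k, 'm::ab_group_add, 'z) vspace_scheme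
    \<Rightarrow> ('h \<Rightarrow> 'v \<Rightarrow> 'v) \<Rightarrow> ('v list \<Rightarrow> 'm) \<Rightarrow> 'h \<Rightarrow> 'v list \<Rightarrow> 'm" where
  "eval_diag H M act f h [] = scale M (counit H h) (f [])"
| "eval_diag H M act f h (x # xs) =
     lift H H (\<lambda>h\<^sub>1 h\<^sub>2. eval_diag H M act (\<lambda>ys. f (act h\<^sub>1 x # ys)) h\<^sub>2 xs) (comult H h)"

text \<open>\<open>(h\<cdot>f)(x) = h\<^sub>1\<cdot>f(S(h\<^sub>2)\<cdot>x)\<close>\<close>

definition rel_dact ::
  "('k::field, 'e::ab_group_add) hopf \<Rightarrow> ('k, 'a::ab_group_add) alg \<Rightarrow> ('e \<Rightarrow> 'a \<Rightarrow> 'a) \<Rightarrow> nat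
    \<Rightarrow> ('k, 'e, 'e \<Rightarrow> 'k) tensor \<Rightarrow> (('k, 'a, 'e) tensor list \<Rightarrow> ('k, 'a, 'e) tensor)
    \<Rightarrow> ('k, 'a, 'e) tensor list \<Rightarrow> ('k, 'a, 'e) tensor" where
  "rel_dact E A act n h f = (let D = drinfeld_double E; B = smash E A act in
     restr (tuples (rel_slot E A n) (rel_length n)) (\<lambda>bs.
       lift D D (\<lambda>h\<^sub>1 h\<^sub>2. smash_dact E A act h\<^sub>1
         (eval_diag D B (smash_dact E A act) f (antipode D h\<^sub>2) bs)) (comult D h)))"

definition rel_restrict ::
  "('k::field, 'e::ab_group_add) hopf \<Rightarrow> ('k, 'a::ab_group_add) alg \<Rightarrow> nat
    \<Rightarrow> (('k, 'a, 'e) tensor list \<Rightarrow> ('k, 'a, 'e) tensor) \<Rightarrow> 'a list \<Rightarrow> ('k, 'a, 'e) tensor" where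
  "rel_restrict E A n f = restr (tuples A n) (\<lambda>as.
     f (if n = 0 then [incl_E E A (unity E)] else map (incl_A E A) as))"

definition hoch_dact ::
  "('k::field, 'e::ab_group_add) hopf \<Rightarrow> ('k, 'a::ab_group_add) alg \<Rightarrow> ('e \<Rightarrow> 'a \<Rightarrow> 'a) \<Rightarrow> nat
    \<Rightarrow> ('k, 'e, 'e \<Rightarrow> 'k) tensor \<Rightarrow> ('a list \<Rightarrow> ('k, 'a, 'e) tensor) \<Rightarrow> 'a list \<Rightarrow> ('k, 'a, 'e) tensor" where
  "hoch_dact E A act n h f =
     rel_restrict E A n (rel_dact E A act n h
       (inv_into (rel_cochains E A act n) (rel_restrict E A n) f))"

end

theory Submission
  imports Defs
begin

text \<open>Projections onto the carriers make all operations total, so that Sweedler notation becomes a sum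
  over a dual basis of \<open>E\<close> and linearity conditions are unguarded.  A relative cochain is determined by
  its values \<open>f\<close> on \<open>A\<close>, since elements of \<open>E\<close> can be moved to the right; this turns the action of
  \<open>w\<xi> \<in> D\<close> into \<open>S(w1) (\<xi>\<cdot>f(w2\<cdot>(a1 \<otimes> ... \<otimes> an))) w3\<close>.  With this formula the cochains with values in \<open>B\<close>
  form a dg module algebra over \<open>D\<close>.  As \<open>\<xi> \<in> E*\<close> acts on the values only and the twisted product
  agrees with the old one when a factor lies in \<open>A\<close>, the differential and the bimodule structure do not
  change, and the cup product becomes the \<open>F\<close>-twisted one.  Its equivariance for \<open>K \<Delta>(h) F\<close>, where
  \<open>K\<close> is the inverse of \<open>F\<close>, is the identity \<open>F (K \<Delta>(h) F) = \<Delta>(h) F\<close>.\<close>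


section \<open>Linear maps and tensor products\<close>

text \<open>The definitions contain choices that must be computed before any identity can be
  checked. \<open>lift_into\<close>, the coproduct of \<open>E*\<close> and the inverse of
  \<open>F\<close> are definite descriptions: functionals separate points, which makes lifts well
  defined, and the other two are unique by evaluation on \<open>E\<close> and by associativity of
  \<open>D \<otimes> D\<close>. The action on cochains inverts the restriction map by
  \<open>inv_into\<close>, so an explicit extension \<open>rext\<close> from \<open>A\<close> to
  \<open>B\<close> is built. The antipode of the double inverts that of \<open>E\<close>, whose
  bijectivity is a theorem in finite dimension and not part of \<open>hopf_algebra\<close>. In the
  formula for \<open>w\<xi>\<close> the antipode of the double has vanished: the inverse antipode
  cancels against conjugation, and \<open>E*\<close> does not move arguments in \<open>A\<close>,
  which are coinvariant. The conditions on \<open>J\<close> act in different places: the cocycle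
  identity, read as a two-cocycle on \<open>E\<close>, gives associativity of the twisted product,
  the counit conditions give the products with a factor in \<open>A\<close>, and invertibility gives
  the twisted coproduct.\<close>

definition lin ::
 "('k => 'v::ab_group_add => 'v) => ('k => 'w::ab_group_add => 'w) => ('v => 'w) => bool" where
 "lin s t f \<longleftrightarrow> (\<forall>x y. f (x + y) = f x + f y) \<and> (\<forall>c x. f (s c x) = t c (f x))"

text \<open>A target without membership conditions: linearity into \<open>amb u\<close> leaves open
  in which subspace the values lie.\<close>

abbreviation amb :: "('k => 'u => 'u) => ('k, 'u) vspace" where
 "amb u \<equiv> \<lparr>carrier = UNIV, scale = u\<rparr>"

named_theorems lin_intros

lemma lin_add: "lin s t f ==> f (x + y) = f x + f y"
 and lin_scale: "lin s t f ==> f (s c x) = t c (f x)"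
 by (auto simp: lin_def)

lemma lin_zero: "lin s t f ==> f 0 = 0"
 using lin_add[of s t f 0 0] by simp

lemma lin_diff: "lin s t f ==> f (x - y) = f x - f y"
 using lin_add[of s t f "x - y" y] by (simp add: algebra_simps)

lemma lin_sum: "lin s t f ==> f (\<Sum>i\<in>I. g i) = (\<Sum>i\<in>I. f (g i))"
 by (induction I rule: infinite_finite_induct) (auto simp: lin_add lin_zero)

lemma lin_sum_list: "lin s t f ==> f (\<Sum>i\<leftarrow>xs. g i) = (\<Sum>i\<leftarrow>xs. f (g i))"
 by (induction xs) (auto simp: lin_add lin_zero)

lemma lin_ident [lin_intros]: "lin s s (%x. x)"
 by (simp add: lin_def)

lemma lin_compose: "lin t u g ==> lin s t f ==> lin s u (%x. g (f x))"
 by (simp add: lin_def)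

lemma vector_space_add: "vector_space s ==> s c (x + y) = s c x + s c y"
 and vector_space_add_left: "vector_space s ==> s (c + d) x = s c x + s d x"
 and vector_space_mult: "vector_space s ==> s c (s d x) = s (c * d) x"
 and vector_space_one: "vector_space s ==> s 1 x = x"
 by (simp_all add: vector_space_def)

lemma vector_space_zero: "vector_space s ==> s c 0 = 0"
 and vector_space_zero_left: "vector_space s ==> s 0 x = 0"
 using vector_space_add[of s c 0 0] vector_space_add_left[of s 0 0 x] by simp_all

lemma vector_space_minus: "vector_space s ==> s c (- x) = - s c x"
 using vector_space_add[of s c x "- x"] by (simp add: vector_space_zero eq_neg_iff_add_eq_0 add.commute)

lemma vector_space_diff: "vector_space s ==> s c (x - y) = s c x - s c y"
 using vector_space_add[of s c x "- y"] by (simp add: vector_space_minus)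

lemma vector_space_sum: "vector_space s ==> s c (\<Sum>i\<in>I. f i) = (\<Sum>i\<in>I. s c (f i))"
 by (induction I rule: infinite_finite_induct) (auto simp: vector_space_add vector_space_zero)

lemma lin_plus [lin_intros]: "lin s t f ==> lin s t g ==> vector_space t ==> lin s t (%x. f x + g x)"
 by (simp add: lin_def vector_space_add algebra_simps)

lemma lin_const_zero [lin_intros]: "vector_space t ==> lin s t (%x. 0)"
 by (simp add: lin_def vector_space_zero)

lemma lin_sum_fun [lin_intros]:
 "vector_space t ==> (\<And>i. i \<in> I ==> lin s t (f i)) ==> lin s t (%x. \<Sum>i\<in>I. f i x)"
 by (simp add: lin_def vector_space_sum sum.distrib)

lemma lin_sum_list_fun [lin_intros]:
 "vector_space t ==> (\<And>i. i \<in> set is ==> lin s t (f i)) ==> lin s t (%x. \<Sum>i\<leftarrow>is. f i x)"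
 by (induction "is") (auto intro: lin_plus lin_const_zero)

lemma lin_scale_left [lin_intros]:
 "vector_space t ==> lin s (*) f ==> lin s t (%x. t (f x) y)"
 by (simp add: lin_def vector_space_add_left vector_space_mult)

lemma lin_scale_right [lin_intros]:
 "vector_space t ==> lin s t f ==> lin s t (%x. t c (f x))"
 by (simp add: lin_def vector_space_add vector_space_mult mult.commute)

lemma vector_space_field [lin_intros, simp]: "vector_space ((*) :: 'k::field => 'k => 'k)"
 by unfold_locales (auto simp: algebra_simps)

lemma vs_fscale [lin_intros, simp]: "vector_space (fscale :: 'k::field => ('x => 'k) => _)"
 by unfold_locales (auto simp: fscale_def algebra_simps fun_eq_iff)

lemma lin_mult_left [lin_intros]:
 "lin s (*) f ==> lin s (*) (%x. f x * (c::'k::field))"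
 and lin_mult_right [lin_intros]: "lin s (*) f ==> lin s (*) (%x. c * f x)"
 by (auto simp: lin_def algebra_simps)

lemma fscale_apply: "fscale c f x = c * f x"
 by (simp add: fscale_def)

text \<open>A nonzero \<open>x - y\<close> is completed to a basis of the ambient space, and its
  coordinate functional is 1 on it. Tensors are functionals on scalar bilinear forms, so this
  reduces vector-valued maps to what tensors can detect.\<close>

lemma functionals_separate:
 fixes s :: "'k::field => 'v::ab_group_add => 'v"
 assumes "vector_space s" and *: "\<And>l. lin s (*) l ==> l x = l y"
 shows "x = y"
proof (rule ccontr)
 interpret vector_space s by fact
 assume "x \<noteq> y"
 then have ind: "independent {x - y}" by simp
 define B where "B = extend_basis {x - y}"
 have B: "independent B" "span B = UNIV" "x - y \<in> B"
  using independent_extend_basis[OF ind] span_extend_basis[OF ind] extend_basis_superset[OF ind]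
  by (auto simp: B_def)
 have "lin s (*) (%v. representation B v (x - y))"
  unfolding lin_def using B by (simp add: representation_add representation_scale)
 then have "representation B (x - y) (x - y) = 0"
  using *[of "%v. representation B v (x - y)"] lin_diff[of s "(*)"] by fastforce
 then show False using representation_basis[OF B(1,3)] by simp
qed

text \<open>A linear left inverse of the inclusion of \<open>V\<close>, which exists over a field.
  The projections \<open>Q\<close> and \<open>PB\<close> come from it.\<close>

lemma ex_projection:
 fixes s :: "'k::field => 'v::ab_group_add => 'v"
 assumes "vector_space s" "module.subspace s V"
 shows "\<exists>p. lin s s p \<and> (\<forall>x. p x \<in> V) \<and> (\<forall>x\<in>V. p x = x)"
proof -
 interpret vector_space_pair s s using assms(1) by (simp add: vector_space_pair_def)
 have "\<exists>g. range g \<subseteq> V \<and> Vector_Spaces.linear s s g \<and> (\<forall>v\<in>V. g v = v)"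
  using linear_exists_left_inverse_on[of "%x. x" V] assms vs1.linear_id by (auto simp: inj_on_def id_def)
 then show ?thesis by (auto simp: lin_def Vector_Spaces.linear_iff)
qed

text \<open>Rank argument on a finite basis. It serves both for convolution with the antipode and
  for the antipode itself.\<close>

lemma injective_endo_surjective:
 fixes s :: "'k::field => 'v::ab_group_add => 'v"
 assumes "vector_space s" and f: "lin s s f" and S: "finite S"
  and V: "module.span s S = V" and "f ` V \<subseteq> V" and inj: "\<And>x. x \<in> V ==> f x = 0 ==> x = 0"
 shows "f ` V = V"
proof -
 interpret vector_space s by fact
 have sV: "subspace V" using V subspace_span by blast
 obtain B where B: "B \<subseteq> V" "independent B" "V \<subseteq> span B"
  using maximal_independent_subset[of V] by blast
 have VB: "V = span B" using B sV span_minimal by blast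
 have fB: "finite B" using independent_span_bound[OF S B(2)] B(1) V by blast
 have lf: "Vector_Spaces.linear s s f" using f assms(1) by (auto simp: Vector_Spaces.linear_iff lin_def)
 have vp: "vector_space_pair s s" by unfold_locales
 have injV: "inj_on f V"
 proof (rule inj_onI)
  fix x y assume "x \<in> V" "y \<in> V" "f x = f y"
  then have "x - y \<in> V" "f (x - y) = 0" using sV subspace_diff lin_diff[OF f] by auto
  then show "x = y" using inj[of "x - y"] by auto
 qed
 have ind: "independent (f ` B)"
  using vector_space_pair.linear_independent_injective_image[OF vp lf B(2)] injV VB by blast
 have "f ` B \<subseteq> span B" using assms(5) B(1) VB by blast
 have cB: "card (f ` B) = card B" using card_image injV B(1) inj_on_subset by metis
 \<comment> \<open>A vector outside this span would extend the image of \<open>B\<close> to an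
   independent set in \<open>span B\<close> with more than \<open>card B\<close> elements.\<close>
 have "V \<subseteq> span (f ` B)"
 proof (rule subsetI, rule ccontr)
  fix v assume v: "v \<in> V" "v \<notin> span (f ` B)"
  then have "independent (insert v (f ` B))" using ind independent_insertI by blast
  moreover have "insert v (f ` B) \<subseteq> span B" using v VB \<open>f ` B \<subseteq> span B\<close> by blast
  ultimately have "card (insert v (f ` B)) \<le> card B" using independent_span_bound[OF fB] by blast
  moreover have "v \<notin> f ` B" using v span_superset by blast
  ultimately show False using cB fB by simp
 qed
 also have "span (f ` B) = f ` span B"
  using module_hom.span_image[of s s f] lf Vector_Spaces.linear_def by blast
 finally show ?thesis using assms(5) VB by auto
qed

section \<open>Linear and bilinear maps between carriers\<close>

lemma linear_on_lin: "lin (scale V) u f ==> linear_on V (amb u) f"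
 by (auto simp: lin_def linear_on_def)

lemma bilinear_on_lin:
 "(\<And>w. lin (scale V) u (%v. \<phi> v w)) ==> (\<And>v. lin (scale W) u (\<phi> v)) ==> bilinear_on V W (amb u) \<phi>"
 by (auto simp: bilinear_on_def intro: linear_on_lin)

lemma linear_on_compose: "linear_on V W f ==> linear_on W U g ==> linear_on V U (%x. g (f x))"
 by (simp add: linear_on_def)

lemma linear_on_amb: "linear_on V W f ==> linear_on V (amb (scale W)) f"
 by (simp add: linear_on_def)

lemma bilinear_on_amb: "bilinear_on V W U f ==> bilinear_on V W (amb (scale U)) f"
 by (auto simp: bilinear_on_def intro: linear_on_amb)

lemma bilinear_on_compose_left:
 "bilinear_on U V W \<phi> ==> linear_on U' U f ==> bilinear_on U' V W (%x. \<phi> (f x))"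
 by (simp add: linear_on_def bilinear_on_def)

lemma bilinear_on_compose_right:
 "bilinear_on U V W \<phi> ==> linear_on V' V f ==> bilinear_on U V' W (%x y. \<phi> x (f y))"
 by (simp add: linear_on_def bilinear_on_def)

lemma bilinear_on_compose: "bilinear_on U V W \<phi> ==> linear_on W W' f ==> bilinear_on U V W' (%x y. f (\<phi> x y))"
 by (auto simp: bilinear_on_def intro: linear_on_compose)

lemma vec_space_vector_space: "vec_space V ==> vector_space (scale V)"
 by (simp add: vec_space_def)

lemma vector_space_module: "vector_space s ==> module s"
 by (simp add: vector_space_def module_def)

lemma vec_space_closed:
 assumes "vec_space V"
 shows vec_space_zero_closed: "0 \<in> carrier V"
  and vec_space_add_closed: "x \<in> carrier V ==> y \<in> carrier V ==> x + y \<in> carrier V"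
  and vec_space_scale_closed: "x \<in> carrier V ==> scale V c x \<in> carrier V"
proof -
 interpret module "scale V" using assms by (intro vector_space_module vec_space_vector_space)
 have "subspace (carrier V)" using assms by (simp add: vec_space_def)
 then show "0 \<in> carrier V" "x \<in> carrier V ==> y \<in> carrier V ==> x + y \<in> carrier V"
  "x \<in> carrier V ==> scale V c x \<in> carrier V"
  by (auto simp: subspace_def)
qed

lemma vec_spaceI:
 assumes "vector_space (scale V)" "0 \<in> carrier V"
  "\<And>x y. x \<in> carrier V ==> y \<in> carrier V ==> x + y \<in> carrier V"
  "\<And>c x. x \<in> carrier V ==> scale V c x \<in> carrier V"
 shows "vec_space V"
proof -
 interpret module "scale V" using assms(1) by (rule vector_space_module)
 show ?thesis using assms by (auto simp: vec_space_def subspace_def)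
qed

lemma vec_space_sum_closed:
 "vec_space V ==> (\<And>i. i \<in> I ==> f i \<in> carrier V) ==> (\<Sum>i\<in>I. f i) \<in> carrier V"
 by (induction I rule: infinite_finite_induct) (auto simp: vec_space_zero_closed vec_space_add_closed)

lemma vec_space_sum_list_closed:
 "vec_space V ==> (\<And>i. i \<in> set is ==> f i \<in> carrier V) ==> (\<Sum>i\<leftarrow>is. f i) \<in> carrier V"
 by (induction "is") (auto simp: vec_space_zero_closed vec_space_add_closed)

lemma linear_on_zero: "vec_space V ==> linear_on V W f ==> f 0 = 0"
 using vec_space_zero_closed[of V] unfolding linear_on_def by (metis add_cancel_right_right)

lemma linear_on_sum:
 assumes "linear_on V W f" "vec_space V" "\<And>i. i \<in> I ==> g i \<in> carrier V"
 shows "f (\<Sum>i\<in>I. g i) = (\<Sum>i\<in>I. f (g i))"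
 using assms(3)
proof (induction I rule: infinite_finite_induct)
 case (insert x F)
 then show ?case using assms(1,2) by (simp add: linear_on_def vec_space_sum_closed)
qed (use assms linear_on_zero in auto)

section \<open>Tensors as sums of pure tensors\<close>

lemma tens_apply: "bilinear_on V W ground \<beta> ==> tens V W v w \<beta> = \<beta> v w"
 by (simp add: tens_def)

lemma tens_amb_bilinear: "bilinear_on V W (amb fscale) (tens V W)"
 by (auto simp: bilinear_on_def linear_on_def tens_def fscale_def ground_def fun_eq_iff)

lemma tens_in_carrier: "v \<in> carrier V ==> w \<in> carrier W ==> tens V W v w \<in> tens_carrier V W"
proof -
 interpret module fscale by (rule vector_space_module) simp
 show "v \<in> carrier V ==> w \<in> carrier W ==> tens V W v w \<in> tens_carrier V W"
  unfolding tens_carrier_def by (rule span_base) auto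
qed

lemma tens_space_simps [simp]: "carrier (tens_space V W) = tens_carrier V W" "scale (tens_space V W) = fscale"
 by (simp_all add: tens_space_def)

lemma vec_space_tens [simp]: "vec_space (tens_space V W)"
proof -
 interpret module fscale by (rule vector_space_module) simp
 show ?thesis by (simp add: vec_space_def tens_carrier_def)
qed

lemmas tens_carrier_zero = vec_space_zero_closed[OF vec_space_tens, simplified]
 and tens_carrier_add = vec_space_add_closed[OF vec_space_tens, simplified]
 and tens_carrier_scale = vec_space_scale_closed[OF vec_space_tens, simplified]
 and tens_carrier_sum = vec_space_sum_closed[OF vec_space_tens, simplified]
 and tens_carrier_sum_list = vec_space_sum_list_closed[OF vec_space_tens, simplified]

lemma tens_bilinear: "bilinear_on V W (tens_space V W) (tens V W)"
 using tens_amb_bilinear[of V W] by (auto simp: bilinear_on_def linear_on_def intro: tens_in_carrier)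

text \<open>Several records describe the same space: \<open>dual_space E\<close> and
  \<open>dual_hopf E\<close>, or the double, its twist and \<open>tens_space E E'\<close>. Only
  carrier and scaling enter a tensor, so these records may be exchanged.\<close>

lemma tens_congr:
 "carrier V' = carrier V ==> scale V' = scale V ==> carrier W' = carrier W ==> scale W' = scale W ==>
 tens V' W' = tens V W"
 by (simp add: tens_def bilinear_on_def linear_on_def fun_eq_iff)

lemma tens_carrier_congr:
 "carrier V' = carrier V ==> scale V' = scale V ==> carrier W' = carrier W ==> scale W' = scale W ==>
 tens_carrier V' W' = tens_carrier V W"
 by (simp add: tens_carrier_def tens_congr[of V' V W' W])

lemma lift_into_congr:
 "carrier V' = carrier V ==> scale V' = scale V ==> carrier W' = carrier W ==> scale W' = scale W ==>
 lift_into a z V' W' = lift_into a z V W"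
 by (simp add: lift_into_def tens_congr[of V' V W' W] fun_eq_iff)

text \<open>Coefficients of a linear combination are absorbed into the first factor, so every tensor
  comes from a list of pairs of the kind that \<open>lift_into\<close> quantifies over.\<close>

lemma tens_carrier_sum_of_pure:
 assumes "vec_space V" "t \<in> tens_carrier V W"
 shows "\<exists>ps. set ps \<subseteq> carrier V \<times> carrier W \<and> t = (\<Sum>(v, w)\<leftarrow>ps. tens V W v w)"
proof -
 interpret module fscale by (rule vector_space_module) simp
 let ?P = "%t. \<exists>ps. set ps \<subseteq> carrier V \<times> carrier W \<and> t = (\<Sum>(v, w)\<leftarrow>ps. tens V W v w)"
 have scal: "fscale c (tens V W v w) = tens V W (scale V c v) w" if "v \<in> carrier V" "w \<in> carrier W" for c v w
  using that tens_amb_bilinear[of V W] by (simp add: bilinear_on_def linear_on_def)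
 show "?P t"
  using assms(2) unfolding tens_carrier_def
 proof (induction rule: span_induct_alt)
  case base
  show ?case by (rule exI[of _ "[]"]) simp
 next
  case (step c x y)
  then obtain v w ps where *: "x = tens V W v w" "v \<in> carrier V" "w \<in> carrier W"
   "set ps \<subseteq> carrier V \<times> carrier W" "y = (\<Sum>(v, w)\<leftarrow>ps. tens V W v w)" by auto
  show ?case
   by (rule exI[of _ "(scale V c v, w) # ps"]) (use * scal assms(1) vec_space_scale_closed in auto)
 qed
qed

lemma tens_induct [consumes 3, case_names pure add]:
 assumes "t \<in> tens_carrier V W" "vec_space V" "vec_space W"
  and pure: "\<And>v w. v \<in> carrier V ==> w \<in> carrier W ==> Q (tens V W v w)"
  and add: "\<And>s t. s \<in> tens_carrier V W ==> t \<in> tens_carrier V W ==> Q s ==> Q t ==> Q (s + t)"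
 shows "Q t"
proof -
 obtain ps where ps: "set ps \<subseteq> carrier V \<times> carrier W" "t = (\<Sum>(v, w)\<leftarrow>ps. tens V W v w)"
  using tens_carrier_sum_of_pure assms(1,2) by blast
 have "tens V W 0 0 = 0"
  using tens_bilinear[of V W] vec_space_zero_closed[OF assms(2)] vec_space_zero_closed[OF assms(3)]
  linear_on_zero[OF assms(3)] unfolding bilinear_on_def by blast
 \<comment> \<open>The empty sum is covered by the pure case as
   \<open>0 \<otimes> 0\<close>.\<close>
 then have Q0: "Q 0" using pure[of 0 0] assms vec_space_zero_closed by metis
 have "Q (\<Sum>(v, w)\<leftarrow>ps. tens V W v w) \<and> (\<Sum>(v, w)\<leftarrow>ps. tens V W v w) \<in> tens_carrier V W"
  using ps(1)
 proof (induction ps)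
  case Nil
  then show ?case by (simp only: list.map sum_list.Nil Q0 tens_carrier_zero simp_thms)
 next
  case (Cons p ps)
  obtain v w where p: "p = (v, w)" by fastforce
  have vw: "v \<in> carrier V" "w \<in> carrier W" using Cons.prems p by auto
  have IH: "Q (\<Sum>(v, w)\<leftarrow>ps. tens V W v w)" "(\<Sum>(v, w)\<leftarrow>ps. tens V W v w) \<in> tens_carrier V W"
   using Cons by auto
  have "(\<Sum>(v, w)\<leftarrow>p # ps. tens V W v w) = tens V W v w + (\<Sum>(v, w)\<leftarrow>ps. tens V W v w)"
   by (simp add: p)
  then show ?case
   using add[OF tens_in_carrier[OF vw] IH(2) pure[OF vw] IH(1)]
    tens_carrier_add[OF tens_in_carrier[OF vw] IH(2)] by metis
 qed
 then show ?thesis using ps(2) by simp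
qed

text \<open>Composed with a functional \<open>l\<close>, the map \<open>\<phi>\<close> becomes a
  bilinear form, and both sides are the value of the same tensor at this form. This is the
  well-definedness behind \<open>lift_into\<close>.\<close>

lemma sum_of_pure_unique:
 fixes u :: "'k::field => 'u::ab_group_add => 'u"
 assumes "vector_space u" "bilinear_on V W (amb u) \<phi>"
  and "set ps \<subseteq> carrier V \<times> carrier W" "set qs \<subseteq> carrier V \<times> carrier W"
  and eq: "(\<Sum>(v, w)\<leftarrow>ps. tens V W v w) = (\<Sum>(v, w)\<leftarrow>qs. tens V W v w)"
 shows "(\<Sum>(v, w)\<leftarrow>ps. \<phi> v w) = (\<Sum>(v, w)\<leftarrow>qs. \<phi> v w)"
proof (rule functionals_separate[OF assms(1)])
 fix l assume l: "lin u (*) l"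
 have "linear_on (amb u) ground l" using l by (auto simp: lin_def linear_on_def ground_def)
 then have b: "bilinear_on V W ground (%v w. l (\<phi> v w))"
  using assms(2) bilinear_on_compose by blast
 have "l (\<Sum>(v, w)\<leftarrow>rs. \<phi> v w) = (\<Sum>(v, w)\<leftarrow>rs. tens V W v w) (%v w. l (\<phi> v w))" for rs
  by (induction rs) (auto simp: lin_zero[OF l] lin_add[OF l] tens_apply[OF b])
 then show "l (\<Sum>(v, w)\<leftarrow>ps. \<phi> v w) = l (\<Sum>(v, w)\<leftarrow>qs. \<phi> v w)" using eq by simp
qed

section \<open>Linear maps induced by bilinear maps\<close>

lemma foldr_plus: "foldr (%(v, w). (+) (\<phi> v w)) ps 0 = (\<Sum>(v, w)\<leftarrow>ps. \<phi> v w)"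
 by (induction ps) auto

lemma lift_sum_of_pure:
 fixes u :: "'k::field => 'u::ab_group_add => 'u"
 assumes "vector_space u" "bilinear_on V W (amb u) \<phi>" "set ps \<subseteq> carrier V \<times> carrier W"
 shows "lift V W \<phi> (\<Sum>(v, w)\<leftarrow>ps. tens V W v w) = (\<Sum>(v, w)\<leftarrow>ps. \<phi> v w)"
 unfolding lift_def lift_into_def foldr_plus
proof (rule the_equality)
 show "\<exists>qs. set qs \<subseteq> carrier V \<times> carrier W \<and>
   (\<Sum>(v, w)\<leftarrow>ps. tens V W v w) = (\<Sum>(v, w)\<leftarrow>qs. tens V W v w) \<and>
   (\<Sum>(v, w)\<leftarrow>ps. \<phi> v w) = (\<Sum>(v, w)\<leftarrow>qs. \<phi> v w)"
  using assms(3) by (intro exI[of _ ps] conjI refl)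
 show "x = (\<Sum>(v, w)\<leftarrow>ps. \<phi> v w)"
  if "\<exists>qs. set qs \<subseteq> carrier V \<times> carrier W \<and>
   (\<Sum>(v, w)\<leftarrow>ps. tens V W v w) = (\<Sum>(v, w)\<leftarrow>qs. tens V W v w) \<and>
   x = (\<Sum>(v, w)\<leftarrow>qs. \<phi> v w)" for x
  using that sum_of_pure_unique[OF assms(1-3)] by (elim exE conjE) simp
qed

lemma lift_tens:
 "vector_space u ==> bilinear_on V W (amb u) \<phi> ==> v \<in> carrier V ==> w \<in> carrier W ==>
 lift V W \<phi> (tens V W v w) = \<phi> v w"
 using lift_sum_of_pure[of u V W \<phi> "[(v, w)]"] by simp

text \<open>The description of \<open>lift\<close> only sees values on the carriers. A raw operation
  can therefore be replaced by its extension to the ambient space before bilinearity is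
  established.\<close>

lemma lift_cong:
 assumes "\<And>v w. v \<in> carrier V ==> w \<in> carrier W ==> \<phi> v w = \<psi> v w"
 shows "lift V W \<phi> t = lift V W \<psi> t"
proof -
 have "foldr (%(v, w). (+) (\<phi> v w)) ps 0 = foldr (%(v, w). (+) (\<psi> v w)) ps 0"
  if "set ps \<subseteq> carrier V \<times> carrier W" for ps
  using that assms by (induction ps) auto
 then have "(set ps \<subseteq> carrier V \<times> carrier W \<and> t = (\<Sum>(v, w)\<leftarrow>ps. tens V W v w) \<and>
    u = foldr (%(v, w). (+) (\<phi> v w)) ps 0) \<longleftrightarrow>
   (set ps \<subseteq> carrier V \<times> carrier W \<and> t = (\<Sum>(v, w)\<leftarrow>ps. tens V W v w) \<and>
    u = foldr (%(v, w). (+) (\<psi> v w)) ps 0)" for u ps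
  by (intro conj_cong refl) simp
 then show ?thesis unfolding lift_def lift_into_def by simp
qed

lemma lift_add:
 assumes "vector_space u" "bilinear_on V W (amb u) \<phi>" "vec_space V"
  and "s \<in> tens_carrier V W" "t \<in> tens_carrier V W"
 shows "lift V W \<phi> (s + t) = lift V W \<phi> s + lift V W \<phi> t"
proof -
 obtain ps qs where *: "set ps \<subseteq> carrier V \<times> carrier W" "s = (\<Sum>(v, w)\<leftarrow>ps. tens V W v w)"
  "set qs \<subseteq> carrier V \<times> carrier W" "t = (\<Sum>(v, w)\<leftarrow>qs. tens V W v w)"
  using assms tens_carrier_sum_of_pure by metis
 have "s + t = (\<Sum>(v, w)\<leftarrow>ps @ qs. tens V W v w)" using * by simp
 then have "lift V W \<phi> (s + t) = (\<Sum>(v, w)\<leftarrow>ps @ qs. \<phi> v w)"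
  using * lift_sum_of_pure[OF assms(1,2), of "ps @ qs"] by simp
 then show ?thesis using * lift_sum_of_pure[OF assms(1,2)] by simp
qed

lemma lift_scale:
 assumes "vector_space u" "bilinear_on V W (amb u) \<phi>" "vec_space V" "vec_space W"
  and "t \<in> tens_carrier V W"
 shows "lift V W \<phi> (fscale c t) = u c (lift V W \<phi> t)"
 using assms(5,3,4)
proof (induction rule: tens_induct)
 case (pure v w)
 have "fscale c (tens V W v w) = tens V W (scale V c v) w"
  using pure tens_amb_bilinear[of V W] by (simp add: bilinear_on_def linear_on_def)
 then show ?case using pure assms lift_tens[OF assms(1,2)] vec_space_scale_closed[OF assms(3)]
  by (simp add: bilinear_on_def linear_on_def)
next
 case (add s t)
 have "fscale c (s + t) = fscale c s + fscale c t" by (simp add: fscale_def fun_eq_iff algebra_simps)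
 then have "lift V W \<phi> (fscale c (s + t)) = u c (lift V W \<phi> (s + t))"
  using add lift_add[OF assms(1-3)] assms(1) by (simp add: vector_space_add tens_carrier_scale)
 then show ?case .
qed

lemma lift_linear_amb:
 "vector_space u ==> bilinear_on V W (amb u) \<phi> ==> vec_space V ==> vec_space W ==>
 linear_on (tens_space V W) (amb u) (lift V W \<phi>)"
 by (simp add: linear_on_def lift_add lift_scale)

lemma lift_in_carrier:
 assumes "bilinear_on V W U \<phi>" "vec_space V" "vec_space W" "vec_space U"
  and "t \<in> tens_carrier V W"
 shows "lift V W \<phi> t \<in> carrier U"
 using assms(5,2,3)
proof (induction rule: tens_induct)
 case (pure v w)
 then show ?case using assms lift_tens[OF vec_space_vector_space bilinear_on_amb, of U V W \<phi> v w]
  by (simp add: bilinear_on_def linear_on_def)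
next
 case (add s t)
 then show ?case
  using lift_add[OF vec_space_vector_space bilinear_on_amb] assms vec_space_add_closed by metis
qed

lemma lift_linear:
 "bilinear_on V W U \<phi> ==> vec_space V ==> vec_space W ==> vec_space U ==>
 linear_on (tens_space V W) U (lift V W \<phi>)"
 using lift_linear_amb[OF vec_space_vector_space bilinear_on_amb, of U V W \<phi>] lift_in_carrier[of V W U \<phi>]
 by (auto simp: linear_on_def)

lemma lin_lift:
 assumes "vector_space u" "bilinear_on V W (amb u) \<phi>" "vec_space V" "t \<in> tens_carrier V W" "lin u u' f"
  "vector_space u'"
 shows "f (lift V W \<phi> t) = lift V W (%v w. f (\<phi> v w)) t"
proof -
 obtain ps where *: "set ps \<subseteq> carrier V \<times> carrier W" "t = (\<Sum>(v, w)\<leftarrow>ps. tens V W v w)"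
  using assms tens_carrier_sum_of_pure by metis
 have b: "bilinear_on V W (amb u') (%v w. f (\<phi> v w))"
  by (rule bilinear_on_compose[OF assms(2)]) (use assms(5) in \<open>auto simp: lin_def linear_on_def\<close>)
 show ?thesis
  using * lift_sum_of_pure[OF assms(1,2) *(1)] lift_sum_of_pure[OF assms(6) b *(1)]
   lin_sum_list[OF assms(5)]
  by (simp add: split_def)
qed

text \<open>Most identities of tensors below are proved in this way: linearity leaves only pure
  tensors to be checked, one argument at a time.\<close>

lemma linear_on_tens_eqI:
 assumes "linear_on (tens_space V W) U f" "linear_on (tens_space V W) U' g" "vec_space V" "vec_space W"
  and "\<And>v w. v \<in> carrier V ==> w \<in> carrier W ==> f (tens V W v w) = g (tens V W v w)"
  and "t \<in> tens_carrier V W"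
 shows "f t = g t"
 using assms(6,3,4)
proof (induction rule: tens_induct)
 case (pure v w)
 then show ?case by (rule assms(5))
next
 case (add s t)
 then have "f (s + t) = g (s + t)" using assms(1,2) by (simp add: linear_on_def)
 then show ?case .
qed

lemma linear_on_lift:
 assumes "linear_on U U' f" "bilinear_on V W U \<phi>" "vec_space V" "vec_space W" "vec_space U" "vec_space U'"
  and "t \<in> tens_carrier V W"
 shows "f (lift V W \<phi> t) = lift V W (%v w. f (\<phi> v w)) t"
proof (rule linear_on_tens_eqI[where f = "%t. f (lift V W \<phi> t)", OF _ _ assms(3,4) _ assms(7)])
 have b: "bilinear_on V W U' (%v w. f (\<phi> v w))" using assms(1,2) bilinear_on_compose by blast
 show "linear_on (tens_space V W) U' (%t. f (lift V W \<phi> t))"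
  using linear_on_compose[OF lift_linear] assms by blast
 show "linear_on (tens_space V W) U' (lift V W (%v w. f (\<phi> v w)))"
  using lift_linear[OF b] assms by blast
 show "f (lift V W \<phi> (tens V W v w)) = lift V W (%v w. f (\<phi> v w)) (tens V W v w)"
  if "v \<in> carrier V" "w \<in> carrier W" for v w
  using that lift_tens[OF vec_space_vector_space[OF assms(5)] bilinear_on_amb[OF assms(2)]]
   lift_tens[OF vec_space_vector_space[OF assms(6)] bilinear_on_amb[OF b]] by simp
qed

text \<open>A decomposition of \<open>t\<close> into pure tensors does not depend on the parameter
  \<open>x\<close>, so the lift is a fixed finite sum of maps that are linear in
  \<open>x\<close>.\<close>

lemma linear_on_lift_param:
 assumes "vec_space V" "vec_space W" "vec_space U" "vec_space X" "t \<in> tens_carrier V W"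
  and b: "\<And>x. x \<in> carrier X ==> bilinear_on V W U (\<phi> x)"
  and l: "\<And>v w. v \<in> carrier V ==> w \<in> carrier W ==> linear_on X U (%x. \<phi> x v w)"
 shows "linear_on X U (%x. lift V W (\<phi> x) t)"
proof -
 obtain ps where ps: "set ps \<subseteq> carrier V \<times> carrier W" "t = (\<Sum>(v, w)\<leftarrow>ps. tens V W v w)"
  using tens_carrier_sum_of_pure assms(1,5) by blast
 have eq: "lift V W (\<phi> x) t = (\<Sum>(v, w)\<leftarrow>ps. \<phi> x v w)" if "x \<in> carrier X" for x
  using ps lift_sum_of_pure[OF vec_space_vector_space[OF assms(3)] bilinear_on_amb[OF b[OF that]]] by simp
 have "linear_on X U (%x. \<Sum>(v, w)\<leftarrow>ps. \<phi> x v w)"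
  using ps(1)
 proof (induction ps)
  case Nil
  then show ?case
   using assms(3) by (simp add: linear_on_def vec_space_zero_closed vector_space_zero vec_space_vector_space)
 next
  case (Cons p ps)
  obtain v w where p: "p = (v, w)" by fastforce
  have "linear_on X U (%x. \<phi> x v w)" "linear_on X U (%x. \<Sum>(v, w)\<leftarrow>ps. \<phi> x v w)"
   using l[of v w] Cons p by auto
  then have "linear_on X U (%x. \<phi> x v w + (\<Sum>(v, w)\<leftarrow>ps. \<phi> x v w))"
   using assms(3) unfolding linear_on_def
   by (simp add: vec_space_add_closed vector_space_add vec_space_vector_space algebra_simps)
  then show ?case by (simp add: p)
 qed
 then show ?thesis
  using eq assms(4) unfolding linear_on_def by (simp add: vec_space_closed)
qed

section \<open>Tensor products of algebras\<close>

lemma algebra_vec_space: "algebra A ==> vec_space A"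
 and algebra_bilinear: "algebra A ==> bilinear_on A A A (mult A)"
 and algebra_unity_closed: "algebra A ==> unity A \<in> carrier A"
 and algebra_assoc: "algebra A ==> x \<in> carrier A ==> y \<in> carrier A ==> z \<in> carrier A ==>
  mult A (mult A x y) z = mult A x (mult A y z)"
 and algebra_unity_left: "algebra A ==> x \<in> carrier A ==> mult A (unity A) x = x"
 and algebra_unity_right: "algebra A ==> x \<in> carrier A ==> mult A x (unity A) = x"
 by (simp_all add: algebra_def)

lemma bilinear_on_closed: "bilinear_on U V W \<phi> ==> x \<in> carrier U ==> y \<in> carrier V ==> \<phi> x y \<in> carrier W"
 by (simp add: bilinear_on_def linear_on_def)

lemma tens_alg_simps [simp]:
 "carrier (tens_alg A B) = tens_carrier A B" "scale (tens_alg A B) = fscale"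
 "unity (tens_alg A B) = tens A B (unity A) (unity B)"
 by (simp_all add: tens_alg_def)

lemma vec_space_tens_alg [simp]: "vec_space (tens_alg A B)"
 using vec_space_tens[of A B] by (simp add: vec_space_def)

lemma bilinear_on_cong_space:
 "carrier U = carrier U' ==> scale U = scale U' ==> carrier V = carrier V' ==> scale V = scale V' ==>
 carrier W = carrier W' ==> scale W = scale W' ==>
 bilinear_on U V W f \<longleftrightarrow> bilinear_on U' V' W' f"
 by (simp add: bilinear_on_def linear_on_def)

context
 fixes A :: "('k::field, 'v::ab_group_add, 'y) alg_scheme" and B :: "('k, 'w::ab_group_add, 'z) alg_scheme"
 assumes vA: "vec_space A" and vB: "vec_space B"
  and bA: "bilinear_on A A A (mult A)" and bB: "bilinear_on B B B (mult B)"
begin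

private lemma inner_bilinear:
 assumes "a \<in> carrier A" "b \<in> carrier B"
 shows "bilinear_on A B (tens_space A B) (%a' b'. tens A B (mult A a a') (mult B b b'))"
proof -
 have "linear_on A A (mult A a)" "linear_on B B (mult B b)"
  using assms bA bB by (auto simp: bilinear_on_def)
 from bilinear_on_compose_right[OF bilinear_on_compose_left[OF tens_bilinear this(1)] this(2)]
 show ?thesis .
qed

private lemma outer_bilinear:
 assumes "t \<in> tens_carrier A B"
 shows "bilinear_on A B (tens_space A B)
  (%a b. lift A B (%a' b'. tens A B (mult A a a') (mult B b b')) t)"
 unfolding bilinear_on_def
proof (intro conjI ballI)
 fix a assume a: "a \<in> carrier A"
 show "linear_on B (tens_space A B) (%b. lift A B (%a' b'. tens A B (mult A a a') (mult B b b')) t)"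
 proof (rule linear_on_lift_param[OF vA vB vec_space_tens vB assms inner_bilinear[OF a]])
  fix v w assume vw: "v \<in> carrier A" "w \<in> carrier B"
  have "linear_on B (tens_space A B) (tens A B (mult A a v))"
   using tens_bilinear[of A B] bilinear_on_closed[OF bA a vw(1)] by (auto simp: bilinear_on_def)
  then show "linear_on B (tens_space A B) (%b. tens A B (mult A a v) (mult B b w))"
   using bB vw linear_on_compose[of B B "%b. mult B b w"] by (auto simp: bilinear_on_def)
 qed
next
 fix b assume b: "b \<in> carrier B"
 show "linear_on A (tens_space A B) (%a. lift A B (%a' b'. tens A B (mult A a a') (mult B b b')) t)"
 proof (rule linear_on_lift_param[OF vA vB vec_space_tens vA assms inner_bilinear[OF _ b]])
  fix v w assume vw: "v \<in> carrier A" "w \<in> carrier B"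
  have "linear_on A (tens_space A B) (%a. tens A B a (mult B b w))"
   using tens_bilinear[of A B] bilinear_on_closed[OF bB b vw(2)] by (auto simp: bilinear_on_def)
  then show "linear_on A (tens_space A B) (%a. tens A B (mult A a v) (mult B b w))"
   using bA vw linear_on_compose[of A A "%a. mult A a v"] by (auto simp: bilinear_on_def)
 qed
qed

private lemma lift_tens_pure:
 "bilinear_on A B (tens_space A B) \<phi> ==> a \<in> carrier A ==> b \<in> carrier B ==>
 lift A B \<phi> (tens A B a b) = \<phi> a b"
 using lift_tens[OF vs_fscale, of A B \<phi> a b] bilinear_on_amb[of A B "tens_space A B" \<phi>] by simp

lemma tens_alg_mult:
 assumes "a \<in> carrier A" "a' \<in> carrier A" "b \<in> carrier B" "b' \<in> carrier B"
 shows "mult (tens_alg A B) (tens A B a b) (tens A B a' b') = tens A B (mult A a a') (mult B b b')"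
 unfolding tens_alg_def using assms
 by (simp add: lift_tens_pure outer_bilinear tens_in_carrier inner_bilinear)

lemma tens_alg_bilinear: "bilinear_on (tens_alg A B) (tens_alg A B) (tens_alg A B) (mult (tens_alg A B))"
proof -
 have "bilinear_on (tens_space A B) (tens_space A B) (tens_space A B) (mult (tens_alg A B))"
  unfolding bilinear_on_def
 proof (intro conjI ballI)
  fix t assume t: "t \<in> carrier (tens_space A B)"
  show "linear_on (tens_space A B) (tens_space A B) (%s. mult (tens_alg A B) s t)"
   using lift_linear[OF outer_bilinear[of t] vA vB vec_space_tens] t by (simp add: tens_alg_def)
 next
  fix s assume s: "s \<in> carrier (tens_space A B)"
  have "linear_on (tens_space A B) (tens_space A B)
   (%t. lift A B (%a b. lift A B (%a' b'. tens A B (mult A a a') (mult B b b')) t) s)"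
  proof (rule linear_on_lift_param[OF vA vB vec_space_tens vec_space_tens])
   fix v w assume "v \<in> carrier A" "w \<in> carrier B"
   then show "linear_on (tens_space A B) (tens_space A B)
    (lift A B (%a' b'. tens A B (mult A v a') (mult B w b')))"
    using lift_linear[OF inner_bilinear vA vB vec_space_tens] by blast
  qed (use s outer_bilinear in auto)
  then show "linear_on (tens_space A B) (tens_space A B) (mult (tens_alg A B) s)"
   by (simp add: tens_alg_def)
 qed
 then show ?thesis by (subst bilinear_on_cong_space[of _ "tens_space A B" _ "tens_space A B" _ "tens_space A B"]) auto
qed

end

lemma linear_on_tens_sum_eqI:
 assumes "linear_on (tens_space V W) U f" "linear_on (tens_space V W) U' g" "vec_space V" "vec_space W"
  and "\<And>v w. v \<in> carrier V ==> w \<in> carrier W ==> f (tens V W v w) = g (tens V W v w)"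
 shows "\<forall>t\<in>tens_carrier V W. f t = g t"
 using linear_on_tens_eqI[OF assms(1-4)] assms(5) by blast

lemma algebra_tens_alg:
 assumes A: "algebra A" and B: "algebra B"
 shows "algebra (tens_alg A B)"
proof -
 let ?T = "tens_alg A B"
 note v = algebra_vec_space[OF A] algebra_vec_space[OF B]
 note mul = tens_alg_mult[OF v algebra_bilinear[OF A] algebra_bilinear[OF B]]
 note bil = tens_alg_bilinear[OF v algebra_bilinear[OF A] algebra_bilinear[OF B]]
 note cl = bilinear_on_closed[OF algebra_bilinear[OF A]] bilinear_on_closed[OF algebra_bilinear[OF B]]
  algebra_unity_closed[OF A] algebra_unity_closed[OF B]
 have T: "linear_on ?T ?T f \<longleftrightarrow> linear_on (tens_space A B) (tens_space A B) f" for f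
  by (simp add: linear_on_def)
 have L: "linear_on (tens_space A B) (tens_space A B) (mult ?T x)"
  "linear_on (tens_space A B) (tens_space A B) (%y. mult ?T y x)" if "x \<in> tens_carrier A B" for x
  using bil that by (auto simp: bilinear_on_def T)
 have cT: "mult ?T x y \<in> tens_carrier A B" if "x \<in> tens_carrier A B" "y \<in> tens_carrier A B" for x y
  using bilinear_on_closed[OF bil] that by simp
 \<comment> \<open>Associativity is linear in each argument. The arguments are freed from the pure
   case one at a time: here the third one, then the second and the first.\<close>
 have 1: "mult ?T (mult ?T (tens A B a b) (tens A B a' b')) z =
   mult ?T (tens A B a b) (mult ?T (tens A B a' b') z)"
  if "a \<in> carrier A" "b \<in> carrier B" "a' \<in> carrier A" "b' \<in> carrier B" "z \<in> tens_carrier A B" for a b a' b' z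
 proof (rule linear_on_tens_eqI[OF _ _ v _ that(5)])
  show "linear_on (tens_space A B) (tens_space A B) (mult ?T (mult ?T (tens A B a b) (tens A B a' b')))"
   using that by (intro L cT tens_in_carrier)
  show "linear_on (tens_space A B) (tens_space A B) (%z. mult ?T (tens A B a b) (mult ?T (tens A B a' b') z))"
   using that by (intro linear_on_compose[OF L(1) L(1)] tens_in_carrier)
 qed (use that in \<open>simp add: mul cl algebra_assoc[OF A] algebra_assoc[OF B]\<close>)
 have 2: "mult ?T (mult ?T (tens A B a b) y) z = mult ?T (tens A B a b) (mult ?T y z)"
  if "a \<in> carrier A" "b \<in> carrier B" "y \<in> tens_carrier A B" "z \<in> tens_carrier A B" for a b y z
 proof (rule linear_on_tens_eqI[OF _ _ v _ that(3)])
  show "linear_on (tens_space A B) (tens_space A B) (%y. mult ?T (mult ?T (tens A B a b) y) z)"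
   using that by (intro linear_on_compose[OF L(1) L(2)] tens_in_carrier)
  show "linear_on (tens_space A B) (tens_space A B) (%y. mult ?T (tens A B a b) (mult ?T y z))"
   using that by (intro linear_on_compose[OF L(2) L(1)] tens_in_carrier)
 qed (use that 1 in auto)
 have 3: "mult ?T (mult ?T x y) z = mult ?T x (mult ?T y z)"
  if "x \<in> tens_carrier A B" "y \<in> tens_carrier A B" "z \<in> tens_carrier A B" for x y z
 proof (rule linear_on_tens_eqI[OF _ _ v _ that(1)])
  show "linear_on (tens_space A B) (tens_space A B) (%x. mult ?T (mult ?T x y) z)"
   using that by (intro linear_on_compose[OF L(2) L(2)])
  show "linear_on (tens_space A B) (tens_space A B) (%x. mult ?T x (mult ?T y z))"
   using that by (intro L cT)
 qed (use that 2 in auto)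
 have u: "tens A B (unity A) (unity B) \<in> tens_carrier A B" by (intro tens_in_carrier cl)
 have 4: "mult ?T (tens A B (unity A) (unity B)) x = x" if "x \<in> tens_carrier A B" for x
  by (rule linear_on_tens_eqI[OF L(1)[OF u] _ v _ that, of "tens_space A B"])
   (auto simp: linear_on_def mul cl algebra_unity_left[OF A] algebra_unity_left[OF B])
 have 5: "mult ?T x (tens A B (unity A) (unity B)) = x" if "x \<in> tens_carrier A B" for x
  by (rule linear_on_tens_eqI[OF L(2)[OF u] _ v _ that, of "tens_space A B"])
   (auto simp: linear_on_def mul cl algebra_unity_right[OF A] algebra_unity_right[OF B])
 show ?thesis using 3 4 5 bil u by (simp add: algebra_def)
qed


section \<open>Finite dimensional Hopf algebras\<close>

lemma sum_fun_apply: "(\<Sum>i\<in>I. f i) x = (\<Sum>i\<in>I. f i x)"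
 by (induction I rule: infinite_finite_induct) auto

text \<open>The basis of the carrier is extended to one of the whole ambient space, so that the
  coordinates are linear everywhere and not only on the carrier.\<close>

lemma ex_dual_basis:
 fixes V :: "('k::field, 'v::ab_group_add, 'z) vspace_scheme"
 assumes "vec_space V" "finite_dim V"
 shows "\<exists>B c. finite B \<and> B \<subseteq> carrier V \<and> (\<forall>b. lin (scale V) (*) (c b)) \<and>
  (\<forall>b\<in>B. \<forall>b'\<in>B. c b b' = (if b = b' then 1 else 0)) \<and>
  (\<forall>x\<in>carrier V. x = (\<Sum>b\<in>B. scale V (c b x) b))"
proof -
 interpret vector_space "scale V" using assms(1) by (rule vec_space_vector_space)
 obtain S where S: "finite S" "S \<subseteq> carrier V" "span S = carrier V"
  using assms(2) by (auto simp: finite_dim_def)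
 obtain B where B: "B \<subseteq> S" "independent B" "S \<subseteq> span B"
  using maximal_independent_subset[of S] by blast
 have fB: "finite B" using B(1) S(1) finite_subset by blast
 have spB: "span B = carrier V" using B S by (metis span_mono span_span subset_antisym)
 define X where "X = extend_basis B"
 have X: "independent X" "span X = UNIV" "B \<subseteq> X"
  using independent_extend_basis[OF B(2)] span_extend_basis[OF B(2)] extend_basis_superset[OF B(2)]
  by (auto simp: X_def)
 let ?c = "%b v. representation X v b"
 have "lin (scale V) (*) (?c b)" for b
  unfolding lin_def using X by (simp add: representation_add representation_scale)
 moreover have "?c b b' = (if b = b' then 1 else 0)" if "b \<in> B" "b' \<in> B" for b b'
  using representation_basis[OF X(1), of b'] that X(3) by auto
 moreover have "x = (\<Sum>b\<in>B. scale V (?c b x) b)" if "x \<in> carrier V" for x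
 proof -
  have "x \<in> span B" using that spB by simp
  then have "representation X x = representation B x" "(\<Sum>b\<in>B. scale V (representation B x b) b) = x"
   using representation_extend[OF X(1) _ X(3)] sum_representation_eq[OF B(2) _ fB] by auto
  then show ?thesis by simp
 qed
 moreover have "B \<subseteq> carrier V" using B(1) S(2) by blast
 ultimately show ?thesis using fB by (intro exI[of _ B] exI[of _ ?c]) blast
qed

text \<open>With \<open>w = (\<Sum>i\<in>I. c i w e i)\<close>, a tensor becomes a sum of pure
  tensors with fixed second factors. The Sweedler sums and their analogues for
  \<open>A \<otimes> E\<close> and \<open>E* \<otimes> E*\<close> are instances.\<close>

lemma lift_expand:
 assumes "vec_space V" "vec_space W" "t \<in> tens_carrier V W" "vector_space u" "bilinear_on V W (amb u) \<phi>"
  and e: "\<And>i. i \<in> I ==> e i \<in> carrier W" and c: "\<And>i. linear_on W ground (c i)"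
  and exp: "\<And>w. w \<in> carrier W ==> (\<Sum>i\<in>I. scale W (c i w) (e i)) = w"
 shows "lift V W \<phi> t = (\<Sum>i\<in>I. \<phi> (lift V W (%v w. scale V (c i w) v) t) (e i))"
proof (rule linear_on_tens_eqI[OF _ _ assms(1,2) _ assms(3)])
 note sV = vec_space_vector_space[OF assms(1)]
 have cb: "bilinear_on V W V (%v w. scale V (c i w) v)" for i
  using c[of i] unfolding bilinear_on_def linear_on_def ground_def
  by (simp add: vec_space_scale_closed[OF assms(1)] vector_space_add[OF sV] vector_space_mult[OF sV]
   vector_space_add_left[OF sV] mult.commute)
 show "linear_on (tens_space V W) (amb u) (lift V W \<phi>)"
  using assms by (intro lift_linear_amb) auto
 have l: "linear_on (tens_space V W) V (lift V W (%v w. scale V (c i w) v))" for i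
  using lift_linear[OF cb assms(1,2,1)] .
 have "linear_on (tens_space V W) (amb u) (%t. \<phi> (lift V W (%v w. scale V (c i w) v) t) (e i))"
  if "i \<in> I" for i
  by (rule linear_on_compose[OF l]) (use assms(5) e[OF that] in \<open>auto simp: bilinear_on_def\<close>)
 then show "linear_on (tens_space V W) (amb u)
   (%t. \<Sum>i\<in>I. \<phi> (lift V W (%v w. scale V (c i w) v) t) (e i))"
  using assms(4) by (simp add: linear_on_def sum.distrib vector_space_sum[OF assms(4)])
 fix v w assume vw: "v \<in> carrier V" "w \<in> carrier W"
 have lv: "linear_on W (amb u) (\<phi> v)" using assms(5) vw by (auto simp: bilinear_on_def)
 have "lift V W (%v w. scale V (c i w) v) (tens V W v w) = scale V (c i w) v" for i
  using lift_tens[OF sV bilinear_on_amb[OF cb]] vw by simp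
 moreover have "(\<Sum>i\<in>I. \<phi> (scale V (c i w) v) (e i)) = (\<Sum>i\<in>I. \<phi> v (scale W (c i w) (e i)))"
  using assms(5) vw e by (intro sum.cong) (auto simp: bilinear_on_def linear_on_def)
 moreover have "... = \<phi> v w"
  using linear_on_sum[OF lv assms(2), of I "%i. scale W (c i w) (e i)"] vec_space_scale_closed[OF assms(2)]
   exp[OF vw(2)] e by simp
 ultimately show "lift V W \<phi> (tens V W v w) =
   (\<Sum>i\<in>I. \<phi> (lift V W (%v w. scale V (c i w) v) (tens V W v w)) (e i))"
  using lift_tens[OF assms(4,5) vw] by simp
qed

locale fd_hopf =
 fixes E :: "('k::field, 'e::ab_group_add) hopf"
 assumes hopf: "hopf_algebra E" and fin_dim: "finite_dim E"
begin

abbreviation sE :: "'k => 'e => 'e" where "sE \<equiv> scale E"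

lemma alg_E: "algebra E"
 using hopf by (simp add: hopf_algebra_def)

lemma vec_space_E [simp]: "vec_space E"
 using alg_E by (simp add: algebra_def)

lemma vector_space_E [simp, lin_intros]: "vector_space sE"
 using vec_space_E by (rule vec_space_vector_space)

text \<open>A basis of \<open>E\<close> and coordinate functionals, which are defined on the ambient space.\<close>

definition basis_coords :: "'e set \<times> ('e => 'e => 'k)" where
 "basis_coords = (SOME (B, c). finite B \<and> B \<subseteq> carrier E \<and> (\<forall>b. lin sE (*) (c b)) \<and>
  (\<forall>b\<in>B. \<forall>b'\<in>B. c b b' = (if b = b' then 1 else 0)) \<and>
  (\<forall>x\<in>carrier E. x = (\<Sum>b\<in>B. sE (c b x) b)))"

definition bas :: "'e set" where "bas = fst basis_coords"
definition cf :: "'e => 'e => 'k" where "cf = snd basis_coords"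

lemma basis_coords:
 "finite bas \<and> bas \<subseteq> carrier E \<and> (\<forall>b. lin sE (*) (cf b)) \<and>
  (\<forall>b\<in>bas. \<forall>b'\<in>bas. cf b b' = (if b = b' then 1 else 0)) \<and>
  (\<forall>x\<in>carrier E. x = (\<Sum>b\<in>bas. sE (cf b x) b))"
proof -
 have "case basis_coords of (B, c) => finite B \<and> B \<subseteq> carrier E \<and> (\<forall>b. lin sE (*) (c b)) \<and>
  (\<forall>b\<in>B. \<forall>b'\<in>B. c b b' = (if b = b' then 1 else 0)) \<and>
  (\<forall>x\<in>carrier E. x = (\<Sum>b\<in>B. sE (c b x) b))"
  unfolding basis_coords_def
  by (rule someI_ex) (use ex_dual_basis[OF vec_space_E fin_dim] in auto)
 then show ?thesis by (simp add: bas_def cf_def split_def)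
qed

lemma finite_bas [simp]: "finite bas"
 and bas_closed [simp]: "b \<in> bas ==> b \<in> carrier E"
 and lin_cf [simp]: "lin sE (*) (cf b)"
 and cf_bas: "b \<in> bas ==> b' \<in> bas ==> cf b b' = (if b = b' then 1 else 0)"
 and basis_expand: "x \<in> carrier E ==> (\<Sum>b\<in>bas. sE (cf b x) b) = x"
 using basis_coords by auto

lemma lin_cf' [lin_intros]: "lin s sE f ==> lin s (*) (%x. cf b (f x))"
 by (rule lin_compose[OF lin_cf])

text \<open>A projection of the ambient space onto \<open>E\<close>.  All operations are extended along it, so that
 multilinearity needs no membership conditions.\<close>

definition P :: "'e => 'e" where "P x = (\<Sum>b\<in>bas. sE (cf b x) b)"

lemma P_closed [simp]: "P x \<in> carrier E"
 unfolding P_def by (intro vec_space_sum_closed vec_space_scale_closed) auto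

lemma P_id [simp]: "x \<in> carrier E ==> P x = x"
 unfolding P_def by (rule basis_expand)

lemma lin_P [lin_intros]: "lin s sE f ==> lin s sE (%x. P (f x))"
 unfolding P_def by (intro lin_intros)

lemma cf_P [simp]: "cf b (P x) = cf b x" if "b \<in> bas"
proof -
 have "cf b (P x) = (\<Sum>b'\<in>bas. cf b' x * cf b b')"
  unfolding P_def by (simp add: lin_sum[OF lin_cf] lin_scale[OF lin_cf])
 also have "... = (\<Sum>b'\<in>bas. if b' = b then cf b x else 0)"
  by (rule sum.cong) (auto simp: cf_bas that)
 finally show ?thesis using that by simp
qed

lemma bilinear_cf:
 assumes "vec_space V"
 shows "bilinear_on V E V (%v x. scale V (cf b x) v)"
proof -
 note sV = vec_space_vector_space[OF assms]
 show ?thesis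
  unfolding bilinear_on_def linear_on_def
  by (simp add: vec_space_scale_closed[OF assms] vector_space_add[OF sV] vector_space_mult[OF sV]
   vector_space_add_left[OF sV] lin_add[OF lin_cf] lin_scale[OF lin_cf] mult.commute)
qed

lemma lift_basis:
 assumes "vec_space V" "t \<in> tens_carrier V E" "vector_space u" "bilinear_on V E (amb u) \<phi>"
 shows "lift V E \<phi> t = (\<Sum>b\<in>bas. \<phi> (lift V E (%v x. scale V (cf b x) v) t) b)"
 by (rule lift_expand[OF assms(1) vec_space_E assms(2-4)])
  (use lin_cf in \<open>auto simp: linear_on_def lin_def ground_def basis_expand\<close>)

text \<open>The coefficient of \<open>b\<close> when the second factor of the coproduct is expanded
  in the basis: the coproduct of \<open>x\<close> is
  \<open>\<Sum>b\<in>bas. R b x \<otimes> b\<close>.\<close>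

definition R :: "'e => 'e => 'e" where
 "R b x = lift E E (%x1 x2. sE (cf b x2) x1) (comult E (P x))"

text \<open>\<open>sw \<phi> x\<close> is \<open>\<phi> x1 x2\<close> in Sweedler notation.\<close>

definition sw :: "('e => 'e => 'u::ab_group_add) => 'e => 'u" where
 "sw \<phi> x = (\<Sum>b\<in>bas. \<phi> (R b x) b)"

lemma comult_linear: "linear_on E (tens_space E E) (comult E)"
 using hopf by (simp add: hopf_algebra_def)

lemma comult_closed [simp]: "x \<in> carrier E ==> comult E x \<in> tens_carrier E E"
 using comult_linear by (simp add: linear_on_def)

lemma lin_P_linear_on: "linear_on E V f ==> lin sE (scale V) (%x. f (P x))"
 using lin_P[OF lin_ident] P_closed by (simp add: lin_def linear_on_def)

lemma R_closed [simp]: "R b x \<in> carrier E"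
 unfolding R_def by (rule lift_in_carrier[OF bilinear_cf[OF vec_space_E]]) auto

lemma lin_R: "lin sE sE (R b)"
 unfolding R_def
 using lin_P_linear_on[OF linear_on_compose[OF comult_linear lift_linear[OF bilinear_cf[OF vec_space_E]]]] by simp

lemma lin_R' [lin_intros]: "lin s sE f ==> lin s sE (%x. R b (f x))"
 by (rule lin_compose[OF lin_R])

lemma R_P [simp]: "R b (P x) = R b x"
 by (simp add: R_def)

lemma sw_P [simp]: "sw \<phi> (P x) = sw \<phi> x"
 by (simp add: sw_def)

lemma sw_cong:
 "(\<And>x y. x \<in> carrier E ==> y \<in> carrier E ==> \<phi> x y = \<psi> x y) ==> sw \<phi> z = sw \<psi> z"
 unfolding sw_def by (intro sum.cong) auto

text \<open>\<open>x\<close> enters through \<open>R b (f x)\<close> in the first argument of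
  \<open>\<phi>\<close>, while the second one runs through the fixed basis.\<close>

lemma lin_sw_arg [lin_intros]:
 "vector_space u ==> (\<And>y. lin sE u (%x. \<phi> x y)) ==> lin s sE f ==> lin s u (%x. sw \<phi> (f x))"
 unfolding sw_def by (rule lin_sum_fun, assumption, rule lin_compose[OF _ lin_R']) auto

lemma lin_sw_fun [lin_intros]:
 "vector_space u ==> (\<And>y z. lin s u (%x. \<phi> x y z)) ==> lin s u (%x. sw (\<phi> x) c)"
 unfolding sw_def by (intro lin_sum_fun)

lemma lin_of_sw: "lin t u f ==> f (sw \<phi> z) = sw (%x y. f (\<phi> x y)) z"
 unfolding sw_def by (rule lin_sum)

lemma sw_swap: "sw (%x y. sw (%x' y'. \<phi> x y x' y') w) z = sw (%x' y'. sw (%x y. \<phi> x y x' y') z) w"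
 unfolding sw_def by (rule sum.swap)

lemma lift_comult:
 assumes "vector_space u" "bilinear_on E E (amb u) \<phi>" "x \<in> carrier E"
 shows "lift E E \<phi> (comult E x) = sw \<phi> x"
 using lift_basis[OF vec_space_E _ assms(1,2), of "comult E x"] assms(3) by (simp add: sw_def R_def)

lemma lift_comult_total:
 assumes "vector_space u" "\<And>x y. x \<in> carrier E ==> y \<in> carrier E ==> \<phi> x y = \<psi> x y"
  and "\<And>y. lin sE u (%x. \<psi> x y)" "\<And>x. lin sE u (\<psi> x)" "z \<in> carrier E"
 shows "lift E E \<phi> (comult E z) = sw \<psi> z"
 using lift_cong[of E E \<phi> \<psi>] assms lift_comult[OF assms(1) bilinear_on_lin] by metis

definition m :: "'e => 'e => 'e" where "m x y = mult E (P x) (P y)"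
definition S :: "'e => 'e" where "S x = antipode E (P x)"
definition eps :: "'e => 'k" where "eps x = counit E (P x)"
definition one :: 'e where "one = unity E"

lemma m_eq: "x \<in> carrier E ==> y \<in> carrier E ==> mult E x y = m x y"
 and S_eq: "x \<in> carrier E ==> antipode E x = S x"
 and eps_eq: "x \<in> carrier E ==> counit E x = eps x"
 by (simp_all add: m_def S_def eps_def)

lemma m_closed [simp]: "m x y \<in> carrier E"
 unfolding m_def using bilinear_on_closed[OF algebra_bilinear[OF alg_E]] by simp

lemma S_closed [simp]: "S x \<in> carrier E"
 unfolding S_def using hopf by (simp add: hopf_algebra_def linear_on_def)

lemma one_closed [simp]: "one \<in> carrier E"
 unfolding one_def using algebra_unity_closed[OF alg_E] .

lemma P_absorb [simp]: "m (P x) y = m x y" "m x (P y) = m x y" "S (P x) = S x" "eps (P x) = eps x"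
 by (simp_all add: m_def S_def eps_def)

lemma m_one [simp]: "m one x = P x" "m x one = P x"
 using algebra_unity_left[OF alg_E] algebra_unity_right[OF alg_E] one_closed
 by (simp_all add: m_def one_def)

lemma m_assoc: "m (m x y) z = m x (m y z)"
 using algebra_assoc[OF alg_E] m_closed by (simp add: m_def)

lemma lin_m1 [lin_intros]: "lin s sE f ==> lin s sE (%x. m (f x) y)"
proof (rule lin_compose[of sE sE "%x. m x y"])
 have "linear_on E E (%x. mult E x (P y))"
  using algebra_bilinear[OF alg_E] by (auto simp: bilinear_on_def)
 then show "lin sE sE (%x. m x y)" unfolding m_def by (rule lin_P_linear_on)
qed

lemma lin_m2 [lin_intros]: "lin s sE f ==> lin s sE (%x. m y (f x))"
proof (rule lin_compose[of sE sE "m y"])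
 have "linear_on E E (mult E (P y))"
  using algebra_bilinear[OF alg_E] by (auto simp: bilinear_on_def)
 then show "lin sE sE (m y)" unfolding m_def by (rule lin_P_linear_on)
qed

lemma lin_S: "lin sE sE S"
 unfolding S_def using hopf lin_P_linear_on[of E "antipode E"] by (simp add: hopf_algebra_def)

lemma lin_eps: "lin sE (*) eps"
 unfolding eps_def using hopf lin_P_linear_on[of ground "counit E"]
 by (simp add: hopf_algebra_def ground_def)

lemma lin_S' [lin_intros]: "lin s sE f ==> lin s sE (%x. S (f x))"
 and lin_eps' [lin_intros]: "lin s sE f ==> lin s (*) (%x. eps (f x))"
 by (rule lin_compose[OF lin_S], assumption, rule lin_compose[OF lin_eps], assumption)

lemma eps_m [simp]: "eps (m x y) = eps x * eps y"
 using hopf by (simp add: hopf_algebra_def eps_def m_def[symmetric]) (simp add: m_def)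

lemma eps_one [simp]: "eps one = 1"
 using hopf by (simp add: hopf_algebra_def eps_def one_def[symmetric])

lemma sw_counit_left_E: "sw (%x y. sE (eps x) y) z = P z"
 and sw_counit_right_E: "sw (%x y. sE (eps y) x) z = P z"
 and sw_antipode_left_E: "sw (%x y. m (S x) y) z = sE (eps z) one"
 and sw_antipode_right_E: "sw (%x y. m x (S y)) z = sE (eps z) one"
proof -
 have "lift E E (%x y. sE (counit E x) y) (comult E (P z)) = sw (%x y. sE (eps x) y) (P z)"
  "lift E E (%x y. sE (counit E y) x) (comult E (P z)) = sw (%x y. sE (eps y) x) (P z)"
  "lift E E (%x y. mult E (antipode E x) y) (comult E (P z)) = sw (%x y. m (S x) y) (P z)"
  "lift E E (%x y. mult E x (antipode E y)) (comult E (P z)) = sw (%x y. m x (S y)) (P z)"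
  by (rule lift_comult_total[where u = sE]; (intro lin_intros P_closed)?; simp add: m_eq S_eq eps_eq; fail)+
 moreover have "lift E E (%x y. sE (counit E x) y) (comult E (P z)) = P z"
  "lift E E (%x y. sE (counit E y) x) (comult E (P z)) = P z"
  "lift E E (%x y. mult E (antipode E x) y) (comult E (P z)) = sE (counit E (P z)) (unity E)"
  "lift E E (%x y. mult E x (antipode E y)) (comult E (P z)) = sE (counit E (P z)) (unity E)"
  using hopf P_closed[of z] unfolding hopf_algebra_def by blast+
 ultimately show "sw (%x y. sE (eps x) y) z = P z" "sw (%x y. sE (eps y) x) z = P z"
  "sw (%x y. m (S x) y) z = sE (eps z) one" "sw (%x y. m x (S y)) z = sE (eps z) one"
  unfolding sw_P eps_def one_def by metis+
qed

lemma sw_counit_left: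
 assumes "lin sE u f" shows "sw (%x y. u (eps x) (f y)) z = f (P z)"
 using lin_of_sw[OF assms, of "%x y. sE (eps x) y" z] by (simp add: sw_counit_left_E lin_scale[OF assms])

lemma sw_counit_right:
 assumes "lin sE u f" shows "sw (%x y. u (eps y) (f x)) z = f (P z)"
 using lin_of_sw[OF assms, of "%x y. sE (eps y) x" z] by (simp add: sw_counit_right_E lin_scale[OF assms])

lemma sw_antipode_left:
 assumes "lin sE u f" shows "sw (%x y. f (m (S x) y)) z = u (eps z) (f one)"
 using lin_of_sw[OF assms, of "%x y. m (S x) y" z] by (simp add: sw_antipode_left_E lin_scale[OF assms])

lemma sw_antipode_right:
 assumes "lin sE u f" shows "sw (%x y. f (m x (S y))) z = u (eps z) (f one)"
 using lin_of_sw[OF assms, of "%x y. m x (S y)" z] by (simp add: sw_antipode_right_E lin_scale[OF assms])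

text \<open>Both sides are values of one linear map on triple tensors, taken at the two iterated
  coproducts of \<open>w\<close>.\<close>

lemma sw_coassoc:
 fixes u :: "'k => 'u::ab_group_add => 'u"
 assumes u: "vector_space u" and l1: "\<And>y z. lin sE u (%x. \<phi> x y z)" and l2: "\<And>x z. lin sE u (%y. \<phi> x y z)"
  and l3: "\<And>x y. lin sE u (%z. \<phi> x y z)"
 shows "sw (%x z. sw (%x y. \<phi> x y z) x) w = sw (%x y. sw (%y z. \<phi> x y z) y) w"
proof -
 let ?E2 = "tens_space E E"
 \<comment> \<open>The map \<open>x \<otimes> y \<otimes> z \<mapsto> \<phi> x y z\<close>,
   bracketed to the left like \<open>comult_left\<close> and \<open>comult_right\<close>.\<close>
 let ?T = "lift ?E2 E (%t z. lift E E (%x y. \<phi> x y z) t)"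
 let ?U = "amb u"
 have vU: "vec_space ?U" using u by (intro vec_spaceI) auto
 have b1: "bilinear_on E E ?U (%x y. \<phi> x y z)" for z
  using l1 l2 by (intro bilinear_on_lin) auto
 have b2: "bilinear_on ?E2 E ?U (%t z. lift E E (%x y. \<phi> x y z) t)"
  unfolding bilinear_on_def
 proof (intro conjI ballI)
  show "linear_on ?E2 ?U (lift E E (%x y. \<phi> x y z))" for z
   using lift_linear_amb[OF u b1] by simp
  show "linear_on E ?U (%z. lift E E (%x y. \<phi> x y z) t)" if "t \<in> carrier ?E2" for t
   by (rule linear_on_lift_param[OF vec_space_E vec_space_E vU vec_space_E])
    (use that b1 l3 in \<open>auto intro: linear_on_lin\<close>)
 qed
 have T: "linear_on (tens_space ?E2 E) ?U ?T"
  using lift_linear_amb[OF u b2] by simp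
 have Tp: "?T (tens ?E2 E t z) = lift E E (%x y. \<phi> x y z) t" if "t \<in> tens_carrier E E" "z \<in> carrier E" for t z
  using lift_tens[OF u b2] that by simp
 have b3: "bilinear_on E E (tens_space ?E2 E) (%x y. tens ?E2 E (comult E x) y)"
  using bilinear_on_compose_left[OF tens_bilinear comult_linear] .
 have in_b: "bilinear_on E E (tens_space ?E2 E) (%y1 y2. tens ?E2 E (tens E E x y1) y2)"
  if "x \<in> carrier E" for x
  using that tens_bilinear[of E E] by (intro bilinear_on_compose_left[OF tens_bilinear]) (auto simp: bilinear_on_def)
 have b4: "bilinear_on E E (tens_space ?E2 E)
   (%x y. lift E E (%y1 y2. tens ?E2 E (tens E E x y1) y2) (comult E y))"
  unfolding bilinear_on_def
 proof (intro conjI ballI)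
  fix x assume "x \<in> carrier E"
  then show "linear_on E (tens_space ?E2 E) (%y. lift E E (%y1 y2. tens ?E2 E (tens E E x y1) y2) (comult E y))"
   by (intro linear_on_compose[OF comult_linear] lift_linear in_b) auto
 next
  fix y assume "y \<in> carrier E"
  show "linear_on E (tens_space ?E2 E) (%x. lift E E (%y1 y2. tens ?E2 E (tens E E x y1) y2) (comult E y))"
  proof (rule linear_on_lift_param[OF vec_space_E vec_space_E vec_space_tens vec_space_E])
   fix v w assume vw: "v \<in> carrier E" "w \<in> carrier E"
   have "linear_on E ?E2 (%x. tens E E x v)" "linear_on ?E2 (tens_space ?E2 E) (%t. tens ?E2 E t w)"
    using vw tens_bilinear[of E E] tens_bilinear[of ?E2 E] by (auto simp: bilinear_on_def)
   then show "linear_on E (tens_space ?E2 E) (%x. tens ?E2 E (tens E E x v) w)"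
    using linear_on_compose by blast
  qed (use \<open>y \<in> carrier E\<close> in_b in auto)
 qed
 have "?T (comult_left E (comult E (P w))) = lift E E (%x y. ?T (tens ?E2 E (comult E x) y)) (comult E (P w))"
  unfolding comult_left_def using vU by (intro linear_on_lift[OF T b3]) auto
 also have "... = sw (%x z. sw (%x y. \<phi> x y z) x) (P w)"
 proof (rule lift_comult_total[OF u])
  show "?T (tens ?E2 E (comult E x) z) = sw (%x y. \<phi> x y z) x" if "x \<in> carrier E" "z \<in> carrier E" for x z
   using that Tp lift_comult[OF u b1] by simp
 qed (intro lin_intros u l1 l2 l3 P_closed)+
 finally have 1: "?T (comult_left E (comult E (P w))) = sw (%x z. sw (%x y. \<phi> x y z) x) w" by simp
 have "?T (comult_right E (comult E (P w))) =
   lift E E (%x y. ?T (lift E E (%y1 y2. tens ?E2 E (tens E E x y1) y2) (comult E y))) (comult E (P w))"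
  unfolding comult_right_def using vU by (intro linear_on_lift[OF T b4]) auto
 also have "... = sw (%x y. sw (%y z. \<phi> x y z) y) (P w)"
 proof (rule lift_comult_total[OF u])
  fix x y assume xy: "x \<in> carrier E" "y \<in> carrier E"
  have "?T (lift E E (%y1 y2. tens ?E2 E (tens E E x y1) y2) (comult E y)) =
   lift E E (%y1 y2. ?T (tens ?E2 E (tens E E x y1) y2)) (comult E y)"
   using vU xy by (intro linear_on_lift[OF T in_b]) auto
  also have "... = sw (%y z. \<phi> x y z) y"
   by (rule lift_comult_total[OF u])
    (use xy l2 l3 in \<open>auto simp: Tp tens_in_carrier lift_tens[OF u b1]\<close>)
  finally show "?T (lift E E (%y1 y2. tens ?E2 E (tens E E x y1) y2) (comult E y)) =
   sw (%y z. \<phi> x y z) y" .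
 qed (intro lin_intros u l1 l2 l3 P_closed)+
 finally have 2: "?T (comult_right E (comult E (P w))) = sw (%x y. sw (%y z. \<phi> x y z) y) w" by simp
 have "comult_left E (comult E (P w)) = comult_right E (comult E (P w))"
  using hopf P_closed unfolding hopf_algebra_def by blast
 then show ?thesis using 1 2 by simp
qed

lemma comult_expand: "x \<in> carrier E ==> comult E x = (\<Sum>b\<in>bas. tens E E (R b x) b)"
proof -
 assume x: "x \<in> carrier E"
 have b: "bilinear_on E E (amb fscale) (tens E E)" by (rule tens_amb_bilinear)
 have "lift E E (tens E E) (comult E x) = comult E x"
  by (rule linear_on_tens_eqI[where U' = "tens_space E E" and g = "%t. t",
     OF lift_linear_amb[OF vs_fscale b] _ vec_space_E vec_space_E])
   (use x lift_tens[OF vs_fscale b] in \<open>auto simp: linear_on_def\<close>)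
 then show ?thesis using lift_comult[OF vs_fscale b x] by (simp add: sw_def)
qed

text \<open>Expanding both coproducts in the basis turns the product in \<open>E \<otimes> E\<close>
  into a double sum of pure tensors, on which \<open>\<phi>\<close> can be evaluated.\<close>

lemma sw_m:
 fixes u :: "'k => 'u::ab_group_add => 'u"
 assumes u: "vector_space u" and l1: "\<And>y. lin sE u (%x. \<phi> x y)" and l2: "\<And>x. lin sE u (%y. \<phi> x y)"
 shows "sw \<phi> (m x y) = sw (%x1 x2. sw (%y1 y2. \<phi> (m x1 y1) (m x2 y2)) y) x"
proof -
 let ?T = "tens_alg E E"
 have b: "bilinear_on E E (amb u) \<phi>" using l1 l2 by (intro bilinear_on_lin) auto
 have bT: "bilinear_on ?T ?T ?T (mult ?T)"
  by (rule tens_alg_bilinear) (simp_all add: algebra_bilinear[OF alg_E])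
 have mT: "mult ?T (tens E E x y) (tens E E x' y') = tens E E (m x x') (m y y')"
  if "x \<in> carrier E" "y \<in> carrier E" "x' \<in> carrier E" "y' \<in> carrier E" for x y x' y'
  using that tens_alg_mult[OF vec_space_E vec_space_E] by (simp add: algebra_bilinear[OF alg_E] m_eq)
 have "comult E (m x y) = mult ?T (comult E (P x)) (comult E (P y))"
  using hopf unfolding m_def by (simp add: hopf_algebra_def)
 also have "... = (\<Sum>b\<in>bas. mult ?T (tens E E (R b x) b) (comult E (P y)))"
  using linear_on_sum[of ?T ?T "%s. mult ?T s (comult E (P y))" bas "%b. tens E E (R b x) b"] bT
  by (simp add: comult_expand[of "P x"] bilinear_on_def tens_in_carrier)
 also have "... = (\<Sum>b\<in>bas. \<Sum>b'\<in>bas. tens E E (m (R b x) (R b' y)) (m b b'))"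
 proof (rule sum.cong[OF refl])
  fix b assume "b \<in> bas"
  then show "mult ?T (tens E E (R b x) b) (comult E (P y)) = (\<Sum>b'\<in>bas. tens E E (m (R b x) (R b' y)) (m b b'))"
   using linear_on_sum[of ?T ?T "mult ?T (tens E E (R b x) b)" bas "%b. tens E E (R b y) b"] bT
   by (simp add: comult_expand[of "P y"] bilinear_on_def tens_in_carrier mT)
 qed
 finally have eq: "comult E (m x y) = (\<Sum>b\<in>bas. \<Sum>b'\<in>bas. tens E E (m (R b x) (R b' y)) (m b b'))" .
 have sumL: "lift E E \<phi> (\<Sum>i\<in>I. g i) = (\<Sum>i\<in>I. lift E E \<phi> (g i))"
  if "\<And>i. i \<in> I ==> g i \<in> tens_carrier E E" for g and I :: "'e set"
  by (rule linear_on_sum[OF lift_linear_amb[OF u b] vec_space_tens]) (use that in auto)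
 have "sw \<phi> (m x y) = lift E E \<phi> (comult E (m x y))"
  using lift_comult[OF u b] by simp
 also have "... = (\<Sum>b\<in>bas. \<Sum>b'\<in>bas. lift E E \<phi> (tens E E (m (R b x) (R b' y)) (m b b')))"
  unfolding eq by (simp add: sumL tens_in_carrier tens_carrier_sum)
 finally show ?thesis by (simp add: lift_tens[OF u b] sw_def)
qed

lemma sw_one:
 fixes u :: "'k => 'u::ab_group_add => 'u"
 assumes u: "vector_space u" and l1: "\<And>y. lin sE u (%x. \<phi> x y)" and l2: "\<And>x. lin sE u (%y. \<phi> x y)"
 shows "sw \<phi> one = \<phi> one one"
proof -
 have b: "bilinear_on E E (amb u) \<phi>" using l1 l2 by (intro bilinear_on_lin) auto
 have "comult E one = tens E E one one" using hopf by (simp add: hopf_algebra_def one_def)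
 then show ?thesis using lift_comult[OF u b one_closed] lift_tens[OF u b one_closed one_closed] by simp
qed

text \<open>Uniqueness of convolution inverses: \<open>S(xy)\<close> and \<open>S(y)S(x)\<close> are both inverse to \<open>xy\<close>.\<close>

lemma S_m: "S (m x y) = m (S y) (S x)"
proof -
 \<comment> \<open>With \<open>a b c\<close> the parts of \<open>x\<close> and \<open>d e f\<close>
   those of \<open>y\<close>, this is the summand of the threefold convolution of
   \<open>S(xy)\<close>, \<open>xy\<close> and \<open>S(y)S(x)\<close>.\<close>
 let ?F = "%a b c d e f. m (S (m a d)) (m (m b e) (m (S f) (S c)))"
 let ?Z = "sw (%a x'. sw (%b c. sw (%d y'. sw (%e f. ?F a b c d e f) y') y) x') x"
 \<comment> \<open>One grouping cancels \<open>e S(f)\<close> and then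
   \<open>b S(c)\<close>.\<close>
 have 1: "sw (%d y'. sw (%e f. ?F a b c d e f) y') y = m (S (m a y)) (m b (S c))" for a b c
 proof -
  have "sw (%e f. ?F a b c d e f) y' = sE (eps y') (m (S (m a d)) (m b (S c)))" for d y'
   using sw_antipode_right[of sE "%t. m (S (m a d)) (m b (m t (S c)))" y']
   by (simp add: m_assoc lin_intros)
  then show ?thesis
   using sw_counit_right[of sE "%d. m (S (m a d)) (m b (S c))" y] by (simp add: lin_intros)
 qed
 have 2: "sw (%b c. m (S (m a y)) (m b (S c))) x' = sE (eps x') (S (m a y))" for a x'
  using sw_antipode_right[of sE "%t. m (S (m a y)) t" x'] by (simp add: lin_intros)
 have "?Z = S (m x y)"
  unfolding 1 2 using sw_counit_right[of sE "%a. S (m a y)" x] by (simp add: lin_intros)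
 \<comment> \<open>The other grouping pairs \<open>S(ad)\<close> with \<open>be\<close>, which is
   the antipode law for a product.\<close>
 moreover have "?Z = m (S y) (S x)"
 proof -
  have 3: "sw (%d y'. sw (%e f. ?F a b c d e f) y') y = sw (%g f. sw (%d e. ?F a b c d e f) g) y" for a b c
   by (rule sw_coassoc[symmetric, where u = sE]) (intro lin_intros)+
  have 4: "?Z = sw (%h c. sw (%a b. sw (%g f. sw (%d e. ?F a b c d e f) g) y) h) x"
   unfolding 3 by (rule sw_coassoc[symmetric, where u = sE]) (intro lin_intros)+
  have 5: "sw (%a b. sw (%d e. ?F a b c d e f) g) h = sE (eps h) (sE (eps g) (m (S f) (S c)))" for c f g h
  proof -
   have "sw (%a b. sw (%d e. ?F a b c d e f) g) h = sw (%p q. m (S p) (m q (m (S f) (S c)))) (m h g)"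
    by (rule sw_m[symmetric, where u = sE]) (intro lin_intros)+
   also have "... = sE (eps (m h g)) (m (S f) (S c))"
    using sw_antipode_left[of sE "%t. m t (m (S f) (S c))" "m h g"] by (simp add: m_assoc lin_intros)
   finally show ?thesis by (simp add: vector_space_mult[OF vector_space_E])
  qed
  have 6: "sw (%a b. sw (%g f. sw (%d e. ?F a b c d e f) g) y) h = sE (eps h) (m (S y) (S c))" for c h
  proof -
   have "sw (%a b. sw (%g f. sw (%d e. ?F a b c d e f) g) y) h =
     sw (%g f. sE (eps h) (sE (eps g) (m (S f) (S c)))) y"
    by (subst sw_swap) (simp only: 5)
   also have "... = sw (%g f. sE (eps g) (sE (eps h) (m (S f) (S c)))) y"
    by (simp add: vector_space_mult[OF vector_space_E] mult.commute)
   also have "... = sE (eps h) (m (S (P y)) (S c))"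
    by (rule sw_counit_left) (intro lin_intros)
   finally show ?thesis by simp
  qed
  show ?thesis
   unfolding 4 6 using sw_counit_left[of sE "%c. m (S y) (S c)" x] by (simp add: lin_intros)
 qed
 ultimately show ?thesis by simp
qed

lemma S_one [simp]: "S one = one"
 using sw_antipode_left[of sE "%t. t" one] sw_one[of sE "%x y. m (S x) y"]
 by (simp add: lin_intros vector_space_one)

lemma eps_S [simp]: "eps (S x) = eps x"
proof -
 have "sw (%a b. eps (m (S a) b)) x = eps x * eps one"
  by (rule sw_antipode_left) (intro lin_intros)
 moreover have "sw (%a b. eps (m (S a) b)) x = eps (S (P x))"
  using sw_counit_right[of "(*)" "%a. eps (S a)" x] by (simp add: lin_intros mult.commute)
 ultimately show ?thesis by simp
qed

text \<open>Uniqueness of convolution inverses again, now for maps into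
  \<open>E \<otimes> E\<close>: \<open>?Z\<close> multiplies the coproduct of \<open>S x1\<close>,
  the coproduct of \<open>x2\<close> and \<open>S x4 \<otimes> S x3\<close>, and either neighbouring
  pair cancels.\<close>

lemma sw_S:
 fixes u :: "'k => 'u::ab_group_add => 'u"
 assumes u: "vector_space u" and l1: "\<And>y. lin sE u (%x. \<phi> x y)" and l2: "\<And>x. lin sE u (%y. \<phi> x y)"
 shows "sw \<phi> (S x) = sw (%a b. \<phi> (S b) (S a)) x"
proof -
 note l = lin_intros u lin_compose[OF l1] lin_compose[OF l2]
 have l1': "lin s u (%x. \<phi> (f x) y)" if "lin s sE f" for s :: "'k => 'e => 'e" and f y
  using lin_compose[OF l1 that] .
 have l2': "lin s u (%x. \<phi> y (f x))" if "lin s sE f" for s :: "'k => 'e => 'e" and f y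
  using lin_compose[OF l2 that] .
 note l = lin_intros u l1' l2'
 let ?G = "%s t p q c d. \<phi> (m s (m p (S d))) (m t (m q (S c)))"
 let ?Z = "sw (%a x'. sw (%s t. sw (%b y. sw (%p q. sw (%c d. ?G s t p q c d) y) b) x') (S a)) x"
 \<comment> \<open>Cancellation on the right: coassociativity makes \<open>q\<close> and
   \<open>c\<close> neighbours, so \<open>q S(c)\<close> goes first and \<open>p S(d)\<close>
   next.\<close>
 have 1: "sw (%b y. sw (%p q. sw (%c d. ?G s t p q c d) y) b) x' = u (eps x') (\<phi> (P s) (P t))" for s t x'
 proof -
  have "sw (%b y. sw (%p q. sw (%c d. ?G s t p q c d) y) b) x' =
    sw (%p z. sw (%q y. sw (%c d. ?G s t p q c d) y) z) x'"
   by (rule sw_coassoc[OF u]) (intro l)+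
  also have "... = sw (%p z. sw (%w d. sw (%q c. ?G s t p q c d) w) z) x'"
   by (subst sw_coassoc[OF u]) (intro l refl)+
  also have "... = sw (%p z. sw (%w d. u (eps w) (\<phi> (m s (m p (S d))) (P t))) z) x'"
  proof -
   have "sw (%q c. ?G s t p q c d) w = u (eps w) (\<phi> (m s (m p (S d))) (m t one))" for p d w
    by (rule sw_antipode_right[where f = "%r. \<phi> (m s (m p (S d))) (m t r)"]) (intro l)
   then show ?thesis by simp
  qed
  also have "... = sw (%p z. \<phi> (m s (m p (S z))) (P t)) x'"
  proof -
   have "sw (%w d. u (eps w) (\<phi> (m s (m p (S d))) (P t))) z = \<phi> (m s (m p (S (P z)))) (P t)" for p z
    by (rule sw_counit_left) (intro l)
   then show ?thesis by simp
  qed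
  also have "... = u (eps x') (\<phi> (m s one) (P t))"
   by (rule sw_antipode_right[where f = "%r. \<phi> (m s r) (P t)"]) (intro l)
  finally show ?thesis by simp
 qed
 have "?Z = sw (%a x'. u (eps x') (sw \<phi> (S a))) x"
 proof -
  have "sw (%s t. u (eps x') (\<phi> (P s) (P t))) y = u (eps x') (sw \<phi> y)" for x' y
  proof -
   have "sw (%s t. u (eps x') (\<phi> (P s) (P t))) y = sw (%s t. u (eps x') (\<phi> s t)) y"
    by (rule sw_cong) simp
   then show ?thesis by (simp add: sw_def vector_space_sum[OF u])
  qed
  then show ?thesis unfolding 1 by simp
 qed
 also have "... = sw \<phi> (S (P x))"
  by (rule sw_counit_right) (intro l l1 l2)
 finally have Z1: "?Z = sw \<phi> (S x)" by simp
 \<comment> \<open>Cancellation on the left: the first two coproducts multiply to that of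
   \<open>S(a) b\<close>, which the antipode law reduces to \<open>one\<close>.\<close>
 let ?psi = "%P Q y. sw (%c d. \<phi> (m P (S d)) (m Q (S c))) y"
 have "?Z = sw (%a x'. sw (%b y. sw (%s t. sw (%p q. ?psi (m s p) (m t q) y) b) (S a)) x') x"
  by (subst sw_swap) (simp add: m_assoc)
 also have "... = sw (%a x'. sw (%b y. sw (%P Q. ?psi P Q y) (m (S a) b)) x') x"
  by (subst sw_m[OF u]) (intro l refl)+
 also have "... = sw (%w y. sw (%a b. sw (%P Q. ?psi P Q y) (m (S a) b)) w) x"
  by (rule sw_coassoc[symmetric, OF u]) (intro l)+
 also have "... = sw (%w y. u (eps w) (?psi one one y)) x"
 proof -
  have "sw (%a b. sw (%P Q. ?psi P Q y) (m (S a) b)) w = u (eps w) (sw (%P Q. ?psi P Q y) one)" for w y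
   by (rule sw_antipode_left) (intro l)
  moreover have "sw (%P Q. ?psi P Q y) one = ?psi one one y" for y
   by (rule sw_one[OF u]) (intro l)+
  ultimately show ?thesis by simp
 qed
 also have "... = ?psi one one (P x)"
  by (rule sw_counit_left) (intro l)
 finally show ?thesis using Z1 by simp
qed

text \<open>Linear maps of the form \<open>f \<circ> S\<close> are a finite dimensional space that is stable under convolution
 with \<open>S\<close> and contains the convolution unit.  Convolution with \<open>S\<close> is injective, hence the identity,
 being the convolution inverse of \<open>S\<close>, is in this space.\<close>

lemma S_left_cancellable: "\<exists>h. lin sE sE h \<and> (\<forall>x. P x = h (S x))"
proof -
 define fE where "fE = (%c (f :: 'e => 'e) x. sE c (f x))"
 define V where "V = {f. \<exists>h. lin sE sE h \<and> (\<forall>x. h x \<in> carrier E) \<and> f = (%x. h (S x))}"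
 define S0 where "S0 = (%(b, b') x. sE (cf b (S x)) b') ` (bas \<times> bas)"
 define T where "T = (%f x. sw (%a b. m (f a) (S b)) x)"
 have fE: "vector_space fE"
  unfolding fE_def by unfold_locales
   (auto simp: fun_eq_iff vector_space_add[OF vector_space_E] vector_space_add_left[OF vector_space_E]
    vector_space_mult[OF vector_space_E] vector_space_one[OF vector_space_E])
 interpret F: vector_space fE by (rule fE)
 have linT: "lin fE fE T"
  unfolding lin_def fE_def T_def fun_eq_iff
  by (auto simp: sw_def sum.distrib lin_add[OF lin_m1[OF lin_ident]] lin_scale[OF lin_m1[OF lin_ident]]
   vector_space_sum[OF vector_space_E])
 have spanV: "F.span S0 = V"
 proof
  have "F.subspace V"
  proof (rule F.subspaceI)
   show "0 \<in> V" unfolding V_def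
    by (auto intro!: exI[of _ "%x. 0"] lin_const_zero simp: vec_space_zero_closed fun_eq_iff)
   show "f + g \<in> V" if "f \<in> V" "g \<in> V" for f g
   proof -
    from that obtain h k where "lin sE sE h" "\<forall>x. h x \<in> carrier E" "f = (%x. h (S x))"
     "lin sE sE k" "\<forall>x. k x \<in> carrier E" "g = (%x. k (S x))" by (auto simp: V_def)
    then show ?thesis unfolding V_def
     by (auto intro!: exI[of _ "%x. h x + k x"] lin_plus simp: vec_space_add_closed fun_eq_iff)
   qed
   show "fE c f \<in> V" if "f \<in> V" for c f
   proof -
    from that obtain h where "lin sE sE h" "\<forall>x. h x \<in> carrier E" "f = (%x. h (S x))" by (auto simp: V_def)
    then show ?thesis unfolding V_def fE_def
     by (auto intro!: exI[of _ "%x. sE c (h x)"] lin_scale_right simp: vec_space_scale_closed fun_eq_iff)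
   qed
  qed
  moreover have "S0 \<subseteq> V"
   unfolding S0_def V_def
   by (auto intro!: lin_intros simp: vec_space_scale_closed fun_eq_iff) 
    (rule_tac x = "%x. sE (cf a x) b" in exI, auto intro!: lin_intros simp: vec_space_scale_closed)
  ultimately show "F.span S0 \<subseteq> V" by (intro F.span_minimal)
  show "V \<subseteq> F.span S0"
  proof
   fix f assume "f \<in> V"
   then obtain h where h: "lin sE sE h" "\<forall>x. h x \<in> carrier E" "f = (%x. h (S x))" by (auto simp: V_def)
   have "f x = (\<Sum>b\<in>bas. \<Sum>b'\<in>bas. sE (cf b' (h b)) (sE (cf b (S x)) b'))" for x
   proof -
    have "f x = h (\<Sum>b\<in>bas. sE (cf b (S x)) b)" using h basis_expand[of "S x"] by simp
    also have "... = (\<Sum>b\<in>bas. sE (cf b (S x)) (h b))"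
     by (simp add: lin_sum[OF h(1)] lin_scale[OF h(1)])
    also have "... = (\<Sum>b\<in>bas. sE (cf b (S x)) (\<Sum>b'\<in>bas. sE (cf b' (h b)) b'))"
     using h by (simp add: basis_expand)
    finally show ?thesis
     by (simp add: vector_space_sum[OF vector_space_E] vector_space_mult[OF vector_space_E] mult.commute)
   qed
   then have "f = (\<Sum>b\<in>bas. \<Sum>b'\<in>bas. fE (cf b' (h b)) (%x. sE (cf b (S x)) b'))"
    unfolding fE_def fun_eq_iff by (simp add: sum_fun_apply)
   also have "... \<in> F.span S0"
    by (intro F.span_sum F.span_scale F.span_base) (auto simp: S0_def)
   finally show "f \<in> F.span S0" .
  qed
 qed
 \<comment> \<open>As \<open>S\<close> reverses coproducts, the sum of \<open>h(S a) S(b)\<close>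
   over the parts of \<open>x\<close> is a function of \<open>S x\<close>.\<close>
 have T_V: "T ` V \<subseteq> V"
 proof
  fix g assume "g \<in> T ` V"
  then obtain h where h: "lin sE sE h" "g = T (%x. h (S x))" by (auto simp: V_def)
  have "g x = sw (%a b. m (h b) a) (S x)" for x
   unfolding h(2) T_def
   by (rule sw_S[symmetric, of sE]) (intro lin_intros lin_compose[OF h(1)] vector_space_E)+
  then show "g \<in> V" unfolding V_def
   by (auto intro!: exI[of _ "%y. sw (%a b. m (h b) a) y"] lin_intros lin_compose[OF h(1)]
    simp: sw_def vec_space_sum_closed)
 qed
 \<comment> \<open>Convolution with the identity undoes \<open>T\<close>, because
   \<open>S(b) c\<close> cancels.\<close>
 have conv: "sw (%w c. m (T f w) c) x = P (f x)" if "f \<in> V" for f x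
 proof -
  from that obtain h where h: "lin sE sE h" "f = (%x. h (S x))" by (auto simp: V_def)
  have lf: "lin sE sE f" unfolding h(2) by (intro lin_compose[OF h(1)] lin_S)
  have "sw (%w c. m (T f w) c) x = sw (%w c. sw (%a b. m (f a) (m (S b) c)) w) x"
   unfolding T_def by (simp add: lin_of_sw[OF lin_m1[OF lin_ident]] m_assoc)
  also have "... = sw (%a y. sw (%b c. m (f a) (m (S b) c)) y) x"
   by (rule sw_coassoc[where u = sE]) (intro lin_intros lin_compose[OF lf])+
  also have "... = sw (%a y. sE (eps y) (m (f a) one)) x"
  proof -
   have "sw (%b c. m (f a) (m (S b) c)) y = sE (eps y) (m (f a) one)" for a y
    by (rule sw_antipode_left[of sE "%t. m (f a) t"]) (intro lin_intros)
   then show ?thesis by simp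
  qed
  also have "... = P (f (P x))"
   using sw_counit_right[of sE "%a. m (f a) one"] lin_P[OF lf] by simp
  finally show ?thesis by (simp add: h(2))
 qed
 have "T ` V = V"
 proof (rule injective_endo_surjective[OF fE linT _ spanV T_V])
  show "finite S0" by (simp add: S0_def)
  show "f = 0" if f: "f \<in> V" "T f = 0" for f
  proof
   fix x
   have "f x = P (f x)" using f(1) by (auto simp: V_def)
   also have "... = sw (%w c. m (T f w) c) x" using conv[OF f(1)] by simp
   also have "... = 0" using f(2) lin_zero[OF lin_m1[OF lin_ident]] by (simp add: sw_def)
   finally show "f x = 0 x" by simp
  qed
 qed
 \<comment> \<open>The convolution unit factors through \<open>S\<close> because
   \<open>eps (S x) = eps x\<close>.\<close>
 moreover have "(%x. sE (eps x) one) \<in> V"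
  unfolding V_def
  by (auto intro!: exI[of _ "%x. sE (eps x) one"] lin_intros simp: vec_space_scale_closed)
 ultimately obtain f where f: "f \<in> V" "T f = (%x. sE (eps x) one)" by (metis imageE)
 from f(1) obtain h where h: "lin sE sE h" "f = (%x. h (S x))" by (auto simp: V_def)
 \<comment> \<open>Convolving the equation for \<open>T f\<close> with the identity recovers
   \<open>f\<close> on one side and leaves the identity on the other.\<close>
 have "P x = P (h (S x))" for x
 proof -
  have "P (f x) = sw (%w c. m (sE (eps w) one) c) x" using conv[OF f(1)] f(2) by simp
  also have "... = sw (%w c. sE (eps w) (P c)) x" by (simp add: lin_scale[OF lin_m1[OF lin_ident]])
  also have "... = P (P x)" by (rule sw_counit_left) (intro lin_intros)
  finally show ?thesis by (simp add: h(2))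
 qed
 then show ?thesis using lin_P[OF h(1)] by (intro exI[of _ "%y. P (h y)"]) auto
qed

text \<open>Gives meaning to \<open>inv_into\<close> in the antipode of the double. A left inverse
  of \<open>S\<close> makes it injective, and finite dimension does the rest.\<close>

lemma bij_betw_antipode: "bij_betw (antipode E) (carrier E) (carrier E)"
proof -
 obtain h where h: "lin sE sE h" "\<And>x. P x = h (S x)" using S_left_cancellable by blast
 have inj: "inj_on S (carrier E)"
  by (rule inj_onI) (metis h(2) P_id)
 obtain X where X: "finite X" "module.span sE X = carrier E"
  using fin_dim by (auto simp: finite_dim_def)
 have "S ` carrier E = carrier E"
 proof (rule injective_endo_surjective[OF vector_space_E lin_S X])
  show "x = 0" if "x \<in> carrier E" "S x = 0" for x
   using h(2)[of x] that lin_zero[OF h(1)] by simp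
 qed auto
 then have "bij_betw S (carrier E) (carrier E)" using inj by (simp add: bij_betw_def)
 then show ?thesis by (subst bij_betw_cong[of _ _ S]) (auto simp: S_eq)
qed

definition Si :: "'e => 'e" where "Si x = inv_into (carrier E) (antipode E) (P x)"

lemma Si_eq: "x \<in> carrier E ==> inv_into (carrier E) (antipode E) x = Si x"
 by (simp add: Si_def)

lemma Si_closed [simp]: "Si x \<in> carrier E"
 unfolding Si_def using bij_betw_antipode by (metis P_closed bij_betw_def inv_into_into)

lemma Si_P [simp]: "Si (P x) = Si x"
 by (simp add: Si_def)

lemma S_Si [simp]: "S (Si x) = P x"
proof -
 have "antipode E (Si x) = P x"
  unfolding Si_def using bij_betw_antipode by (metis P_closed bij_betw_def f_inv_into_f)
 then show ?thesis by (simp add: S_def)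
qed

lemma S_inject: "S x = S y ==> P x = P y"
 using S_left_cancellable by metis

lemma Si_S [simp]: "Si (S x) = P x"
 using S_inject[of "Si (S x)" x] by simp

lemma lin_Si: "lin sE sE Si"
proof -
 obtain h where h: "lin sE sE h" "\<And>x. P x = h (S x)" using S_left_cancellable by blast
 have "Si = (%x. h (P x))" using h(2)[of "Si _"] by (simp add: fun_eq_iff)
 then show ?thesis using lin_compose[OF h(1) lin_P[OF lin_ident]] by simp
qed

lemma lin_Si' [lin_intros]: "lin s sE f ==> lin s sE (%x. Si (f x))"
 by (rule lin_compose[OF lin_Si])

lemma sw_Si:
 fixes u :: "'k => 'u::ab_group_add => 'u"
 assumes u: "vector_space u" and l1: "\<And>y. lin sE u (%x. \<phi> x y)" and l2: "\<And>x. lin sE u (%y. \<phi> x y)"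
 shows "sw \<phi> (Si x) = sw (%a b. \<phi> (Si b) (Si a)) x"
proof -
 have "sw (%a b. \<phi> (Si b) (Si a)) x = sw (%a b. \<phi> (Si b) (Si a)) (S (Si x))" by simp
 also have "... = sw (%a b. \<phi> (Si (S a)) (Si (S b))) (Si x)"
  by (rule sw_S[OF u]) (intro lin_compose[OF l1] lin_compose[OF l2] lin_Si)+
 also have "... = sw \<phi> (Si x)" by (rule sw_cong) simp
 finally show ?thesis by simp
qed

text \<open>Applying \<open>S\<close>, which is injective on \<open>E\<close> and reverses products,
  turns \<open>Si(y) x\<close> into \<open>S(x) y\<close>.\<close>

lemma sw_Si_cancel:
 assumes "lin sE u f" shows "sw (%x y. f (m (Si y) x)) z = u (eps z) (f one)"
proof -
 have "sw (%x y. m (Si y) x) z = sE (eps z) one"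
 proof -
  have "S (sw (%x y. m (Si y) x) z) = sw (%x y. m (S x) y) z"
   by (simp add: lin_of_sw[OF lin_S] S_m)
  also have "... = S (sE (eps z) one)" by (simp add: sw_antipode_left_E lin_scale[OF lin_S])
  finally have "P (sw (%x y. m (Si y) x) z) = P (sE (eps z) one)" by (rule S_inject)
  then show ?thesis by (simp add: sw_def vec_space_sum_closed vec_space_scale_closed)
 qed
 then show ?thesis
  using lin_of_sw[OF assms, of "%x y. m (Si y) x" z] by (simp add: lin_scale[OF assms])
qed

end


section \<open>The dual and the Drinfeld double\<close>

lemma lin_apply [lin_intros]: "lin fscale (*) (%\<xi>. \<xi> z)"
 by (simp add: lin_def fscale_def)

lemma linear_on_of_lin: "lin (scale V) (scale W) f ==> (\<And>x. x \<in> carrier V ==> f x \<in> carrier W) ==> linear_on V W f"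
 by (auto simp: lin_def linear_on_def)

context fd_hopf
begin

abbreviation E' :: "('k, 'e => 'k) hopf" where "E' \<equiv> dual_hopf E"

lemma dual_unity: "unity E' = restr (carrier E) eps"
 by (auto simp: dual_hopf_def restr_def fun_eq_iff eps_eq)

lemma dual_mult_raw: "mult E' \<xi> \<eta> = restr (carrier E) (%x. lift E E (%a b. \<xi> a * \<eta> b) (comult E x))"
 by (simp add: dual_hopf_def)

lemma dual_comult_raw:
 "comult E' \<xi> = (THE t. t \<in> tens_carrier (dual_space E) (dual_space E) \<and>
  (\<forall>x\<in>carrier E. \<forall>y\<in>carrier E.
    lift (dual_space E) (dual_space E) (%\<xi>1 \<xi>2. \<xi>1 x * \<xi>2 y) t = \<xi> (mult E x y)))"
 by (simp add: dual_hopf_def)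

lemma dual_antipode: "antipode E' \<xi> = restr (carrier E) (%x. \<xi> (S x))"
 by (auto simp: dual_hopf_def restr_def fun_eq_iff S_eq)

lemma dual_carrier: "\<xi> \<in> carrier E' \<longleftrightarrow> linear_on E ground \<xi> \<and> (\<forall>x. x \<notin> carrier E \<longrightarrow> \<xi> x = 0)"
 by (simp add: dual_hopf_def dual_space_def)

lemma dual_simps [simp]:
 "scale E' = fscale" "counit E' = (%\<xi>. \<xi> one)"
 "carrier (dual_space E) = carrier E'" "scale (dual_space E) = fscale"
 by (simp_all add: dual_hopf_def dual_space_def one_def)

lemma lin_dual: "\<xi> \<in> carrier E' ==> lin sE (*) (%x. \<xi> (P x))"
 using lin_P_linear_on[of ground \<xi>] by (simp add: dual_carrier ground_def)

lemma dual_eqI: "\<xi> \<in> carrier E' ==> \<eta> \<in> carrier E' ==> (\<And>x. x \<in> carrier E ==> \<xi> x = \<eta> x) ==> \<xi> = \<eta>"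
 unfolding dual_carrier by (rule ext) metis

lemma restr_dual: "lin sE (*) f ==> restr (carrier E) f \<in> carrier E'"
 by (auto simp: dual_carrier restr_def linear_on_def lin_def ground_def
  vec_space_add_closed vec_space_scale_closed)

lemma restr_apply [simp]: "x \<in> X ==> restr X f x = f x"
 by (simp add: restr_def)

lemma vec_space_dual [simp]: "vec_space E'"
proof (rule vec_spaceI)
 show "0 \<in> carrier E'" by (simp add: dual_carrier linear_on_def ground_def)
 show "\<xi> + \<eta> \<in> carrier E'" if "\<xi> \<in> carrier E'" "\<eta> \<in> carrier E'" for \<xi> \<eta>
  using that by (simp add: dual_carrier linear_on_def ground_def distrib_left)
 show "scale E' c \<xi> \<in> carrier E'" if "\<xi> \<in> carrier E'" for c \<xi>
  using that by (simp add: dual_carrier linear_on_def ground_def fscale_def distrib_left mult.left_commute)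
qed simp

section \<open>Convolution of functionals and the dual Hopf algebra\<close>

definition cv :: "('e => 'k) => ('e => 'k) => 'e => 'k" where
 "cv \<xi> \<eta> x = sw (%a b. \<xi> a * \<eta> b) x"

lemma cv_P [simp]: "cv \<xi> \<eta> (P x) = cv \<xi> \<eta> x"
 by (simp add: cv_def)

lemma cv_cong: "(\<And>x. x \<in> carrier E ==> \<xi> x = \<xi>' x) ==> (\<And>x. x \<in> carrier E ==> \<eta> x = \<eta>' x) ==> cv \<xi> \<eta> = cv \<xi>' \<eta>'"
 unfolding cv_def by (intro ext sw_cong) simp

lemma lin_cv1 [lin_intros]: "(\<And>a. lin s (*) (%x. F x a)) ==> lin s (*) (%x. cv (F x) \<eta> b)"
 unfolding cv_def by (intro lin_intros)

lemma lin_cv2 [lin_intros]: "(\<And>a. lin s (*) (%x. F x a)) ==> lin s (*) (%x. cv \<xi> (F x) b)"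
 unfolding cv_def by (intro lin_intros)

lemma lin_cv3: "lin sE (*) \<xi> ==> lin s sE f ==> lin s (*) (%x. cv \<xi> \<eta> (f x))"
 unfolding cv_def by (intro lin_intros)

lemma dual_mult:
 assumes "\<xi> \<in> carrier E'" "\<eta> \<in> carrier E'"
 shows "mult E' \<xi> \<eta> = restr (carrier E) (cv \<xi> \<eta>)"
proof -
 note l = lin_compose[OF lin_dual[OF assms(1)]] lin_compose[OF lin_dual[OF assms(2)]]
 have "lift E E (%a b. \<xi> a * \<eta> b) (comult E x) = cv \<xi> \<eta> x" if "x \<in> carrier E" for x
 proof -
  have "lift E E (%a b. \<xi> a * \<eta> b) (comult E x) = sw (%a b. \<xi> (P a) * \<eta> (P b)) x"
   by (rule lift_comult_total[where u = "(*)"]) (use that in \<open>simp | intro lin_intros l\<close>)+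
  also have "... = cv \<xi> \<eta> x" unfolding cv_def by (rule sw_cong) simp
  finally show ?thesis .
 qed
 then show ?thesis unfolding dual_mult_raw by (auto simp: restr_def fun_eq_iff)
qed

lemma dual_mult_closed [simp]:
 assumes "\<xi> \<in> carrier E'" "\<eta> \<in> carrier E'" shows "mult E' \<xi> \<eta> \<in> carrier E'"
proof -
 have "lin sE (*) (cv (%x. \<xi> (P x)) \<eta>)"
  using lin_cv3[OF lin_dual[OF assms(1)] lin_ident] .
 moreover have "cv (%x. \<xi> (P x)) \<eta> = cv \<xi> \<eta>" by (rule cv_cong) auto
 ultimately show ?thesis by (simp add: dual_mult assms restr_dual)
qed

lemma cv_assoc:
 assumes "lin sE (*) \<xi>" "lin sE (*) \<eta>" "lin sE (*) \<zeta>"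
 shows "cv (cv \<xi> \<eta>) \<zeta> = cv \<xi> (cv \<eta> \<zeta>)"
proof
 fix x
 have "cv (cv \<xi> \<eta>) \<zeta> x = sw (%w c. sw (%a b. \<xi> a * \<eta> b * \<zeta> c) w) x"
  unfolding cv_def by (simp add: sw_def sum_distrib_right)
 also have "... = sw (%a w. sw (%b c. \<xi> a * \<eta> b * \<zeta> c) w) x"
  by (rule sw_coassoc[where u = "(*)"]) (intro lin_intros assms lin_compose[OF assms(1)] lin_compose[OF assms(2)] vector_space_field lin_compose[OF assms(3)])+
 also have "... = cv \<xi> (cv \<eta> \<zeta>) x"
  unfolding cv_def by (simp add: sw_def sum_distrib_left mult.assoc)
 finally show "cv (cv \<xi> \<eta>) \<zeta> x = cv \<xi> (cv \<eta> \<zeta>) x" .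
qed

lemma cv_eps_left: "lin sE (*) \<xi> ==> cv eps \<xi> x = \<xi> (P x)"
 and cv_eps_right: "lin sE (*) \<xi> ==> cv \<xi> eps x = \<xi> (P x)"
 unfolding cv_def using sw_counit_left[of "(*)" \<xi> x] sw_counit_right[of "(*)" \<xi> x]
 by (simp_all add: mult.commute)

lemma dual_bilinear: "bilinear_on E' E' E' (mult E')"
proof -
 have l: "restr (carrier E) (cv (\<xi> + \<xi>') \<eta>) = restr (carrier E) (cv \<xi> \<eta>) + restr (carrier E) (cv \<xi>' \<eta>)"
  "restr (carrier E) (cv \<eta> (\<xi> + \<xi>')) = restr (carrier E) (cv \<eta> \<xi>) + restr (carrier E) (cv \<eta> \<xi>')"
  "restr (carrier E) (cv (fscale c \<xi>) \<eta>) = fscale c (restr (carrier E) (cv \<xi> \<eta>))"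
  "restr (carrier E) (cv \<eta> (fscale c \<xi>)) = fscale c (restr (carrier E) (cv \<eta> \<xi>))" for \<xi> \<xi>' \<eta> c
  by (auto simp: restr_def cv_def fun_eq_iff sw_def sum.distrib algebra_simps fscale_def sum_distrib_left)
 show ?thesis
  unfolding bilinear_on_def linear_on_def
 proof (intro conjI ballI allI)
  fix \<xi> \<eta> \<zeta> :: "'e => 'k" and c
  assume "\<xi> \<in> carrier E'" "\<eta> \<in> carrier E'"
  then show "mult E' \<xi> \<eta> \<in> carrier E'" "mult E' \<eta> \<xi> \<in> carrier E'"
   by simp_all
  from \<open>\<xi> \<in> carrier E'\<close> \<open>\<eta> \<in> carrier E'\<close> show "mult E' \<xi> (scale E' c \<eta>) = scale E' c (mult E' \<xi> \<eta>)"
   "mult E' (scale E' c \<eta>) \<xi> = scale E' c (mult E' \<eta> \<xi>)"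
   using vec_space_scale_closed[OF vec_space_dual, of \<eta> c] by (simp_all add: dual_mult l)
  assume "\<zeta> \<in> carrier E'"
  with \<open>\<xi> \<in> carrier E'\<close> \<open>\<eta> \<in> carrier E'\<close>
  show "mult E' \<xi> (\<eta> + \<zeta>) = mult E' \<xi> \<eta> + mult E' \<xi> \<zeta>"
   "mult E' (\<eta> + \<zeta>) \<xi> = mult E' \<eta> \<xi> + mult E' \<zeta> \<xi>"
   using vec_space_add_closed[OF vec_space_dual, of \<eta> \<zeta>] by (simp_all add: dual_mult l)
 qed
qed

lemma dual_unity_closed: "unity E' \<in> carrier E'"
 using restr_dual[OF lin_eps] by (simp add: dual_unity)

lemma alg_dual: "algebra E'"
 unfolding algebra_def
proof (intro conjI ballI)
 fix \<xi> \<eta> \<zeta> assume *: "\<xi> \<in> carrier E'" "\<eta> \<in> carrier E'" "\<zeta> \<in> carrier E'"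
 let ?p = "%\<xi> x. \<xi> (P x) :: 'k"
 have "cv (restr (carrier E) (cv \<xi> \<eta>)) \<zeta> = cv (cv (?p \<xi>) (?p \<eta>)) (?p \<zeta>)"
  by (intro cv_cong) (auto intro!: fun_cong[OF cv_cong])
 moreover have "cv \<xi> (restr (carrier E) (cv \<eta> \<zeta>)) = cv (?p \<xi>) (cv (?p \<eta>) (?p \<zeta>))"
  by (intro cv_cong) (auto intro!: fun_cong[OF cv_cong])
 ultimately have "cv (restr (carrier E) (cv \<xi> \<eta>)) \<zeta> = cv \<xi> (restr (carrier E) (cv \<eta> \<zeta>))"
  using cv_assoc[OF lin_dual lin_dual lin_dual, OF *] by simp
 then show "mult E' (mult E' \<xi> \<eta>) \<zeta> = mult E' \<xi> (mult E' \<eta> \<zeta>)"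
  using * dual_mult_closed[OF *(1,2)] dual_mult_closed[OF *(2,3)] by (simp add: dual_mult)
next
 fix \<xi> assume *: "\<xi> \<in> carrier E'"
 let ?p = "%x. \<xi> (P x)"
 have "cv (restr (carrier E) eps) \<xi> = cv eps ?p" "cv \<xi> (restr (carrier E) eps) = cv ?p eps"
  by (intro cv_cong; simp)+
 then have "mult E' (unity E') \<xi> = restr (carrier E) ?p" "mult E' \<xi> (unity E') = restr (carrier E) ?p"
  using * dual_unity_closed by (auto simp: dual_mult dual_unity cv_eps_left[OF lin_dual] cv_eps_right[OF lin_dual] restr_def)
 moreover have "restr (carrier E) ?p = \<xi>"
  using * by (auto simp: restr_def dual_carrier fun_eq_iff)
 ultimately show "mult E' (unity E') \<xi> = \<xi>" "mult E' \<xi> (unity E') = \<xi>" by auto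
qed (use dual_bilinear dual_unity_closed in auto)

definition cfd :: "'e => 'e => 'k" where "cfd b = restr (carrier E) (cf b)"

lemma cfd_closed [simp]: "cfd b \<in> carrier E'"
 by (simp add: cfd_def restr_dual)

lemma dual_expand:
 assumes "\<xi> \<in> carrier E'" shows "(\<Sum>b\<in>bas. fscale (\<xi> b) (cfd b)) = \<xi>"
proof (rule dual_eqI[OF _ assms])
 show "(\<Sum>b\<in>bas. fscale (\<xi> b) (cfd b)) \<in> carrier E'"
  using vec_space_scale_closed[OF vec_space_dual] by (intro vec_space_sum_closed) auto
 fix x assume x: "x \<in> carrier E"
 have l: "linear_on E ground \<xi>" using assms by (simp add: dual_carrier)
 have "\<xi> (\<Sum>b\<in>bas. sE (cf b x) b) = (\<Sum>b\<in>bas. cf b x * \<xi> b)"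
  using l by (subst linear_on_sum[OF l vec_space_E]) (auto simp: vec_space_scale_closed linear_on_def ground_def)
 then show "(\<Sum>b\<in>bas. fscale (\<xi> b) (cfd b)) x = \<xi> x"
  using x by (simp add: sum_fun_apply fscale_def cfd_def basis_expand mult.commute)
qed

lemma lift_dual_basis:
 assumes "vec_space V" "t \<in> tens_carrier V E'" "vector_space u" "bilinear_on V E' (amb u) \<phi>"
 shows "lift V E' \<phi> t = (\<Sum>b\<in>bas. \<phi> (lift V E' (%v \<xi>. scale V (\<xi> b) v) t) (cfd b))"
 by (rule lift_expand[OF assms(1) vec_space_dual assms(2-4)])
  (auto simp: linear_on_def ground_def fscale_def dual_expand[unfolded fscale_def])

text \<open>Expanding the second factor in the dual basis leaves functionals as coefficients, and
  these are determined by their values. This is the uniqueness behind the description that defines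
  \<open>comult E'\<close>.\<close>

lemma tens_dual_eqI:
 assumes "s \<in> tens_carrier E' E'" "t \<in> tens_carrier E' E'"
  and "\<And>x y. x \<in> carrier E ==> y \<in> carrier E ==>
   lift E' E' (%\<xi> \<eta>. \<xi> x * \<eta> y) s = lift E' E' (%\<xi> \<eta>. \<xi> x * \<eta> y) t"
 shows "s = t"
proof -
 have b: "bilinear_on E' E' (amb fscale) (tens E' E')" by (rule tens_amb_bilinear)
 have id: "lift E' E' (tens E' E') r = r" if "r \<in> tens_carrier E' E'" for r
  by (rule linear_on_tens_eqI[where U' = "tens_space E' E'" and g = "%t. t",
     OF lift_linear_amb[OF vs_fscale b] _ vec_space_dual vec_space_dual])
   (use that lift_tens[OF vs_fscale b] in \<open>auto simp: linear_on_def\<close>)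
 have bb: "bilinear_on E' E' E' (%\<xi> \<eta>. fscale (\<eta> b) \<xi>)" for b
  using vec_space_scale_closed[OF vec_space_dual] unfolding bilinear_on_def linear_on_def
  by (auto simp: vector_space_add[OF vs_fscale] vector_space_mult[OF vs_fscale]
   vector_space_add_left[OF vs_fscale] fscale_apply mult.commute)
 let ?c = "%b r. lift E' E' (%\<xi> \<eta>. fscale (\<eta> b) \<xi>) r"
 have c: "?c b s = ?c b t" if "b \<in> bas" for b
 proof (rule dual_eqI)
  show "?c b s \<in> carrier E'" "?c b t \<in> carrier E'"
   using assms lift_in_carrier[OF bb] by auto
  fix x assume x: "x \<in> carrier E"
  have "?c b r x = lift E' E' (%\<xi> \<eta>. \<xi> x * \<eta> b) r" if "r \<in> tens_carrier E' E'" for r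
   using lin_lift[OF vs_fscale _ vec_space_dual that, of "%\<xi> \<eta>. fscale (\<eta> b) \<xi>" "(*)" "%f. f x"]
    bilinear_on_amb[OF bb, of b]
   by (simp add: lin_def fscale_def mult.commute)
  then show "?c b s x = ?c b t x" using assms x that by simp
 qed
 have "r = (\<Sum>b\<in>bas. tens E' E' (?c b r) (cfd b))" if "r \<in> tens_carrier E' E'" for r
  using lift_dual_basis[OF vec_space_dual that vs_fscale b] id[OF that] by simp
 then show ?thesis using c assms(1,2) by (metis (no_types, lifting) sum.cong)
qed

text \<open>The coproduct of \<open>E*\<close> is dual to the product of \<open>E\<close>;
  \<open>rsh \<xi> b\<close> is the first factor that stands next to the dual basis element
  \<open>cf b\<close>.\<close>

definition rsh :: "('e => 'k) => 'e => 'e => 'k" where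
 "rsh \<xi> z = (%x. \<xi> (m x z))"

lemma lin_rsh: "lin sE (*) \<xi> ==> lin sE (*) (rsh \<xi> z)"
 unfolding rsh_def by (rule lin_compose, assumption, intro lin_intros)

lemma dual_comult:
 assumes "\<xi> \<in> carrier E'"
 shows "comult E' \<xi> = (\<Sum>b\<in>bas. tens E' E' (restr (carrier E) (rsh \<xi> b)) (cfd b))"
proof -
 let ?t = "\<Sum>b\<in>bas. tens E' E' (restr (carrier E) (rsh \<xi> b)) (cfd b)"
 have cl: "restr (carrier E) (rsh \<xi> b) \<in> carrier E'" for b
 proof -
  have "rsh \<xi> b = (%x. \<xi> (P (m x b)))" by (simp add: rsh_def)
  then show ?thesis using lin_compose[OF lin_dual[OF assms] lin_m1[OF lin_ident], of b]
   by (simp add: restr_dual)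
 qed
 have t: "?t \<in> tens_carrier E' E'" by (intro tens_carrier_sum tens_in_carrier cl cfd_closed)
 have b: "bilinear_on E' E' (amb (*)) (%\<xi> \<eta>. \<xi> x * \<eta> y)" for x y
  by (auto simp: bilinear_on_def linear_on_def fscale_def algebra_simps)
 have ev: "lift E' E' (%\<xi>1 \<xi>2. \<xi>1 x * \<xi>2 y) ?t = \<xi> (mult E x y)"
  if xy: "x \<in> carrier E" "y \<in> carrier E" for x y
 proof -
  have "lift E' E' (%\<xi>1 \<xi>2. \<xi>1 x * \<xi>2 y) ?t = (\<Sum>b\<in>bas. \<xi> (m x b) * cf b y)"
   using tens_in_carrier[OF cl cfd_closed] lift_tens[OF vector_space_field b cl cfd_closed] xy
   by (subst linear_on_sum[OF lift_linear_amb[OF vector_space_field b]]) (auto simp: rsh_def cfd_def)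
  also have "... = (\<Sum>b\<in>bas. \<xi> (P (m x (sE (cf b y) b))))"
   using lin_scale[OF lin_compose[OF lin_dual[OF assms] lin_m2[OF lin_ident]]]
   by (simp add: mult.commute)
  also have "... = \<xi> (P (m x (\<Sum>b\<in>bas. sE (cf b y) b)))"
   unfolding lin_sum[OF lin_compose[OF lin_dual[OF assms] lin_m2[OF lin_ident]]] ..
  finally show ?thesis using xy by (simp add: basis_expand m_eq)
 qed
 have eq: "tens_carrier (dual_space E) (dual_space E) = tens_carrier E' E'"
  "lift (dual_space E) (dual_space E) = lift E' E'"
  by (rule tens_carrier_congr; simp) (simp add: lift_def lift_into_congr[of "dual_space E" E' "dual_space E" E'])
 have "comult E' \<xi> = (THE t. t \<in> tens_carrier E' E' \<and> (\<forall>x\<in>carrier E. \<forall>y\<in>carrier E.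
   lift E' E' (%\<xi>1 \<xi>2. \<xi>1 x * \<xi>2 y) t = \<xi> (mult E x y)))"
  unfolding dual_comult_raw eq ..
 also have "... = ?t"
  by (rule the_equality) (use t ev in \<open>auto intro!: tens_dual_eqI\<close>)
 finally show ?thesis .
qed


text \<open>Elements of \<open>E \<otimes> E\<^sup>*\<close>, with arguments from the ambient spaces.\<close>

definition te :: "'e => ('e => 'k) => ('k, 'e, 'e => 'k) tensor" where
 "te w \<xi> = tens E E' (P w) (\<Sum>b\<in>bas. fscale (\<xi> b) (cfd b))"

abbreviation ED :: "('k, ('k, 'e, 'e => 'k) tensor) vspace" where "ED \<equiv> tens_space E E'"

lemma te_sum_closed [simp]: "(\<Sum>b\<in>bas. fscale (\<xi> b) (cfd b)) \<in> carrier E'"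
 using vec_space_scale_closed[OF vec_space_dual] by (intro vec_space_sum_closed) auto

lemma te_closed [simp]: "te w \<xi> \<in> tens_carrier E E'"
 unfolding te_def by (intro tens_in_carrier) auto

lemma te_tens: "w \<in> carrier E ==> \<xi> \<in> carrier E' ==> tens E E' w \<xi> = te w \<xi>"
 by (simp add: te_def dual_expand)

lemma te_cong: "(\<And>x. x \<in> carrier E ==> \<xi> x = \<eta> x) ==> te w \<xi> = te w \<eta>"
 unfolding te_def by (intro arg_cong2[where f = "tens E E'"] sum.cong refl) auto

lemma te_P [simp]: "te (P w) \<xi> = te w \<xi>"
 by (simp add: te_def)

lemma lin_te1 [lin_intros]: "lin s sE f ==> lin s fscale (%x. te (f x) \<xi>)"
proof (rule lin_compose[of sE fscale "%w. te w \<xi>"])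
 have "linear_on E (amb fscale) (%w. tens E E' w (\<Sum>b\<in>bas. fscale (\<xi> b) (cfd b)))"
  using tens_amb_bilinear[of E E'] by (auto simp: bilinear_on_def)
 from lin_P_linear_on[OF this] show "lin sE fscale (%w. te w \<xi>)" by (simp add: te_def)
qed

lemma lin_te2 [lin_intros]:
 assumes "\<And>b. b \<in> bas ==> lin s (*) (%x. F x b)" shows "lin s fscale (%x. te w (F x))"
proof -
 have l: "linear_on E' (amb fscale) (tens E E' (P w))"
  using tens_amb_bilinear[of E E'] by (auto simp: bilinear_on_def)
 have "te w \<xi> = (\<Sum>b\<in>bas. fscale (\<xi> b) (tens E E' (P w) (cfd b)))" for \<xi>
  unfolding te_def using vec_space_scale_closed[OF vec_space_dual] l
  by (subst linear_on_sum[OF l vec_space_dual]) (auto simp: linear_on_def)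
 then have "(%x. te w (F x)) = (%x. \<Sum>b\<in>bas. fscale (F x b) (tens E E' (P w) (cfd b)))" by blast
 then show ?thesis by (simp only:) (intro lin_sum_fun lin_scale_left vs_fscale assms)
qed

text \<open>A functional on \<open>E\<close> extends to the ambient space by composition with
  \<open>P\<close>, so the pure case comes with a \<open>\<xi>\<close> that is linear without
  guards.\<close>

lemma te_induct [consumes 1, case_names pure add]:
 assumes "t \<in> tens_carrier E E'" and "\<And>w \<xi>. lin sE (*) \<xi> ==> Q (te w \<xi>)"
  and "\<And>s t. s \<in> tens_carrier E E' ==> t \<in> tens_carrier E E' ==> Q s ==> Q t ==> Q (s + t)"
 shows "Q t"
proof (rule tens_induct[OF assms(1) vec_space_E vec_space_dual])
 fix w \<xi> assume *: "w \<in> carrier E" "\<xi> \<in> carrier E'"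
 have "tens E E' w \<xi> = te w (%x. \<xi> (P x))"
  using te_tens[OF *] te_cong[of \<xi> "%x. \<xi> (P x)" w] by simp
 then show "Q (tens E E' w \<xi>)" using assms(2)[OF lin_dual[OF *(2)]] by simp
qed (rule assms(3))

lemma te_sum_apply:
 assumes "lin sE (*) \<xi>" "x \<in> carrier E"
 shows "(\<Sum>b\<in>bas. fscale (\<xi> b) (cfd b)) x = \<xi> x"
proof -
 have "\<xi> x = \<xi> (\<Sum>b\<in>bas. sE (cf b x) b)" using assms(2) by (simp add: basis_expand)
 also have "... = (\<Sum>b\<in>bas. cf b x * \<xi> b)" by (simp add: lin_sum[OF assms(1)] lin_scale[OF assms(1)])
 finally show ?thesis using assms(2) by (simp add: sum_fun_apply fscale_def cfd_def mult.commute)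
qed

text \<open>\<open>te w \<xi>\<close> sees \<open>\<xi>\<close> on the basis alone. There it agrees
  with an element of \<open>E*\<close>, and \<open>cong\<close> leads from that element back to
  \<open>\<xi>\<close>.\<close>

lemma lift_te:
 assumes u: "vector_space u" and eq: "\<And>w \<xi>. w \<in> carrier E ==> \<xi> \<in> carrier E' ==> \<phi> w \<xi> = \<psi> w \<xi>"
  and b: "bilinear_on E E' (amb u) \<psi>"
  and cong: "\<And>w \<xi> \<eta>. (\<And>x. x \<in> carrier E ==> \<xi> x = \<eta> x) ==> \<psi> w \<xi> = \<psi> w \<eta>"
  and xi: "lin sE (*) \<xi>"
 shows "lift E E' \<phi> (te w \<xi>) = \<psi> (P w) \<xi>"
proof -
 have "lift E E' \<phi> (te w \<xi>) = lift E E' \<psi> (te w \<xi>)" by (rule lift_cong) (rule eq)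
 also have "... = \<psi> (P w) (\<Sum>b\<in>bas. fscale (\<xi> b) (cfd b))"
  unfolding te_def by (rule lift_tens[OF u b]) auto
 also have "... = \<psi> (P w) \<xi>" by (rule cong) (rule te_sum_apply[OF xi])
 finally show ?thesis .
qed

text \<open>\<open>dm w \<xi> v \<eta>\<close> is the product \<open>(w\<xi>)(v\<eta>) = v2w \<otimes> \<xi>(S(v1)_v3)\<eta>\<close> in the double.\<close>

definition ad :: "('e => 'k) => 'e => 'e => 'e => 'k" where
 "ad \<xi> p q = (%x. \<xi> (m (m (S p) x) q))"

definition dm :: "'e => ('e => 'k) => 'e => ('e => 'k) => ('k, 'e, 'e => 'k) tensor" where
 "dm w \<xi> v \<eta> = sw (%v1 u. sw (%v2 v3. te (m v2 w) (cv (ad \<xi> v1 v3) \<eta>)) u) v"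

lemma lin_ad:
 assumes "lin sE (*) \<xi>"
 shows "lin s sE f ==> lin s (*) (%x. ad \<xi> (f x) q z)" "lin s sE f ==> lin s (*) (%x. ad \<xi> p (f x) z)"
  "lin s sE f ==> lin s (*) (%x. ad \<xi> p q (f x))" "lin sE (*) (ad \<xi> p q)"
 unfolding ad_def by (rule lin_compose[OF assms], intro lin_intros, assumption?)+

lemma ad_cong: "(\<And>x. x \<in> carrier E ==> \<xi> x = \<eta> x) ==> ad \<xi> = ad \<eta>"
 by (simp add: ad_def fun_eq_iff)

lemma dm_cong: "(\<And>x. x \<in> carrier E ==> \<xi> x = \<xi>' x) ==> (\<And>x. x \<in> carrier E ==> \<eta> x = \<eta>' x) ==>
  dm w \<xi> v \<eta> = dm w \<xi>' v \<eta>'"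
 unfolding dm_def using ad_cong[of \<xi> \<xi>'] by (simp add: cv_cong[of _ _ \<eta> \<eta>'])

lemma dm_P [simp]: "dm (P w) \<xi> v \<eta> = dm w \<xi> v \<eta>" "dm w \<xi> (P v) \<eta> = dm w \<xi> v \<eta>"
 by (simp_all add: dm_def)

lemma lin_dm:
 "lin s sE f ==> lin s fscale (%x. dm (f x) \<xi> v \<eta>)" "lin fscale fscale (%\<xi>. dm w \<xi> v \<eta>)"
 "lin fscale fscale (dm w \<xi> v)" "lin sE (*) \<xi> ==> lin sE fscale (%v. dm w \<xi> v \<eta>)"
proof -
 show "lin s sE f ==> lin s fscale (%x. dm (f x) \<xi> v \<eta>)"
  unfolding dm_def by (intro lin_intros)
 show "lin fscale fscale (%\<xi>. dm w \<xi> v \<eta>)"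
  unfolding dm_def ad_def by (intro lin_intros)
 show "lin fscale fscale (dm w \<xi> v)"
  unfolding dm_def by (intro lin_intros)
 show "lin sE (*) \<xi> ==> lin sE fscale (%v. dm w \<xi> v \<eta>)"
  unfolding dm_def by (intro lin_intros lin_ad)
qed

lemma dm_closed [simp]: "dm w \<xi> v \<eta> \<in> tens_carrier E E'"
 unfolding dm_def sw_def by (intro tens_carrier_sum te_closed)

lemma linear_on_sw: "linear_on V W f ==> vec_space V ==> (\<And>x y. \<phi> x y \<in> carrier V) ==>
  f (sw \<phi> z) = sw (%x y. f (\<phi> x y)) z"
 unfolding sw_def by (rule linear_on_sum)

lemma dm_bilinear:
 assumes "\<xi> \<in> carrier E'"
 shows "bilinear_on E E' ED (%v \<eta>. dm w \<xi> v \<eta>)"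
 unfolding bilinear_on_def
proof (intro conjI ballI)
 show "linear_on E' ED (dm w \<xi> v)" for v
  by (rule linear_on_of_lin) (simp_all add: lin_dm)
 have "dm w \<xi> = dm w (%x. \<xi> (P x))" by (intro ext dm_cong) simp_all
 then show "linear_on E ED (%v. dm w \<xi> v \<eta>)" for \<eta>
  by (auto intro!: linear_on_of_lin lin_dm simp: lin_dual[OF assms])
qed

definition Dm where "Dm s t = lift E E' (%w \<xi>. lift E E' (%v \<eta>. dm w \<xi> v \<eta>) t) s"

lemma double_mult_eq: "double_mult E s t = Dm s t"
 unfolding double_mult_def Let_def Dm_def
proof (intro lift_cong)
 fix w \<xi> v \<eta> assume *: "w \<in> carrier E" "\<xi> \<in> carrier E'" "v \<in> carrier E" "\<eta> \<in> carrier E'"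
 let ?x = "%x. \<xi> (P x)"
 have ad: "restr (carrier E) (%x. \<xi> (mult E (mult E (antipode E p) x) q)) = restr (carrier E) (ad ?x p q)"
  if "p \<in> carrier E" "q \<in> carrier E" for p q
  using that by (auto simp: restr_def ad_def m_eq S_eq fun_eq_iff)
 have t: "tens E E' (mult E y w) (mult E' (restr (carrier E) (%x. \<xi> (mult E (mult E (antipode E p) x) q))) \<eta>)
   = te (m y w) (cv (ad ?x p q) \<eta>)"
  if "p \<in> carrier E" "q \<in> carrier E" "y \<in> carrier E" for p q y
 proof -
  have c: "restr (carrier E) (ad ?x p q) \<in> carrier E'"
   by (rule restr_dual[OF lin_ad(4)[OF lin_dual[OF *(2)]]])
  have "te (m y w) (restr (carrier E) (cv (restr (carrier E) (ad ?x p q)) \<eta>)) = te (m y w) (cv (ad ?x p q) \<eta>)"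
   by (rule te_cong) (simp add: cv_cong[of "restr (carrier E) (ad ?x p q)" "ad ?x p q" \<eta> \<eta>])
  then show ?thesis
   using that * c dual_mult_closed[OF c *(4)] by (simp add: ad m_eq te_tens dual_mult)
 qed
 note l = lin_intros lin_ad[OF lin_dual[OF *(2)]]
 have "lift E E (%v1 u. lift E E (%v2 v3. tens E E' (mult E v2 w)
   (mult E' (restr (carrier E) (%x. \<xi> (mult E (mult E (antipode E v1) x) v3))) \<eta>)) (comult E u)) (comult E v)
  = sw (%v1 u. sw (%v2 v3. te (m v2 w) (cv (ad ?x v1 v3) \<eta>)) u) v"
 proof (rule lift_comult_total[OF vs_fscale])
  show "lift E E (%v2 v3. tens E E' (mult E v2 w)
   (mult E' (restr (carrier E) (%x. \<xi> (mult E (mult E (antipode E p) x) v3))) \<eta>)) (comult E u)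
   = sw (%v2 v3. te (m v2 w) (cv (ad ?x p v3) \<eta>)) u" if "p \<in> carrier E" "u \<in> carrier E" for p u
   by (rule lift_comult_total[OF vs_fscale]) (use that t in \<open>(simp; fail) | (intro l)\<close>)+
 qed (intro l *)+
 also have "... = dm w ?x v \<eta>" by (simp add: dm_def)
 also have "... = dm w \<xi> v \<eta>" by (rule dm_cong) simp_all
 finally show "lift E E (%v1 u. lift E E (%v2 v3. tens E E' (mult E v2 w)
   (mult E' (restr (carrier E) (%x. \<xi> (mult E (mult E (antipode E v1) x) v3))) \<eta>)) (comult E u)) (comult E v)
  = dm w \<xi> v \<eta>" .
qed

lemma Dm_inner_bilinear:
 assumes "t \<in> tens_carrier E E'"
 shows "bilinear_on E E' ED (%w \<xi>. lift E E' (%v \<eta>. dm w \<xi> v \<eta>) t)"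
 unfolding bilinear_on_def
proof (intro conjI ballI)
 show "linear_on E' ED (%\<xi>. lift E E' (%v \<eta>. dm w \<xi> v \<eta>) t)" for w
  by (rule linear_on_lift_param[OF vec_space_E vec_space_dual vec_space_tens vec_space_dual assms])
   (auto intro!: dm_bilinear linear_on_of_lin lin_dm)
 show "linear_on E ED (%w. lift E E' (%v \<eta>. dm w \<xi> v \<eta>) t)" if "\<xi> \<in> carrier E'" for \<xi>
  by (rule linear_on_lift_param[OF vec_space_E vec_space_dual vec_space_tens vec_space_E assms])
   (use that in \<open>auto intro!: dm_bilinear linear_on_of_lin lin_dm lin_ident\<close>)
qed

lemma Dm_bilinear: "bilinear_on ED ED ED Dm"
 unfolding bilinear_on_def
proof (intro conjI ballI)
 show "linear_on ED ED (%s. Dm s t)" if "t \<in> carrier ED" for t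
  unfolding Dm_def using that by (intro lift_linear Dm_inner_bilinear) auto
 show "linear_on ED ED (Dm s)" if "s \<in> carrier ED" for s
  unfolding Dm_def
  by (rule linear_on_lift_param[OF vec_space_E vec_space_dual vec_space_tens vec_space_tens])
   (use that in \<open>auto intro!: lift_linear dm_bilinear Dm_inner_bilinear\<close>)
qed

lemma Dm_te:
 assumes "lin sE (*) \<xi>" "lin sE (*) \<eta>"
 shows "Dm (te w \<xi>) (te v \<eta>) = dm w \<xi> v \<eta>"
proof -
 have 1: "lift E E' (%v \<eta>. dm w \<xi> v \<eta>) (te v \<eta>) = dm w \<xi> v \<eta>" if "\<xi> \<in> carrier E'" for w \<xi>
  using lift_te[OF vs_fscale _ bilinear_on_amb[OF dm_bilinear[OF that, of w], simplified] _ assms(2), of "dm w \<xi>" v]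
   dm_cong[of \<xi> \<xi>] by fastforce
 have "Dm (te w \<xi>) (te v \<eta>) = dm (P w) \<xi> v \<eta>"
  unfolding Dm_def
 proof (rule lift_te[OF vs_fscale 1 _ _ assms(1)])
  show "bilinear_on E E' (amb fscale) (%w \<xi>. dm w \<xi> v \<eta>)"
   by (rule bilinear_on_lin) (simp_all add: lin_dm lin_ident)
 qed (auto intro: dm_cong)
 then show ?thesis by simp
qed

end


context fd_hopf
begin

section \<open>Threefold coproducts and associativity of the double\<close>

definition sw3 :: "('e => 'e => 'e => 'u::ab_group_add) => 'e => 'u" where
 "sw3 \<phi> x = sw (%a r. sw (%b c. \<phi> a b c) r) x"

lemma sw3_P [simp]: "sw3 \<phi> (P x) = sw3 \<phi> x"
 by (simp add: sw3_def)

lemma sw3_cong: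
 "(\<And>x y z. x \<in> carrier E ==> y \<in> carrier E ==> z \<in> carrier E ==> \<phi> x y z = \<psi> x y z) ==> sw3 \<phi> w = sw3 \<psi> w"
 unfolding sw3_def by (intro sw_cong)

lemma lin_sw3_arg [lin_intros]:
 "vector_space u ==> (\<And>y z. lin sE u (%x. \<phi> x y z)) ==> (\<And>x z. lin sE u (%y. \<phi> x y z)) ==>
 lin s sE f ==> lin s u (%x. sw3 \<phi> (f x))"
 unfolding sw3_def by (intro lin_intros)

lemma lin_sw3_fun [lin_intros]:
 "vector_space u ==> (\<And>y z w. lin s u (%x. \<phi> x y z w)) ==> lin s u (%x. sw3 (\<phi> x) c)"
 unfolding sw3_def by (intro lin_intros)

lemma lin_of_sw3: "lin t u f ==> f (sw3 \<phi> z) = sw3 (%x y z. f (\<phi> x y z)) z"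
 unfolding sw3_def by (simp add: lin_of_sw)

lemma sw3_sw_swap: "sw3 (%x y z. sw (%a b. \<phi> x y z a b) v) u = sw (%a b. sw3 (%x y z. \<phi> x y z a b) u) v"
proof -
 have "sw3 (%x y z. sw (%a b. \<phi> x y z a b) v) u = sw (%x r. sw (%a b. sw (%y z. \<phi> x y z a b) r) v) u"
  unfolding sw3_def by (subst sw_swap) simp
 also have "... = sw (%a b. sw3 (%x y z. \<phi> x y z a b) u) v"
  unfolding sw3_def by (rule sw_swap)
 finally show ?thesis .
qed

lemma sw3_swap: "sw3 (%x y z. sw3 (%a b c. \<phi> x y z a b c) v) u = sw3 (%a b c. sw3 (%x y z. \<phi> x y z a b c) u) v"
proof -
 have "sw3 (%x y z. sw3 (%a b c. \<phi> x y z a b c) v) u = sw (%a r. sw3 (%x y z. sw (%b c. \<phi> x y z a b c) r) u) v"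
  unfolding sw3_def[of _ v] by (rule sw3_sw_swap)
 also have "... = sw3 (%a b c. sw3 (%x y z. \<phi> x y z a b c) u) v"
  unfolding sw3_def[of _ v] by (simp only: sw3_sw_swap)
 finally show ?thesis .
qed

lemma sw3_left:
 assumes "vector_space u" "\<And>y z. lin sE u (%x. \<phi> x y z)" "\<And>x z. lin sE u (%y. \<phi> x y z)"
  "\<And>x y. lin sE u (%z. \<phi> x y z)"
 shows "sw3 \<phi> w = sw (%r c. sw (%a b. \<phi> a b c) r) w"
 unfolding sw3_def by (rule sw_coassoc[symmetric, OF assms])

lemma sw3_m:
 assumes u: "vector_space u" and l: "\<And>y z. lin sE u (%x. \<phi> x y z)" "\<And>x z. lin sE u (%y. \<phi> x y z)"
  "\<And>x y. lin sE u (%z. \<phi> x y z)"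
 shows "sw3 \<phi> (m g v) = sw3 (%a b c. sw3 (%x y z. \<phi> (m a x) (m b y) (m c z)) v) g"
proof -
 have "sw3 \<phi> (m g v) = sw (%a t. sw (%x r. sw (%b c. \<phi> (m a x) b c) (m t r)) v) g"
  unfolding sw3_def by (rule sw_m[OF u]) (intro lin_intros u l)+
 also have "... = sw (%a t. sw (%x r. sw (%b c. sw (%y z. \<phi> (m a x) (m b y) (m c z)) r) t) v) g"
  by (subst sw_m[OF u]) (intro l refl)+
 also have "... = sw (%a t. sw (%b c. sw (%x r. sw (%y z. \<phi> (m a x) (m b y) (m c z)) r) v) t) g"
  by (subst sw_swap) simp
 finally show ?thesis unfolding sw3_def .
qed

text \<open>Two groupings of a fivefold coproduct: either the outer parts of a threefold one are
  split, or its middle part. Associativity of the double and compatibility of the action with its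
  product both come down to this.\<close>

lemma sw5:
 assumes u: "vector_space u"
  and l: "\<And>b c d e. lin sE u (%a. F a b c d e)" "\<And>a c d e. lin sE u (%b. F a b c d e)"
   "\<And>a b d e. lin sE u (%c. F a b c d e)" "\<And>a b c e. lin sE u (%d. F a b c d e)"
   "\<And>a b c d. lin sE u (%e. F a b c d e)"
 shows "sw3 (%x c y. sw (%a b. sw (%d e. F a b c d e) y) x) w = sw3 (%a g e. sw3 (%b c d. F a b c d e) g) w"
proof -
 have "sw3 (%x c y. sw (%a b. sw (%d e. F a b c d e) y) x) w =
   sw (%x r. sw (%a b. sw (%c y. sw (%d e. F a b c d e) y) r) x) w"
  unfolding sw3_def by (subst sw_swap) simp
 also have "... = sw (%a s. sw (%b r. sw (%c y. sw (%d e. F a b c d e) y) r) s) w"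
  by (rule sw_coassoc[OF u]) (intro lin_intros u l)+
 also have "... = sw (%a s. sw (%b r. sw (%t e. sw (%c d. F a b c d e) t) r) s) w"
  by (subst sw_coassoc[OF u, symmetric]) (intro u l refl)+
 also have "... = sw (%a s. sw (%g e. sw (%b t. sw (%c d. F a b c d e) t) g) s) w"
 proof -
  have "sw (%b r. sw (%t e. sw (%c d. F a b c d e) t) r) s =
    sw (%g e. sw (%b t. sw (%c d. F a b c d e) t) g) s" for a s
   by (rule sw_coassoc[symmetric, OF u]) (intro lin_intros u l)+
  then show ?thesis by simp
 qed
 finally show ?thesis unfolding sw3_def .
qed

lemma sw3_counit_outer:
 assumes u: "vector_space u" and f: "lin sE u f"
 shows "sw3 (%a b c. u (eps a) (u (eps c) (f b))) w = f (P w)"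
proof -
 have "sw3 (%a b c. u (eps a) (u (eps c) (f b))) w = sw (%a r. u (eps a) (f (P r))) w"
 proof -
  have "sw (%b c. u (eps a) (u (eps c) (f b))) r = u (eps a) (sw (%b c. u (eps c) (f b)) r)" for a r
   by (simp only: sw_def vector_space_sum[OF u])
  then have "sw (%b c. u (eps a) (u (eps c) (f b))) r = u (eps a) (f (P r))" for a r
   by (simp add: sw_counit_right[OF f])
  then show ?thesis by (simp add: sw3_def)
 qed
 also have "... = f (P (P w))" by (rule sw_counit_left) (intro lin_compose[OF f] lin_intros)
 finally show ?thesis by simp
qed

lemma dm_sw3: "dm w \<xi> v \<eta> = sw3 (%v1 v2 v3. te (m v2 w) (cv (ad \<xi> v1 v3) \<eta>)) v"
 by (simp add: dm_def sw3_def)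

lemma te_scale: "te w (%x. c * \<xi> x) = fscale c (te w \<xi>)"
 using lin_scale[OF lin_te2[of fscale "%\<xi>. \<xi>" w], of c \<xi>] by (simp add: lin_apply fscale_def)

text \<open>The coproduct of \<open>S(p) x q\<close> is a product of coproducts, and
  \<open>S\<close> exchanges the two parts of \<open>p\<close>; hence \<open>p2\<close> meets
  \<open>\<alpha>\<close> and \<open>p1\<close> meets \<open>\<beta>\<close>.\<close>

lemma ad_cv:
 assumes "lin sE (*) \<alpha>" "lin sE (*) \<beta>"
 shows "ad (cv \<alpha> \<beta>) p q = (%x. sw (%p1 p2. sw (%q1 q2. cv (ad \<alpha> p2 q1) (ad \<beta> p1 q2) x) q) p)"
proof
 fix x
 note l = lin_intros lin_compose[OF assms(1)] lin_compose[OF assms(2)]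
 have "ad (cv \<alpha> \<beta>) p q x = sw (%y z. sw (%q1 q2. \<alpha> (m y q1) * \<beta> (m z q2)) q) (m (S p) x)"
  unfolding ad_def cv_def by (rule sw_m[where u = "(*)"]) (intro l assms)+
 also have "... = sw (%s t. sw (%a b. sw (%q1 q2. \<alpha> (m (m s a) q1) * \<beta> (m (m t b) q2)) q) x) (S p)"
  by (rule sw_m[where u = "(*)"]) (intro l)+
 also have "... = sw (%p1 p2. sw (%a b. sw (%q1 q2. \<alpha> (m (m (S p2) a) q1) * \<beta> (m (m (S p1) b) q2)) q) x) p"
  by (rule sw_S[where u = "(*)"]) (intro l)+
 also have "... = sw (%p1 p2. sw (%q1 q2. cv (ad \<alpha> p2 q1) (ad \<beta> p1 q2) x) q) p"
  unfolding cv_def ad_def by (subst sw_swap) simp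
 finally show "ad (cv \<alpha> \<beta>) p q x = ..." .
qed

lemma ad_ad: "ad (ad \<xi> a b) p q = ad \<xi> (m p a) (m q b)"
 by (simp add: ad_def S_m m_assoc fun_eq_iff)

lemma te_sw: "te w (%x. sw (%a b. F a b x) z) = sw (%a b. te w (F a b)) z"
proof -
 have "(%x. sw (%a b. F a b x) z) = sw F z" by (simp add: sw_def fun_eq_iff sum_fun_apply)
 then show ?thesis
  using lin_of_sw[OF lin_te2[of fscale "%\<xi>. \<xi>" w], of F z] by (simp add: lin_apply)
qed

lemma cv_sw_left: "cv (%x. sw (%a b. F a b x) z) \<zeta> = (%x. sw (%a b. cv (F a b) \<zeta> x) z)"
 unfolding cv_def
proof
 fix x
 have "sw (%c d. sw (%a b. F a b c) z * \<zeta> d) x = sw (%c d. sw (%a b. F a b c * \<zeta> d) z) x"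
  by (simp add: sw_def sum_distrib_right)
 also have "... = sw (%a b. sw (%c d. F a b c * \<zeta> d) x) z" by (rule sw_swap)
 finally show "sw (%c d. sw (%a b. F a b c) z * \<zeta> d) x = ..." .
qed

lemma Dm_assoc_te:
 assumes "lin sE (*) \<xi>" "lin sE (*) \<eta>" "lin sE (*) \<zeta>"
 shows "Dm (Dm (te w \<xi>) (te v \<eta>)) (te u \<zeta>) = Dm (te w \<xi>) (Dm (te v \<eta>) (te u \<zeta>))"
proof -
 note l = lin_intros lin_ad[OF assms(1)] lin_ad[OF assms(2)] lin_ad[OF assms(3)]
 \<comment> \<open>Both bracketings reduce to these summands, with \<open>p1 p2 c q1 q2\<close> the
   parts of \<open>u\<close> and \<open>v1 v2 v3\<close> those of \<open>v\<close>. They differ in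
   how the parts of \<open>u\<close> are grouped.\<close>
 define F where "F p1 p2 c q1 q2 v1 v2 v3 =
  te (m c (m v2 w)) (cv (ad \<xi> (m p2 v1) (m q1 v3)) (cv (ad \<eta> p1 q2) \<zeta>))" for p1 p2 c q1 q2 v1 v2 v3
 let ?F = "%p1 p2 c q1 q2. sw3 (F p1 p2 c q1 q2) v"
 have lcv: "lin sE (*) (cv \<alpha> \<beta>)" if "lin sE (*) \<alpha>" for \<alpha> \<beta>
  by (rule lin_cv3[OF that lin_ident])
 have sumD: "Dm (sw3 \<phi> z) t = sw3 (%a b c. Dm (\<phi> a b c) t) z" "Dm t (sw3 \<phi> z) = sw3 (%a b c. Dm t (\<phi> a b c)) z"
  if "\<And>a b c. \<phi> a b c \<in> tens_carrier E E'" "t \<in> tens_carrier E E'" for \<phi> z t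
 proof -
  have l: "linear_on ED ED (%s. Dm s t)" "linear_on ED ED (Dm t)"
   using Dm_bilinear that(2) by (auto simp: bilinear_on_def)
  have "sw (%b c. \<phi> a b c) r \<in> tens_carrier E E'" for a r
   unfolding sw_def by (intro tens_carrier_sum that)
  then show "Dm (sw3 \<phi> z) t = sw3 (%a b c. Dm (\<phi> a b c) t) z"
   "Dm t (sw3 \<phi> z) = sw3 (%a b c. Dm t (\<phi> a b c)) z"
   unfolding sw3_def using that(1) by (simp_all add: linear_on_sw[OF l(1)] linear_on_sw[OF l(2)])
 qed
 have "Dm (Dm (te w \<xi>) (te v \<eta>)) (te u \<zeta>) =
   sw3 (%v1 v2 v3. dm (m v2 w) (cv (ad \<xi> v1 v3) \<eta>) u \<zeta>) v"
  by (simp add: Dm_te assms dm_sw3[of w] sumD) (simp add: Dm_te lcv lin_ad assms)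
 also have "... = sw3 (%v1 v2 v3. sw3 (%x c y. sw (%p1 p2. sw (%q1 q2. F p1 p2 c q1 q2 v1 v2 v3) y) x) u) v"
  unfolding dm_sw3[of _ _ u]
  by (simp add: ad_cv lin_ad assms cv_sw_left te_sw ad_ad cv_assoc F_def)
 also have "... = sw3 (%x c y. sw (%p1 p2. sw (%q1 q2. ?F p1 p2 c q1 q2) y) x) u"
  by (subst sw3_swap) (simp only: sw3_sw_swap)
 also have "... = sw3 (%p1 g q2. sw3 (%p2 c q1. ?F p1 p2 c q1 q2) g) u"
  by (rule sw5[OF vs_fscale]; unfold F_def; intro l)
 also have "... = sw3 (%u1 g u3. dm w \<xi> (m g v) (cv (ad \<eta> u1 u3) \<zeta>)) u"
 proof -
  have "dm w \<xi> (m g v) (cv (ad \<eta> u1 u3) \<zeta>) = sw3 (%p2 c q1. ?F u1 p2 c q1 u3) g" for u1 g u3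
  proof -
   have "dm w \<xi> (m g v) (cv (ad \<eta> u1 u3) \<zeta>) = sw3 (%a b c. sw3 (%x y z.
     te (m (m b y) w) (cv (ad \<xi> (m a x) (m c z)) (cv (ad \<eta> u1 u3) \<zeta>))) v) g"
    unfolding dm_sw3 by (rule sw3_m[OF vs_fscale]; intro l)
   moreover have "F u1 a b c u3 = (%x y z. te (m (m b y) w)
     (cv (ad \<xi> (m a x) (m c z)) (cv (ad \<eta> u1 u3) \<zeta>)))" for a b c
    by (simp add: F_def fun_eq_iff m_assoc)
   ultimately show ?thesis by simp
  qed
  then show ?thesis by simp
 qed
 also have "... = Dm (te w \<xi>) (Dm (te v \<eta>) (te u \<zeta>))"
  by (simp add: Dm_te assms dm_sw3[of v] sumD) (simp add: Dm_te lcv lin_ad assms)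
 finally show ?thesis .
qed

definition D where "D = drinfeld_double E"

lemma D_simps [simp]:
 "carrier D = tens_carrier E E'" "scale D = fscale" "mult D = Dm" "unity D = te one eps"
proof -
 show "unity D = te one eps"
  using dual_unity_closed te_cong[of "restr (carrier E) eps" eps one]
  by (simp add: D_def drinfeld_double_def Let_def te_tens dual_unity flip: one_def)
qed (simp_all add: D_def drinfeld_double_def Let_def double_mult_eq fun_eq_iff)

lemma Dm_closed: "s \<in> tens_carrier E E' ==> t \<in> tens_carrier E E' ==> Dm s t \<in> tens_carrier E E'"
 using bilinear_on_closed[OF Dm_bilinear] by simp

lemma Dm_add:
 assumes "s \<in> tens_carrier E E'" "s' \<in> tens_carrier E E'" "t \<in> tens_carrier E E'"
 shows "Dm (s + s') t = Dm s t + Dm s' t" "Dm t (s + s') = Dm t s + Dm t s'"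
 using Dm_bilinear assms by (auto simp: bilinear_on_def linear_on_def)

lemma Dm_assoc:
 assumes "s \<in> tens_carrier E E'" "t \<in> tens_carrier E E'" "r \<in> tens_carrier E E'"
 shows "Dm (Dm s t) r = Dm s (Dm t r)"
 using assms
proof (induction s rule: te_induct)
 case (pure w \<xi>)
 from pure(2,1,3) show ?case
 proof (induction t rule: te_induct)
  case (pure v \<eta>)
  from pure(3,1,2) show ?case
  proof (induction r rule: te_induct)
   case (pure u \<zeta>)
   then show ?case by (simp add: Dm_assoc_te)
  next
   case (add r r')
   have "Dm (Dm (te w \<xi>) (te v \<eta>)) (r + r') = Dm (te w \<xi>) (Dm (te v \<eta>) (r + r'))"
    using add by (simp add: Dm_add Dm_closed)
   then show ?case .
  qed
 next
  case (add t t')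
  have "Dm (Dm (te w \<xi>) (t + t')) r = Dm (te w \<xi>) (Dm (t + t') r)"
   using add by (simp add: Dm_add Dm_closed)
  then show ?case .
 qed
next
 case (add s s')
 have "Dm (Dm (s + s') t) r = Dm (s + s') (Dm t r)"
  using add by (simp add: Dm_add Dm_closed)
 then show ?case .
qed

text \<open>\<open>eps(S(a) x c)\<close> is a product of counits, and these strip the outer parts
  off \<open>v\<close>.\<close>

lemma dm_one_left: "lin sE (*) \<eta> ==> dm one eps v \<eta> = te v \<eta>"
proof -
 assume eta: "lin sE (*) \<eta>"
 have "cv (ad eps a c) \<eta> = (%x. eps a * (eps c * \<eta> (P x)))" for a c
 proof
  fix x
  have "cv (ad eps a c) \<eta> x = eps a * eps c * cv eps \<eta> x"
   unfolding cv_def ad_def by (simp add: sw_def sum_distrib_left algebra_simps)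
  then show "cv (ad eps a c) \<eta> x = eps a * (eps c * \<eta> (P x))" by (simp add: cv_eps_left[OF eta])
 qed
 then have "dm one eps v \<eta> = sw3 (%a b c. fscale (eps a) (fscale (eps c) (te b (%x. \<eta> (P x))))) v"
  by (simp add: dm_sw3 te_scale)
 also have "... = te (P v) (%x. \<eta> (P x))"
  by (rule sw3_counit_outer) (intro lin_intros vs_fscale)+
 also have "... = te v \<eta>" using te_cong[of "%x. \<eta> (P x)" \<eta>] by simp
 finally show ?thesis .
qed

lemma dm_at_one:
 assumes xi: "lin sE (*) \<xi>" shows "dm w \<xi> one \<eta> = te w (cv \<xi> \<eta>)"
proof -
 note l = lin_intros lin_ad[OF xi]
 have "dm w \<xi> one \<eta> = te (m one w) (cv (ad \<xi> one one) \<eta>)"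
  unfolding dm_def
  by (subst sw_one[OF vs_fscale], intro l, intro l, rule sw_one[OF vs_fscale]) (intro l)+
 also have "... = te w (cv \<xi> \<eta>)"
 proof -
  have "cv (ad \<xi> one one) \<eta> = cv \<xi> \<eta>" by (rule cv_cong) (simp_all add: ad_def)
  then show ?thesis by simp
 qed
 finally show ?thesis .
qed

lemma dm_one_right: "lin sE (*) \<xi> ==> dm w \<xi> one eps = te w \<xi>"
 using te_cong[of "cv \<xi> eps" \<xi>] by (simp add: dm_at_one cv_eps_right)

lemma alg_D: "algebra D"
proof -
 have "Dm (te one eps) t = t \<and> Dm t (te one eps) = t" if "t \<in> tens_carrier E E'" for t
  using that
 proof (induction t rule: te_induct)
  case (pure w \<xi>)
  then show ?case by (simp add: Dm_te lin_eps dm_one_left dm_one_right)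
 next
  case (add s t)
  have "Dm (te one eps) (s + t) = s + t \<and> Dm (s + t) (te one eps) = s + t"
   using add by (simp add: Dm_add)
  then show ?case .
 qed
 moreover have "bilinear_on D D D Dm"
  using Dm_bilinear by (subst bilinear_on_cong_space[of D ED D ED D ED]) auto
 moreover have "vec_space D" using vec_space_tens[of E E'] by (simp add: vec_space_def)
 ultimately show ?thesis by (simp add: algebra_def Dm_assoc)
qed

lemma vec_space_D [simp]: "vec_space D"
 using alg_D by (rule algebra_vec_space)

section \<open>Coproduct, counit and antipode of the double\<close>

lemma tens_D [simp]: "tens D D = tens ED ED" "tens_carrier D D = tens_carrier ED ED" "lift D D = lift ED ED"
proof -
 show "tens D D = tens ED ED" "tens_carrier D D = tens_carrier ED ED"
  by (rule tens_congr tens_carrier_congr; simp)+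
 show "lift D D = lift ED ED" by (simp add: lift_def lift_into_congr[of D ED D ED])
qed

lemma lin_tens1 [lin_intros]:
 assumes "lin s fscale F" "\<And>x. F x \<in> tens_carrier E E'" "y \<in> tens_carrier E E'"
 shows "lin s fscale (%x. tens ED ED (F x) y)"
 using tens_amb_bilinear[of ED ED] assms by (simp add: bilinear_on_def linear_on_def lin_def)

lemma lin_tens2 [lin_intros]:
 assumes "lin s fscale F" "\<And>x. F x \<in> tens_carrier E E'" "y \<in> tens_carrier E E'"
 shows "lin s fscale (%x. tens ED ED y (F x))"
 using tens_amb_bilinear[of ED ED] assms by (simp add: bilinear_on_def linear_on_def lin_def)

lemma restr_rsh_closed [simp]: "\<xi> \<in> carrier E' ==> restr (carrier E) (rsh \<xi> b) \<in> carrier E'"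
proof -
 assume "\<xi> \<in> carrier E'"
 moreover have "rsh \<xi> b = rsh (%x. \<xi> (P x)) b" by (simp add: rsh_def)
 ultimately show ?thesis using restr_dual[OF lin_rsh[OF lin_dual]] by metis
qed

lemma lift_dual_comult:
 assumes u: "vector_space u" and b: "bilinear_on E' E' (amb u) \<phi>" and "\<xi> \<in> carrier E'"
 shows "lift E' E' \<phi> (comult E' \<xi>) = (\<Sum>b\<in>bas. \<phi> (restr (carrier E) (rsh \<xi> b)) (cfd b))"
proof -
 have "tens E' E' (restr (carrier E) (rsh \<xi> b)) (cfd b) \<in> carrier (tens_space E' E')" for b
  using assms(3) by (simp add: tens_in_carrier)
 then show ?thesis
  unfolding dual_comult[OF assms(3)]
  by (subst linear_on_sum[OF lift_linear_amb[OF u b]]) (use assms(3) in \<open>auto simp: lift_tens[OF u b]\<close>)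
qed

text \<open>The coproduct of \<open>w\<xi>\<close> in the double, which as a coalgebra is
  \<open>E \<otimes> E*\<close>; the sum over \<open>bas\<close> is the coproduct of
  \<open>\<xi>\<close>.\<close>

definition Dc :: "'e => ('e => 'k) => ('k, ('k, 'e, 'e => 'k) tensor, ('k, 'e, 'e => 'k) tensor) tensor" where
 "Dc w \<xi> = sw (%w1 w2. \<Sum>b\<in>bas. tens ED ED (te w1 (rsh \<xi> b)) (te w2 (cf b))) w"

lemma Dc_closed: "Dc w \<xi> \<in> tens_carrier ED ED"
 unfolding Dc_def sw_def by (intro tens_carrier_sum tens_in_carrier) auto

lemma Dc_cong: "(\<And>x. x \<in> carrier E ==> \<xi> x = \<eta> x) ==> Dc w \<xi> = Dc w \<eta>"
 unfolding Dc_def by (simp add: rsh_def)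

lemma lin_Dc: "lin sE fscale (%w. Dc w \<xi>)" "lin fscale fscale (Dc w)"
 unfolding Dc_def rsh_def by (intro lin_intros te_closed)+

lemma Dc_bilinear: "bilinear_on E E' (tens_space ED ED) Dc"
 unfolding bilinear_on_def by (auto intro!: linear_on_of_lin lin_Dc Dc_closed)

lemma comult_D_eq: "comult D t = lift E E' Dc t"
proof -
 have 1: "lift E' E' (%\<xi>1 \<xi>2. tens ED ED (tens E E' w1 \<xi>1) (tens E E' w2 \<xi>2)) (comult E' \<xi>) =
   (\<Sum>b\<in>bas. tens ED ED (te w1 (rsh \<xi> b)) (te w2 (cf b)))"
  if w: "w1 \<in> carrier E" "w2 \<in> carrier E" and xi: "\<xi> \<in> carrier E'" for w1 w2 \<xi>
 proof -
  have "linear_on E' ED (tens E E' w1)" "linear_on E' ED (tens E E' w2)"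
   using w tens_bilinear[of E E'] by (auto simp: bilinear_on_def)
  from bilinear_on_compose_right[OF bilinear_on_compose_left[OF tens_bilinear this(1)] this(2)]
  have b: "bilinear_on E' E' (amb fscale) (%\<xi>1 \<xi>2. tens ED ED (tens E E' w1 \<xi>1) (tens E E' w2 \<xi>2))"
   by (auto dest: bilinear_on_amb)
  have "te w1 (restr (carrier E) (rsh \<xi> b)) = te w1 (rsh \<xi> b)" "te w2 (cfd b) = te w2 (cf b)" for b
   by (rule te_cong; simp add: cfd_def)+
  then show ?thesis
   using w xi by (simp add: lift_dual_comult[OF vs_fscale b xi] te_tens)
 qed
 have "comult D t = lift E E' (%w \<xi>. lift E E (%w1 w2. lift E' E' (%\<xi>1 \<xi>2.
    tens ED ED (tens E E' w1 \<xi>1) (tens E E' w2 \<xi>2)) (comult E' \<xi>)) (comult E w)) t"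
  by (simp add: D_def drinfeld_double_def Let_def)
 also have "... = lift E E' Dc t"
 proof (rule lift_cong)
  fix w \<xi> assume *: "w \<in> carrier E" "\<xi> \<in> carrier E'"
  show "lift E E (%w1 w2. lift E' E' (%\<xi>1 \<xi>2.
    tens ED ED (tens E E' w1 \<xi>1) (tens E E' w2 \<xi>2)) (comult E' \<xi>)) (comult E w) = Dc w \<xi>"
   unfolding Dc_def
   by (rule lift_comult_total[OF vs_fscale 1[OF _ _ *(2)]]) (assumption | rule * | intro lin_intros te_closed vs_fscale)+
 qed
 finally show ?thesis .
qed

lemma comult_D_linear: "linear_on ED (tens_space ED ED) (comult D)"
 using lift_linear[OF Dc_bilinear] by (simp add: comult_D_eq[abs_def])

lemma comult_D_te: "lin sE (*) \<xi> ==> comult D (te w \<xi>) = Dc w \<xi>"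
 unfolding comult_D_eq
 using lift_te[OF vs_fscale _ bilinear_on_amb[OF Dc_bilinear, simplified] Dc_cong, of Dc \<xi> w]
 by (simp add: Dc_def)

lemma lift_comult_D:
 assumes u: "vector_space u" and b: "bilinear_on ED ED (amb u) \<phi>" and xi: "lin sE (*) \<xi>"
 shows "lift ED ED \<phi> (comult D (te w \<xi>)) = sw (%w1 w2. \<Sum>b\<in>bas. \<phi> (te w1 (rsh \<xi> b)) (te w2 (cf b))) w"
proof -
 note L = linear_on_sum[OF lift_linear_amb[OF u b vec_space_tens vec_space_tens] vec_space_tens, simplified]
 have "tens ED ED (te x f) (te y g) \<in> tens_carrier ED ED" for x y f g
  by (simp add: tens_in_carrier)
 then show ?thesis
  unfolding comult_D_te[OF xi] Dc_def sw_def
  by (simp add: L tens_carrier_sum lift_tens[OF u b])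
qed

lemma counit_D_te:
 assumes "lin sE (*) \<xi>" shows "counit D (te w \<xi>) = eps w * \<xi> one"
proof -
 have "counit D (te w \<xi>) = eps (P w) * \<xi> one"
  unfolding D_def drinfeld_double_def Let_def hopf.simps
 proof (rule lift_te[OF vector_space_field _ _ _ assms])
  show "bilinear_on E E' (amb (*)) (%w \<xi>. eps w * \<xi> one)"
   by (rule bilinear_on_lin; (unfold dual_simps)?; intro lin_intros)
 qed (simp_all add: eps_eq)
 then show ?thesis by simp
qed

lemma counit_D_linear: "linear_on ED (amb (*)) (counit D)"
proof -
 have b: "bilinear_on E E' (amb (*)) (%w \<xi>. eps w * \<xi> one)"
  by (rule bilinear_on_lin; (unfold dual_simps)?; intro lin_intros)
 have "counit D = lift E E' (%w \<xi>. eps w * \<xi> one)"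
  unfolding D_def drinfeld_double_def Let_def hopf.simps
  by (intro ext lift_cong) (simp add: eps_eq)
 then show ?thesis using lift_linear_amb[OF vector_space_field b] by simp
qed

lemma antipode_D_bilinear: "bilinear_on E E' ED (%w \<xi>. dm one (%x. \<xi> (S x)) (Si w) eps)"
 unfolding bilinear_on_def
proof (intro conjI ballI)
 show "linear_on E' ED (%\<xi>. dm one (%x. \<xi> (S x)) (Si w) eps)" for w
 proof (rule linear_on_of_lin)
  show "lin (scale E') (scale ED) (%\<xi>. dm one (%x. \<xi> (S x)) (Si w) eps)"
   unfolding dm_def ad_def tens_space_simps dual_simps by (intro lin_intros)
 qed simp
 show "linear_on E ED (%w. dm one (%x. \<xi> (S x)) (Si w) eps)" if "\<xi> \<in> carrier E'" for \<xi>
 proof (rule linear_on_of_lin)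
  have "dm one (%x. \<xi> (S x)) = dm one (%x. \<xi> (P (S x)))" by simp
  moreover have "lin sE (*) (%x. \<xi> (P (S x)))" by (rule lin_compose[OF lin_dual[OF that] lin_S])
  ultimately show "lin sE (scale ED) (%w. dm one (%x. \<xi> (S x)) (Si w) eps)"
   using lin_compose[OF lin_dm(4) lin_Si] by simp
 qed simp
qed

lemma antipode_D_eq: "antipode D = lift E E' (%w \<xi>. dm one (%x. \<xi> (S x)) (Si w) eps)"
 unfolding D_def drinfeld_double_def Let_def hopf.simps
proof (rule ext, rule lift_cong)
 fix w \<xi> assume *: "w \<in> carrier E" "\<xi> \<in> carrier E'"
 let ?x = "%x. \<xi> (P (S x))"
 have x: "lin sE (*) ?x" by (rule lin_compose[OF lin_dual[OF *(2)] lin_S])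
 have c: "antipode E' \<xi> \<in> carrier E'" using restr_dual[OF x] by (simp add: dual_antipode)
 have "te one (antipode E' \<xi>) = te one ?x" "te (Si w) (unity E') = te (Si w) eps"
  by (rule te_cong; simp add: dual_antipode dual_unity)+
 then show "double_mult E (tens E E' (unity E) (antipode E' \<xi>))
   (tens E E' (inv_into (carrier E) (antipode E) w) (unity E')) = dm one (%x. \<xi> (S x)) (Si w) eps"
  using * c x lin_eps dual_unity_closed by (simp add: te_tens Si_eq double_mult_eq Dm_te flip: one_def)
qed

lemma antipode_D_linear: "linear_on ED ED (antipode D)"
 unfolding antipode_D_eq by (intro lift_linear antipode_D_bilinear) auto

lemma antipode_D_te:
 assumes "lin sE (*) \<xi>" shows "antipode D (te w \<xi>) = dm one (%x. \<xi> (S x)) (Si w) eps"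
proof -
 have "antipode D (te w \<xi>) = dm one (%x. \<xi> (S x)) (Si (P w)) eps"
  unfolding antipode_D_eq
  by (rule lift_te[OF vs_fscale _ bilinear_on_amb[OF antipode_D_bilinear, simplified] _ assms])
   (auto intro: dm_cong)
 then show ?thesis by simp
qed

subsection \<open>Twists from the dual\<close>

abbreviation K2 where "K2 \<equiv> tens_alg E' E'"
abbreviation D2 where "D2 \<equiv> tens_alg D D"

lemma alg_D2: "algebra D2"
 using algebra_tens_alg[OF alg_D alg_D] .

lemma te_one_bilinear: "bilinear_on E' E' (tens_space ED ED) (%\<xi> \<eta>. tens ED ED (te one \<xi>) (te one \<eta>))"
 unfolding bilinear_on_def
 by (auto intro!: linear_on_of_lin lin_intros tens_in_carrier)

lemma embed_dual2_eq: "embed_dual2 E t = lift E' E' (%\<xi> \<eta>. tens ED ED (te one \<xi>) (te one \<eta>)) t"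
proof -
 have "embed_dual2 E t = lift E' E' (%\<xi> \<eta>. tens ED ED (tens E E' one \<xi>) (tens E E' one \<eta>)) t"
  unfolding embed_dual2_def Let_def D_def[symmetric] one_def[symmetric] tens_D ..
 also have "... = lift E' E' (%\<xi> \<eta>. tens ED ED (te one \<xi>) (te one \<eta>)) t"
  by (rule lift_cong) (simp add: te_tens)
 finally show ?thesis .
qed

lemma embed_dual2_tens:
 "\<xi> \<in> carrier E' ==> \<eta> \<in> carrier E' ==> embed_dual2 E (tens E' E' \<xi> \<eta>) = tens ED ED (te one \<xi>) (te one \<eta>)"
 unfolding embed_dual2_eq using bilinear_on_amb[OF te_one_bilinear]
 by (simp add: lift_tens[OF vs_fscale])

lemma embed_dual2_linear: "linear_on (tens_space E' E') (tens_space ED ED) (embed_dual2 E)"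
 unfolding embed_dual2_eq[abs_def] by (intro lift_linear te_one_bilinear) auto

lemma embed_dual2_closed: "t \<in> tens_carrier E' E' ==> embed_dual2 E t \<in> tens_carrier ED ED"
 using embed_dual2_linear by (simp add: linear_on_def)

lemma Dm_te_one: "\<xi> \<in> carrier E' ==> \<eta> \<in> carrier E' ==> Dm (te one \<xi>) (te one \<eta>) = te one (mult E' \<xi> \<eta>)"
proof -
 assume *: "\<xi> \<in> carrier E'" "\<eta> \<in> carrier E'"
 let ?x = "%x. \<xi> (P x)" and ?y = "%x. \<eta> (P x)"
 have "te one \<xi> = te one ?x" "te one \<eta> = te one ?y" by (rule te_cong; simp)+
 then have "Dm (te one \<xi>) (te one \<eta>) = te one (cv ?x ?y)"
  using * by (simp add: Dm_te lin_dual dm_at_one)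
 also have "cv ?x ?y = cv \<xi> \<eta>" by (rule cv_cong) simp_all
 also have "te one (cv \<xi> \<eta>) = te one (mult E' \<xi> \<eta>)" by (rule te_cong) (simp add: dual_mult *)
 finally show ?thesis .
qed

text \<open>\<open>E*\<close> is a subalgebra of the double, by \<open>dm_at_one\<close>.
  Multiplicativity carries the inverse of \<open>J\<close> over to
  \<open>D \<otimes> D\<close>.\<close>

lemma embed_dual2_mult:
 assumes s: "s \<in> tens_carrier E' E'" and t: "t \<in> tens_carrier E' E'"
 shows "embed_dual2 E (mult K2 s t) = mult D2 (embed_dual2 E s) (embed_dual2 E t)"
proof -
 let ?K = "tens_space E' E'" and ?D = "tens_space ED ED"
 have bK: "bilinear_on ?K ?K ?K (mult K2)"
  using tens_alg_bilinear[OF vec_space_dual vec_space_dual dual_bilinear dual_bilinear]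
  by (subst bilinear_on_cong_space[of ?K K2 ?K K2 ?K K2]) auto
 have bD: "bilinear_on ?D ?D ?D (mult D2)"
  using algebra_bilinear[OF alg_D2] by (subst bilinear_on_cong_space[of ?D D2 ?D D2 ?D D2]) auto
 have pure: "embed_dual2 E (mult K2 (tens E' E' \<xi> \<eta>) (tens E' E' \<xi>' \<eta>')) =
   mult D2 (embed_dual2 E (tens E' E' \<xi> \<eta>)) (embed_dual2 E (tens E' E' \<xi>' \<eta>'))"
  if "\<xi> \<in> carrier E'" "\<eta> \<in> carrier E'" "\<xi>' \<in> carrier E'" "\<eta>' \<in> carrier E'" for \<xi> \<eta> \<xi>' \<eta>'
  using that tens_alg_mult[OF vec_space_dual vec_space_dual dual_bilinear dual_bilinear]
   tens_alg_mult[OF vec_space_D vec_space_D algebra_bilinear[OF alg_D] algebra_bilinear[OF alg_D]]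
  by (simp add: embed_dual2_tens Dm_te_one)
 have 1: "embed_dual2 E (mult K2 (tens E' E' \<xi> \<eta>) t) = mult D2 (embed_dual2 E (tens E' E' \<xi> \<eta>)) (embed_dual2 E t)"
  if *: "\<xi> \<in> carrier E'" "\<eta> \<in> carrier E'" for \<xi> \<eta>
 proof (rule linear_on_tens_eqI[where f = "%t. embed_dual2 E (mult K2 (tens E' E' \<xi> \<eta>) t)",
    OF _ _ vec_space_dual vec_space_dual pure[OF *] t])
  show "linear_on ?K ?D (%t. embed_dual2 E (mult K2 (tens E' E' \<xi> \<eta>) t))"
   using bK * by (intro linear_on_compose[OF _ embed_dual2_linear]) (auto simp: bilinear_on_def tens_in_carrier)
  show "linear_on ?K ?D (%t. mult D2 (embed_dual2 E (tens E' E' \<xi> \<eta>)) (embed_dual2 E t))"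
   using bD * by (intro linear_on_compose[OF embed_dual2_linear])
    (auto simp: bilinear_on_def tens_in_carrier embed_dual2_closed)
 qed
 show ?thesis
 proof (rule linear_on_tens_eqI[where f = "%s. embed_dual2 E (mult K2 s t)",
    OF _ _ vec_space_dual vec_space_dual 1 s])
  show "linear_on ?K ?D (%s. embed_dual2 E (mult K2 s t))"
   using bK t by (intro linear_on_compose[OF _ embed_dual2_linear]) (auto simp: bilinear_on_def)
  show "linear_on ?K ?D (%s. mult D2 (embed_dual2 E s) (embed_dual2 E t))"
   using bD t by (intro linear_on_compose[OF embed_dual2_linear])
    (auto simp: bilinear_on_def embed_dual2_closed)
 qed
qed

text \<open>Inverses in the associative algebra \<open>D2\<close> are unique, which resolves the
  description in \<open>twist_hopf\<close>.\<close>

lemma the_inverse_embed_dual2: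
 assumes "t \<in> tens_carrier E' E'" "inverse_in K2 t t'"
 shows "(THE K. inverse_in D2 (embed_dual2 E t) K) = embed_dual2 E t'"
  and "inverse_in D2 (embed_dual2 E t) (embed_dual2 E t')"
proof -
 have t': "t' \<in> tens_carrier E' E'" "mult K2 t t' = tens E' E' (unity E') (unity E')"
  "mult K2 t' t = tens E' E' (unity E') (unity E')"
  using assms(2) by (auto simp: inverse_in_def)
 have un: "te one (unity E') = te one eps" by (rule te_cong) (simp add: dual_unity)
 have u: "embed_dual2 E (tens E' E' (unity E') (unity E')) = unity D2"
  by (simp add: embed_dual2_tens dual_unity_closed un)
 show inv: "inverse_in D2 (embed_dual2 E t) (embed_dual2 E t')"
  using t' u embed_dual2_mult[OF assms(1) t'(1)] embed_dual2_mult[OF t'(1) assms(1)]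
  by (simp add: inverse_in_def embed_dual2_closed)
 show "(THE K. inverse_in D2 (embed_dual2 E t) K) = embed_dual2 E t'"
 proof (rule the_equality, rule inv)
  fix K assume K: "inverse_in D2 (embed_dual2 E t) K"
  let ?F = "embed_dual2 E t" and ?G = "embed_dual2 E t'"
  have c: "?F \<in> carrier D2" "?G \<in> carrier D2" "K \<in> carrier D2"
   using assms(1) t'(1) K by (simp_all add: embed_dual2_closed inverse_in_def)
  have "K = mult D2 K (mult D2 ?F ?G)"
   using inv algebra_unity_right[OF alg_D2 c(3)] by (simp add: inverse_in_def)
  also have "... = mult D2 (mult D2 K ?F) ?G" using algebra_assoc[OF alg_D2 c(3,1,2)] by simp
  also have "... = ?G" using K algebra_unity_left[OF alg_D2 c(2)] by (simp add: inverse_in_def)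
  finally show "K = ?G" .
 qed
qed

end


section \<open>The smash product\<close>

locale module_alg = fd_hopf E for E :: "('k::field, 'e::ab_group_add) hopf" +
 fixes A :: "('k, 'a::ab_group_add) alg" and act :: "'e => 'a => 'a"
 assumes modalg: "module_algebra E A act"
begin

abbreviation sA :: "'k => 'a => 'a" where "sA \<equiv> scale A"

lemma alg_A: "algebra A" using modalg by (simp add: module_algebra_def)

lemma vec_space_A [simp]: "vec_space A" using alg_A by (rule algebra_vec_space)

lemma vector_space_A [simp, lin_intros]: "vector_space sA" using vec_space_A by (rule vec_space_vector_space)

text \<open>\<open>A\<close> may have infinite dimension, so this projection is chosen, while
  \<open>P\<close> is a sum over a basis.\<close>

definition Q :: "'a => 'a" where "Q = (SOME p. lin sA sA p \<and> (\<forall>x. p x \<in> carrier A) \<and> (\<forall>x\<in>carrier A. p x = x))"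

lemma Q: "lin sA sA Q \<and> (\<forall>x. Q x \<in> carrier A) \<and> (\<forall>x\<in>carrier A. Q x = x)"
proof -
 have "module.subspace sA (carrier A)" using vec_space_A unfolding vec_space_def ..
 from someI_ex[OF ex_projection[OF vector_space_A this]] show ?thesis unfolding Q_def .
qed

lemma Q_closed [simp]: "Q x \<in> carrier A" and Q_id [simp]: "x \<in> carrier A ==> Q x = x"
 using Q by auto

lemma lin_Q [lin_intros]: "lin s sA f ==> lin s sA (%x. Q (f x))"
 using Q lin_compose by blast

lemma lin_Q_linear_on: "linear_on A V f ==> lin sA (scale V) (%x. f (Q x))"
 using Q by (simp add: lin_def linear_on_def)

definition mu :: "'a => 'a => 'a" where "mu a b = mult A (Q a) (Q b)"
definition al :: "'e => 'a => 'a" where "al w a = act (P w) (Q a)"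
definition oneA :: 'a where "oneA = unity A"

lemma mu_eq: "a \<in> carrier A ==> b \<in> carrier A ==> mult A a b = mu a b"
 and al_eq: "w \<in> carrier E ==> a \<in> carrier A ==> act w a = al w a"
 by (simp_all add: mu_def al_def)

lemma act_bilinear: "bilinear_on E A A act" using modalg by (simp add: module_algebra_def)

lemma mu_closed [simp]: "mu a b \<in> carrier A" and al_closed [simp]: "al w a \<in> carrier A"
 and oneA_closed [simp]: "oneA \<in> carrier A"
 using bilinear_on_closed[OF algebra_bilinear[OF alg_A]] bilinear_on_closed[OF act_bilinear]
  algebra_unity_closed[OF alg_A] by (simp_all add: mu_def al_def oneA_def)

lemma Q_absorb [simp]: "mu (Q a) b = mu a b" "mu a (Q b) = mu a b" "al w (Q a) = al w a" "al (P w) a = al w a"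
 by (simp_all add: mu_def al_def)

lemma mu_one [simp]: "mu oneA a = Q a" "mu a oneA = Q a"
 using algebra_unity_left[OF alg_A] algebra_unity_right[OF alg_A] oneA_closed by (simp_all add: mu_def oneA_def)

lemma mu_assoc: "mu (mu a b) c = mu a (mu b c)"
 using algebra_assoc[OF alg_A] mu_closed by (simp add: mu_def)

lemma lin_mu1 [lin_intros]: "lin s sA f ==> lin s sA (%x. mu (f x) b)"
proof (rule lin_compose[of sA sA "%x. mu x b"])
 show "lin sA sA (%x. mu x b)"
  using algebra_bilinear[OF alg_A] lin_Q_linear_on[of A "%x. mult A x (Q b)"] by (simp add: mu_def bilinear_on_def)
qed

lemma lin_mu2 [lin_intros]: "lin s sA f ==> lin s sA (%x. mu b (f x))"
proof (rule lin_compose[of sA sA "mu b"])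
 show "lin sA sA (mu b)"
  using algebra_bilinear[OF alg_A] lin_Q_linear_on[of A "mult A (Q b)"] by (simp add: mu_def[abs_def] bilinear_on_def)
qed

lemma lin_al1 [lin_intros]: "lin s sE f ==> lin s sA (%x. al (f x) a)"
proof (rule lin_compose[of sE sA "%x. al x a"])
 show "lin sE sA (%x. al x a)"
  using act_bilinear lin_P_linear_on[of A "%x. act x (Q a)"] by (simp add: al_def bilinear_on_def)
qed

lemma lin_al2 [lin_intros]: "lin s sA f ==> lin s sA (%x. al w (f x))"
proof (rule lin_compose[of sA sA "al w"])
 show "lin sA sA (al w)"
  using act_bilinear lin_Q_linear_on[of A "act (P w)"] by (simp add: al_def[abs_def] bilinear_on_def)
qed

lemma al_one [simp]: "al one a = Q a"
 using modalg by (simp add: al_def module_algebra_def flip: one_def)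

lemma al_m: "al (m v w) a = al v (al w a)"
proof -
 have "act (mult E (P v) (P w)) (Q a) = act (P v) (act (P w) (Q a))"
  using modalg P_closed Q_closed unfolding module_algebra_def by blast
 then show ?thesis by (simp add: al_def m_eq) (metis Q_id al_closed al_def)
qed

lemma al_oneA: "al w oneA = sA (eps w) oneA"
 using modalg P_closed unfolding module_algebra_def al_def oneA_def eps_def
 by (metis Q_id algebra_unity_closed)

lemma al_mu: "al w (mu a b) = sw (%w1 w2. mu (al w1 a) (al w2 b)) w"
proof -
 have "act (P w) (mult A (Q a) (Q b)) =
   lift E E (%w1 w2. mult A (act w1 (Q a)) (act w2 (Q b))) (comult E (P w))"
  using modalg P_closed Q_closed unfolding module_algebra_def by blast
 also have "... = sw (%w1 w2. mu (al w1 a) (al w2 b)) (P w)"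
  by (rule lift_comult_total[OF vector_space_A])
   (simp add: mu_eq al_eq | intro lin_intros)+
 finally show ?thesis by (simp add: al_def mu_eq)
qed

abbreviation TB :: "('k, ('k, 'a, 'e) tensor) vspace" where "TB \<equiv> tens_space A E"

definition PB :: "('k, 'a, 'e) tensor => ('k, 'a, 'e) tensor" where
 "PB = (SOME p. lin fscale fscale p \<and> (\<forall>x. p x \<in> tens_carrier A E) \<and> (\<forall>x\<in>tens_carrier A E. p x = x))"

lemma PB: "lin fscale fscale PB \<and> (\<forall>x. PB x \<in> tens_carrier A E) \<and> (\<forall>x\<in>tens_carrier A E. PB x = x)"
proof -
 have "module.subspace fscale (tens_carrier A E)"
  using vec_space_tens[of A E] unfolding vec_space_def by simp
 from someI_ex[OF ex_projection[OF vs_fscale this]] show ?thesis unfolding PB_def .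
qed

lemma PB_closed [simp]: "PB x \<in> tens_carrier A E" and PB_id [simp]: "x \<in> tens_carrier A E ==> PB x = x"
 using PB by auto

lemma lin_PB [lin_intros]: "lin s fscale f ==> lin s fscale (%x. PB (f x))"
 using PB lin_compose by blast

definition tt :: "'a => 'e => ('k, 'a, 'e) tensor" where "tt a w = tens A E (Q a) (P w)"

lemma tt_closed [simp]: "tt a w \<in> tens_carrier A E"
 unfolding tt_def by (intro tens_in_carrier) auto

lemma tt_absorb [simp]: "tt (Q a) w = tt a w" "tt a (P w) = tt a w"
 by (simp_all add: tt_def)

lemma lin_tt1 [lin_intros]: "lin s sA f ==> lin s fscale (%x. tt (f x) w)"
proof (rule lin_compose[of sA fscale "%a. tt a w"])
 show "lin sA fscale (%a. tt a w)"
  using tens_amb_bilinear[of A E] lin_Q_linear_on[of "amb fscale" "%x. tens A E x (P w)"]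
  by (simp add: tt_def bilinear_on_def)
qed

lemma lin_tt2 [lin_intros]: "lin s sE f ==> lin s fscale (%x. tt a (f x))"
proof (rule lin_compose[of sE fscale "tt a"])
 show "lin sE fscale (tt a)"
  using tens_amb_bilinear[of A E] lin_P_linear_on[of "amb fscale" "tens A E (Q a)"]
  by (simp add: tt_def[abs_def] bilinear_on_def)
qed

text \<open>The coefficient in \<open>A\<close> of the basis element \<open>e\<close>, as in
  \<open>b = (\<Sum>e\<in>bas. co e b \<otimes> e)\<close>. It has the role that \<open>R\<close>
  has for the coproduct.\<close>

definition co :: "'e => ('k, 'a, 'e) tensor => 'a" where
 "co e b = lift A E (%a w. sA (cf e w) a) (PB b)"

lemma lin_co [lin_intros]: "lin s fscale f ==> lin s sA (%x. co e (f x))"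
proof (rule lin_compose[of fscale sA "co e"])
 have "linear_on TB A (lift A E (%a w. sA (cf e w) a))"
  by (intro lift_linear bilinear_cf) auto
 then show "lin fscale sA (co e)"
  using PB by (simp add: co_def[abs_def] lin_def linear_on_def)
qed

lemma co_PB [simp]: "co e (PB b) = co e b"
 by (simp add: co_def)

text \<open>The analogue of \<open>sw\<close> for \<open>A \<otimes> E\<close>: the terms
  \<open>\<phi> a w\<close> are summed over the parts \<open>a \<otimes> w\<close> of
  \<open>b\<close>.\<close>

definition lf :: "('a => 'e => 'u::ab_group_add) => ('k, 'a, 'e) tensor => 'u" where
 "lf \<phi> b = (\<Sum>e\<in>bas. \<phi> (co e b) e)"

lemma lf_PB [simp]: "lf \<phi> (PB b) = lf \<phi> b"
 by (simp add: lf_def)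

lemma lin_lf_arg [lin_intros]:
 "vector_space u ==> (\<And>y. lin sA u (%x. \<phi> x y)) ==> lin s fscale f ==> lin s u (%x. lf \<phi> (f x))"
 unfolding lf_def by (rule lin_sum_fun, assumption, rule lin_compose[OF _ lin_co]) auto

lemma lin_lf_fun [lin_intros]:
 "vector_space u ==> (\<And>y z. lin s u (%x. \<phi> x y z)) ==> lin s u (%x. lf (\<phi> x) c)"
 unfolding lf_def by (intro lin_sum_fun)

lemma lin_of_lf: "lin t u f ==> f (lf \<phi> z) = lf (%x y. f (\<phi> x y)) z"
 unfolding lf_def by (rule lin_sum)

lemma lf_swap: "lf (%x y. lf (%x' y'. \<phi> x y x' y') w) z = lf (%x' y'. lf (%x y. \<phi> x y x' y') z) w"
 unfolding lf_def by (rule sum.swap)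

lemma lf_sw_swap: "lf (%x y. sw (%x' y'. \<phi> x y x' y') w) z = sw (%x' y'. lf (%x y. \<phi> x y x' y') z) w"
 unfolding lf_def sw_def by (rule sum.swap)

lemma lift_lf:
 assumes "vector_space u" "\<And>a w. a \<in> carrier A ==> w \<in> carrier E ==> \<phi> a w = \<psi> a w"
  and "\<And>w. lin sA u (%a. \<psi> a w)" "\<And>a. lin sE u (\<psi> a)" "b \<in> tens_carrier A E"
 shows "lift A E \<phi> b = lf \<psi> b"
proof -
 have "lift A E \<phi> b = lift A E \<psi> b" by (rule lift_cong) (rule assms(2))
 then show ?thesis
  using lift_basis[OF vec_space_A assms(5,1) bilinear_on_lin[of A u \<psi> E]] assms(3-5) by (simp add: lf_def co_def)
qed

lemma lf_tt:
 assumes "vector_space u" "\<And>w. lin sA u (%a. \<psi> a w)" "\<And>a. lin sE u (\<psi> a)"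
 shows "lf \<psi> (tt a w) = \<psi> (Q a) (P w)"
 using lift_lf[OF assms(1) refl assms(2,3) tt_closed, of a w]
  lift_tens[OF assms(1) bilinear_on_lin[of A u \<psi> E]] assms(2,3) by (simp add: tt_def)

lemma tt_eqI:
 assumes f: "lin fscale u f" and g: "lin fscale u g" and eq: "\<And>a w. f (tt a w) = g (tt a w)"
 shows "f (PB b) = g (PB b)"
proof (rule linear_on_tens_eqI[OF _ _ vec_space_A vec_space_E _ PB_closed])
 show "linear_on TB (amb u) f" "linear_on TB (amb u) g"
  using f g by (auto simp: lin_def linear_on_def)
 show "f (tens A E v w) = g (tens A E v w)" if "v \<in> carrier A" "w \<in> carrier E" for v w
  using eq[of v w] that by (simp add: tt_def)
qed

section \<open>The smash product as an algebra\<close>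

definition mB :: "('k, 'a, 'e) tensor => ('k, 'a, 'e) tensor => ('k, 'a, 'e) tensor" where
 "mB s t = lf (%a w. lf (%a' w'. sw (%w1 w2. tt (mu a (al w1 a')) (m w2 w')) w) t) s"

definition B where "B = smash E A act"

lemma B_simps [simp]: "carrier B = tens_carrier A E" "scale B = fscale" "unity B = tt oneA one"
 by (simp_all add: B_def smash_def tt_def oneA_def one_def algebra_unity_closed[OF alg_A] algebra_unity_closed[OF alg_E])

lemma mB_eq:
 assumes "s \<in> tens_carrier A E" "t \<in> tens_carrier A E"
 shows "mult B s t = mB s t"
proof -
 have "mult B s t = lift A E (%a w. lift A E (%a' w'. lift E E (%w1 w2.
    tens A E (mult A a (act w1 a')) (mult E w2 w')) (comult E w)) t) s"
  by (simp add: B_def smash_def)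
 also have "... = mB s t"
  unfolding mB_def
 proof (rule lift_lf[OF vs_fscale])
  fix a w assume aw: "a \<in> carrier A" "w \<in> carrier E"
  show "lift A E (%a' w'. lift E E (%w1 w2.
    tens A E (mult A a (act w1 a')) (mult E w2 w')) (comult E w)) t =
   lf (%a' w'. sw (%w1 w2. tt (mu a (al w1 a')) (m w2 w')) w) t"
  proof (rule lift_lf[OF vs_fscale])
   fix a' w' assume aw': "a' \<in> carrier A" "w' \<in> carrier E"
   show "lift E E (%w1 w2. tens A E (mult A a (act w1 a')) (mult E w2 w')) (comult E w) =
    sw (%w1 w2. tt (mu a (al w1 a')) (m w2 w')) w"
   proof (rule lift_comult_total[OF vs_fscale])
    show "tens A E (mult A a (act x a')) (mult E y w') = tt (mu a (al x a')) (m y w')"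
     if "x \<in> carrier E" "y \<in> carrier E" for x y
     using that aw aw' by (simp add: tt_def mu_eq al_eq m_eq)
   qed (intro lin_intros aw)+
  qed (intro lin_intros assms)+
 qed (intro lin_intros assms)+
 finally show ?thesis .
qed

lemma mB_closed [simp]: "mB s t \<in> tens_carrier A E"
 unfolding mB_def lf_def sw_def by (intro tens_carrier_sum tt_closed)

lemma mB_PB [simp]: "mB (PB s) t = mB s t" "mB s (PB t) = mB s t"
 by (simp_all add: mB_def)

lemma lin_mB1 [lin_intros]: "lin s fscale f ==> lin s fscale (%x. mB (f x) b)"
 and lin_mB2 [lin_intros]: "lin s fscale f ==> lin s fscale (%x. mB b (f x))"
 unfolding mB_def by (intro lin_intros; assumption)+

lemma mB_tt: "mB (tt a w) (tt a' w') = sw (%w1 w2. tt (mu a (al w1 a')) (m w2 w')) w"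
proof -
 have "mB (tt a w) (tt a' w') = lf (%a' w'. sw (%w1 w2. tt (mu (Q a) (al w1 a')) (m w2 w')) (P w)) (tt a' w')"
  unfolding mB_def by (rule lf_tt[OF vs_fscale]) (intro lin_intros)+
 also have "... = sw (%w1 w2. tt (mu (Q a) (al w1 (Q a'))) (m w2 (P w'))) (P w)"
  by (rule lf_tt[OF vs_fscale]) (intro lin_intros)+
 finally show ?thesis by simp
qed

text \<open>Multiplicativity of the coproduct expands the left side, the module algebra law the
  right side, and coassociativity at \<open>w\<close> matches the sums.\<close>

lemma mB_assoc_tt: "mB (mB (tt a w) (tt a' w')) (tt a'' w'') = mB (tt a w) (mB (tt a' w') (tt a'' w''))"
proof -
 let ?F = "%p q r x y. tt (mu a (mu (al p a') (al (m q x) a''))) (m r (m y w''))"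
 have "mB (mB (tt a w) (tt a' w')) (tt a'' w'') =
   sw (%p t. sw (%q r. sw (%x y. ?F p q r x y) w') t) w"
 proof -
  have "sw (%s z. tt (mu (mu a (al p a')) (al s a'')) (m z w'')) (m t w') =
    sw (%q r. sw (%x y. tt (mu (mu a (al p a')) (al (m q x) a'')) (m (m r y) w'')) w') t" for p t
   by (rule sw_m[OF vs_fscale]) (intro lin_intros)+
  then show ?thesis
   by (simp add: mB_tt lin_of_sw[OF lin_mB1[OF lin_ident]] mu_assoc m_assoc)
 qed
 also have "... = sw (%u r. sw (%p q. sw (%x y. ?F p q r x y) w') u) w"
  by (rule sw_coassoc[symmetric, OF vs_fscale]) (intro lin_intros)+
 also have "... = sw (%u r. sw (%x y. sw (%p q. ?F p q r x y) u) w') w"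
  by (subst sw_swap) simp
 also have "... = sw (%x y. sw (%u r. sw (%p q. ?F p q r x y) u) w) w'"
  by (rule sw_swap)
 also have "... = mB (tt a w) (mB (tt a' w') (tt a'' w''))"
 proof -
  have "sw (%p q. ?F p q r x y) u = tt (mu a (al u (mu a' (al x a'')))) (m r (m y w''))" for r u x y
   by (simp add: al_mu al_m lin_of_sw[OF lin_mu2[OF lin_ident]] lin_of_sw[OF lin_tt1[OF lin_ident]])
  then show ?thesis
   by (simp add: mB_tt lin_of_sw[OF lin_mB2[OF lin_ident]])
 qed
 finally show ?thesis .
qed

lemma mB_assoc: "mB (mB s t) r = mB s (mB t r)"
proof -
 have "mB (mB (tt a w) (tt a' w')) (PB r) = mB (tt a w) (mB (tt a' w') (PB r))" for a w a' w' r
  by (rule tt_eqI[where u = fscale and f = "mB (mB (tt a w) (tt a' w'))" and g = "%r. mB (tt a w) (mB (tt a' w') r)"])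
   (intro lin_intros mB_assoc_tt)+
 then have 1: "mB (mB (tt a w) (tt a' w')) r = mB (tt a w) (mB (tt a' w') r)" for a w a' w' r by simp
 have "mB (mB (tt a w) (PB t)) r = mB (tt a w) (mB (PB t) r)" for a w t r
  by (rule tt_eqI[where u = fscale and f = "%t. mB (mB (tt a w) t) r" and g = "%t. mB (tt a w) (mB t r)"])
   (intro lin_intros 1)+
 then have 2: "mB (mB (tt a w) t) r = mB (tt a w) (mB t r)" for a w t r by simp
 have "mB (mB (PB s) t) r = mB (PB s) (mB t r)"
  by (rule tt_eqI[where u = fscale and f = "%s. mB (mB s t) r" and g = "%s. mB s (mB t r)"])
   (intro lin_intros 2)+
 then show ?thesis by simp
qed

definition ii :: "'a => ('k, 'a, 'e) tensor" where "ii a = tt a one"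
definition jj :: "'e => ('k, 'a, 'e) tensor" where "jj w = tt oneA w"
abbreviation oneB where "oneB \<equiv> tt oneA one"

lemma ii_closed [simp]: "ii a \<in> tens_carrier A E" and jj_closed [simp]: "jj w \<in> tens_carrier A E"
 by (simp_all add: ii_def jj_def)

lemma ii_Q [simp]: "ii (Q a) = ii a" and jj_P [simp]: "jj (P w) = jj w"
 by (simp_all add: ii_def jj_def)

lemma incl_A_eq: "a \<in> carrier A ==> incl_A E A a = ii a"
 by (simp add: incl_A_def ii_def tt_def one_def algebra_unity_closed[OF alg_E])

lemma incl_E_eq: "w \<in> carrier E ==> incl_E E A w = jj w"
 by (simp add: incl_E_def jj_def tt_def oneA_def algebra_unity_closed[OF alg_A])

lemma lin_ii [lin_intros]: "lin s sA f ==> lin s fscale (%x. ii (f x))"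
 unfolding ii_def by (intro lin_intros)

lemma lin_jj [lin_intros]: "lin s sE f ==> lin s fscale (%x. jj (f x))"
 unfolding jj_def by (intro lin_intros)

lemma ii_ii: "mB (ii a) (ii b) = ii (mu a b)"
proof -
 have "mB (ii a) (ii b) = tt (mu a (al one b)) (m one one)"
  unfolding ii_def mB_tt by (rule sw_one[OF vs_fscale]) (intro lin_intros)+
 then show ?thesis by (simp add: ii_def)
qed

lemma ii_tt: "mB (ii a) (tt b w) = tt (mu a b) w"
proof -
 have "mB (ii a) (tt b w) = tt (mu a (al one b)) (m one w)"
  unfolding ii_def mB_tt by (rule sw_one[OF vs_fscale]) (intro lin_intros)+
 then show ?thesis by simp
qed

lemma ii_jj: "mB (ii a) (jj w) = tt a w"
 by (simp add: jj_def ii_tt)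

lemma tt_jj: "mB (tt a v) (jj w) = tt a (m v w)"
proof -
 have "mB (tt a v) (jj w) = sw (%v1 v2. fscale (eps v1) (tt a (m v2 w))) v"
  unfolding jj_def mB_tt
  by (simp add: al_oneA lin_scale[OF lin_mu2[OF lin_ident]] lin_scale[OF lin_tt1[OF lin_ident]])
 also have "... = tt a (m (P v) w)" by (rule sw_counit_left) (intro lin_intros)
 finally show ?thesis by simp
qed

lemma jj_jj: "mB (jj v) (jj w) = jj (m v w)"
 unfolding jj_def using tt_jj[of oneA v w] by (simp add: jj_def)

text \<open>The commutation relation of the smash product, by which elements of \<open>E\<close>
  move to the right of elements of \<open>A\<close>.\<close>

lemma jj_ii: "mB (jj w) (ii a) = sw (%w1 w2. mB (ii (al w1 a)) (jj w2)) w"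
 unfolding ii_jj by (simp add: jj_def ii_def mB_tt)

lemma jj_one: "jj one = oneB" and ii_one: "ii oneA = oneB"
 by (simp_all add: jj_def ii_def)

lemma oneB_left [simp]: "mB oneB b = PB b"
proof -
 have "mB oneB (PB b) = PB b"
  by (rule tt_eqI[where f = "mB oneB" and g = "%b. b" and u = fscale])
   (intro lin_intros, intro lin_intros, simp add: ii_tt flip: ii_one)
 then show ?thesis by simp
qed

lemma oneB_right [simp]: "mB b oneB = PB b"
proof -
 have "mB (PB b) oneB = PB b"
  by (rule tt_eqI[where f = "%b. mB b oneB" and g = "%b. b" and u = fscale])
   (intro lin_intros, intro lin_intros, simp add: tt_jj flip: jj_one)
 then show ?thesis by simp
qed

lemma mB_bilinear: "bilinear_on B B B (mult B)"
 unfolding bilinear_on_def linear_on_def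
 by (simp add: mB_eq tens_carrier_add tens_carrier_scale lin_add[OF lin_mB1[OF lin_ident]] lin_add[OF lin_mB2[OF lin_ident]]
  lin_scale[OF lin_mB1[OF lin_ident]] lin_scale[OF lin_mB2[OF lin_ident]])

lemma vec_space_B [simp]: "vec_space B"
 using vec_space_tens[of A E] by (simp add: vec_space_def)

lemma alg_B: "algebra B"
 unfolding algebra_def using mB_bilinear by (simp add: mB_eq mB_assoc)

subsection \<open>The coaction\<close>

text \<open>\<open>swB \<psi> b\<close> is \<open>\<psi> b0 b1\<close>.\<close>

definition swB :: "(('k, 'a, 'e) tensor => 'e => 'u::ab_group_add) => ('k, 'a, 'e) tensor => 'u" where
 "swB \<psi> b = lf (%a w. sw (%w1 w2. \<psi> (tt a w1) w2) w) b"

lemma swB_PB [simp]: "swB \<psi> (PB b) = swB \<psi> b"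
 by (simp add: swB_def)

lemma swB_cong: "(\<And>x y. x \<in> tens_carrier A E ==> y \<in> carrier E ==> \<phi> x y = \<psi> x y) ==> swB \<phi> b = swB \<psi> b"
 unfolding swB_def lf_def by (intro sum.cong refl sw_cong) auto

lemma lin_swB_arg [lin_intros]:
 "vector_space u ==> (\<And>y. lin fscale u (%x. \<psi> x y)) ==> lin s fscale f ==> lin s u (%x. swB \<psi> (f x))"
 unfolding swB_def
 by (rule lin_lf_arg, assumption, rule lin_sw_fun, assumption, rule lin_compose[of fscale u "%x. \<psi> x _"])
  (auto intro!: lin_intros)

lemma lin_swB_fun [lin_intros]:
 "vector_space u ==> (\<And>y z. lin s u (%x. \<psi> x y z)) ==> lin s u (%x. swB (\<psi> x) c)"
 unfolding swB_def by (rule lin_lf_fun, assumption, rule lin_sw_fun)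

lemma lin_of_swB: "lin t u f ==> f (swB \<psi> z) = swB (%x y. f (\<psi> x y)) z"
 unfolding swB_def by (simp add: lin_of_lf lin_of_sw)

lemma swB_sw_swap: "swB (%x y. sw (%x' y'. \<phi> x y x' y') w) z = sw (%x' y'. swB (%x y. \<phi> x y x' y') z) w"
proof -
 have "swB (%x y. sw (%x' y'. \<phi> x y x' y') w) z =
   lf (%a v. sw (%x' y'. sw (%x y. \<phi> (tt a x) y x' y') v) w) z"
  unfolding swB_def by (intro arg_cong[where f = "%F. lf F z"] ext) (rule sw_swap)
 then show ?thesis unfolding swB_def by (simp only: lf_sw_swap)
qed

lemma swB_lf_swap: "swB (%x y. lf (%x' y'. \<phi> x y x' y') w) z = lf (%x' y'. swB (%x y. \<phi> x y x' y') z) w"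
proof -
 have "swB (%x y. lf (%x' y'. \<phi> x y x' y') w) z =
   lf (%a v. lf (%x' y'. sw (%x y. \<phi> (tt a x) y x' y') v) w) z"
  unfolding swB_def by (simp only: lf_sw_swap)
 also have "... = lf (%x' y'. swB (%x y. \<phi> x y x' y') z) w"
  unfolding swB_def by (rule lf_swap)
 finally show ?thesis .
qed

lemma swB_swap: "swB (%x y. swB (%x' y'. \<phi> x y x' y') w) z = swB (%x' y'. swB (%x y. \<phi> x y x' y') z) w"
 unfolding swB_def[of _ w] by (simp only: swB_lf_swap swB_sw_swap)

lemma swB_tt:
 assumes u: "vector_space u" and l: "\<And>y. lin fscale u (%x. \<psi> x y)" "\<And>x. lin sE u (\<psi> x)"
 shows "swB \<psi> (tt a w) = sw (%w1 w2. \<psi> (tt a w1) w2) w"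
proof -
 have "swB \<psi> (tt a w) = sw (%w1 w2. \<psi> (tt (Q a) w1) w2) (P w)"
  unfolding swB_def by (rule lf_tt[OF u]) (intro lin_intros u lin_compose[OF l(1)] l(2))+
 then show ?thesis by simp
qed

text \<open>Elements of \<open>A\<close> are coinvariant. With the counit conditions on
  \<open>J\<close>, this is why twisting leaves products with them unchanged.\<close>

lemma swB_ii:
 assumes u: "vector_space u" and l: "\<And>y. lin fscale u (%x. \<psi> x y)" "\<And>x. lin sE u (\<psi> x)"
 shows "swB \<psi> (ii a) = \<psi> (ii a) one"
proof -
 have "swB \<psi> (ii a) = sw (%w1 w2. \<psi> (tt a w1) w2) one"
  unfolding ii_def by (rule swB_tt[OF assms])
 also have "... = \<psi> (tt a one) one" by (rule sw_one[OF u]) (intro lin_intros lin_compose[OF l(1)] l(2))+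
 finally show ?thesis by (simp add: ii_def)
qed

lemma swB_jj:
 assumes u: "vector_space u" and l: "\<And>y. lin fscale u (%x. \<psi> x y)" "\<And>x. lin sE u (\<psi> x)"
 shows "swB \<psi> (jj w) = sw (%w1 w2. \<psi> (jj w1) w2) w"
 unfolding jj_def by (rule swB_tt[OF assms])

text \<open>\<open>B\<close> is a comodule algebra: the coaction is the coproduct on the
  \<open>E\<close> part, and this is multiplicative.\<close>

lemma swB_mB:
 assumes u: "vector_space u" and l: "\<And>y. lin fscale u (%x. \<psi> x y)" "\<And>x. lin sE u (\<psi> x)"
 shows "swB \<psi> (mB b c) = swB (%b0 b1. swB (%c0 c1. \<psi> (mB b0 c0) (m b1 c1)) c) b"
proof -
 note ll = lin_intros u lin_compose[OF l(1)] lin_compose[OF l(2)] l(2)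
 have pure: "swB \<psi> (mB (tt a w) (tt a' w')) =
   swB (%b0 b1. swB (%c0 c1. \<psi> (mB b0 c0) (m b1 c1)) (tt a' w')) (tt a w)" for a w a' w'
 proof -
  let ?F = "%p q r x y. \<psi> (tt (mu a (al p a')) (m q x)) (m r y)"
  have "swB \<psi> (mB (tt a w) (tt a' w')) = sw (%p t. sw (%q r. sw (%x y. ?F p q r x y) w') t) w"
  proof -
   have "swB \<psi> (tt c (m t w')) = sw (%q r. sw (%x y. \<psi> (tt c (m q x)) (m r y)) w') t" for c t
    unfolding swB_tt[OF assms] by (rule sw_m[OF u]) (intro ll)+
   then show ?thesis unfolding mB_tt by (simp add: lin_of_sw[OF lin_swB_arg[OF u l(1) lin_ident]])
  qed
  also have "... = sw (%z r. sw (%p q. sw (%x y. ?F p q r x y) w') z) w"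
   by (rule sw_coassoc[symmetric, OF u]) (intro ll)+
  also have "... = sw (%z r. sw (%x y. \<psi> (mB (tt a z) (tt a' x)) (m r y)) w') w"
   unfolding mB_tt by (subst sw_swap) (simp add: lin_of_sw[OF l(1)])
  also have "... = sw (%z r. swB (%c0 c1. \<psi> (mB (tt a z) c0) (m r c1)) (tt a' w')) w"
   by (subst swB_tt[OF u]) (intro ll refl)+
  also have "... = swB (%b0 b1. swB (%c0 c1. \<psi> (mB b0 c0) (m b1 c1)) (tt a' w')) (tt a w)"
   by (rule swB_tt[OF u, symmetric]) (intro ll)+
  finally show ?thesis .
 qed
 have "swB \<psi> (mB (tt a w) (PB c)) =
   swB (%b0 b1. swB (%c0 c1. \<psi> (mB b0 c0) (m b1 c1)) (PB c)) (tt a w)" for a w c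
  by (rule tt_eqI[where u = u and f = "%c. swB \<psi> (mB (tt a w) c)"
     and g = "%c. swB (%b0 b1. swB (%c0 c1. \<psi> (mB b0 c0) (m b1 c1)) c) (tt a w)"])
   (intro ll, intro ll, rule pure)
 then have 1: "swB \<psi> (mB (tt a w) c) =
   swB (%b0 b1. swB (%c0 c1. \<psi> (mB b0 c0) (m b1 c1)) c) (tt a w)" for a w c
  by simp
 have "swB \<psi> (mB (PB b) c) =
   swB (%b0 b1. swB (%c0 c1. \<psi> (mB b0 c0) (m b1 c1)) c) (PB b)"
  by (rule tt_eqI[where u = u and f = "%b. swB \<psi> (mB b c)"
     and g = "%b. swB (%b0 b1. swB (%c0 c1. \<psi> (mB b0 c0) (m b1 c1)) c) b"])
   (intro ll, intro ll, rule 1)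
 then show ?thesis by simp
qed

lemma swB_coassoc:
 assumes u: "vector_space u" and l: "\<And>y z. lin fscale u (%x. \<phi> x y z)" "\<And>x z. lin sE u (%y. \<phi> x y z)"
  "\<And>x y. lin sE u (%z. \<phi> x y z)"
 shows "swB (%b z. swB (%x y. \<phi> x y z) b) c = swB (%x b. sw (%y z. \<phi> x y z) b) c"
proof -
 note ll = lin_intros u lin_compose[OF l(1)] lin_compose[OF l(2)] lin_compose[OF l(3)] l
 have "swB (%b z. swB (%x y. \<phi> x y z) b) (tt a w) = swB (%x b. sw (%y z. \<phi> x y z) b) (tt a w)" for a w
 proof -
  have "swB (%b z. swB (%x y. \<phi> x y z) b) (tt a w) = sw (%b z. swB (%x y. \<phi> x y z) (tt a b)) w"
   by (rule swB_tt[OF u]) (intro ll)+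
  also have "... = sw (%b z. sw (%x y. \<phi> (tt a x) y z) b) w"
   by (subst swB_tt[OF u]) (intro ll refl)+
  also have "... = sw (%x b. sw (%y z. \<phi> (tt a x) y z) b) w"
   by (rule sw_coassoc[OF u]) (intro ll)+
  also have "... = swB (%x b. sw (%y z. \<phi> x y z) b) (tt a w)"
   by (rule swB_tt[OF u, symmetric]) (intro ll)+
  finally show ?thesis .
 qed
 then have "swB (%b z. swB (%x y. \<phi> x y z) b) (PB c) = swB (%x b. sw (%y z. \<phi> x y z) b) (PB c)"
  by (rule tt_eqI[where u = u and f = "swB (%b z. swB (%x y. \<phi> x y z) b)"
     and g = "swB (%x b. sw (%y z. \<phi> x y z) b)", rotated 2]) (intro ll)+
 then show ?thesis by simp
qed

lemma swB_counit:
 assumes u: "vector_space u" and f: "lin fscale u f"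
 shows "swB (%x y. u (eps y) (f x)) b = f (PB b)"
proof -
 note ll = lin_intros u lin_compose[OF f]
 have "swB (%x y. u (eps y) (f x)) (tt a w) = f (tt a w)" for a w
 proof -
  have "swB (%x y. u (eps y) (f x)) (tt a w) = sw (%x y. u (eps y) (f (tt a x))) w"
   by (rule swB_tt[OF u]) (intro ll)+
  also have "... = f (tt a (P w))" by (rule sw_counit_right) (intro ll)
  finally show ?thesis by simp
 qed
 then have "swB (%x y. u (eps y) (f x)) (PB b) = f (PB b)"
  by (rule tt_eqI[where u = u and f = "swB (%x y. u (eps y) (f x))" and g = f, rotated 2]) (intro ll f)+
 then show ?thesis by simp
qed

end


lemma linear_on_sum_fun:
 assumes "vec_space W" "\<And>i. i \<in> I ==> linear_on V W (f i)"
 shows "linear_on V W (%x. \<Sum>i\<in>I. f i x)"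
 using assms(2) unfolding linear_on_def
 by (simp add: vec_space_sum_closed[OF assms(1)] sum.distrib vector_space_sum[OF vec_space_vector_space[OF assms(1)]])

lemma vec_space_amb: "vector_space u ==> vec_space (amb u)"
 by (rule vec_spaceI) simp_all

context module_alg
begin

text \<open>The action of \<open>\<xi>\<close> on \<open>B\<close> as an element of the
  double.\<close>

definition tri :: "('e => 'k) => ('k, 'a, 'e) tensor => ('k, 'a, 'e) tensor" where
 "tri \<xi> b = swB (%x y. fscale (\<xi> y) x) b"

lemma tri_cong: "(\<And>x. x \<in> carrier E ==> \<xi> x = \<eta> x) ==> tri \<xi> = tri \<eta>"
 unfolding tri_def by (intro ext swB_cong) simp

lemma lin_tri [lin_intros]: "lin s fscale f ==> lin s fscale (%x. tri \<xi> (f x))"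
 unfolding tri_def by (intro lin_intros)

lemma lin_tri_fun [lin_intros]: "(\<And>y. lin s (*) (%x. F x y)) ==> lin s fscale (%x. tri (F x) b)"
 unfolding tri_def by (intro lin_intros)

lemma tri_PB [simp]: "tri \<xi> (PB b) = tri \<xi> b"
 by (simp add: tri_def)

lemma tri_closed [simp]: "tri \<xi> b \<in> tens_carrier A E"
 unfolding tri_def swB_def lf_def sw_def by (intro tens_carrier_sum tens_carrier_scale tt_closed)

text \<open>Coinvariance of \<open>A\<close> makes the action of \<open>E*\<close> linear over
  \<open>A\<close> on both sides. The equivariance of the Hochschild differential rests on
  this.\<close>

lemma tri_ii_left: "lin sE (*) \<xi> ==> tri \<xi> (mB (ii a) b) = mB (ii a) (tri \<xi> b)"
 and tri_ii_right: "lin sE (*) \<xi> ==> tri \<xi> (mB b (ii a)) = mB (tri \<xi> b) (ii a)"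
proof -
 assume xi: "lin sE (*) \<xi>"
 note l = lin_intros lin_compose[OF xi]
 have "tri \<xi> (mB (ii a) b) = swB (%x y. swB (%x' y'. fscale (\<xi> (m y y')) (mB x x')) b) (ii a)"
  unfolding tri_def by (rule swB_mB[OF vs_fscale]) (intro l xi)+
 also have "... = swB (%x' y'. fscale (\<xi> (m one y')) (mB (ii a) x')) b"
  by (rule swB_ii[OF vs_fscale]) (intro l)+
 also have "... = swB (%x' y'. mB (ii a) (fscale (\<xi> y') x')) b"
  by (rule swB_cong) (simp add: lin_scale[OF lin_mB2[OF lin_ident]])
 finally show "tri \<xi> (mB (ii a) b) = mB (ii a) (tri \<xi> b)"
  unfolding tri_def by (simp add: lin_of_swB[OF lin_mB2[OF lin_ident]])
 have "tri \<xi> (mB b (ii a)) = swB (%x y. swB (%x' y'. fscale (\<xi> (m y y')) (mB x x')) (ii a)) b"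
  unfolding tri_def by (rule swB_mB[OF vs_fscale]) (intro l xi)+
 also have "... = swB (%x y. fscale (\<xi> (m y one)) (mB x (ii a))) b"
  by (subst swB_ii[OF vs_fscale]) (intro l refl)+
 also have "... = swB (%x y. mB (fscale (\<xi> y) x) (ii a)) b"
  by (rule swB_cong) (simp add: lin_scale[OF lin_mB1[OF lin_ident]])
 finally show "tri \<xi> (mB b (ii a)) = mB (tri \<xi> b) (ii a)"
  unfolding tri_def by (simp add: lin_of_swB[OF lin_mB1[OF lin_ident]])
qed

lemma tri_ii:
 assumes "lin sE (*) \<xi>" shows "tri \<xi> (ii a) = fscale (\<xi> one) (ii a)"
 unfolding tri_def by (rule swB_ii[OF vs_fscale]) (intro lin_intros lin_compose[OF assms] assms)+

lemma tri_tri: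
 assumes xi: "lin sE (*) \<xi>" and eta: "lin sE (*) \<eta>"
 shows "tri \<xi> (tri \<eta> b) = tri (cv \<xi> \<eta>) b"
proof -
 note l = lin_intros lin_compose[OF xi] lin_compose[OF eta] xi eta
 have "tri \<xi> (tri \<eta> b) = swB (%c z. swB (%x y. fscale (\<eta> z) (fscale (\<xi> y) x)) c) b"
 proof -
  have "tri \<xi> (tri \<eta> b) = swB (%c z. fscale (\<eta> z) (tri \<xi> c)) b"
   unfolding tri_def[of \<eta>] by (simp add: lin_of_swB[OF lin_tri[OF lin_ident]] lin_scale[OF lin_tri[OF lin_ident]])
  then show ?thesis
   by (simp add: tri_def lin_of_swB[OF lin_scale_right[OF vs_fscale lin_ident]])
 qed
 also have "... = swB (%x b. sw (%y z. fscale (\<eta> z) (fscale (\<xi> y) x)) b) b"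
  by (rule swB_coassoc[OF vs_fscale]) (intro l)+
 also have "... = tri (cv \<xi> \<eta>) b"
 proof -
  have "sw (%y z. fscale (\<eta> z) (fscale (\<xi> y) x)) c = fscale (cv \<xi> \<eta> c) x"
   for x :: "('k, 'a, 'e) tensor" and c
   unfolding cv_def
   by (simp add: vector_space_mult[OF vs_fscale] mult.commute
     lin_of_sw[OF lin_scale_left[OF vs_fscale lin_ident]])
  then show ?thesis unfolding tri_def by (intro swB_cong) simp
 qed
 finally show ?thesis .
qed

lemma tri_eps: "tri eps b = PB b"
 unfolding tri_def by (rule swB_counit[OF vs_fscale]) (intro lin_intros)

lemma sw_sum: "sw (%x y. \<Sum>i\<in>I. F i x y) z = (\<Sum>i\<in>I. sw (F i) z)"
 unfolding sw_def by (rule sum.swap)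

lemma swB_sum: "swB (%x y. \<Sum>i\<in>I. F i x y) z = (\<Sum>i\<in>I. swB (F i) z)"
 unfolding swB_def sw_sum unfolding lf_def by (rule sum.swap)

text \<open>The coproduct of \<open>\<xi>\<close> is \<open>\<Sum>e. rsh \<xi> e \<otimes> cf e\<close>.\<close>

lemma tri_mB:
 assumes "lin sE (*) \<xi>"
 shows "tri \<xi> (mB b c) = (\<Sum>e\<in>bas. mB (tri (rsh \<xi> e) b) (tri (cf e) c))"
proof -
 note l = lin_intros lin_compose[OF assms]
 have xim: "\<xi> (m y y') = (\<Sum>e\<in>bas. rsh \<xi> e y * cf e y')" for y y'
 proof -
  have "\<xi> (m y (P y')) = (\<Sum>e\<in>bas. rsh \<xi> e y * cf e y')"
   unfolding P_def rsh_def lin_sum[OF lin_compose[OF assms lin_m2[OF lin_ident]]]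
    lin_scale[OF lin_compose[OF assms lin_m2[OF lin_ident]]] by (simp add: mult.commute)
  then show ?thesis by simp
 qed
 have "tri \<xi> (mB b c) = swB (%x y. swB (%x' y'. fscale (\<xi> (m y y')) (mB x x')) c) b"
  unfolding tri_def by (rule swB_mB[OF vs_fscale]) (intro l assms)+
 also have "... = swB (%x y. swB (%x' y'. \<Sum>e\<in>bas. mB (fscale (rsh \<xi> e y) x) (fscale (cf e y') x')) c) b"
  unfolding xim
  by (simp add: lin_scale[OF lin_mB1[OF lin_ident]] lin_scale[OF lin_mB2[OF lin_ident]]
   vector_space_mult[OF vs_fscale] lin_sum[OF lin_scale_left[OF vs_fscale lin_ident]] mult.commute)
 also have "... = (\<Sum>e\<in>bas. swB (%x y. swB (%x' y'. mB (fscale (rsh \<xi> e y) x) (fscale (cf e y') x')) c) b)"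
  by (simp only: swB_sum)
 also have "... = (\<Sum>e\<in>bas. mB (tri (rsh \<xi> e) b) (tri (cf e) c))"
  unfolding tri_def lin_of_swB[OF lin_mB1[OF lin_ident]]
  unfolding lin_of_swB[OF lin_mB2[OF lin_ident]] ..
 finally show ?thesis .
qed

text \<open>The coaction of \<open>x\<close> is its coproduct: one part stays in \<open>B\<close>,
  the other one shifts the functional.\<close>

lemma tri_jj_right:
 assumes "lin sE (*) \<xi>"
 shows "tri \<xi> (mB b (jj x)) = sw (%x1 x2. mB (tri (rsh \<xi> x2) b) (jj x1)) x"
proof -
 note l = lin_intros lin_compose[OF assms]
 have "tri \<xi> (mB b (jj x)) = swB (%c z. swB (%x' y'. fscale (\<xi> (m z y')) (mB c x')) (jj x)) b"
  unfolding tri_def by (rule swB_mB[OF vs_fscale]) (intro l assms)+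
 also have "... = swB (%c z. sw (%p q. fscale (\<xi> (m z q)) (mB c (jj p))) x) b"
  by (subst swB_jj[OF vs_fscale]) (intro l refl)+
 also have "... = sw (%p q. swB (%c z. fscale (\<xi> (m z q)) (mB c (jj p))) b) x"
  by (rule swB_sw_swap)
 finally show ?thesis
  unfolding tri_def rsh_def
  by (simp add: lin_of_swB[OF lin_mB1[OF lin_ident]] lin_scale[OF lin_mB1[OF lin_ident]])
qed

lemma tri_jj_left:
 assumes "lin sE (*) \<xi>"
 shows "tri \<xi> (mB (jj x) b) = sw (%x1 x2. mB (jj x1) (tri (%z. \<xi> (m x2 z)) b)) x"
proof -
 note l = lin_intros lin_compose[OF assms]
 have "tri \<xi> (mB (jj x) b) = swB (%x' y'. swB (%c z. fscale (\<xi> (m y' z)) (mB x' c)) b) (jj x)"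
  unfolding tri_def by (rule swB_mB[OF vs_fscale]) (intro l assms)+
 also have "... = sw (%p q. swB (%c z. fscale (\<xi> (m q z)) (mB (jj p) c)) b) x"
  by (rule swB_jj[OF vs_fscale]) (intro l)+
 finally show ?thesis
  unfolding tri_def
  by (simp add: lin_of_swB[OF lin_mB2[OF lin_ident]] lin_scale[OF lin_mB2[OF lin_ident]])
qed

subsection \<open>The action of the double on the smash product\<close>

text \<open>The action of \<open>w\<xi>\<close> on \<open>B\<close>: first \<open>\<xi>\<close>,
  then the right adjoint action of \<open>w\<close>.\<close>

definition da :: "'e => ('e => 'k) => ('k, 'a, 'e) tensor => ('k, 'a, 'e) tensor" where
 "da w \<xi> b = sw (%w1 w2. mB (mB (jj (S w1)) (tri \<xi> b)) (jj w2)) w"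

lemma da_closed [simp]: "da w \<xi> b \<in> tens_carrier A E"
 unfolding da_def sw_def by (intro tens_carrier_sum mB_closed)

lemma da_absorb [simp]: "da (P w) \<xi> b = da w \<xi> b" "da w \<xi> (PB b) = da w \<xi> b"
 by (simp_all add: da_def)

lemma da_cong: "(\<And>x. x \<in> carrier E ==> \<xi> x = \<eta> x) ==> da w \<xi> = da w \<eta>"
 using tri_cong[of \<xi> \<eta>] by (intro ext[of "da w \<xi>"]) (simp only: da_def)

lemma lin_da1 [lin_intros]: "lin s sE f ==> lin s fscale (%x. da (f x) \<xi> b)"
 unfolding da_def by (intro lin_intros)

lemma lin_da2 [lin_intros]: "(\<And>y. lin s (*) (%x. F x y)) ==> lin s fscale (%x. da w (F x) b)"
 unfolding da_def by (intro lin_intros)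

lemma lin_da3 [lin_intros]: "lin s fscale f ==> lin s fscale (%x. da w \<xi> (f x))"
 unfolding da_def by (intro lin_intros)

lemma smash_ract_eq:
 assumes "b \<in> tens_carrier A E" "w \<in> carrier E"
 shows "smash_ract E A act b w = sw (%w1 w2. mB (mB (jj (S w1)) b) (jj w2)) w"
 unfolding smash_ract_def Let_def B_def[symmetric]
proof (rule lift_comult_total[OF vs_fscale])
 show "mult B (mult B (incl_E E A (antipode E x)) b) (incl_E E A y) = mB (mB (jj (S x)) b) (jj y)"
  if "x \<in> carrier E" "y \<in> carrier E" for x y
  using that assms by (simp add: S_eq incl_E_eq mB_eq)
qed (intro lin_intros assms)+

lemma lin_tensB1 [lin_intros]:
 assumes "lin s fscale F" "\<And>x. F x \<in> tens_carrier A E" "y \<in> carrier E"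
 shows "lin s fscale (%x. tens TB E (F x) y)"
 using tens_amb_bilinear[of TB E] assms by (simp add: bilinear_on_def linear_on_def lin_def)

lemma lin_tensB2 [lin_intros]:
 assumes "lin s sE F" "\<And>x. F x \<in> carrier E" "y \<in> tens_carrier A E"
 shows "lin s fscale (%x. tens TB E y (F x))"
 using tens_amb_bilinear[of TB E] assms by (simp add: bilinear_on_def linear_on_def lin_def)

lemma smash_coact_eq:
 assumes "b \<in> tens_carrier A E"
 shows "smash_coact E A b = lf (%a w. sw (%w1 w2. tens TB E (tt a w1) (P w2)) w) b"
 unfolding smash_coact_def
proof (rule lift_lf[OF vs_fscale])
 fix a w assume aw: "a \<in> carrier A" "w \<in> carrier E"
 show "lift E E (%w1 w2. tens TB E (tens A E a w1) w2) (comult E w) =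
   sw (%w1 w2. tens TB E (tt a w1) (P w2)) w"
 proof (rule lift_comult_total[OF vs_fscale])
  show "tens TB E (tens A E a x) y = tens TB E (tt a x) (P y)" if "x \<in> carrier E" "y \<in> carrier E" for x y
   using that aw by (simp add: tt_def)
 qed (intro lin_intros aw tt_closed P_closed)+
qed (intro lin_intros assms tt_closed P_closed)+

lemma coact_tri:
 assumes "b \<in> tens_carrier A E" "\<xi> \<in> carrier E'"
 shows "lift TB E (%b0 b1. fscale (\<xi> b1) b0) (smash_coact E A b) = tri \<xi> b"
proof -
 have b: "bilinear_on TB E (amb fscale) (%b0 b1. fscale (\<xi> b1) b0)"
  using assms(2) unfolding bilinear_on_def linear_on_def dual_carrier ground_def
  by (simp add: vector_space_add[OF vs_fscale] vector_space_add_left[OF vs_fscale]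
    vector_space_mult[OF vs_fscale] mult.commute)
 note L = linear_on_sum[OF lift_linear_amb[OF vs_fscale b vec_space_tens vec_space_E] vec_space_tens, simplified]
 have "tens TB E (tt a x) y \<in> tens_carrier TB E" if "y \<in> carrier E" for a x y
  using that by (intro tens_in_carrier) auto
 then have "lift TB E (%b0 b1. fscale (\<xi> b1) b0) (smash_coact E A b) =
   lf (%a w. sw (%w1 w2. fscale (\<xi> (P w2)) (tt a w1)) w) b"
  unfolding smash_coact_eq[OF assms(1)] lf_def sw_def
  by (simp add: L tens_carrier_sum lift_tens[OF vs_fscale b])
 also have "... = tri (%x. \<xi> (P x)) b" by (simp add: tri_def swB_def)
 also have "... = tri \<xi> b" by (rule fun_cong[OF tri_cong]) simp
 finally show ?thesis .
qed

lemma smash_dact_eq: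
 assumes "b \<in> tens_carrier A E"
 shows "smash_dact E A act h b = lift E E' (%w \<xi>. da w \<xi> b) h"
 unfolding smash_dact_def by (rule lift_cong) (simp add: coact_tri assms smash_ract_eq da_def)

lemma da_bilinear: "bilinear_on E E' TB (%w \<xi>. da w \<xi> b)"
 unfolding bilinear_on_def by (auto intro!: linear_on_of_lin lin_intros)

lemma smash_dact_linear:
 assumes "b \<in> tens_carrier A E" shows "linear_on ED TB (%h. smash_dact E A act h b)"
 unfolding smash_dact_eq[OF assms] by (intro lift_linear da_bilinear) auto

lemma smash_dact_te:
 assumes "b \<in> tens_carrier A E" "lin sE (*) \<xi>"
 shows "smash_dact E A act (te w \<xi>) b = da w \<xi> b"
proof -
 have "lift E E' (%w \<xi>. da w \<xi> b) (te w \<xi>) = da (P w) \<xi> b"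
  by (rule lift_te[OF vs_fscale refl bilinear_on_amb[OF da_bilinear, simplified] _ assms(2)])
   (rule fun_cong[OF da_cong])
 then show ?thesis by (simp add: smash_dact_eq[OF assms(1)])
qed

lemma da_one: "da one \<xi> b = tri \<xi> b"
proof -
 have "da one \<xi> b = mB (mB (jj (S one)) (tri \<xi> b)) (jj one)"
  unfolding da_def by (rule sw_one[OF vs_fscale]) (intro lin_intros)+
 then show ?thesis by (simp add: jj_one)
qed

end

subsection \<open>Twisting by a dual cocycle\<close>

locale twisted_alg = module_alg E A act
 for E :: "('k::field, 'e::ab_group_add) hopf" and A :: "('k, 'a::ab_group_add) alg" and act +
 fixes J :: "('k, 'e => 'k, 'e => 'k) tensor"
 assumes J: "invertible_dual_cocycle (dual_hopf E) J"
begin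

abbreviation KS where "KS \<equiv> tens_space E' E'"
abbreviation K3 where "K3 \<equiv> tens_alg K2 E'"

lemma J_closed: "J \<in> tens_carrier E' E'"
 using J by (simp add: invertible_dual_cocycle_def Let_def)

definition js :: "(('e => 'k) \<times> ('e => 'k)) list" where
 "js = (SOME ps. set ps \<subseteq> carrier E' \<times> carrier E' \<and> J = (\<Sum>(\<xi>, \<eta>)\<leftarrow>ps. tens E' E' \<xi> \<eta>))"

abbreviation nJ :: "nat set" where "nJ \<equiv> {..<length js}"
text \<open>The value \<open>0\<close> beyond the end of the list keeps \<open>jl i\<close> and
  \<open>jr i\<close> in the dual for every index.\<close>

definition jl :: "nat => 'e => 'k" where "jl i = (if i < length js then fst (js ! i) else 0)"
definition jr :: "nat => 'e => 'k" where "jr i = (if i < length js then snd (js ! i) else 0)"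

lemma js: "set js \<subseteq> carrier E' \<times> carrier E'" "J = (\<Sum>(\<xi>, \<eta>)\<leftarrow>js. tens E' E' \<xi> \<eta>)"
 using someI_ex[OF tens_carrier_sum_of_pure[OF vec_space_dual J_closed]] unfolding js_def by blast+

lemma sum_js: "(\<Sum>(\<xi>, \<eta>)\<leftarrow>js. f \<xi> \<eta>) = (\<Sum>i\<in>nJ. f (jl i) (jr i))"
 by (simp add: sum_list_sum_nth split_def atLeast0LessThan jl_def jr_def)

lemma jl_closed [simp]: "jl i \<in> carrier E'" and jr_closed [simp]: "jr i \<in> carrier E'"
proof -
 have "js ! i \<in> carrier E' \<times> carrier E'" if "i < length js"
  using js(1) nth_mem[OF that] by blast
 then show "jl i \<in> carrier E'" "jr i \<in> carrier E'"
  using vec_space_zero_closed[OF vec_space_dual] by (auto simp: jl_def jr_def mem_Times_iff)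
qed

lemma lift_J:
 assumes "vector_space u" "bilinear_on E' E' (amb u) \<phi>"
 shows "lift E' E' \<phi> J = (\<Sum>i\<in>nJ. \<phi> (jl i) (jr i))"
 using arg_cong[OF js(2), of "lift E' E' \<phi>"] unfolding lift_sum_of_pure[OF assms js(1)]
 unfolding sum_js .

text \<open>\<open>J\<close> as a bilinear form on \<open>E\<close>, extended to the ambient space.
  In this guise it is a normalized two-cocycle, and the twist of \<open>B\<close> is a cocycle
  deformation of a comodule algebra.\<close>

definition sig :: "'e => 'e => 'k" where
 "sig x y = (\<Sum>i\<in>nJ. jl i (P x) * jr i (P y))"

lemma lin_sig1 [lin_intros]: "lin s sE f ==> lin s (*) (%x. sig (f x) y)"
 and lin_sig2 [lin_intros]: "lin s sE f ==> lin s (*) (%x. sig y (f x))"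
 unfolding sig_def
 by (intro lin_sum_fun vector_space_field lin_mult_left lin_mult_right
  lin_compose[OF lin_dual[OF jl_closed]] lin_compose[OF lin_dual[OF jr_closed]]; assumption)+

lemma sig_P [simp]: "sig (P x) y = sig x y" "sig x (P y) = sig x y"
 by (simp_all add: sig_def)

text \<open>The two counit conditions on \<open>J\<close>, evaluated at a point.\<close>

lemma sig_one: "sig one y = eps y" "sig x one = eps x"
proof -
 have b1: "bilinear_on E' E' (amb fscale) (%\<xi> \<eta>. fscale (\<xi> one) \<eta>)"
  "bilinear_on E' E' (amb fscale) (%\<xi> \<eta>. fscale (\<eta> one) \<xi>)"
  by (rule bilinear_on_lin; unfold dual_simps; intro lin_intros)+
 have "lift E' E' (%\<xi> \<eta>. fscale (\<xi> one) \<eta>) J = unity E'" "lift E' E' (%\<xi> \<eta>. fscale (\<eta> one) \<xi>) J = unity E'"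
  using J by (simp_all add: invertible_dual_cocycle_def Let_def)
 then have "(\<Sum>i\<in>nJ. fscale (jl i one) (jr i)) = restr (carrier E) eps"
  "(\<Sum>i\<in>nJ. fscale (jr i one) (jl i)) = restr (carrier E) eps"
  by (simp_all add: lift_J[OF vs_fscale b1(1)] lift_J[OF vs_fscale b1(2)] dual_unity)
 from fun_cong[OF this(1), of "P y"] fun_cong[OF this(2), of "P x"] show "sig one y = eps y" "sig x one = eps x"
  unfolding sig_def by (simp_all add: sum_fun_apply fscale_apply mult.commute)
qed

definition ev2 :: "'e => 'e => ('k, 'e => 'k, 'e => 'k) tensor => 'k" where
 "ev2 x y = lift E' E' (%\<xi> \<eta>. \<xi> x * \<eta> y)"

lemma ev2_bilinear: "bilinear_on E' E' (amb (*)) (%\<xi> \<eta>. \<xi> x * \<eta> y)"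
 by (rule bilinear_on_lin; unfold dual_simps; intro lin_intros)

lemma ev2_linear: "linear_on KS (amb (*)) (ev2 x y)"
 unfolding ev2_def by (intro lift_linear_amb ev2_bilinear) auto

lemma ev2_tens: "\<xi> \<in> carrier E' ==> \<eta> \<in> carrier E' ==> ev2 x y (tens E' E' \<xi> \<eta>) = \<xi> x * \<eta> y"
 unfolding ev2_def by (rule lift_tens[OF vector_space_field ev2_bilinear])

lemma ev2_J: "ev2 (P x) (P y) J = sig x y"
 unfolding ev2_def sig_def by (rule lift_J[OF vector_space_field ev2_bilinear])

lemma comult_dual_linear: "linear_on E' KS (comult E')"
proof -
 have l: "linear_on E' KS (%\<xi>. tens E' E' (restr (carrier E) (rsh \<xi> b)) (cfd b))" for b
 proof (rule linear_on_compose[where W = E'])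
  show "linear_on E' E' (%\<xi>. restr (carrier E) (rsh \<xi> b))"
   unfolding linear_on_def
   by (intro conjI ballI allI restr_rsh_closed; (simp add: restr_def rsh_def fun_eq_iff fscale_apply)?)
  show "linear_on E' KS (%\<xi>. tens E' E' \<xi> (cfd b))"
   using tens_bilinear[of E' E'] by (auto simp: bilinear_on_def)
 qed
 have "linear_on E' KS (%\<xi>. \<Sum>b\<in>bas. tens E' E' (restr (carrier E) (rsh \<xi> b)) (cfd b))"
  by (rule linear_on_sum_fun[OF vec_space_tens l])
 then show ?thesis
  using vec_space_closed[OF vec_space_dual] unfolding linear_on_def by (simp add: dual_comult)
qed

lemma ev2_comult:
 assumes "\<xi> \<in> carrier E'" shows "ev2 (P x) (P y) (comult E' \<xi>) = \<xi> (m x y)"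
proof -
 have "ev2 (P x) (P y) (comult E' \<xi>) = (\<Sum>b\<in>bas. \<xi> (m x b) * cf b y)"
  unfolding ev2_def lift_dual_comult[OF vector_space_field ev2_bilinear assms] by (simp add: rsh_def cfd_def)
 also have "... = \<xi> (P (m x (\<Sum>b\<in>bas. sE (cf b y) b)))"
  unfolding lin_sum[OF lin_compose[OF lin_dual[OF assms] lin_m2[OF lin_ident]]]
   lin_scale[OF lin_compose[OF lin_dual[OF assms] lin_m2[OF lin_ident]]] by (simp add: mult.commute)
 finally show ?thesis by (simp flip: P_def)
qed

lemma K2_mult_tens:
 "\<xi> \<in> carrier E' ==> \<eta> \<in> carrier E' ==> \<xi>' \<in> carrier E' ==> \<eta>' \<in> carrier E' ==>
 mult K2 (tens E' E' \<xi> \<eta>) (tens E' E' \<xi>' \<eta>') = tens E' E' (mult E' \<xi> \<xi>') (mult E' \<eta> \<eta>')"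
 using tens_alg_mult[OF vec_space_dual vec_space_dual dual_bilinear dual_bilinear] by simp

lemma K2_bilinear: "bilinear_on KS KS KS (mult K2)"
 using tens_alg_bilinear[OF vec_space_dual vec_space_dual dual_bilinear dual_bilinear]
 by (subst bilinear_on_cong_space[of KS K2 KS K2 KS K2]) auto

text \<open>The product of \<open>E* \<otimes> E*\<close> is the convolution of bilinear forms. This
  is checked on pure tensors and extended by linearity in one argument at a time.\<close>

lemma ev2_mult:
 assumes s: "s \<in> tens_carrier E' E'" and t: "t \<in> tens_carrier E' E'"
 shows "ev2 (P x) (P y) (mult K2 s t) =
  sw (%x1 x2. sw (%y1 y2. ev2 (P x1) (P y1) s * ev2 (P x2) (P y2) t) y) x"
proof -
 let ?G = "%s t. sw (%x1 x2. sw (%y1 y2. ev2 (P x1) (P y1) s * ev2 (P x2) (P y2) t) y) x"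
 have pure: "ev2 (P x) (P y) (mult K2 (tens E' E' \<xi> \<eta>) (tens E' E' \<xi>' \<eta>')) = ?G (tens E' E' \<xi> \<eta>) (tens E' E' \<xi>' \<eta>')"
  if "\<xi> \<in> carrier E'" "\<eta> \<in> carrier E'" "\<xi>' \<in> carrier E'" "\<eta>' \<in> carrier E'" for \<xi> \<eta> \<xi>' \<eta>'
 proof -
  have "ev2 (P x) (P y) (mult K2 (tens E' E' \<xi> \<eta>) (tens E' E' \<xi>' \<eta>')) = cv \<xi> \<xi>' x * cv \<eta> \<eta>' y"
  proof -
   have "mult E' \<xi> \<xi>' (P x) = cv \<xi> \<xi>' x" "mult E' \<eta> \<eta>' (P y) = cv \<eta> \<eta>' y"
    by (simp_all add: dual_mult that)
   then show ?thesis by (simp add: K2_mult_tens ev2_tens that)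
  qed
  also have "... = sw (%x1 x2. sw (%y1 y2. \<xi> x1 * \<eta> y1 * (\<xi>' x2 * \<eta>' y2)) y) x"
   unfolding cv_def sw_def sum_product by (simp add: ac_simps)
  also have "... = ?G (tens E' E' \<xi> \<eta>) (tens E' E' \<xi>' \<eta>')"
   by (intro sw_cong) (simp add: ev2_tens that)
  finally show ?thesis .
 qed
 have G1: "linear_on KS (amb (*)) (%s. ?G s t)" and G2: "linear_on KS (amb (*)) (?G t)" for t
 proof -
  have "linear_on KS (amb (*)) (%s. ev2 a b s * c)" "linear_on KS (amb (*)) (%s. c * ev2 a b s)" for a b c
   using ev2_linear[of a b] by (simp_all add: linear_on_def algebra_simps)
  note m = this
  show "linear_on KS (amb (*)) (%s. ?G s t)" "linear_on KS (amb (*)) (?G t)"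
   unfolding sw_def by (intro linear_on_sum_fun vec_space_amb vector_space_field m)+
 qed
 have 1: "ev2 (P x) (P y) (mult K2 (tens E' E' \<xi> \<eta>) t) = ?G (tens E' E' \<xi> \<eta>) t"
  if "\<xi> \<in> carrier E'" "\<eta> \<in> carrier E'" for \<xi> \<eta>
 proof (rule linear_on_tens_eqI[where f = "%t. ev2 (P x) (P y) (mult K2 (tens E' E' \<xi> \<eta>) t)",
    OF _ G2 vec_space_dual vec_space_dual pure[OF that] t])
  show "linear_on KS (amb (*)) (%t. ev2 (P x) (P y) (mult K2 (tens E' E' \<xi> \<eta>) t))"
   using K2_bilinear that by (intro linear_on_compose[OF _ ev2_linear]) (auto simp: bilinear_on_def tens_in_carrier)
 qed
 show ?thesis
 proof (rule linear_on_tens_eqI[where f = "%s. ev2 (P x) (P y) (mult K2 s t)",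
    OF _ G1 vec_space_dual vec_space_dual 1 s])
  show "linear_on KS (amb (*)) (%s. ev2 (P x) (P y) (mult K2 s t))"
   using K2_bilinear t by (intro linear_on_compose[OF _ ev2_linear]) (auto simp: bilinear_on_def)
 qed
qed


lemma K3_tens: "tens K2 E' = tens KS E'"
 by (rule tens_congr) simp_all

definition ev3 where "ev3 x y z = lift KS E' (%t \<zeta>. ev2 x y t * \<zeta> z)"

lemma ev3_bilinear: "bilinear_on KS E' (amb (*)) (%t \<zeta>. ev2 x y t * \<zeta> z)"
 unfolding bilinear_on_def
proof (intro conjI ballI)
 show "linear_on KS (amb (*)) (%t. ev2 x y t * \<zeta> z)" for \<zeta>
  using ev2_linear[of x y] by (simp add: linear_on_def algebra_simps)
 show "linear_on E' (amb (*)) (%\<zeta>. ev2 x y t * \<zeta> z)" for t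
  by (rule linear_on_lin) (unfold dual_simps, intro lin_intros)
qed

lemma ev3_linear: "linear_on (tens_space KS E') (amb (*)) (ev3 x y z)"
 unfolding ev3_def by (intro lift_linear_amb ev3_bilinear) auto

lemma ev3_tens:
 "t \<in> tens_carrier E' E' ==> \<zeta> \<in> carrier E' ==> ev3 x y z (tens KS E' t \<zeta>) = ev2 x y t * \<zeta> z"
 unfolding ev3_def by (subst lift_tens[OF vector_space_field ev3_bilinear]) simp_all

lemma K3_bilinear: "bilinear_on (tens_space KS E') (tens_space KS E') (tens_space KS E') (mult K3)"
proof -
 have "bilinear_on K2 K2 K2 (mult K2)"
  using tens_alg_bilinear[OF vec_space_dual vec_space_dual dual_bilinear dual_bilinear] .
 from tens_alg_bilinear[OF vec_space_tens_alg vec_space_dual this dual_bilinear]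
 have *: "bilinear_on K3 K3 K3 (mult K3)" .
 have "tens_carrier K2 E' = tens_carrier KS E'" by (rule tens_carrier_congr) simp_all
 then show ?thesis
  using * by (subst bilinear_on_cong_space[of _ K3 _ K3 _ K3]) auto
qed

lemma K3_mult_tens:
 assumes "s \<in> tens_carrier E' E'" "t \<in> tens_carrier E' E'" "\<xi> \<in> carrier E'" "\<eta> \<in> carrier E'"
 shows "mult K3 (tens KS E' s \<xi>) (tens KS E' t \<eta>) = tens KS E' (mult K2 s t) (mult E' \<xi> \<eta>)"
 using tens_alg_mult[OF vec_space_tens_alg vec_space_dual
   tens_alg_bilinear[OF vec_space_dual vec_space_dual dual_bilinear dual_bilinear] dual_bilinear] assms
 by (simp add: K3_tens)

lemma K2_closed: "s \<in> tens_carrier E' E' ==> t \<in> tens_carrier E' E' ==> mult K2 s t \<in> tens_carrier E' E'"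
 using bilinear_on_closed[OF K2_bilinear] by simp

lemma dual_mult_one: "\<xi> \<in> carrier E' ==> mult E' \<xi> (unity E') = \<xi>" "\<xi> \<in> carrier E' ==> mult E' (unity E') \<xi> = \<xi>"
 using algebra_unity_right[OF alg_dual] algebra_unity_left[OF alg_dual] by auto

text \<open>The cocycle identity of \<open>J\<close>, evaluated at
  \<open>x \<otimes> y \<otimes> z\<close>. Coproducts of \<open>E*\<close> evaluate to products in
  \<open>E\<close>, and products of \<open>E*\<close> to convolutions.\<close>

lemma sig_cocycle:
 "sw (%x1 x2. sw (%y1 y2. sig (m x1 y1) z * sig x2 y2) y) x =
 sw (%y1 y2. sw (%z1 z2. sig x (m y1 z1) * sig y2 z2) z) y"
proof -
 let ?T = "tens_space KS E'" and ?e = "ev3 (P x) (P y) (P z)"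
 let ?one = "unity E'"
 let ?L = "comult_left E' J" and ?R = "comult_right E' J"
 \<comment> \<open>Summands of the coproduct on the second factor of \<open>J\<close>, with
   \<open>b\<close> the basis index in that coproduct; the \<open>Y i\<close> are the summands of
   \<open>1 \<otimes> J\<close>.\<close>
 define X where "X i b = tens KS E' (tens E' E' (jl i) (restr (carrier E) (rsh (jr i) b))) (cfd b)" for i b
 define Y where "Y i = tens KS E' (tens E' E' ?one (jl i)) (jr i)" for i
 have XY: "X i b \<in> tens_carrier KS E'" "Y i \<in> tens_carrier KS E'" for i b
  unfolding X_def Y_def by (intro tens_in_carrier; simp add: tens_in_carrier dual_unity_closed)+
 have com: "comult E' \<xi> \<in> tens_carrier E' E'" if "\<xi> \<in> carrier E'" for \<xi>
  using comult_dual_linear that by (simp add: linear_on_def)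
 have L: "?L = (\<Sum>i\<in>nJ. tens KS E' (comult E' (jl i)) (jr i))"
  unfolding comult_left_def
  using bilinear_on_amb[OF bilinear_on_compose_left[OF tens_bilinear[of KS E'] comult_dual_linear]]
  by (intro lift_J) auto
 have R: "?R = (\<Sum>i\<in>nJ. \<Sum>b\<in>bas. X i b)"
 proof -
  let ?X = "%\<xi> \<eta>. \<Sum>b\<in>bas. tens KS E' (tens E' E' \<xi> (restr (carrier E) (rsh \<eta> b))) (cfd b)"
  have l: "linear_on E' E' (%\<xi>. restr (carrier E) (rsh \<xi> b))" for b
   unfolding linear_on_def
   by (intro conjI ballI allI restr_rsh_closed; (simp add: restr_def rsh_def fun_eq_iff fscale_apply)?)
  have t1: "linear_on E' KS (tens E' E' \<xi>)" "linear_on E' KS (%\<eta>. tens E' E' \<eta> \<xi>)"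
   "linear_on KS ?T (%t. tens KS E' t \<xi>)" if "\<xi> \<in> carrier E'" for \<xi>
   using tens_bilinear[of E' E'] tens_bilinear[of KS E'] that by (auto simp: bilinear_on_def)
  have bX: "bilinear_on E' E' ?T ?X"
   unfolding bilinear_on_def
   by (intro conjI ballI linear_on_sum_fun vec_space_tens
     linear_on_compose[OF linear_on_compose[OF l t1(1)] t1(3)] linear_on_compose[OF t1(2) t1(3)]
     cfd_closed restr_rsh_closed)
  have "lift E' E' (%\<eta>1 \<eta>2. tens KS E' (tens E' E' \<xi> \<eta>1) \<eta>2) (comult E' \<eta>) = ?X \<xi> \<eta>"
   if "\<xi> \<in> carrier E'" "\<eta> \<in> carrier E'" for \<xi> \<eta>
   using bilinear_on_amb[OF bilinear_on_compose_left[OF tens_bilinear[of KS E'] t1(1)[OF that(1)]]]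
   by (intro lift_dual_comult that) auto
  then have "?R = lift E' E' ?X J" unfolding comult_right_def by (intro lift_cong)
  also have "... = (\<Sum>i\<in>nJ. ?X (jl i) (jr i))"
   using bilinear_on_amb[OF bX] by (intro lift_J) auto
  finally show ?thesis by (simp add: X_def)
 qed
 have Y: "lift E' E' (%\<xi> \<eta>. tens K2 E' (tens E' E' ?one \<xi>) \<eta>) J = (\<Sum>i\<in>nJ. Y i)"
 proof -
  have "linear_on E' KS (tens E' E' ?one)"
   using tens_bilinear[of E' E'] dual_unity_closed by (auto simp: bilinear_on_def)
  from bilinear_on_amb[OF bilinear_on_compose_left[OF tens_bilinear[of KS E'] this]]
  show ?thesis unfolding K3_tens Y_def by (intro lift_J) auto
 qed
 have linM: "linear_on ?T (amb (*)) (%s. ?e (mult K3 s t))" "linear_on ?T (amb (*)) (%s. ?e (mult K3 t s))"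
  if "t \<in> tens_carrier KS E'" for t
  using K3_bilinear that by (intro linear_on_compose[OF _ ev3_linear]; simp add: bilinear_on_def)+
 have M: "mult K3 ?L (tens KS E' J ?one) = mult K3 ?R (\<Sum>i\<in>nJ. Y i)"
  using J unfolding invertible_dual_cocycle_def Let_def Y[unfolded K3_tens, symmetric] K3_tens by blast
 have "?e (mult K3 ?L (tens KS E' J ?one)) =
   (\<Sum>i\<in>nJ. ?e (mult K3 (tens KS E' (comult E' (jl i)) (jr i)) (tens KS E' J ?one)))"
  unfolding L by (rule linear_on_sum[OF linM(1) vec_space_tens])
   (auto intro!: tens_in_carrier simp: J_closed dual_unity_closed com)
 also have "... = (\<Sum>i\<in>nJ. sw (%x1 x2. sw (%y1 y2. jl i (m x1 y1) * sig x2 y2) y) x * jr i (P z))"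
  by (simp add: K3_mult_tens com J_closed dual_unity_closed dual_mult_one ev3_tens K2_closed ev2_mult ev2_comult ev2_J)
 also have "... = sw (%x1 x2. sw (%y1 y2. (\<Sum>i\<in>nJ. jl i (m x1 y1) * sig x2 y2 * jr i (P z)) ) y) x"
  unfolding sw_sum by (simp add: sw_def sum_distrib_right)
 also have "... = sw (%x1 x2. sw (%y1 y2. sig (m x1 y1) z * sig x2 y2) y) x"
  unfolding sig_def[of "m _ _" z] by (simp add: sum_distrib_right mult.assoc mult.commute[of "sig _ _"])
 finally have 1: "?e (mult K3 ?L (tens KS E' J ?one)) = ..." .
 have XYp: "?e (mult K3 (X i b) (Y k)) = jl i (P x) * cv (rsh (jr i) b) (jl k) y * cv (cf b) (jr k) z" for i b k
 proof -
  have "cv (restr (carrier E) (rsh (jr i) b)) (jl k) = cv (rsh (jr i) b) (jl k)" "cv (cfd b) (jr k) = cv (cf b) (jr k)"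
   by (rule cv_cong; simp add: cfd_def)+
  moreover have "mult E' (restr (carrier E) (rsh (jr i) b)) (jl k) \<in> carrier E'" by simp
  ultimately show ?thesis unfolding X_def Y_def
   by (simp add: K3_mult_tens tens_in_carrier dual_unity_closed dual_mult_one ev3_tens K2_mult_tens ev2_tens
     dual_mult_closed)
    (simp add: dual_mult)
 qed
 \<comment> \<open>The basis sum from the coproduct of \<open>jr i\<close> recombines to a product
   in \<open>E\<close>.\<close>
 have eta: "(\<Sum>b\<in>bas. rsh (jr i) b y' * cf b z') = jr i (m y' z')" for i y' z'
 proof -
  have "jr i (P (m y' (\<Sum>b\<in>bas. sE (cf b z') b))) = (\<Sum>b\<in>bas. rsh (jr i) b y' * cf b z')"
   unfolding lin_sum[OF lin_compose[OF lin_dual[OF jr_closed] lin_m2[OF lin_ident]]]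
    lin_scale[OF lin_compose[OF lin_dual[OF jr_closed] lin_m2[OF lin_ident]]] by (simp add: mult.commute rsh_def)
  then show ?thesis by (simp flip: P_def)
 qed
 have "?e (mult K3 ?R (\<Sum>i\<in>nJ. Y i)) = (\<Sum>i\<in>nJ. \<Sum>b\<in>bas. \<Sum>k\<in>nJ. ?e (mult K3 (X i b) (Y k)))"
 proof -
  have c: "(\<Sum>i\<in>nJ. Y i) \<in> tens_carrier KS E'" "(\<Sum>b\<in>bas. X i b) \<in> tens_carrier KS E'" for i
   by (intro tens_carrier_sum XY)+
  note l1 = linear_on_sum[OF linM(1)[OF c(1)] vec_space_tens, simplified]
  note l2 = linear_on_sum[OF linM(2)[OF XY(1)] vec_space_tens, simplified]
  show ?thesis unfolding R by (simp add: l1 l2 c XY)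
 qed
 also have "... = (\<Sum>i\<in>nJ. \<Sum>k\<in>nJ. \<Sum>b\<in>bas. jl i (P x) * cv (rsh (jr i) b) (jl k) y * cv (cf b) (jr k) z)"
  unfolding XYp by (subst sum.swap[of _ bas nJ]) simp
 also have "... = (\<Sum>i\<in>nJ. \<Sum>k\<in>nJ. sw (%y1 y2. sw (%z1 z2.
   jl i (P x) * jr i (m y1 z1) * (jl k y2 * jr k z2)) z) y)"
 proof -
  have "(\<Sum>b\<in>bas. jl i (P x) * cv (rsh (jr i) b) (jl k) y * cv (cf b) (jr k) z) =
   sw (%y1 y2. sw (%z1 z2. jl i (P x) * jr i (m y1 z1) * (jl k y2 * jr k z2)) z) y" for i k
  proof -
   have "(\<Sum>b\<in>bas. jl i (P x) * cv (rsh (jr i) b) (jl k) y * cv (cf b) (jr k) z) =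
    (\<Sum>b\<in>bas. sw (%y1 y2. sw (%z1 z2. jl i (P x) * (rsh (jr i) b y1 * cf b z1) * (jl k y2 * jr k z2)) z) y)"
    unfolding cv_def sw_def by (simp add: sum_product sum_distrib_left ac_simps)
   also have "... = sw (%y1 y2. sw (%z1 z2. \<Sum>b\<in>bas. jl i (P x) * (rsh (jr i) b y1 * cf b z1) * (jl k y2 * jr k z2)) z) y"
    by (simp only: sw_sum)
   finally show ?thesis by (simp add: eta flip: sum_distrib_left sum_distrib_right)
  qed
  then show ?thesis by simp
 qed
 also have "... = sw (%y1 y2. sw (%z1 z2. \<Sum>i\<in>nJ. \<Sum>k\<in>nJ.
   jl i (P x) * jr i (m y1 z1) * (jl k y2 * jr k z2)) z) y"
  by (simp only: sw_sum)
 also have "... = sw (%y1 y2. sw (%z1 z2. sig x (m y1 z1) * sig y2 z2) z) y"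
  by (intro sw_cong) (simp add: sig_def sum_product)
 finally show ?thesis using 1 M by simp
qed

subsection \<open>The twisted smash product\<close>

text \<open>The twisted product as a cocycle deformation, with the coactions fed into
  \<open>sig\<close>. The form that \<open>smash_twist\<close> produces is
  \<open>mJ_sum\<close>.\<close>

definition mJ :: "('k, 'a, 'e) tensor => ('k, 'a, 'e) tensor => ('k, 'a, 'e) tensor" where
 "mJ s t = swB (%b x. swB (%c y. fscale (sig x y) (mB b c)) t) s"

lemma mJ_sum: "mJ s t = (\<Sum>i\<in>nJ. mB (tri (jl i) s) (tri (jr i) t))"
proof -
 have "mJ s t = swB (%b x. swB (%c y. \<Sum>i\<in>nJ. mB (fscale (jl i x) b) (fscale (jr i y) c)) t) s"
  unfolding mJ_def
 proof (intro swB_cong)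
  fix x y b c assume "x \<in> carrier E" "y \<in> carrier E"
  then show "fscale (sig x y) (mB b c) = (\<Sum>i\<in>nJ. mB (fscale (jl i x) b) (fscale (jr i y) c))"
   by (simp add: sig_def lin_sum[OF lin_scale_left[OF vs_fscale lin_ident]]
    lin_scale[OF lin_mB1[OF lin_ident]] lin_scale[OF lin_mB2[OF lin_ident]]
    vector_space_mult[OF vs_fscale] mult.commute)
 qed
 also have "... = (\<Sum>i\<in>nJ. mB (tri (jl i) s) (tri (jr i) t))"
  unfolding tri_def lin_of_swB[OF lin_mB1[OF lin_ident]]
  unfolding lin_of_swB[OF lin_mB2[OF lin_ident]] by (simp only: swB_sum)
 finally show ?thesis .
qed

lemma mJ_closed [simp]: "mJ s t \<in> tens_carrier A E"
 unfolding mJ_sum by (intro tens_carrier_sum mB_closed)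

lemma lin_mJ1 [lin_intros]: "lin s fscale f ==> lin s fscale (%x. mJ (f x) b)"
 and lin_mJ2 [lin_intros]: "lin s fscale f ==> lin s fscale (%x. mJ b (f x))"
 unfolding mJ_sum by (intro lin_intros; assumption)+

lemma mJ_PB [simp]: "mJ (PB s) t = mJ s t" "mJ s (PB t) = mJ s t"
 by (simp_all add: mJ_def)

text \<open>\<open>ii a\<close> is coinvariant and \<open>sig one y = eps y\<close>, so the cocycle
  is reduced to the counit of the coaction of \<open>b\<close>.\<close>

lemma mJ_ii_left: "mJ (ii a) b = mB (ii a) b"
proof -
 have "mJ (ii a) b = swB (%c y. fscale (sig one y) (mB (ii a) c)) b"
  unfolding mJ_def by (rule swB_ii[OF vs_fscale]) (intro lin_intros)+
 also have "... = mB (ii a) (PB b)"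
  unfolding sig_one by (rule swB_counit[OF vs_fscale]) (intro lin_intros)
 finally show ?thesis by simp
qed

lemma mJ_ii_right: "mJ b (ii a) = mB b (ii a)"
proof -
 have "mJ b (ii a) = swB (%c x. fscale (sig x one) (mB c (ii a))) b"
  unfolding mJ_def by (subst swB_ii[OF vs_fscale]) (intro lin_intros refl)+
 also have "... = mB (PB b) (ii a)"
  unfolding sig_one by (rule swB_counit[OF vs_fscale]) (intro lin_intros)
 finally show ?thesis by simp
qed

lemma mJ_mB_left: "mJ (mB b c) r = swB (%p q. swB (%p' q'. swB (%d z. fscale (sig (m q q') z) (mB (mB p p') d)) r) c) b"
 unfolding mJ_def by (rule swB_mB[OF vs_fscale]) (intro lin_intros)+

lemma mJ_mB_right: "mJ b (mB c d) = swB (%p x. swB (%q y. swB (%r z. fscale (sig x (m y z)) (mB p (mB q r))) d) c) b"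
proof -
 have "swB (%q y. fscale (sig x y) (mB p q)) (mB c d) =
   swB (%q y. swB (%r z. fscale (sig x (m y z)) (mB p (mB q r))) d) c" for x p
  by (rule swB_mB[OF vs_fscale]) (intro lin_intros)+
 then show ?thesis unfolding mJ_def by simp
qed

text \<open>Multiplicativity of the coaction and coassociativity bring both sides into the form of
  one threefold product with a scalar that depends on the three coaction parts. The two scalars are
  the two sides of \<open>sig_cocycle\<close>.\<close>

lemma mJ_assoc: "mJ (mJ s t) r = mJ s (mJ t r)"
proof -
 note l = lin_intros
 have "mJ (mJ s t) r = swB (%b x. swB (%c y. fscale (sig x y) (mJ (mB b c) r)) t) s"
  unfolding mJ_def[of s t]
  by (simp add: lin_of_swB[OF lin_mJ1[OF lin_ident]] lin_scale[OF lin_mJ1[OF lin_ident]])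
 also have "... = swB (%b x. swB (%c y. swB (%p q. swB (%p' q'. swB (%d z.
   fscale (sig x y * sig (m q q') z) (mB (mB p p') d)) r) c) b) t) s"
  unfolding mJ_mB_left
  by (simp add: lin_of_swB[OF lin_scale_right[OF vs_fscale lin_ident]] vector_space_mult[OF vs_fscale])
 also have "... = swB (%b x. swB (%p q. swB (%c y. swB (%p' q'. swB (%d z.
   fscale (sig x y * sig (m q q') z) (mB (mB p p') d)) r) c) t) b) s"
  by (subst swB_swap) simp
 also have "... = swB (%b x. swB (%p q. swB (%p' y. sw (%q' y. swB (%d z.
   fscale (sig x y * sig (m q q') z) (mB (mB p p') d)) r) y) t) b) s"
  by (subst swB_coassoc[OF vs_fscale]) (intro l refl)+
 also have "... = swB (%p x. sw (%q x. swB (%p' y. sw (%q' y. swB (%d z.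
   fscale (sig x y * sig (m q q') z) (mB (mB p p') d)) r) y) t) x) s"
  by (rule swB_coassoc[OF vs_fscale]) (intro l)+
 \<comment> \<open>The scalar is now a function of \<open>x\<close>, \<open>y\<close> and
   \<open>z\<close>, the coaction parts of \<open>s\<close>, \<open>t\<close> and
   \<open>r\<close>.\<close>
 also have "... = swB (%p x. swB (%p' y. swB (%d z.
   fscale (sw (%q x. sw (%q' y. sig (m q q') z * sig x y) y) x) (mB (mB p p') d)) r) t) s"
  by (simp add: lin_of_sw[OF lin_scale_left[OF vs_fscale lin_ident]] mult.commute flip: swB_sw_swap)
 also have "... = swB (%p x. swB (%p' y. swB (%d z.
   fscale (sw (%y1 y2. sw (%z1 z2. sig x (m y1 z1) * sig y2 z2) z) y) (mB p (mB p' d))) r) t) s"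
  unfolding sig_cocycle mB_assoc ..
 also have "... = swB (%p x. swB (%p' y. sw (%y1 y2. swB (%d z. sw (%z1 z2.
   fscale (sig x (m y1 z1) * sig y2 z2) (mB p (mB p' d))) z) r) y) t) s"
  by (simp add: lin_of_sw[OF lin_scale_left[OF vs_fscale lin_ident]] swB_sw_swap)
 also have "... = swB (%p x. swB (%p' y. sw (%y1 y2. swB (%d z2. swB (%d z1.
   fscale (sig x (m y1 z1) * sig y2 z2) (mB p (mB p' d))) d) r) y) t) s"
  by (subst swB_coassoc[OF vs_fscale]) (intro l refl)+
 also have "... = swB (%p x. swB (%c y2. swB (%p' y1. swB (%d z2. swB (%d z1.
   fscale (sig x (m y1 z1) * sig y2 z2) (mB p (mB p' d))) d) r) c) t) s"
  by (subst swB_coassoc[OF vs_fscale]) (intro l refl)+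
 also have "... = swB (%c y. swB (%d z. swB (%p x. swB (%p' y1. swB (%d z1.
   fscale (sig x (m y1 z1) * sig y z) (mB p (mB p' d))) d) c) s) r) t"
 proof -
  have "swB (%p' y1. swB (%d z2. swB (%d z1.
   fscale (sig x (m y1 z1) * sig y2 z2) (mB p (mB p' d))) d) r) c =
   swB (%d z2. swB (%p' y1. swB (%d z1.
   fscale (sig x (m y1 z1) * sig y2 z2) (mB p (mB p' d))) d) c) r" for p x c y2
   by (rule swB_swap)
  then have "swB (%p x. swB (%c y2. swB (%p' y1. swB (%d z2. swB (%d z1.
   fscale (sig x (m y1 z1) * sig y2 z2) (mB p (mB p' d))) d) r) c) t) s =
   swB (%p x. swB (%c y2. swB (%d z2. swB (%p' y1. swB (%d z1.
   fscale (sig x (m y1 z1) * sig y2 z2) (mB p (mB p' d))) d) c) r) t) s" by simp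
  also have "... = swB (%c y. swB (%p x. swB (%d z. swB (%p' y1. swB (%d z1.
   fscale (sig x (m y1 z1) * sig y z) (mB p (mB p' d))) d) c) r) s) t"
   by (rule swB_swap)
  also have "... = swB (%c y. swB (%d z. swB (%p x. swB (%p' y1. swB (%d z1.
   fscale (sig x (m y1 z1) * sig y z) (mB p (mB p' d))) d) c) s) r) t"
   by (subst swB_swap) simp
  finally show ?thesis .
 qed
 also have "... = swB (%c y. swB (%d z. fscale (sig y z) (mJ s (mB c d))) r) t"
  unfolding mJ_mB_right
  by (simp add: lin_of_swB[OF lin_scale_right[OF vs_fscale lin_ident]] vector_space_mult[OF vs_fscale]
   mult.commute)
 also have "... = mJ s (mJ t r)"
  unfolding mJ_def[of t r]
  by (simp add: lin_of_swB[OF lin_mJ2[OF lin_ident]] lin_scale[OF lin_mJ2[OF lin_ident]])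
 finally show ?thesis .
qed


definition F where "F = embed_dual2 E J"

lemma F_sum: "F = (\<Sum>i\<in>nJ. tens ED ED (te one (jl i)) (te one (jr i)))"
 unfolding F_def embed_dual2_eq
 using bilinear_on_amb[OF te_one_bilinear] by (intro lift_J) auto

lemma F_closed: "F \<in> tens_carrier ED ED"
 unfolding F_def by (rule embed_dual2_closed[OF J_closed])

lemma lift_F:
 assumes "vector_space u" "bilinear_on ED ED (amb u) \<phi>"
 shows "lift ED ED \<phi> F = (\<Sum>i\<in>nJ. \<phi> (te one (jl i)) (te one (jr i)))"
 unfolding F_sum
 by (subst linear_on_sum[OF lift_linear_amb[OF assms vec_space_tens vec_space_tens] vec_space_tens])
  (auto simp: lift_tens[OF assms] intro!: tens_in_carrier)

lemma te_one_dual: "\<xi> \<in> carrier E' ==> te one \<xi> = te one (%x. \<xi> (P x))"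
 by (rule te_cong) simp

lemma smash_dact_dual:
 assumes "\<xi> \<in> carrier E'" "b \<in> tens_carrier A E"
 shows "smash_dact E A act (te one \<xi>) b = tri \<xi> b"
proof -
 have "smash_dact E A act (te one \<xi>) b = tri (%x. \<xi> (P x)) b"
  using assms by (simp add: te_one_dual[OF assms(1)] smash_dact_te lin_dual da_one)
 also have "... = tri \<xi> b" by (rule fun_cong[OF tri_cong]) simp
 finally show ?thesis .
qed

definition BJ where "BJ = smash_twist E A act J"

lemma BJ_simps [simp]: "carrier BJ = tens_carrier A E" "scale BJ = fscale" "unity BJ = oneB"
 by (simp_all add: BJ_def smash_twist_def Let_def flip: B_def)

lemma mJ_eq:
 assumes s: "s \<in> tens_carrier A E" and t: "t \<in> tens_carrier A E"
 shows "mult BJ s t = mJ s t"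
proof -
 have b: "bilinear_on ED ED (amb fscale) (%h h'. mult B (smash_dact E A act h s) (smash_dact E A act h' t))"
 proof -
  have "bilinear_on TB TB TB (mult B)"
   using mB_bilinear by (subst bilinear_on_cong_space[of _ B _ B _ B]) auto
  from bilinear_on_compose_right[OF bilinear_on_compose_left[OF this smash_dact_linear[OF s]] smash_dact_linear[OF t]]
  show ?thesis by (auto dest: bilinear_on_amb)
 qed
 have "mult BJ s t = lift D D (%h h'. mult B (smash_dact E A act h s) (smash_dact E A act h' t)) F"
  by (simp add: BJ_def smash_twist_def Let_def twisted_product_def lift_def F_def B_def D_def)
 also have "... = (\<Sum>i\<in>nJ. mult B (smash_dact E A act (te one (jl i)) s) (smash_dact E A act (te one (jr i)) t))"
  unfolding tens_D by (rule lift_F[OF vs_fscale b])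
 finally show ?thesis
  by (simp add: smash_dact_dual s t mB_eq mJ_sum)
qed

lemma mJ_oneB [simp]: "mJ oneB b = PB b" "mJ b oneB = PB b"
 using mJ_ii_left[of oneA b] mJ_ii_right[of b oneA] by (simp_all add: ii_one)

lemma alg_BJ: "algebra BJ"
proof -
 have "bilinear_on BJ BJ BJ (mult BJ)"
  unfolding bilinear_on_def linear_on_def
  by (simp add: mJ_eq tens_carrier_add tens_carrier_scale lin_add[OF lin_mJ1[OF lin_ident]] lin_add[OF lin_mJ2[OF lin_ident]]
   lin_scale[OF lin_mJ1[OF lin_ident]] lin_scale[OF lin_mJ2[OF lin_ident]])
 moreover have "vec_space BJ" using vec_space_tens[of A E] by (simp add: vec_space_def)
 ultimately show ?thesis by (simp add: algebra_def mJ_eq mJ_assoc)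
qed

end


section \<open>The Hochschild dg algebra\<close>

lemma tuples_simps:
 "xs \<in> tuples V n \<longleftrightarrow> length xs = n \<and> set xs \<subseteq> carrier V"
 by (simp add: tuples_def)

text \<open>A slot written as \<open>us @ x # vs\<close> follows recursions on lists, which
  \<open>xs[i := x]\<close> does not.\<close>

lemma multilinear_mapsI:
 assumes "\<And>xs. xs \<notin> tuples V n ==> f xs = 0" "\<And>xs. xs \<in> tuples V n ==> f xs \<in> carrier W"
  and "\<And>us vs. set us \<subseteq> carrier V ==> set vs \<subseteq> carrier V ==> Suc (length us + length vs) = n ==>
   linear_on V W (%x. f (us @ x # vs))"
 shows "f \<in> multilinear_maps V W n"
proof -
 have "linear_on V W (%x. f (xs[i := x]))" if xs: "xs \<in> tuples V n" "i < n" for xs i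
 proof -
  have "linear_on V W (%x. f (take i xs @ x # drop (Suc i) xs))"
   using xs set_take_subset[of i xs] set_drop_subset[of "Suc i" xs] by (intro assms(3)) (auto simp: tuples_simps)
  then show ?thesis using xs by (simp add: upd_conv_take_nth_drop tuples_simps)
 qed
 then show ?thesis using assms(1,2) by (auto simp: multilinear_maps_def)
qed

lemma multilinear_maps_zero: "f \<in> multilinear_maps V W n ==> xs \<notin> tuples V n ==> f xs = 0"
 by (simp add: multilinear_maps_def)

lemma multilinear_maps_closed: "f \<in> multilinear_maps V W n ==> xs \<in> tuples V n ==> f xs \<in> carrier W"
 by (simp add: multilinear_maps_def)

lemma multilinear_maps_slot:
 assumes f: "f \<in> multilinear_maps V W n" and V: "0 \<in> carrier V"
  and us: "set us \<subseteq> carrier V" "set vs \<subseteq> carrier V" "Suc (length us + length vs) = n"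
 shows "linear_on V W (%x. f (us @ x # vs))"
proof -
 have "us @ 0 # vs \<in> tuples V n" "length us < n" using us V by (auto simp: tuples_simps)
 then have "linear_on V W (%x. f ((us @ 0 # vs)[length us := x]))"
  using f unfolding multilinear_maps_def by blast
 then show ?thesis by simp
qed

text \<open>The Hochschild differential is \<open>\<iota>(a1) f(a2, ...) - T f\<close>. The
  recursion replaces an indexed sum with signs, so that identities become inductions on the list.
  The value at the empty list is a default, as arguments have length \<open>Suc n\<close>.\<close>

fun hT :: "('k, 'a, 'y) alg_scheme => ('k, 'm::ab_group_add, 'z) alg_scheme => ('a => 'm) =>
  ('a list => 'm) => 'a list => 'm" where
 "hT A M \<iota> f [] = 0"
| "hT A M \<iota> f [a] = mult M (f []) (\<iota> a)"
| "hT A M \<iota> f (a # b # as) = f (mult A a b # as) - hT A M \<iota> (%xs. f (a # xs)) (b # as)"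

text \<open>Covers all coefficients at once: \<open>A\<close> itself, the smash product and its
  twist.\<close>

locale hochschild =
 fixes A :: "('k::field, 'a::ab_group_add, 'y) alg_scheme" and M :: "('k, 'm::ab_group_add, 'z) alg_scheme"
  and \<iota> :: "'a => 'm"
 assumes alg_A: "algebra A" and alg_M: "algebra M" and iota: "linear_on A M \<iota>"
  and iota_mult: "\<And>a b. a \<in> carrier A ==> b \<in> carrier A ==> \<iota> (mult A a b) = mult M (\<iota> a) (\<iota> b)"
begin

abbreviation T where "T \<equiv> hT A M \<iota>"
abbreviation sM where "sM \<equiv> scale M"
abbreviation CA where "CA \<equiv> carrier A"
abbreviation CM where "CM \<equiv> carrier M"
abbreviation Mul where "Mul \<equiv> multilinear_maps A M"
abbreviation dd where "dd \<equiv> hoch_diff A M \<iota>"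

lemma vs_A: "vec_space A" and vs_M: "vec_space M"
 using alg_A alg_M by (auto intro: algebra_vec_space)

lemmas vM = vec_space_vector_space[OF vs_M]

lemma M_closed: "x \<in> CM ==> y \<in> CM ==> mult M x y \<in> CM" and A_closed: "a \<in> CA ==> b \<in> CA ==> mult A a b \<in> CA"
 and iota_closed: "a \<in> CA ==> \<iota> a \<in> CM" and zero_A: "0 \<in> CA"
 using bilinear_on_closed[OF algebra_bilinear[OF alg_M]] bilinear_on_closed[OF algebra_bilinear[OF alg_A]] iota
  vec_space_zero_closed[OF vs_A] by (auto simp: linear_on_def)

lemma M_uminus_closed: "x \<in> CM ==> - x \<in> CM"
 using vec_space_scale_closed[OF vs_M, of x "- 1"] vector_space_minus[OF vM, of 1 x]
  module.scale_minus_left[OF vector_space_module[OF vM], of 1 x] vector_space_one[OF vM] by simp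

lemma M_minus_closed: "x \<in> CM ==> y \<in> CM ==> x - y \<in> CM"
 using vec_space_add_closed[OF vs_M, of x "- y"] M_uminus_closed by simp

lemmas M_add_closed = vec_space_add_closed[OF vs_M] and M_scale_closed = vec_space_scale_closed[OF vs_M]
 and M_zero_closed = vec_space_zero_closed[OF vs_M]

lemma scale_uminus: "sM (- c) x = - sM c x"
 by (rule module.scale_minus_left[OF vector_space_module[OF vM]])

lemma mM_add: "x \<in> CM ==> y \<in> CM ==> z \<in> CM ==> mult M (x + y) z = mult M x z + mult M y z"
 "x \<in> CM ==> y \<in> CM ==> z \<in> CM ==> mult M z (x + y) = mult M z x + mult M z y"
 and mM_scale: "x \<in> CM ==> z \<in> CM ==> mult M (sM c x) z = sM c (mult M x z)"
 "x \<in> CM ==> z \<in> CM ==> mult M z (sM c x) = sM c (mult M z x)"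
 and mA_add: "a \<in> CA ==> b \<in> CA ==> d \<in> CA ==> mult A (a + b) d = mult A a d + mult A b d"
 "a \<in> CA ==> b \<in> CA ==> d \<in> CA ==> mult A d (a + b) = mult A d a + mult A d b"
 and mA_scale: "a \<in> CA ==> d \<in> CA ==> mult A (scale A c a) d = scale A c (mult A a d)"
 "a \<in> CA ==> d \<in> CA ==> mult A d (scale A c a) = scale A c (mult A d a)"
 using algebra_bilinear[OF alg_M] algebra_bilinear[OF alg_A] unfolding bilinear_on_def linear_on_def by auto

lemma mM_uminus: "x \<in> CM ==> z \<in> CM ==> mult M (- x) z = - mult M x z"
 "x \<in> CM ==> z \<in> CM ==> mult M z (- x) = - mult M z x"
 using mM_scale[of x z "- 1"] vector_space_one[OF vM] scale_uminus[of 1] by simp_all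

lemma mM_minus: "x \<in> CM ==> y \<in> CM ==> z \<in> CM ==> mult M (x - y) z = mult M x z - mult M y z"
 "x \<in> CM ==> y \<in> CM ==> z \<in> CM ==> mult M z (x - y) = mult M z x - mult M z y"
 using mM_add[of x "- y" z] M_uminus_closed[of y] mM_uminus[of y z] by simp_all

lemmas mM_assoc = algebra_assoc[OF alg_M] and mA_assoc = algebra_assoc[OF alg_A]

text \<open>Weaker than multilinearity, and passed on to \<open>%xs. f (a # xs)\<close> in the
  inductions.\<close>

definition vals :: "nat => ('a list => 'm) => bool" where
 "vals n f \<longleftrightarrow> (\<forall>xs\<in>tuples A n. f xs \<in> CM)"

lemma vals_Mul: "f \<in> Mul n ==> vals n f"
 by (simp add: vals_def multilinear_maps_closed)

lemma vals_Cons: "vals (Suc n) f ==> a \<in> CA ==> vals n (%xs. f (a # xs))"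
 by (simp add: vals_def tuples_simps)

lemma T_closed: "vals n f ==> as \<in> tuples A (Suc n) ==> T f as \<in> CM"
proof (induction n arbitrary: f as)
 case 0
 then obtain a where "as = [a]" "a \<in> CA" by (auto simp: tuples_simps length_Suc_conv)
 then show ?case using 0 by (simp add: M_closed iota_closed vals_def tuples_simps)
next
 case (Suc n)
 then obtain a b bs where *: "as = a # b # bs" "a \<in> CA" "b \<in> CA" "set bs \<subseteq> CA" "length bs = n"
  by (auto simp: tuples_simps length_Suc_conv)
 have "T (%xs. f (a # xs)) (b # bs) \<in> CM"
  using Suc.IH[of "%xs. f (a # xs)" "b # bs"] vals_Cons[OF Suc.prems(1)] * by (simp add: tuples_simps)
 moreover have "f (mult A a b # bs) \<in> CM"
  using Suc.prems * A_closed by (simp add: vals_def tuples_simps)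
 ultimately show ?case using * by (simp add: M_minus_closed)
qed

lemma T_cong: "(\<And>xs. xs \<in> tuples A n ==> f xs = g xs) ==> as \<in> tuples A (Suc n) ==> T f as = T g as"
proof (induction n arbitrary: f g as)
 case 0
 then obtain a where "as = [a]" "a \<in> CA" by (auto simp: tuples_simps length_Suc_conv)
 then show ?case using 0 by (simp add: tuples_simps)
next
 case (Suc n)
 then obtain a b bs where *: "as = a # b # bs" "a \<in> CA" "b \<in> CA" "set bs \<subseteq> CA" "length bs = n"
  by (auto simp: tuples_simps length_Suc_conv)
 have "T (%xs. f (a # xs)) (b # bs) = T (%xs. g (a # xs)) (b # bs)"
  using * by (intro Suc.IH) (auto simp: tuples_simps intro!: Suc.prems)
 moreover have "f (mult A a b # bs) = g (mult A a b # bs)"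
  using * A_closed by (intro Suc.prems) (simp add: tuples_simps)
 ultimately show ?case using * by simp
qed

lemma T_add: "vals n f ==> vals n g ==> as \<in> tuples A (Suc n) ==> T (%xs. f xs + g xs) as = T f as + T g as"
proof (induction n arbitrary: f g as)
 case 0
 then obtain a where "as = [a]" "a \<in> CA" by (auto simp: tuples_simps length_Suc_conv)
 then show ?case using 0 by (simp add: vals_def tuples_simps mM_add iota_closed)
next
 case (Suc n)
 then obtain a b bs where *: "as = a # b # bs" "a \<in> CA" "b # bs \<in> tuples A (Suc n)"
  by (auto simp: tuples_simps length_Suc_conv)
 show ?case
  using Suc.IH[OF vals_Cons[OF Suc.prems(1) *(2)] vals_Cons[OF Suc.prems(2) *(2)] *(3)] * by simp
qed

lemma T_scale: "vals n f ==> as \<in> tuples A (Suc n) ==> T (%xs. sM c (f xs)) as = sM c (T f as)"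
proof (induction n arbitrary: f as)
 case 0
 then obtain a where "as = [a]" "a \<in> CA" by (auto simp: tuples_simps length_Suc_conv)
 then show ?case using 0 by (simp add: vals_def tuples_simps mM_scale iota_closed)
next
 case (Suc n)
 then obtain a b bs where *: "as = a # b # bs" "a \<in> CA" "b # bs \<in> tuples A (Suc n)"
  by (auto simp: tuples_simps length_Suc_conv)
 show ?case
  using Suc.IH[OF vals_Cons[OF Suc.prems(1) *(2)] *(3)] * by (simp add: vector_space_diff[OF vM])
qed

lemma T_diff:
 assumes "vals n f" "vals n g" "as \<in> tuples A (Suc n)"
 shows "T (%xs. f xs - g xs) as = T f as - T g as"
proof -
 have "vals n (%xs. f xs - g xs)" using assms by (simp add: vals_def M_minus_closed)
 from T_add[OF this assms(2,3)] show ?thesis by simp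
qed

lemma T_mult_left: "vals n f ==> x \<in> CM ==> as \<in> tuples A (Suc n) ==> T (%xs. mult M x (f xs)) as = mult M x (T f as)"
proof (induction n arbitrary: f as)
 case 0
 then obtain a where "as = [a]" "a \<in> CA" by (auto simp: tuples_simps length_Suc_conv)
 then show ?case using 0 by (simp add: vals_def tuples_simps mM_assoc iota_closed)
next
 case (Suc n)
 then obtain a b bs where *: "as = a # b # bs" "a \<in> CA" "b # bs \<in> tuples A (Suc n)"
  by (auto simp: tuples_simps length_Suc_conv)
 have "f (mult A a b # bs) \<in> CM" using Suc.prems * by (auto simp: vals_def tuples_simps A_closed)
 then show ?case
  using Suc.IH[OF vals_Cons[OF Suc.prems(1) *(2)] Suc.prems(2) *(3)] * Suc.prems
   T_closed[OF vals_Cons[OF Suc.prems(1) *(2)] *(3)] by (simp add: mM_minus)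
qed

text \<open>One step of the recursion shifts the index by one and changes the sign, as in the sum of
  \<open>hoch_diff\<close>.\<close>

lemma T_sum: "length as = Suc n ==> T f as =
 (\<Sum>i<n. sM ((-1) ^ i) (f (take i as @ [mult A (as ! i) (as ! Suc i)] @ drop (i + 2) as))) +
 sM ((-1) ^ n) (mult M (f (butlast as)) (\<iota> (last as)))"
proof (induction n arbitrary: f as)
 case 0
 then obtain a where "as = [a]" by (auto simp: length_Suc_conv)
 then show ?case by (simp add: vector_space_one[OF vM])
next
 case (Suc n)
 then obtain a b bs where *: "as = a # b # bs" "length (b # bs) = Suc n"
  by (auto simp: length_Suc_conv)
 have "T f as = f (mult A a b # bs) - T (%xs. f (a # xs)) (b # bs)" using * by simp
 also have "... = (\<Sum>i<Suc n. sM ((-1) ^ i) (f (take i as @ [mult A (as ! i) (as ! Suc i)] @ drop (i + 2) as))) +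
   sM ((-1) ^ Suc n) (mult M (f (butlast as)) (\<iota> (last as)))"
  unfolding Suc.IH[OF *(2)] sum.lessThan_Suc_shift
  by (simp add: * vector_space_one[OF vM] scale_uminus sum_negf)
 finally show ?case .
qed

lemma diff_apply:
 assumes "as \<in> tuples A (Suc n)"
 shows "dd n f as = mult M (\<iota> (hd as)) (f (tl as)) - T f as"
 using assms T_sum[of as n f] by (simp add: hoch_diff_def restr_def tuples_simps scale_uminus sum_negf)

lemma diff_outside: "as \<notin> tuples A (Suc n) ==> dd n f as = 0"
 by (simp add: hoch_diff_def restr_def)

text \<open>The slot can be merged with its left or its right neighbour, hence the cases on how many
  arguments stand before it.\<close>

lemma T_slot:
 assumes "\<And>us vs. set us \<subseteq> CA ==> set vs \<subseteq> CA ==> Suc (length us + length vs) = n ==>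
   linear_on A M (%x. f (us @ x # vs))" "vals n f"
  and "set us \<subseteq> CA" "set vs \<subseteq> CA" "length us + length vs = n"
 shows "linear_on A M (%x. T f (us @ x # vs))"
 using assms
proof (induction n arbitrary: f us vs)
 case 0
 then show ?case using iota by (simp add: linear_on_def M_closed mM_add mM_scale vals_def tuples_simps)
next
 case (Suc n)
 note slot = Suc.prems(1)
 have tup: "us @ x # vs \<in> tuples A (Suc (Suc n))" if "x \<in> CA" for x
  using that Suc.prems by (simp add: tuples_simps)
 show ?case
 proof (cases us)
  case Nil
  then obtain b bs where vs: "vs = b # bs" "b \<in> CA" "set bs \<subseteq> CA" "length bs = n"
   using Suc.prems by (auto simp: length_Suc_conv)
  have bs: "b # bs \<in> tuples A (Suc n)" using vs by (simp add: tuples_simps)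
  have v: "vals n (%xs. f (x # xs))" if "x \<in> CA" for x
   using vals_Cons[OF Suc.prems(2) that] .
  have f0: "linear_on A M (%x. f (x # xs))" if "xs \<in> tuples A n" for xs
   using slot[of "[]" xs] that by (simp add: tuples_simps)
  have "f (mult A (x + y) b # bs) = f (mult A x b # bs) + f (mult A y b # bs)" if "x \<in> CA" "y \<in> CA" for x y
   using f0[of bs] vs that by (simp add: linear_on_def mA_add A_closed tuples_simps)
  moreover have "f (mult A (scale A c x) b # bs) = sM c (f (mult A x b # bs))" if "x \<in> CA" for x c
   using f0[of bs] vs that by (simp add: linear_on_def mA_scale A_closed tuples_simps)
  moreover have "T (%xs. f ((x + y) # xs)) (b # bs) = T (%xs. f (x # xs)) (b # bs) + T (%xs. f (y # xs)) (b # bs)"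
   if "x \<in> CA" "y \<in> CA" for x y
   unfolding T_add[OF v[OF that(1)] v[OF that(2)] bs, symmetric]
   by (rule T_cong[OF _ bs]) (use f0 that in \<open>auto simp: linear_on_def\<close>)
  moreover have "T (%xs. f (scale A c x # xs)) (b # bs) = sM c (T (%xs. f (x # xs)) (b # bs))"
   if "x \<in> CA" for x c
   unfolding T_scale[OF v[OF that] bs, symmetric]
   by (rule T_cong[OF _ bs]) (use f0 that in \<open>auto simp: linear_on_def\<close>)
  ultimately show ?thesis
   using Nil vs T_closed[OF Suc.prems(2) tup]
   by (simp add: linear_on_def vector_space_diff[OF vM])
 next
  case (Cons a ws)
  have a: "a \<in> CA" "set ws \<subseteq> CA" using Cons Suc.prems by auto
  have 1: "linear_on A M (%x. T (%xs. f (a # xs)) (ws @ x # vs))"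
  proof (rule Suc.IH)
   show "linear_on A M (%x. f (a # us @ x # vs))"
    if "set us \<subseteq> CA" "set vs \<subseteq> CA" "Suc (length us + length vs) = n" for us vs
    using slot[of "a # us" vs] that a by simp
  qed (use vals_Cons[OF Suc.prems(2) a(1)] Cons Suc.prems a in auto)
  \<comment> \<open>\<open>hd\<close> and \<open>tl\<close> cover two situations: the slot is the
    second argument and is multiplied by \<open>a\<close>, or it comes later.\<close>
  have 2: "linear_on A M (%x. f (mult A a (hd (ws @ x # vs)) # tl (ws @ x # vs)))"
  proof (cases ws)
   case Nil
   have "linear_on A A (mult A a)" using algebra_bilinear[OF alg_A] a by (auto simp: bilinear_on_def)
   moreover have "linear_on A M (%x. f (x # vs))"
    using slot[of "[]" vs] Suc.prems Cons Nil by simp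
   ultimately show ?thesis using Nil linear_on_compose[of A A "mult A a" M "%x. f (x # vs)"] by simp
  next
   case (Cons b ys)
   then show ?thesis
    using slot[of "mult A a b # ys" vs] Suc.prems \<open>us = a # ws\<close> a A_closed by simp
  qed
  have "T f (us @ x # vs) = f (mult A a (hd (ws @ x # vs)) # tl (ws @ x # vs)) - T (%xs. f (a # xs)) (ws @ x # vs)" for x
   using Cons by (cases ws) auto
  then show ?thesis
   using 1 2 unfolding linear_on_def by (simp add: M_minus_closed vector_space_diff[OF vM])
 qed
qed

lemma diff_closed:
 assumes "f \<in> Mul n" shows "dd n f \<in> Mul (Suc n)"
proof (rule multilinear_mapsI)
 show "dd n f as = 0" if "as \<notin> tuples A (Suc n)" for as using that by (rule diff_outside)
 have v: "vals n f" by (rule vals_Mul[OF assms])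
 have cl: "mult M (\<iota> (hd as)) (f (tl as)) \<in> CM" if "as \<in> tuples A (Suc n)" for as
  using that v by (cases as) (auto simp: vals_def tuples_simps M_closed iota_closed)
 then show "dd n f as \<in> CM" if "as \<in> tuples A (Suc n)" for as
  using that T_closed[OF v] by (simp add: diff_apply M_minus_closed)
 fix us vs assume *: "set us \<subseteq> CA" "set vs \<subseteq> CA" "Suc (length us + length vs) = Suc n"
 note slot = multilinear_maps_slot[OF assms zero_A]
 have 1: "linear_on A M (%x. T f (us @ x # vs))"
  by (rule T_slot[OF slot v]) (use * in auto)
 have 2: "linear_on A M (%x. mult M (\<iota> (hd (us @ x # vs))) (f (tl (us @ x # vs))))"
 proof (cases us)
  case Nil
  then have "f vs \<in> CM" using * v by (simp add: vals_def tuples_simps)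
  then have "linear_on M M (%y. mult M y (f vs))" using algebra_bilinear[OF alg_M] by (auto simp: bilinear_on_def)
  then show ?thesis using linear_on_compose[OF iota] Nil by simp
 next
  case (Cons a ws)
  then have "\<iota> a \<in> CM" using * iota_closed by simp
  then have "linear_on M M (mult M (\<iota> a))" using algebra_bilinear[OF alg_M] by (auto simp: bilinear_on_def)
  moreover have "linear_on A M (%x. f (ws @ x # vs))" using slot[of ws vs] Cons * by simp
  ultimately show ?thesis
   using linear_on_compose[of A M "%x. f (ws @ x # vs)" M "mult M (\<iota> a)"] Cons by simp
 qed
 have "dd n f (us @ x # vs) = mult M (\<iota> (hd (us @ x # vs))) (f (tl (us @ x # vs))) - T f (us @ x # vs)"
  if "x \<in> CA" for x
  by (rule diff_apply) (use * that in \<open>simp add: tuples_simps\<close>)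
 then show "linear_on A M (%x. dd n f (us @ x # vs))"
  using 1 2 vec_space_closed[OF vs_A] unfolding linear_on_def
  by (simp add: M_minus_closed vector_space_diff[OF vM])
qed

text \<open>The square of the differential with the leading terms split off. In the induction the
  terms in \<open>a(bc)\<close> and \<open>(ab)c\<close> meet by associativity, and the terms with
  \<open>bc\<close> as a separate argument cancel. The base case is
  \<open>iota_mult\<close>.\<close>

lemma T_T: "vals n f ==> a \<in> CA ==> b \<in> CA ==> bs \<in> tuples A n ==>
 T (%xs. T f (a # xs)) (b # bs) = T f (mult A a b # bs)"
proof (induction n arbitrary: f a b bs)
 case 0
 then show ?case by (simp add: tuples_simps vals_def mM_assoc iota_closed iota_mult)
next
 case (Suc n)
 then obtain c cs where *: "bs = c # cs" "c \<in> CA" "cs \<in> tuples A n"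
  by (auto simp: tuples_simps length_Suc_conv)
 have ab: "mult A a b \<in> CA" "mult A b c \<in> CA" using Suc.prems * by (auto intro: A_closed)
 have cc: "c # cs \<in> tuples A (Suc n)" using * by (simp add: tuples_simps)
 note v = vals_Cons[OF Suc.prems(1)]
 have "T (%xs. T f (a # b # xs)) (c # cs) =
   T (%xs. f (mult A a b # xs) - T (%xs. f (a # xs)) (b # xs)) (c # cs)" by simp
 also have "... = T (%xs. f (mult A a b # xs)) (c # cs) - T (%xs. T (%xs. f (a # xs)) (b # xs)) (c # cs)"
 proof (rule T_diff[OF v[OF ab(1)] _ cc])
  show "vals n (%xs. T (%xs. f (a # xs)) (b # xs))"
   unfolding vals_def using Suc.prems T_closed[OF v[OF Suc.prems(2)]] by (simp add: tuples_simps)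
 qed
 also have "T (%xs. T (%xs. f (a # xs)) (b # xs)) (c # cs) = T (%xs. f (a # xs)) (mult A b c # cs)"
  by (rule Suc.IH[OF v[OF Suc.prems(2)] Suc.prems(3) *(2,3)])
 finally show ?case using * Suc.prems by (simp add: mA_assoc)
qed

lemma diff_diff:
 assumes "f \<in> Mul n" shows "dd (Suc n) (dd n f) = 0"
proof
 fix as
 note v = vals_Mul[OF assms]
 show "dd (Suc n) (dd n f) as = 0 as"
 proof (cases "as \<in> tuples A (Suc (Suc n))")
  case True
  then obtain a b bs where *: "as = a # b # bs" "a \<in> CA" "b \<in> CA" "bs \<in> tuples A n"
   by (auto simp: tuples_simps length_Suc_conv)
  have t: "b # bs \<in> tuples A (Suc n)" "mult A a b # bs \<in> tuples A (Suc n)"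
   using * by (auto simp: tuples_simps A_closed)
  have cl: "\<iota> a \<in> CM" "\<iota> b \<in> CM" "f bs \<in> CM" using * v by (auto simp: vals_def iota_closed)
  have va: "vals n (%xs. T f (a # xs))"
   unfolding vals_def using * T_closed[OF v] by (simp add: tuples_simps)
  have vm: "vals n (%xs. mult M (\<iota> a) (f xs))"
   using v cl by (simp add: vals_def M_closed)
  have "T (%xs. dd n f (a # xs)) (b # bs) = T (%xs. mult M (\<iota> a) (f xs) - T f (a # xs)) (b # bs)"
   by (rule T_cong[OF _ t(1)]) (use * in \<open>simp add: diff_apply tuples_simps\<close>)
  also have "... = mult M (\<iota> a) (T f (b # bs)) - T f (mult A a b # bs)"
   by (simp add: T_diff[OF vm va t(1)] T_mult_left[OF v cl(1) t(1)] T_T[OF v *(2-4)])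
  finally have "T (%xs. dd n f (a # xs)) (b # bs) = mult M (\<iota> a) (T f (b # bs)) - T f (mult A a b # bs)" .
  then show ?thesis
   using True * t cl T_closed[OF v t(1)]
   by (simp add: diff_apply mM_minus M_closed iota_mult mM_assoc)
 qed (simp add: diff_outside)
qed

lemma diff_add:
 assumes "f \<in> Mul n" "g \<in> Mul n" shows "dd n (f + g) = dd n f + dd n g"
proof
 fix as
 show "dd n (f + g) as = (dd n f + dd n g) as"
 proof (cases "as \<in> tuples A (Suc n)")
  case True
  have "f (tl as) \<in> CM" "g (tl as) \<in> CM" "\<iota> (hd as) \<in> CM"
   using vals_Mul[OF assms(1)] vals_Mul[OF assms(2)] True
   by (auto simp: vals_def tuples_simps iota_closed length_Suc_conv)
  moreover have "T (f + g) as = T f as + T g as"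
   using T_add[OF vals_Mul[OF assms(1)] vals_Mul[OF assms(2)] True] by (simp add: plus_fun_def)
  ultimately show ?thesis using True by (simp add: diff_apply mM_add)
 qed (simp add: diff_outside)
qed

lemma diff_scale:
 assumes "f \<in> Mul n" shows "dd n (%as. sM c (f as)) = (%as. sM c (dd n f as))"
proof
 fix as
 show "dd n (%as. sM c (f as)) as = sM c (dd n f as)"
 proof (cases "as \<in> tuples A (Suc n)")
  case True
  have "f (tl as) \<in> CM" "\<iota> (hd as) \<in> CM"
   using vals_Mul[OF assms] True
   by (auto simp: vals_def tuples_simps iota_closed length_Suc_conv)
  then show ?thesis using True T_scale[OF vals_Mul[OF assms] True]
   by (simp add: diff_apply mM_scale vector_space_diff[OF vM])
 qed (simp add: diff_outside vector_space_zero[OF vM])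
qed

lemma Mul_zero: "0 \<in> Mul n"
 by (rule multilinear_mapsI) (auto simp: linear_on_def M_zero_closed vector_space_zero[OF vM])

lemma Mul_add: assumes "f \<in> Mul n" "g \<in> Mul n" shows "f + g \<in> Mul n"
 using assms unfolding multilinear_maps_def linear_on_def
 by (auto simp: M_add_closed vector_space_add[OF vM])

lemma Mul_scale: assumes "f \<in> Mul n" shows "(%as. sM c (f as)) \<in> Mul n"
 using assms unfolding multilinear_maps_def linear_on_def
 by (auto simp: M_scale_closed vector_space_add[OF vM] vector_space_mult[OF vM] vector_space_zero[OF vM] mult.commute)

lemma hoch_cpx_simps:
 "gcar (hoch_cpx A M \<iota>) = Mul" "gadd (hoch_cpx A M \<iota>) = (%n. (+))" "gzero (hoch_cpx A M \<iota>) = (%n. 0)"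
 "gscale (hoch_cpx A M \<iota>) = (%n c f as. sM c (f as))" "gdiff (hoch_cpx A M \<iota>) = dd"
 by (simp_all add: hoch_cpx_def)

lemma is_complex_hoch_cpx: "is_complex (hoch_cpx A M \<iota>)"
 unfolding is_complex_def hoch_cpx_simps
proof (intro allI conjI ballI)
 fix n f assume f: "f \<in> Mul n"
 show "\<exists>g\<in>Mul n. f + g = 0"
 proof
  show "(%as. sM (- 1) (f as)) \<in> Mul n" by (rule Mul_scale[OF f])
  show "f + (%as. sM (- 1) (f as)) = 0"
   by (simp add: fun_eq_iff scale_uminus vector_space_one[OF vM])
 qed
qed (auto simp: Mul_zero Mul_add Mul_scale diff_closed diff_diff diff_add diff_scale add.commute add.assoc fun_eq_iff
  vector_space_add[OF vM] vector_space_add_left[OF vM] vector_space_mult[OF vM] vector_space_one[OF vM])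

subsection \<open>Cup products\<close>

abbreviation cp where "cp \<equiv> cup A (mult M)"

lemma cup_apply: "as \<in> tuples A (m + n) ==> cup A \<mu> m n f g as = \<mu> (f (take m as)) (g (drop m as))"
 by (simp add: cup_def restr_def)

lemma cup_outside: "as \<notin> tuples A (m + n) ==> cup A \<mu> m n f g as = 0"
 by (simp add: cup_def restr_def)

lemma tuples_take: "as \<in> tuples A (m + n) ==> take m as \<in> tuples A m"
 and tuples_drop: "as \<in> tuples A (m + n) ==> drop m as \<in> tuples A n"
 using set_take_subset[of m as] set_drop_subset[of m as] by (auto simp: tuples_simps)

lemma cup_closed:
 assumes f: "f \<in> Mul m" and g: "g \<in> Mul n" shows "cp m n f g \<in> Mul (m + n)"
proof (rule multilinear_mapsI)
 show "cp m n f g as = 0" if "as \<notin> tuples A (m + n)" for as using that by (rule cup_outside)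
 show "cp m n f g as \<in> CM" if "as \<in> tuples A (m + n)" for as
  using that multilinear_maps_closed[OF f tuples_take[OF that]] multilinear_maps_closed[OF g tuples_drop[OF that]]
  by (simp add: cup_apply M_closed)
 fix us vs assume *: "set us \<subseteq> CA" "set vs \<subseteq> CA" "Suc (length us + length vs) = m + n"
 have ap: "cp m n f g (us @ x # vs) = mult M (f (take m (us @ x # vs))) (g (drop m (us @ x # vs)))"
  if "x \<in> CA" for x using that * by (intro cup_apply) (simp add: tuples_simps)
 have "linear_on A M (%x. mult M (f (take m (us @ x # vs))) (g (drop m (us @ x # vs))))"
 proof (cases "length us < m")
  case True
  then obtain k where k: "m = Suc (length us + k)" using less_imp_Suc_add by blast
  have "g (drop k vs) \<in> CM"
   using * k set_drop_subset[of k vs] by (intro multilinear_maps_closed[OF g]) (auto simp: tuples_simps)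
  then have "linear_on M M (%y. mult M y (g (drop k vs)))" using algebra_bilinear[OF alg_M] by (auto simp: bilinear_on_def)
  moreover have "linear_on A M (%x. f (us @ x # take k vs))"
   using * k set_take_subset[of k vs] by (intro multilinear_maps_slot[OF f zero_A]) auto
  ultimately show ?thesis
   using linear_on_compose[of A M "%x. f (us @ x # take k vs)" M] k by simp
 next
  case False
  have "f (take m us) \<in> CM"
   using * False set_take_subset[of m us] by (intro multilinear_maps_closed[OF f]) (auto simp: tuples_simps)
  then have "linear_on M M (mult M (f (take m us)))" using algebra_bilinear[OF alg_M] by (auto simp: bilinear_on_def)
  moreover have "linear_on A M (%x. g (drop m us @ x # vs))"
   using * False set_drop_subset[of m us] by (intro multilinear_maps_slot[OF g zero_A]) auto
  ultimately show ?thesis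
   using linear_on_compose[of A M "%x. g (drop m us @ x # vs)" M] False by simp
 qed
 then show "linear_on A M (%x. cp m n f g (us @ x # vs))"
  using vec_space_closed[OF vs_A] unfolding linear_on_def by (simp add: ap)
qed

text \<open>The graded Leibniz rule with the leading term split off. The recursion uses up the
  arguments of \<open>f\<close>; when none is left, the product of \<open>f []\<close> and
  \<open>\<iota> a\<close> is both the last term of \<open>T f\<close> and the source of the leading
  term of \<open>dd g\<close>, and these cancel.\<close>

lemma T_cup:
 assumes "g \<in> Mul n"
 shows "vals m f ==> as \<in> tuples A (Suc (m + n)) ==>
  T (%xs. mult M (f (take m xs)) (g (drop m xs))) as =
  mult M (T f (take (Suc m) as)) (g (drop (Suc m) as)) - sM ((-1) ^ m) (mult M (f (take m as)) (dd n g (drop m as)))"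
proof (induction m arbitrary: f as)
 case 0
 then obtain a bs where *: "as = a # bs" "a \<in> CA" "bs \<in> tuples A n"
  by (auto simp: tuples_simps length_Suc_conv)
 have cl: "f [] \<in> CM" "\<iota> a \<in> CM" "g bs \<in> CM"
  using 0 * iota_closed multilinear_maps_closed[OF assms] by (auto simp: vals_def tuples_simps)
 have t: "as \<in> tuples A (Suc n)" using 0 by simp
 show ?case
  using * cl T_mult_left[OF vals_Mul[OF assms] cl(1) t] T_closed[OF vals_Mul[OF assms] t]
  by (simp add: diff_apply[OF t, unfolded *(1)] vector_space_one[OF vM] mM_minus mM_assoc M_closed)
next
 case (Suc m)
 then obtain a b bs where *: "as = a # b # bs" "a \<in> CA" "b \<in> CA" "set bs \<subseteq> CA" "length bs = m + n"
  by (auto simp: tuples_simps length_Suc_conv)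
 have t: "b # bs \<in> tuples A (Suc (m + n))" using * by (simp add: tuples_simps)
 note v = vals_Cons[OF Suc.prems(1) *(2)]
 have c: "f (mult A a b # take m bs) \<in> CM" "g (drop m bs) \<in> CM" "T (%xs. f (a # xs)) (b # take m bs) \<in> CM"
  using Suc.prems * set_take_subset[of m bs] set_drop_subset[of m bs] T_closed[OF v, of "b # take m bs"]
   multilinear_maps_closed[OF assms, of "drop m bs"] A_closed
  by (auto simp: vals_def tuples_simps)
 show ?case
  using Suc.IH[OF v t] * c by (simp add: mM_minus scale_uminus)
qed

lemma diff_cup:
 assumes f: "f \<in> Mul m" and g: "g \<in> Mul n"
 shows "dd (m + n) (cp m n f g) = cp (Suc m) n (dd m f) g + (%as. sM ((-1) ^ m) (cp m (Suc n) f (dd n g) as))"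
proof
 fix as
 show "dd (m + n) (cp m n f g) as = (cp (Suc m) n (dd m f) g + (%as. sM ((-1) ^ m) (cp m (Suc n) f (dd n g) as))) as"
 proof (cases "as \<in> tuples A (Suc (m + n))")
  case True
  then obtain a bs where *: "as = a # bs" "a \<in> CA" "bs \<in> tuples A (m + n)"
   by (auto simp: tuples_simps length_Suc_conv)
  have t1: "take (Suc m) as \<in> tuples A (Suc m)" using tuples_take[of as "Suc m" n] True by simp
  have cl: "\<iota> a \<in> CM" "f (take m bs) \<in> CM" "g (drop m bs) \<in> CM" "T f (take (Suc m) as) \<in> CM"
   using * iota_closed multilinear_maps_closed[OF f tuples_take[OF *(3)]]
    multilinear_maps_closed[OF g tuples_drop[OF *(3)]] T_closed[OF vals_Mul[OF f] t1] by auto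
  have "T (cp m n f g) as = T (%xs. mult M (f (take m xs)) (g (drop m xs))) as"
   by (rule T_cong[OF _ True]) (simp add: cup_apply)
  with True * cl t1 T_cup[OF g vals_Mul[OF f] True] show ?thesis
   by (simp add: diff_apply cup_apply mM_minus M_closed mM_assoc)
 qed (simp add: diff_outside cup_outside vector_space_zero[OF vM])
qed

lemma hoch_alg_simps:
 "gcar (hoch_alg A M \<iota>) = Mul" "gadd (hoch_alg A M \<iota>) = (%n. (+))" "gzero (hoch_alg A M \<iota>) = (%n. 0)"
 "gscale (hoch_alg A M \<iota>) = (%n c f as. sM c (f as))" "gdiff (hoch_alg A M \<iota>) = dd"
 "gmult (hoch_alg A M \<iota>) = cp" "gunit (hoch_alg A M \<iota>) = restr (tuples A 0) (%_. unity M)"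
 by (simp_all add: hoch_alg_def hoch_cpx_def cpx.defs dgalg.defs)

lemma is_complex_hoch_alg: "is_complex (hoch_alg A M \<iota>)"
 using is_complex_hoch_cpx unfolding is_complex_def hoch_cpx_simps hoch_alg_simps .

lemma unit_closed: "restr (tuples A 0) (%_. unity M) \<in> Mul 0"
 by (rule multilinear_mapsI) (auto simp: restr_def tuples_simps algebra_unity_closed[OF alg_M])

lemma is_dg_algebra_hoch_alg: "is_dg_algebra (hoch_alg A M \<iota>)"
 unfolding is_dg_algebra_def hoch_alg_simps
proof (intro conjI allI ballI is_complex_hoch_alg unit_closed)
 fix n f assume f: "f \<in> Mul n"
 have "cp 0 n (restr (tuples A 0) (%_. unity M)) f as = f as"
  "cp n 0 f (restr (tuples A 0) (%_. unity M)) as = f as" for as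
  using multilinear_maps_closed[OF f, of as] multilinear_maps_zero[OF f, of as]
  by (auto simp: cup_def restr_def tuples_simps algebra_unity_left[OF alg_M] algebra_unity_right[OF alg_M])
 then show "cp 0 n (restr (tuples A 0) (%_. unity M)) f = f" "cp n 0 f (restr (tuples A 0) (%_. unity M)) = f"
  by auto
next
 fix m n f g assume f: "f \<in> Mul m" and g: "g \<in> Mul n"
 show "cp m n f g \<in> Mul (m + n)" by (rule cup_closed[OF f g])
 show "dd (m + n) (cp m n f g) = cp (Suc m) n (dd m f) g + (%as. sM ((-1) ^ m) (cp m (Suc n) f (dd n g) as))"
  by (rule diff_cup[OF f g])
 note cl = multilinear_maps_closed[OF f tuples_take] multilinear_maps_closed[OF g tuples_drop]
 show "cp m n (%as. sM c (f as)) g = (%as. sM c (cp m n f g as))"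
  "cp m n f (%as. sM c (g as)) = (%as. sM c (cp m n f g as))" for c
  by (auto simp: cup_def restr_def fun_eq_iff vector_space_zero[OF vM] intro!: mM_scale cl)
 show "cp m n (f + f') g = cp m n f g + cp m n f' g" if "f' \<in> Mul m" for f'
  using multilinear_maps_closed[OF that tuples_take] cl
  by (auto simp: cup_def restr_def fun_eq_iff mM_add)
 show "cp m n f (g + g') = cp m n f g + cp m n f g'" if "g' \<in> Mul n" for g'
  using multilinear_maps_closed[OF that tuples_drop] cl
  by (auto simp: cup_def restr_def fun_eq_iff mM_add)
 fix l h assume h: "h \<in> Mul l"
 show "cp (m + n) l (cp m n f g) h = cp m (n + l) f (cp n l g h)"
 proof
  fix as
  show "cp (m + n) l (cp m n f g) h as = cp m (n + l) f (cp n l g h) as"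
  proof (cases "as \<in> tuples A (m + n + l)")
   case True
   have t: "take (m + n) as \<in> tuples A (m + n)" "as \<in> tuples A (m + (n + l))" "drop m as \<in> tuples A (n + l)"
    using True tuples_take tuples_drop[of as m "n + l"] by (auto simp: add.assoc)
   have "f (take m as) \<in> CM" "g (take n (drop m as)) \<in> CM" "h (drop (m + n) as) \<in> CM"
    using multilinear_maps_closed[OF f tuples_take[OF t(2)]] multilinear_maps_closed[OF g tuples_take[OF t(3)]]
     multilinear_maps_closed[OF h tuples_drop[OF True]] by auto
   then show ?thesis
    using True t by (simp add: cup_apply mM_assoc drop_take add.commute)
  qed (simp add: cup_outside add.assoc)
 qed
qed

end


section \<open>Cohomology of dg structures\<close>

text \<open>Cochains are functions with pointwise operations, while the elements of cohomology are
  cosets. The locale describes the former, and properties of \<open>coh\<close> are derived from it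
  through classes.\<close>

locale additive_complex =
 fixes X :: "('k::field, 'c::ab_group_add, 'z) cpx_scheme"
 assumes complex: "is_complex X" and gadd: "gadd X = (%n. (+))" and gzero: "gzero X = (%n. 0)"
  and vs: "\<And>n. vector_space (gscale X n)"
begin

abbreviation C where "C \<equiv> gcar X"
abbreviation Z where "Z \<equiv> cocycles X"
abbreviation Bd where "Bd \<equiv> coboundaries X"
abbreviation d where "d \<equiv> gdiff X"
abbreviation cl where "cl \<equiv> class_of X"

lemma C_zero: "0 \<in> C n" and C_add: "x \<in> C n ==> y \<in> C n ==> x + y \<in> C n"
 and C_uminus: "x \<in> C n ==> - x \<in> C n" and C_scale: "x \<in> C n ==> gscale X n c x \<in> C n"
 and d_closed: "x \<in> C n ==> d n x \<in> C (Suc n)" and d_d: "x \<in> C n ==> d (Suc n) (d n x) = 0"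
 and d_add: "x \<in> C n ==> y \<in> C n ==> d n (x + y) = d n x + d n y"
 and d_scale: "x \<in> C n ==> d n (gscale X n c x) = gscale X (Suc n) c (d n x)"
proof -
 note c = complex[unfolded is_complex_def gadd gzero, THEN spec, of n]
 show "0 \<in> C n" "x \<in> C n ==> y \<in> C n ==> x + y \<in> C n" "x \<in> C n ==> gscale X n c x \<in> C n"
  "x \<in> C n ==> d n x \<in> C (Suc n)" "x \<in> C n ==> d (Suc n) (d n x) = 0"
  "x \<in> C n ==> y \<in> C n ==> d n (x + y) = d n x + d n y"
  "x \<in> C n ==> d n (gscale X n c x) = gscale X (Suc n) c (d n x)"
  using c by simp_all
 have "\<forall>x\<in>C n. \<exists>y\<in>C n. x + y = 0" using c by simp
 then show "x \<in> C n ==> - x \<in> C n" using minus_unique by metis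
qed

lemma d_zero: "d n 0 = 0"
 using d_add[OF C_zero C_zero, of n] by simp

lemma Z_def: "x \<in> Z n \<longleftrightarrow> x \<in> C n \<and> d n x = 0"
 by (simp add: cocycles_def gzero)

lemma Z_C: "x \<in> Z n ==> x \<in> C n"
 by (simp add: Z_def)

lemma Bd_0 [simp]: "Bd 0 = {0}" and Bd_Suc [simp]: "Bd (Suc n) = d n ` C n"
 by (simp_all add: coboundaries_def gzero)

lemma Bd_zero: "0 \<in> Bd n"
 using d_zero C_zero by (cases n) (auto simp: image_iff intro!: bexI[of _ 0])

lemma Bd_add: "x \<in> Bd n ==> y \<in> Bd n ==> x + y \<in> Bd n"
 using d_add C_add by (cases n) (auto simp: image_iff, metis)

lemma Bd_scale: "x \<in> Bd n ==> gscale X n c x \<in> Bd n"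
 using d_scale C_scale by (cases n) (auto simp: image_iff vector_space_zero[OF vs], metis)

lemma Bd_uminus: "x \<in> Bd n ==> - x \<in> Bd n"
proof (cases n)
 case (Suc k)
 assume "x \<in> Bd n"
 then obtain a where a: "a \<in> C k" "x = d k a" using Suc by auto
 have "d k (- a) = - x" using d_add[OF a(1) C_uminus[OF a(1)]] d_zero a(2) by (simp add: eq_neg_iff_add_eq_0 add.commute)
 then show ?thesis using Suc C_uminus[OF a(1)] by (auto simp: image_iff intro!: bexI[of _ "- a"])
qed simp

lemma Bd_Z: "x \<in> Bd n ==> x \<in> Z n"
 by (cases n) (auto simp: Z_def C_zero d_zero d_closed d_d)

lemma Z_zero: "0 \<in> Z n" and Z_add: "x \<in> Z n ==> y \<in> Z n ==> x + y \<in> Z n"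
 and Z_scale: "x \<in> Z n ==> gscale X n c x \<in> Z n"
 by (simp_all add: Z_def C_zero d_zero C_add d_add C_scale d_scale vector_space_zero[OF vs])

lemma Z_uminus: "x \<in> Z n ==> - x \<in> Z n"
 using d_add[of x n "- x"] d_zero[of n] C_uminus by (simp add: Z_def)

lemma class_of_eq: "cl n x = (+) x ` Bd n"
 by (simp add: class_of_def gadd)

lemma class_of_self: "x \<in> cl n x"
 using Bd_zero by (auto simp: class_of_eq image_iff intro!: bexI[of _ 0])

lemma class_of_mem: "p \<in> cl n x ==> \<exists>b\<in>Bd n. p = x + b"
 by (auto simp: class_of_eq)

lemma class_of_cong:
 assumes "y - x \<in> Bd n" shows "cl n y = cl n x"
proof -
 have "cl n y \<subseteq> cl n x" if "y - x \<in> Bd n" for x y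
 proof
  fix p assume "p \<in> cl n y"
  then obtain b where "b \<in> Bd n" "p = y + b" by (auto simp: class_of_eq)
  then show "p \<in> cl n x"
   using that Bd_add unfolding class_of_eq by (intro image_eqI[of _ _ "(y - x) + b"]) auto
 qed
 moreover have "x - y \<in> Bd n" using Bd_uminus[OF assms] by simp
 ultimately show ?thesis using assms by blast
qed

text \<open>Operations on cohomology are unions over representatives. When all representatives give
  the same coset, the nonempty union is that coset.\<close>

lemma UN_class:
 assumes "\<And>b. b \<in> Bd n ==> g (x + b) = R"
 shows "(\<Union>p\<in>cl n x. g p) = R"
proof -
 have "g p = R" if "p \<in> cl n x" for p
  using class_of_mem[OF that] assms by blast
 then have "(\<Union>p\<in>cl n x. g p) = (\<Union>p\<in>cl n x. R)" by simp
 also have "... = R" using class_of_self[of x n] by auto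
 finally show ?thesis .
qed

lemma coh_gcar: "gcar (coh X) n = cl n ` Z n"
 and coh_gzero: "gzero (coh X) n = cl n 0"
 and coh_gdiff: "gdiff (coh X) n P = cl (Suc n) 0"
 by (simp_all add: coh_def gzero)

lemma coh_gadd: "gadd (coh X) n (cl n x) (cl n y) = cl n (x + y)"
proof -
 have "gadd (coh X) n (cl n x) (cl n y) = (\<Union>p\<in>cl n x. \<Union>q\<in>cl n y. cl n (p + q))"
  by (simp add: coh_def gadd)
 also have "... = (\<Union>p\<in>cl n x. cl n (p + y))"
 proof -
  have "(\<Union>q\<in>cl n y. cl n (p + q)) = cl n (p + y)" for p
   by (rule UN_class[where g = "%q. cl n (p + q)"]) (rule class_of_cong, simp add: algebra_simps)
  then show ?thesis by simp
 qed
 also have "... = cl n (x + y)"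
  by (rule UN_class[where g = "%p. cl n (p + y)"]) (rule class_of_cong, simp add: algebra_simps)
 finally show ?thesis .
qed

lemma coh_gscale: "gscale (coh X) n c (cl n x) = cl n (gscale X n c x)"
proof -
 have "gscale (coh X) n c (cl n x) = (\<Union>p\<in>cl n x. cl n (gscale X n c p))"
  by (simp add: coh_def)
 also have "... = cl n (gscale X n c x)"
  by (rule UN_class) (rule class_of_cong, simp add: vector_space_add[OF vs] Bd_scale)
 finally show ?thesis .
qed

lemma is_complex_coh: "is_complex (coh X)"
proof -
 have "\<exists>y\<in>Z n. cl n (x + y) = cl n 0" if "x \<in> Z n" for x n
  using Z_uminus[OF that] by (intro bexI[of _ "- x"]) simp_all
 then show ?thesis
  unfolding is_complex_def coh_gcar coh_gzero coh_gdiff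
  by (simp add: coh_gadd coh_gscale Z_zero Z_add Z_scale add_ac vector_space_add[OF vs]
   vector_space_add_left[OF vs] vector_space_mult[OF vs] vector_space_one[OF vs] vector_space_zero[OF vs])
qed

end

lemma coh_alg_simps [simp]:
 "gcar (coh_alg X) = gcar (coh X)" "gadd (coh_alg X) = gadd (coh X)" "gzero (coh_alg X) = gzero (coh X)"
 "gscale (coh_alg X) = gscale (coh X)" "gdiff (coh_alg X) = gdiff (coh X)"
 "gunit (coh_alg X) = class_of X 0 (gunit X)"
 "gmult (coh_alg X) = (%m n P Q. \<Union>p\<in>P. \<Union>q\<in>Q. class_of X (m + n) (gmult X m n p q))"
 by (simp_all add: coh_alg_def coh_def cpx.defs dgalg.defs)

lemma coh_bimod_simps [simp]:
 "gcar (coh_bimod X) = gcar (coh X)" "gadd (coh_bimod X) = gadd (coh X)" "gzero (coh_bimod X) = gzero (coh X)"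
 "gscale (coh_bimod X) = gscale (coh X)" "gdiff (coh_bimod X) = gdiff (coh X)"
 "lact (coh_bimod X) = (%m n R P. \<Union>r\<in>R. \<Union>p\<in>P. class_of X (m + n) (lact X m n r p))"
 "ract (coh_bimod X) = (%m n R P. \<Union>r\<in>R. \<Union>p\<in>P. class_of X (m + n) (ract X m n r p))"
 by (simp_all add: coh_bimod_def coh_def cpx.defs dgbimod.defs)

lemma is_complex_cong:
 assumes "gcar X = gcar Y" "gadd X = gadd Y" "gzero X = gzero Y" "gscale X = gscale Y" "gdiff X = gdiff Y"
  and "is_complex X"
 shows "is_complex Y"
proof -
 have "is_complex X = is_complex Y" unfolding is_complex_def by (simp only: assms(1-5))
 then show ?thesis using assms(6) by simp
qed

locale additive_dg_algebra = additive_complex X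
 for X :: "('k::field, 'c::ab_group_add, 'z) dgalg_scheme" +
 assumes dgalg: "is_dg_algebra X"
begin

abbreviation mul where "mul \<equiv> gmult X"

lemma mul_closed: "x \<in> C m ==> y \<in> C n ==> mul m n x y \<in> C (m + n)"
 and unit_closed: "gunit X \<in> C 0"
 and mul_unit: "x \<in> C n ==> mul 0 n (gunit X) x = x" "x \<in> C n ==> mul n 0 x (gunit X) = x"
 and d_mul: "x \<in> C m ==> y \<in> C n ==> d (m + n) (mul m n x y) =
  mul (Suc m) n (d m x) y + gscale X (Suc (m + n)) ((-1) ^ m) (mul m (Suc n) x (d n y))"
 and mul_add: "x \<in> C m ==> x' \<in> C m ==> y \<in> C n ==> mul m n (x + x') y = mul m n x y + mul m n x' y"
  "x \<in> C m ==> y \<in> C n ==> y' \<in> C n ==> mul m n x (y + y') = mul m n x y + mul m n x y'"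
 and mul_scale: "x \<in> C m ==> y \<in> C n ==> mul m n (gscale X m c x) y = gscale X (m + n) c (mul m n x y)"
  "x \<in> C m ==> y \<in> C n ==> mul m n x (gscale X n c y) = gscale X (m + n) c (mul m n x y)"
 and mul_assoc: "x \<in> C l ==> y \<in> C m ==> z \<in> C n ==> mul (l + m) n (mul l m x y) z = mul l (m + n) x (mul m n y z)"
 using dgalg unfolding is_dg_algebra_def gadd by - (elim conjE, simp)+

lemma mul_zero: "x \<in> C m ==> mul m n x 0 = 0" "y \<in> C n ==> mul m n 0 y = 0"
 using mul_add(2)[of x m 0 n 0] mul_add(1)[of 0 m 0 y n] C_zero by simp_all

lemma Z_mul: "x \<in> Z m ==> y \<in> Z n ==> mul m n x y \<in> Z (m + n)"
 using d_mul[of x m y n] by (simp add: Z_def mul_closed mul_zero C_zero vector_space_zero[OF vs])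

text \<open>The Leibniz rule for \<open>1 1 = 1\<close> yields
  \<open>d 1 = d 1 + d 1\<close>.\<close>

lemma unit_Z: "gunit X \<in> Z 0"
proof -
 let ?e = "gunit X"
 have "d 0 ?e = mul 1 0 (d 0 ?e) ?e + gscale X 1 1 (mul 0 1 ?e (d 0 ?e))"
  using d_mul[OF unit_closed unit_closed] mul_unit(1)[OF unit_closed] by simp
 then have "d 0 ?e = d 0 ?e + d 0 ?e"
  using mul_unit d_closed[OF unit_closed] by (simp add: vector_space_one[OF vs])
 then show ?thesis by (simp add: Z_def unit_closed)
qed

lemma Bd_mul_left:
 assumes "b \<in> Bd m" "y \<in> Z n" shows "mul m n b y \<in> Bd (m + n)"
proof (cases m)
 case 0
 then show ?thesis using assms mul_zero Bd_zero by (simp add: Z_def)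
next
 case (Suc k)
 then obtain a where a: "a \<in> C k" "b = d k a" using assms by auto
 have "d (k + n) (mul k n a y) = mul m n b y"
  using d_mul[OF a(1) Z_C[OF assms(2)]] assms(2) a Suc by (simp add: Z_def mul_zero vector_space_zero[OF vs])
 then show ?thesis using Suc mul_closed[OF a(1) Z_C[OF assms(2)]] by (metis Bd_Suc add_Suc imageI)
qed

lemma Bd_mul_right:
 assumes "x \<in> Z m" "b \<in> Bd n" shows "mul m n x b \<in> Bd (m + n)"
proof (cases n)
 case 0
 then show ?thesis using assms mul_zero Bd_zero by (simp add: Z_def)
next
 case (Suc k)
 then obtain a where a: "a \<in> C k" "b = d k a" using assms by auto
 have "d (m + k) (mul m k x a) = gscale X (Suc (m + k)) ((-1) ^ m) (mul m n x b)"
  using d_mul[OF Z_C[OF assms(1)] a(1)] assms(1) a Suc by (simp add: Z_def mul_zero)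
 then have "gscale X (m + n) ((-1) ^ m) (mul m n x b) \<in> Bd (m + n)"
  using Suc mul_closed[OF Z_C[OF assms(1)] a(1)] by (metis Bd_Suc add_Suc_right imageI)
 \<comment> \<open>Scaling by the sign once more removes it, and coboundaries are closed under
   scaling.\<close>
 then have "gscale X (m + n) ((-1) ^ m) (gscale X (m + n) ((-1) ^ m) (mul m n x b)) \<in> Bd (m + n)"
  by (rule Bd_scale)
 then show ?thesis
  by (simp add: vector_space_mult[OF vs] vector_space_one[OF vs] flip: power_mult_distrib)
qed

lemma coh_mul:
 assumes "x \<in> Z m" "y \<in> Z n"
 shows "gmult (coh_alg X) m n (cl m x) (cl n y) = cl (m + n) (mul m n x y)"
proof -
 have 1: "cl (m + n) (mul m n (x + b) (y + b')) = cl (m + n) (mul m n x y)"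
  if "b \<in> Bd m" "b' \<in> Bd n" for b b'
 proof (rule class_of_cong)
  have "x + b \<in> Z m" using assms that Bd_Z Z_add by blast
  moreover have "mul m n (x + b) (y + b') = mul m n x y + mul m n b y + mul m n (x + b) b'"
   using assms that Bd_Z[OF that(1)] Bd_Z[OF that(2)] by (simp add: Z_def mul_add C_add)
  ultimately show "mul m n (x + b) (y + b') - mul m n x y \<in> Bd (m + n)"
   using Bd_mul_left[OF that(1) assms(2)] Bd_mul_right[OF _ that(2)] Bd_add by simp
 qed
 have "(\<Union>q\<in>cl n y. cl (m + n) (mul m n (x + b) q)) = cl (m + n) (mul m n x y)" if "b \<in> Bd m" for b
  by (rule UN_class) (rule 1[OF that])
 then have "(\<Union>p\<in>cl m x. \<Union>q\<in>cl n y. cl (m + n) (mul m n p q)) = cl (m + n) (mul m n x y)"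
  by (rule UN_class)
 then show ?thesis by simp
qed

lemma is_dg_algebra_coh: "is_dg_algebra (coh_alg X)"
proof -
 have c: "is_complex (coh_alg X)" by (rule is_complex_cong[OF _ _ _ _ _ is_complex_coh]) simp_all
 have u: "gunit X \<in> Z 0" by (rule unit_Z)
 have 1: "gmult (coh_alg X) m n (cl m x) (cl n 0) = cl (m + n) 0" "gmult (coh_alg X) n m (cl n 0) (cl m x) = cl (n + m) 0"
  if "x \<in> Z m" for m n x
  using that by (simp_all add: coh_mul Z_zero mul_zero Z_C del: coh_alg_simps(7))
 have del: "gmult (coh_alg X) m n (cl m x) (cl n y) = cl (m + n) (mul m n x y)" if "x \<in> Z m" "y \<in> Z n" for m n x y
  using that by (rule coh_mul)
 show ?thesis
  unfolding is_dg_algebra_def coh_alg_simps(1-6) coh_gcar coh_gdiff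
 proof (intro conjI allI ballI c; (elim imageE; hypsubst)?)
 qed (use u in \<open>simp_all add: 1 Z_C del mul_zero C_zero add.assoc Z_mul Z_add Z_scale mul_unit mul_add mul_scale mul_assoc
    vector_space_zero[OF vs] Z_zero coh_gadd coh_gscale del: coh_alg_simps(7)\<close>)
qed

end

locale additive_dg_module = additive_dg_algebra X
 for X :: "('k::field, 'c::ab_group_add) dgalg" +
 fixes H :: "('k, 'h::ab_group_add) hopf" and act :: "nat => 'h => 'c => 'c"
 assumes dgmod: "is_dg_module H X act"
begin

lemma act_closed: "h \<in> carrier H ==> x \<in> C n ==> act n h x \<in> C n"
 and act_add: "h \<in> carrier H ==> x \<in> C n ==> y \<in> C n ==> act n h (x + y) = act n h x + act n h y"
 and act_plus: "h \<in> carrier H ==> g \<in> carrier H ==> x \<in> C n ==> act n (h + g) x = act n h x + act n g x"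
 and act_mult: "h \<in> carrier H ==> g \<in> carrier H ==> x \<in> C n ==> act n (h \<cdot>\<^bsub>H\<^esub> g) x = act n h (act n g x)"
 and act_gscale: "h \<in> carrier H ==> x \<in> C n ==> act n h (gscale X n c x) = gscale X n c (act n h x)"
 and act_scale: "h \<in> carrier H ==> x \<in> C n ==> act n (scale H c h) x = gscale X n c (act n h x)"
 and act_one: "x \<in> C n ==> act n (unity H) x = x"
 and act_d: "h \<in> carrier H ==> x \<in> C n ==> d n (act n h x) = act (Suc n) h (d n x)"
 using dgmod unfolding is_dg_module_def gadd by - (elim conjE, simp)+

lemma act_zero: "h \<in> carrier H ==> act n h 0 = 0"
 using act_add[of h 0 n 0] C_zero by simp

lemma act_Z: "h \<in> carrier H ==> x \<in> Z n ==> act n h x \<in> Z n"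
 by (simp add: Z_def act_closed act_d act_zero)

lemma act_Bd: "h \<in> carrier H ==> b \<in> Bd n ==> act n h b \<in> Bd n"
 by (cases n) (auto simp: act_zero act_d[symmetric] act_closed)

lemma coh_act_class:
 assumes "h \<in> carrier H" "x \<in> Z n"
 shows "coh_act X act n h (cl n x) = cl n (act n h x)"
 unfolding coh_act_def
proof (rule UN_class, rule class_of_cong)
 fix b assume b: "b \<in> Bd n"
 show "act n h (x + b) - act n h x \<in> Bd n"
  using assms b Bd_Z[OF b] by (simp add: act_add Z_C act_Bd)
qed

lemma is_dg_module_coh:
 assumes H: "algebra H"
 shows "is_dg_module H (coh_alg X) (coh_act X act)"
proof -
 note cl = bilinear_on_closed[OF algebra_bilinear[OF H]] algebra_unity_closed[OF H] vec_space_add_closed[OF algebra_vec_space[OF H]]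
  vec_space_scale_closed[OF algebra_vec_space[OF H]]
 have c: "is_complex (coh_alg X)" by (rule is_complex_cong[OF _ _ _ _ _ is_complex_coh]) simp_all
 show ?thesis
  unfolding is_dg_module_def coh_alg_simps(1-6) coh_gcar coh_gdiff
 proof (intro conjI allI ballI c; (elim imageE; hypsubst)?)
 qed (simp_all add: coh_act_class coh_gadd coh_gscale Z_zero act_Z Z_add Z_scale act_add act_gscale act_one
   act_zero Z_C act_plus act_scale act_mult cl)
qed

text \<open>On cosets \<open>lift_into\<close> works with an addition that is not that of a type.
  Every decomposition of \<open>t\<close> gives the class of a sum of cochains, and this sum is the
  same for all decompositions by \<open>sum_of_pure_unique\<close>.\<close>

lemma twisted_product_class:
 assumes H: "vec_space H" and t: "t \<in> tens_carrier H H" and x: "x \<in> Z m" and y: "y \<in> Z n"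
 shows "twisted_product (gadd (coh X) (m + n)) (gzero (coh X) (m + n)) H t (gmult (coh_alg X) m n)
   (coh_act X act m) (coh_act X act n) (cl m x) (cl n y) =
  cl (m + n) (twisted_product (+) 0 H t (mul m n) (act m) (act n) x y)"
proof -
 define \<phi> where "\<phi> h h' = mul m n (act m h x) (act n h' y)" for h h'
 define \<psi> where "\<psi> h h' = gmult (coh_alg X) m n (coh_act X act m h (cl m x)) (coh_act X act n h' (cl n y))" for h h'
 have cls: "\<psi> h h' = cl (m + n) (\<phi> h h')" if "h \<in> carrier H" "h' \<in> carrier H" for h h'
  using that x y by (simp add: \<phi>_def \<psi>_def coh_act_class coh_mul act_Z del: coh_alg_simps)
 have sum: "foldr (%(v, w). gadd (coh X) (m + n) (\<psi> v w)) ps (cl (m + n) 0) = cl (m + n) (\<Sum>(v, w)\<leftarrow>ps. \<phi> v w)"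
  if "set ps \<subseteq> carrier H \<times> carrier H" for ps
  using that by (induction ps) (auto simp: cls coh_gadd)
 have bil: "bilinear_on H H (amb (gscale X (m + n))) \<phi>"
  using x y by (simp add: bilinear_on_def linear_on_def \<phi>_def act_plus act_scale Z_C mul_add mul_scale act_closed)
 obtain ps where ps: "set ps \<subseteq> carrier H \<times> carrier H" "t = (\<Sum>(v, w)\<leftarrow>ps. tens H H v w)"
  using tens_carrier_sum_of_pure[OF H t] by blast
 have "(THE u. \<exists>ps. set ps \<subseteq> carrier H \<times> carrier H \<and> t = (\<Sum>(v, w)\<leftarrow>ps. tens H H v w) \<and>
   u = foldr (%(v, w). gadd (coh X) (m + n) (\<psi> v w)) ps (cl (m + n) 0)) = cl (m + n) (\<Sum>(v, w)\<leftarrow>ps. \<phi> v w)"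
 proof (rule the_equality)
  show "\<exists>qs. set qs \<subseteq> carrier H \<times> carrier H \<and> t = (\<Sum>(v, w)\<leftarrow>qs. tens H H v w) \<and>
   cl (m + n) (\<Sum>(v, w)\<leftarrow>ps. \<phi> v w) = foldr (%(v, w). gadd (coh X) (m + n) (\<psi> v w)) qs (cl (m + n) 0)"
   by (intro exI[of _ ps] conjI ps sum[OF ps(1), symmetric])
 next
  fix u assume "\<exists>qs. set qs \<subseteq> carrier H \<times> carrier H \<and> t = (\<Sum>(v, w)\<leftarrow>qs. tens H H v w) \<and>
   u = foldr (%(v, w). gadd (coh X) (m + n) (\<psi> v w)) qs (cl (m + n) 0)"
  then obtain qs where qs: "set qs \<subseteq> carrier H \<times> carrier H" "t = (\<Sum>(v, w)\<leftarrow>qs. tens H H v w)"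
   "u = foldr (%(v, w). gadd (coh X) (m + n) (\<psi> v w)) qs (cl (m + n) 0)" by blast
  have "(\<Sum>(v, w)\<leftarrow>qs. \<phi> v w) = (\<Sum>(v, w)\<leftarrow>ps. \<phi> v w)"
   using qs(2) ps(2) by (intro sum_of_pure_unique[OF vs bil qs(1) ps(1)]) simp
  then show "u = cl (m + n) (\<Sum>(v, w)\<leftarrow>ps. \<phi> v w)" using qs by (simp add: sum)
 qed
 moreover have "lift H H \<phi> t = (\<Sum>(v, w)\<leftarrow>ps. \<phi> v w)"
  unfolding ps(2) by (rule lift_sum_of_pure[OF vs bil ps(1)])
 ultimately show ?thesis
  unfolding twisted_product_def lift_into_def coh_gzero \<phi>_def[symmetric] \<psi>_def[symmetric] lift_def by simp
qed

lemma is_dg_module_algebra_coh: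
 assumes "is_dg_module_algebra H X act" and H: "algebra H"
  and co: "\<And>h. h \<in> carrier H ==> comult H h \<in> tens_carrier H H"
 shows "is_dg_module_algebra H (coh_alg X) (coh_act X act)"
proof -
 have 1: "act 0 h (gunit X) = gscale X 0 (counit H h) (gunit X)" if "h \<in> carrier H" for h
  using assms(1) that by (simp add: is_dg_module_algebra_def)
 have 2: "act (m + n) h (mul m n x y) = twisted_product (+) 0 H (comult H h) (mul m n) (act m) (act n) x y"
  if "h \<in> carrier H" "x \<in> C m" "y \<in> C n" for h m n x y
  using assms(1) that by (simp add: is_dg_module_algebra_def gadd gzero)
 have 3: "coh_act X act (m + n) h (gmult (coh_alg X) m n (cl m x) (cl n y)) =
  twisted_product (gadd (coh X) (m + n)) (gzero (coh X) (m + n)) H (comult H h) (gmult (coh_alg X) m n)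
   (coh_act X act m) (coh_act X act n) (cl m x) (cl n y)"
  if "h \<in> carrier H" "x \<in> Z m" "y \<in> Z n" for h m n x y
  using that by (simp add: twisted_product_class[OF algebra_vec_space[OF H] co] coh_mul coh_act_class Z_mul 2 Z_C del: coh_alg_simps)
 show ?thesis
  unfolding is_dg_module_algebra_def
 proof (intro conjI is_dg_module_coh H is_dg_algebra_coh allI ballI)
  fix h assume "h \<in> carrier H"
  then show "coh_act X act 0 h (gunit (coh_alg X)) = gscale (coh_alg X) 0 (counit H h) (gunit (coh_alg X))"
   by (simp add: coh_act_class unit_Z 1 coh_gscale)
 next
  fix m n h P Q assume "h \<in> carrier H" "P \<in> gcar (coh_alg X) m" "Q \<in> gcar (coh_alg X) n"
  then show "coh_act X act (m + n) h (gmult (coh_alg X) m n P Q) =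
   twisted_product (gadd (coh_alg X) (m + n)) (gzero (coh_alg X) (m + n)) H (comult H h) (gmult (coh_alg X) m n)
   (coh_act X act m) (coh_act X act n) P Q"
   unfolding coh_alg_simps(1-5) coh_gcar by (elim imageE; hypsubst) (rule 3)
 qed
qed

end


section \<open>Restriction of relative cochains\<close>

text \<open>Linearity in every slot of lists of every length, on the ambient spaces. Fixing the
  first argument preserves it, as recursions on the list require.\<close>

definition mlin :: "('k::field => 'v::ab_group_add => 'v) => ('v list => 'x => 'k) => bool" where
 "mlin s \<phi> \<longleftrightarrow> (\<forall>us vs. lin s fscale (%x. \<phi> (us @ x # vs)))"

lemma mlin_slot: "mlin s \<phi> ==> lin s fscale (%x. \<phi> (us @ x # vs))"
 by (simp add: mlin_def)

lemma mlin_Cons: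
 assumes "mlin s \<phi>" shows "mlin s (%as. \<phi> (a # as))"
 using mlin_slot[OF assms, of "a # us" for us] by (simp add: mlin_def)

lemma mlin_hd:
 assumes "mlin s \<phi>" "lin t s f" shows "lin t fscale (%x. \<phi> (f x # as))"
 using lin_compose[OF mlin_slot[OF assms(1), of "[]"] assms(2)] by simp

context module_alg
begin

lemma lf_sum: "lf (%x y. \<Sum>i\<in>I. F i x y) z = (\<Sum>i\<in>I. lf (F i) z)"
 unfolding lf_def by (rule sum.swap)

text \<open>Right multiplication by \<open>w\<close> only changes the \<open>E\<close> part. The
  balancing of \<open>ex\<close> rests on this.\<close>

lemma lf_mB_jj:
 assumes u: "vector_space u" and l: "\<And>w. lin sA u (%a. \<psi> a w)" "\<And>a. lin sE u (\<psi> a)"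
 shows "lf \<psi> (mB b (jj w)) = lf (%a x. \<psi> a (m x w)) b"
proof -
 note ll = lin_intros u l lin_compose[OF l(1)] lin_compose[OF l(2)]
 have l2: "lin sE u (%x. \<psi> a (m x w))" for a by (rule lin_compose[OF l(2)]) (intro lin_intros)
 have "lf \<psi> (mB (PB b) (jj w)) = lf (%a x. \<psi> a (m x w)) (PB b)"
 proof (rule tt_eqI[where f = "%b. lf \<psi> (mB b (jj w))" and g = "lf (%a x. \<psi> a (m x w))"])
  show "lin fscale u (%b. lf \<psi> (mB b (jj w)))" by (intro ll)
  show "lin fscale u (lf (%a x. \<psi> a (m x w)))" by (intro ll)
  show "lf \<psi> (mB (tt a x) (jj w)) = lf (%a x. \<psi> a (m x w)) (tt a x)" for a x
   using lf_tt[OF u l, of a "m x w"] lf_tt[OF u, of "%a x. \<psi> a (m x w)" a x, OF l(1) l2] by (simp add: tt_jj)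
 qed
 then show ?thesis by simp
qed

text \<open>\<open>B\<close> is spanned by products of an element of \<open>A\<close> with one of
  \<open>E\<close>. This is the expansion that pushes a relative cochain onto
  \<open>A\<close>.\<close>

lemma lf_ii_jj:
 assumes "lin fscale u f" "b \<in> tens_carrier A E"
 shows "f b = lf (%a w. f (mB (ii a) (jj w))) b"
proof -
 have "lf (%a w. tt a w) (PB b) = PB b"
 proof (rule tt_eqI[where u = fscale])
  show "lin fscale fscale (lf tt)" by (intro lin_intros)
  show "lf (%a w. tt a w) (tt a w) = tt a w" for a w
   by (subst lf_tt[OF vs_fscale]) (intro lin_intros | simp)+
 qed (intro lin_intros)
 then have "f b = f (lf tt b)" using assms(2) by simp
 then show ?thesis by (simp add: lin_of_lf[OF assms(1)] ii_jj)
qed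

text \<open>Extends a cochain on \<open>A\<close> to lists over \<open>B\<close>; \<open>v \<in> E\<close> is what has been moved to the right so far.\<close>

primrec ex :: "('a list => ('k, 'a, 'e) tensor) => 'e => ('k, 'a, 'e) tensor list => ('k, 'a, 'e) tensor" where
 "ex \<phi> v [] = mB (\<phi> []) (jj v)"
| "ex \<phi> v (b # bs) = lf (%a w. ex (%as. \<phi> (a # as)) w bs) (mB (jj v) b)"

lemma lin_ex_fun: "(\<And>as. lin s fscale (%x. G x as)) ==> lin s fscale (%x. ex (G x) v bs)"
proof (induction bs arbitrary: G v)
 case Nil then show ?case unfolding ex.simps by (intro lin_intros)
next
 case (Cons b bs)
 have "lin s fscale (%x. ex (%as. G x (a # as)) w bs)" for a w
  by (rule Cons.IH) (rule Cons.prems)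
 then show ?case unfolding ex.simps by (intro lin_lf_fun vs_fscale)
qed

lemma lin_ex_hd: "mlin sA \<phi> ==> lin s sA f ==> lin s fscale (%x. ex (%as. \<phi> (f x # as)) v bs)"
 by (rule lin_ex_fun) (rule mlin_hd)

lemma lin_ex_w: "mlin sA \<phi> ==> lin s sE f ==> lin s fscale (%x. ex \<phi> (f x) bs)"
proof (cases bs)
 case Nil
 assume "lin s sE f"
 then show ?thesis unfolding Nil ex.simps by (intro lin_intros)
next
 case (Cons b bs')
 assume "mlin sA \<phi>" and f: "lin s sE f"
 then show ?thesis unfolding Cons ex.simps by (intro lin_intros lin_ex_hd f)
qed

lemma mlin_ex: "mlin sA \<phi> ==> mlin fscale (ex \<phi> v)"
 unfolding mlin_def[of fscale]
proof (intro allI)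
 fix us vs assume "mlin sA \<phi>"
 then show "lin fscale fscale (%x. ex \<phi> v (us @ x # vs))"
 proof (induction us arbitrary: \<phi> v)
  case Nil
  have "lin fscale fscale (%x. lf (%a w. ex (%as. \<phi> (a # as)) w vs) (mB (jj v) x))"
   by (intro lin_intros lin_ex_hd Nil)
  then show ?case by simp
 next
  case (Cons b us)
  have "lin fscale fscale (%x. ex (%as. \<phi> (a # as)) w (us @ x # vs))" for a w
   by (rule Cons.IH) (rule mlin_Cons[OF Cons.prems])
  then show ?case unfolding append_Cons ex.simps by (intro lin_lf_fun vs_fscale)
 qed
qed

lemma ex_closed [simp]: "ex \<phi> v bs \<in> tens_carrier A E"
 by (induction bs arbitrary: \<phi> v) (simp_all add: lf_def tens_carrier_sum)

text \<open>In both lists \<open>w\<close> joins the part that is carried to the right just before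
  \<open>b'\<close> is read.\<close>

lemma ex_jj_mid:
 "mlin sA \<phi> ==> ex \<phi> v (us @ mB b (jj w) # b' # vs) = ex \<phi> v (us @ b # mB (jj w) b' # vs)"
proof (induction us arbitrary: \<phi> v)
 case Nil
 have "ex \<phi> v (mB b (jj w) # b' # vs) =
   lf (%a x. lf (%a' x'. ex (%as. \<phi> (a # a' # as)) x' vs) (mB (jj x) b')) (mB (mB (jj v) b) (jj w))"
  by (simp add: mB_assoc)
 also have "... = lf (%a x. lf (%a' x'. ex (%as. \<phi> (a # a' # as)) x' vs) (mB (jj (m x w)) b')) (mB (jj v) b)"
 proof (rule lf_mB_jj[OF vs_fscale])
  fix a
  show "lin sE fscale (%x. lf (%a' x'. ex (%as. \<phi> (a # a' # as)) x' vs) (mB (jj x) b'))"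
   by (intro lin_intros lin_ex_hd[of "%as. \<phi> (a # as)"] mlin_Cons Nil)
 next
  fix x
  show "lin sA fscale (%a. lf (%a' x'. ex (%as. \<phi> (a # a' # as)) x' vs) (mB (jj x) b'))"
   by (intro lin_lf_fun lin_ex_fun vs_fscale mlin_hd[OF Nil] lin_ident)
 qed
 finally show ?case by (simp add: jj_jj[symmetric] mB_assoc)
next
 case (Cons c us)
 have "ex (%as. \<phi> (a # as)) x (us @ mB b (jj w) # b' # vs) = ex (%as. \<phi> (a # as)) x (us @ b # mB (jj w) b' # vs)" for a x
  by (rule Cons.IH) (rule mlin_Cons[OF Cons.prems])
 then show ?case by simp
qed

lemma ex_jj_last: "mlin sA \<phi> ==> ex \<phi> v (us @ [mB b (jj w)]) = mB (ex \<phi> v (us @ [b])) (jj w)"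
proof (induction us arbitrary: \<phi> v)
 case Nil
 have "ex \<phi> v [mB b (jj w)] = lf (%a x. mB (\<phi> [a]) (jj x)) (mB (mB (jj v) b) (jj w))"
  by (simp add: mB_assoc)
 also have "... = lf (%a x. mB (\<phi> [a]) (jj (m x w))) (mB (jj v) b)"
  by (rule lf_mB_jj[OF vs_fscale]) (intro lin_intros mlin_hd[OF Nil])+
 also have "... = mB (lf (%a x. mB (\<phi> [a]) (jj x)) (mB (jj v) b)) (jj w)"
  unfolding lin_of_lf[OF lin_mB1[OF lin_ident]] by (simp add: mB_assoc jj_jj)
 finally show ?case by simp
next
 case (Cons c us)
 have "ex (%as. \<phi> (a # as)) x (us @ [mB b (jj w)]) = mB (ex (%as. \<phi> (a # as)) x (us @ [b])) (jj w)" for a x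
  by (rule Cons.IH) (rule mlin_Cons[OF Cons.prems])
 then show ?case by (simp add: lin_of_lf[OF lin_mB1[OF lin_ident]])
qed

lemma ex_ii: "mlin sA \<phi> ==> set as \<subseteq> carrier A ==> ex \<phi> one (map ii as) = PB (\<phi> as)"
proof (induction as arbitrary: \<phi>)
 case Nil then show ?case by (simp add: jj_one)
next
 case (Cons a as)
 have "ex \<phi> one (map ii (a # as)) = lf (%a w. ex (%as. \<phi> (a # as)) w (map ii as)) (tt a one)"
  by (simp add: jj_one) (simp add: ii_def)
 also have "... = ex (%as. \<phi> (Q a # as)) (P one) (map ii as)"
  by (rule lf_tt[OF vs_fscale]) (intro lin_ex_hd lin_ex_w lin_ident mlin_Cons Cons.prems(1))+
 also have "... = PB (\<phi> (a # as))"
  using Cons.IH[OF mlin_Cons[OF Cons.prems(1)], of a] Cons.prems(2) by simp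
 finally show ?case .
qed

abbreviation Ml where "Ml \<equiv> multilinear_maps A B"

text \<open>A cochain is zero off \<open>carrier A\<close>, so it need not be linear on the ambient
  space. Composition with the projection makes it \<open>mlin\<close> and keeps its values on
  \<open>A\<close>.\<close>

definition hat :: "('a list => ('k, 'a, 'e) tensor) => 'a list => ('k, 'a, 'e) tensor" where
 "hat f as = f (map Q as)"

lemma hat_eq: "set as \<subseteq> carrier A ==> hat f as = f as"
 unfolding hat_def by (subst map_idI) auto

lemma mlin_hat:
 assumes f: "f \<in> Ml n" shows "mlin sA (hat f)"
 unfolding mlin_def
proof (intro allI)
 fix us vs
 show "lin sA fscale (%x. hat f (us @ x # vs))"
 proof (cases "Suc (length us + length vs) = n")
  case True
  have "linear_on A B (%x. f (map Q us @ x # map Q vs))"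
   using True by (intro multilinear_maps_slot[OF f] vec_space_zero_closed vec_space_A) auto
  from lin_Q_linear_on[OF this] show ?thesis by (simp add: hat_def)
 next
  case False
  then have "hat f (us @ x # vs) = 0" for x
   unfolding hat_def by (intro multilinear_maps_zero[OF f]) (auto simp: tuples_simps)
  then have "(%x. hat f (us @ x # vs)) = (%x. 0)" by (rule ext)
  then show ?thesis by (simp only: lin_const_zero vs_fscale)
 qed
qed

abbreviation slot where "slot \<equiv> rel_slot E A"

lemma slot_simps: "scale (slot n) = fscale" "n > 0 ==> carrier (slot n) = tens_carrier A E"
 "carrier (slot 0) = jj ` carrier E"
 by (auto simp: rel_slot_def incl_E_eq image_iff)

lemma rel_cochainsD:
 assumes "g \<in> rel_cochains E A act n" "n > 0"
 shows "g \<in> multilinear_maps (slot n) B n"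
  "set us \<subseteq> tens_carrier A E ==> b \<in> tens_carrier A E ==> b' \<in> tens_carrier A E ==> set vs \<subseteq> tens_carrier A E ==>
  w \<in> carrier E ==> Suc (Suc (length us + length vs)) = n ==>
  g (us @ mB b (jj w) # b' # vs) = g (us @ b # mB (jj w) b' # vs)"
  "set us \<subseteq> tens_carrier A E ==> b \<in> tens_carrier A E ==> w \<in> carrier E ==> Suc (length us) = n ==>
  g (us @ [mB b (jj w)]) = mB (g (us @ [b])) (jj w)"
proof -
 note g = assms(1)[unfolded rel_cochains_def Let_def B_def[symmetric] mem_Collect_eq]
 have l: "rel_length n = n" using assms(2) by (simp add: rel_length_def)
 show M: "g \<in> multilinear_maps (slot n) B n" using g l by simp
 have c: "\<forall>bs\<in>tuples (slot n) n. \<forall>w\<in>carrier E. \<forall>i. Suc i < n \<longrightarrow>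
  g (bs[i := mult B (bs ! i) (incl_E E A w)]) = g (bs[Suc i := mult B (incl_E E A w) (bs ! Suc i)])"
  using g l by simp
 {
  assume *: "set us \<subseteq> tens_carrier A E" "b \<in> tens_carrier A E" "b' \<in> tens_carrier A E" "set vs \<subseteq> tens_carrier A E"
   "w \<in> carrier E" "Suc (Suc (length us + length vs)) = n"
  let ?bs = "us @ b # b' # vs"
  have t: "?bs \<in> tuples (slot n) n" using * assms(2) by (auto simp: tuples_simps slot_simps)
  have "g (?bs[length us := mult B (?bs ! length us) (incl_E E A w)]) =
   g (?bs[Suc (length us) := mult B (incl_E E A w) (?bs ! Suc (length us))])"
   using c[THEN bspec, OF t, THEN bspec, OF *(5), THEN spec, of "length us"] *(6) by simp
  then show "g (us @ mB b (jj w) # b' # vs) = g (us @ b # mB (jj w) b' # vs)"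
   using * by (simp add: incl_E_eq mB_eq nth_append list_update_append)
 }
 {
  assume *: "set us \<subseteq> tens_carrier A E" "b \<in> tens_carrier A E" "w \<in> carrier E" "Suc (length us) = n"
  let ?bs = "us @ [b]"
  have t: "?bs \<in> tuples (slot n) n" using * assms(2) by (auto simp: tuples_simps slot_simps)
  have "g (?bs[n - 1 := mult B (last ?bs) (incl_E E A w)]) = mult B (g ?bs) (incl_E E A w)"
   using g t *(3) l by auto
  moreover have "g ?bs \<in> tens_carrier A E" using multilinear_maps_closed[OF M t] by simp
  ultimately show "g (us @ [mB b (jj w)]) = mB (g (us @ [b])) (jj w)"
   using * by (auto simp: incl_E_eq mB_eq)
 }
qed

text \<open>The current argument is expanded into products of \<open>ii a\<close> and
  \<open>jj x\<close>; then \<open>jj x\<close> passes to the next slot by balancing, or out of the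
  last slot by right linearity. The list \<open>as\<close> holds the arguments already brought into
  \<open>A\<close>.\<close>

lemma rel_cochains_ex:
 assumes g: "g \<in> rel_cochains E A act n" and n: "n > 0"
 shows "set as \<subseteq> carrier A ==> b \<in> tens_carrier A E ==> set bs \<subseteq> tens_carrier A E ==> w \<in> carrier E ==>
  length as + Suc (length bs) = n ==>
  g (map ii as @ mB (jj w) b # bs) = ex (%xs. g (map ii (as @ xs))) w (b # bs)"
proof (induction bs arbitrary: as b w)
 note gg = rel_cochainsD[OF g n]
 have sl: "linear_on TB TB (%x. g (us @ x # vs))"
  if "set us \<subseteq> tens_carrier A E" "set vs \<subseteq> tens_carrier A E" "Suc (length us + length vs) = n" for us vs
  using multilinear_maps_slot[OF gg(1), of us vs] that n vec_space_zero_closed[OF vec_space_B]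
  by (simp add: slot_simps linear_on_def)
 have ex: "g (us @ mB (jj w) b # vs) = lf (%a x. g (us @ mB (ii a) (jj x) # vs)) (mB (jj w) b)"
  if "set us \<subseteq> tens_carrier A E" "set vs \<subseteq> tens_carrier A E" "Suc (length us + length vs) = n" for us vs w b
 proof -
  have "lin fscale fscale (%x. g (us @ PB x # vs))"
   using sl[OF that] PB by (auto simp: lin_def linear_on_def)
  from lf_ii_jj[OF this, of "mB (jj w) b"] show ?thesis by simp
 qed
 {
  case Nil
  have "g (map ii as @ [mB (jj w) b]) = lf (%a x. g (map ii as @ [mB (ii a) (jj x)])) (mB (jj w) b)"
   using Nil by (intro ex) auto
  also have "... = lf (%a x. mB (g (map ii as @ [ii a])) (jj (P x))) (mB (jj w) b)"
   unfolding jj_P lf_def using Nil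
   by (intro sum.cong refl gg(3)) auto
  finally show ?case by simp
 next
  case (Cons b' bs)
  have "g (map ii as @ mB (jj w) b # b' # bs) = lf (%a x. g (map ii as @ mB (ii a) (jj x) # b' # bs)) (mB (jj w) b)"
   using Cons.prems by (intro ex) auto
  also have "... = lf (%a x. ex (%xs. g (map ii ((as @ [Q a]) @ xs))) x (b' # bs)) (mB (jj w) b)"
   unfolding lf_def
  proof (intro sum.cong refl)
   fix x assume x: "x \<in> bas"
   have "g (map ii as @ mB (ii (co x (mB (jj w) b))) (jj x) # b' # bs) =
    g (map ii as @ ii (co x (mB (jj w) b)) # mB (jj x) b' # bs)"
    using Cons.prems x by (intro gg(2)) auto
   also have "... = g (map ii (as @ [Q (co x (mB (jj w) b))]) @ mB (jj x) b' # bs)" by simp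
   also have "... = ex (%xs. g (map ii ((as @ [Q (co x (mB (jj w) b))]) @ xs))) x (b' # bs)"
    using Cons.prems x by (intro Cons.IH) auto
   finally show "g (map ii as @ mB (ii (co x (mB (jj w) b))) (jj x) # b' # bs) =
    ex (%xs. g (map ii ((as @ [Q (co x (mB (jj w) b))]) @ xs))) x (b' # bs)" .
  qed
  finally show ?case by simp
 }
qed

text \<open>The inverse of restriction to \<open>A\<close>. In degree zero the argument is a single
  element of \<open>E\<close>, and right linearity forces left multiplication by
  \<open>f []\<close>.\<close>

definition rext :: "nat => ('a list => ('k, 'a, 'e) tensor) => ('k, 'a, 'e) tensor list => ('k, 'a, 'e) tensor" where
 "rext n f = restr (tuples (slot n) (rel_length n)) (%bs.
  if n = 0 then mB (f []) (hd bs) else ex (hat f) one bs)"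

lemma rext_rel_cochains:
 assumes f: "f \<in> Ml n" shows "rext n f \<in> rel_cochains E A act n"
proof (cases "n = 0")
 case True
 have j: "P [] ==> (\<And>b. P [b]) ==> length bs = 1 ==> P bs" for P and bs :: "('k, 'a, 'e) tensor list"
  by (cases bs) auto
 have t: "bs \<in> tuples (slot 0) 1 \<longleftrightarrow> (\<exists>w\<in>carrier E. bs = [jj w])" for bs
  by (cases bs) (auto simp: tuples_simps slot_simps length_Suc_conv)
 have r: "rext 0 f bs = (if bs \<in> tuples (slot 0) 1 then mB (f []) (hd bs) else 0)" for bs
  by (simp add: rext_def restr_def rel_length_def)
 have "rext 0 f \<in> multilinear_maps (slot 0) B 1"
 proof (rule multilinear_mapsI)
  fix us vs :: "('k, 'a, 'e) tensor list" assume "Suc (length us + length vs) = 1"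
  then have "us = []" "vs = []" by auto
  moreover have "linear_on (slot 0) B (%x. rext 0 f [x])"
  proof -
   have "jj ` carrier E = carrier (slot 0)" by (simp add: slot_simps)
   have a: "x + y \<in> jj ` carrier E" "fscale c x \<in> jj ` carrier E" if "x \<in> jj ` carrier E" "y \<in> jj ` carrier E" for x y c
    using that lin_add[OF lin_jj[OF lin_ident], symmetric] lin_scale[OF lin_jj[OF lin_ident], symmetric]
     vec_space_add_closed[OF vec_space_E] vec_space_scale_closed[OF vec_space_E] by fastforce+
   have e: "rext 0 f [x] = mB (f []) x" if "x \<in> jj ` carrier E" for x
   proof -
    have "[x] \<in> tuples (slot 0) 1" using that t by auto
    then show ?thesis by (simp add: r)
   qed
   show ?thesis
    unfolding linear_on_def slot_simps
    using a by (simp add: e lin_add[OF lin_mB2[OF lin_ident]] lin_scale[OF lin_mB2[OF lin_ident]])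
  qed
  ultimately show "linear_on (slot 0) B (%x. rext 0 f (us @ x # vs))" by simp
 qed (auto simp: r t)
 moreover have "rext 0 f (bs[0 := mult B (last bs) (incl_E E A w)]) = mult B (rext 0 f bs) (incl_E E A w)"
  if bs: "bs \<in> tuples (slot 0) 1" and w: "w \<in> carrier E" for bs w
 proof -
  obtain v where v: "bs = [jj v]" using bs t by auto
  have "[jj (m v w)] \<in> tuples (slot 0) 1" using t m_closed by blast
  then have "rext 0 f [mB (jj v) (jj w)] = mB (f []) (jj (m v w))" by (simp add: r jj_jj)
  moreover have "rext 0 f bs = mB (f []) (jj v)" using bs by (simp add: r v)
  ultimately show ?thesis using w by (simp add: v incl_E_eq mB_eq mB_assoc jj_jj)
 qed
 ultimately show ?thesis
  unfolding rel_cochains_def Let_def B_def[symmetric]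
  using True by (simp add: rel_length_def)
next
 case False
 have r: "rext n f bs = (if bs \<in> tuples (slot n) n then ex (hat f) one bs else 0)" for bs
  using False by (simp add: rext_def restr_def rel_length_def)
 have t: "bs \<in> tuples (slot n) n \<longleftrightarrow> length bs = n \<and> set bs \<subseteq> tens_carrier A E" for bs
  using False by (simp add: tuples_simps slot_simps)
 have ml: "rext n f \<in> multilinear_maps (slot n) B n"
 proof (rule multilinear_mapsI)
  fix us vs assume *: "set us \<subseteq> carrier (slot n)" "set vs \<subseteq> carrier (slot n)" "Suc (length us + length vs) = n"
  have "rext n f (us @ x # vs) = ex (hat f) one (us @ x # vs)" if "x \<in> tens_carrier A E" for x
   using * that False by (simp add: r t slot_simps)
  moreover have "lin fscale fscale (%x. ex (hat f) one (us @ x # vs))"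
   by (rule mlin_slot[OF mlin_ex[OF mlin_hat[OF f]]])
  ultimately show "linear_on (slot n) B (%x. rext n f (us @ x # vs))"
   using False vec_space_add_closed[OF vec_space_B] vec_space_scale_closed[OF vec_space_B]
   by (simp add: linear_on_def slot_simps lin_def)
 qed (auto simp: r)
 have 1: "rext n f (bs[i := mult B (bs ! i) (incl_E E A w)]) = rext n f (bs[Suc i := mult B (incl_E E A w) (bs ! Suc i)])"
  if *: "bs \<in> tuples (slot n) n" "w \<in> carrier E" "Suc i < n" for bs w i
 proof -
  let ?u = "take i bs" and ?v = "drop (Suc (Suc i)) bs"
  have len: "length bs = n" "set bs \<subseteq> tens_carrier A E" using * by (auto simp: t)
  have b: "bs ! i \<in> tens_carrier A E" "bs ! Suc i \<in> tens_carrier A E" using * len by (auto simp: subset_iff)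
  have e1: "bs[i := x] = ?u @ x # bs ! Suc i # ?v" for x
   using * len by (simp add: upd_conv_take_nth_drop Cons_nth_drop_Suc)
  have e2: "bs[Suc i := x] = ?u @ bs ! i # x # ?v" for x
   using * len by (simp add: upd_conv_take_nth_drop take_Suc_conv_app_nth)
  have "set ?u \<subseteq> tens_carrier A E" "set ?v \<subseteq> tens_carrier A E"
   using len(2) set_take_subset[of i bs] set_drop_subset[of "Suc (Suc i)" bs] by auto
  then show ?thesis
   unfolding e1 e2 r t using * len(1) b
   by (simp add: incl_E_eq mB_eq ex_jj_mid[OF mlin_hat[OF f]])
 qed
 have 2: "rext n f (bs[n - 1 := mult B (last bs) (incl_E E A w)]) = mult B (rext n f bs) (incl_E E A w)"
  if *: "bs \<in> tuples (slot n) n" "w \<in> carrier E" for bs w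
 proof -
  obtain us b where bs: "bs = us @ [b]" using * False by (cases bs rule: rev_cases) (auto simp: t)
  have len: "length us = n - 1" "set us \<subseteq> tens_carrier A E" "b \<in> tens_carrier A E" using * False by (auto simp: t bs)
  have "bs[n - 1 := mult B (last bs) (incl_E E A w)] = us @ [mB b (jj w)]"
   unfolding len(1)[symmetric] using len(2,3) * by (simp add: bs incl_E_eq mB_eq)
  then show ?thesis
   unfolding r t using * len False by (simp add: bs t incl_E_eq mB_eq ex_jj_last[OF mlin_hat[OF f]])
 qed
 show ?thesis
  unfolding rel_cochains_def Let_def B_def[symmetric]
  using False ml 1 2 by (simp add: rel_length_def)
qed

lemma rel_restrict_rext:
 assumes f: "f \<in> Ml n" shows "rel_restrict E A n (rext n f) = f"
proof
 fix as
 show "rel_restrict E A n (rext n f) as = f as"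
 proof (cases "as \<in> tuples A n")
  case True
  then have as: "length as = n" "set as \<subseteq> carrier A" by (auto simp: tuples_simps)
  have c: "f as \<in> tens_carrier A E" using multilinear_maps_closed[OF f True] by simp
  have 1: "map (incl_A E A) as = map ii as" using as by (auto simp: incl_A_eq)
  show ?thesis
  proof (cases "n = 0")
   case z: True
   have "[jj one] \<in> tuples (slot 0) 1" by (auto simp: tuples_simps slot_simps)
   then have "rext 0 f [jj one] = PB (f [])" by (simp add: rext_def rel_length_def jj_one)
   then show ?thesis using True c z as by (simp add: rel_restrict_def incl_E_eq flip: one_def)
  next
   case False
   have "rel_restrict E A n (rext n f) as = rext n f (map ii as)"
    using True False by (simp only: rel_restrict_def restr_apply if_False 1)
   also have "map ii as \<in> tuples (slot n) (rel_length n)"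
    using as False by (auto simp: rel_length_def tuples_simps slot_simps)
   then have "rext n f (map ii as) = f as"
    using False as c by (simp add: rext_def ex_ii[OF mlin_hat[OF f]] hat_eq)
   finally show ?thesis .
  qed
 next
  case False
  then show ?thesis using multilinear_maps_zero[OF f False] by (simp add: rel_restrict_def restr_def)
 qed
qed

text \<open>In positive degree \<open>rel_cochains_ex\<close> recovers a cochain from its values on
  \<open>A\<close>; in degree zero right linearity recovers it from its value at
  \<open>1 \<in> E\<close>.\<close>

lemma rel_restrict_inj: "inj_on (rel_restrict E A n) (rel_cochains E A act n)"
proof (rule inj_onI)
 fix g g' assume g: "g \<in> rel_cochains E A act n" and g': "g' \<in> rel_cochains E A act n"
  and eq: "rel_restrict E A n g = rel_restrict E A n g'"
 have M: "g \<in> multilinear_maps (slot n) B (rel_length n)" "g' \<in> multilinear_maps (slot n) B (rel_length n)"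
  using g g' by (simp_all add: rel_cochains_def Let_def B_def)
 have e: "g bs = g' bs" if bs: "bs \<in> tuples (slot n) (rel_length n)" for bs
 proof (cases "n = 0")
  case True
  then obtain w where w: "w \<in> carrier E" "bs = [jj w]"
   using bs by (auto simp: tuples_simps slot_simps rel_length_def length_Suc_conv)
  have o: "[jj one] \<in> tuples (slot 0) 1" by (auto simp: tuples_simps slot_simps)
  have "h [mB (jj one) (jj w)] = mB (h [jj one]) (jj w)" if h: "h \<in> rel_cochains E A act n" for h
  proof -
   have "h \<in> multilinear_maps (slot 0) B 1" "\<forall>bs\<in>tuples (slot 0) 1. \<forall>w\<in>carrier E.
    h (bs[0 := mult B (last bs) (incl_E E A w)]) = mult B (h bs) (incl_E E A w)"
    using h True by (simp_all add: rel_cochains_def Let_def B_def rel_length_def)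
   from this(2)[THEN bspec, OF o, THEN bspec, OF w(1)] multilinear_maps_closed[OF this(1) o] show ?thesis
    using w by (simp add: incl_E_eq mB_eq)
  qed
  note this[OF g] this[OF g']
  moreover have "g [jj one] = g' [jj one]"
   using fun_cong[OF eq, of "[]"] True by (simp add: rel_restrict_def tuples_simps incl_E_eq flip: one_def)
  ultimately show ?thesis using w by (simp add: jj_jj)
 next
  case False
  then obtain b bs' where b: "bs = b # bs'" using bs by (cases bs) (auto simp: tuples_simps rel_length_def)
  have len: "length bs = n" "set bs \<subseteq> tens_carrier A E" using bs False by (auto simp: tuples_simps slot_simps rel_length_def)
  have "h bs = ex (%xs. h (map ii xs)) one bs" if h: "h \<in> rel_cochains E A act n" for h
   using rel_cochains_ex[OF h, of "[]" b bs' one] False len b by (simp add: jj_one)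
  moreover have "ex (%xs. g (map ii xs)) one bs = ex (%xs. g' (map ii xs)) one bs"
  proof -
   \<comment> \<open>\<open>ex\<close> uses its cochain only on lists of one length, and there the
     two restrictions agree.\<close>
   have 1: "ex \<phi> v cs = ex \<psi> v cs" if "\<And>xs. length xs = length cs ==> \<phi> xs = \<psi> xs" for \<phi> \<psi> v cs
    using that
   proof (induction cs arbitrary: \<phi> \<psi> v)
    case (Cons c cs)
    have "ex (%as. \<phi> (a # as)) w cs = ex (%as. \<psi> (a # as)) w cs" for a w
     by (rule Cons.IH) (simp add: Cons.prems)
    then show ?case by simp
   qed simp
   have "g (map ii xs) = g' (map ii xs)" if "length xs = n" for xs
   proof -
    have t: "map Q xs \<in> tuples A n" using that by (auto simp: tuples_simps)
    have "map (incl_A E A) (map Q xs) = map ii xs" by (simp add: incl_A_eq)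
    then have "rel_restrict E A n h (map Q xs) = h (map ii xs)" for h
     using t False by (simp only: rel_restrict_def restr_apply if_False)
    then show ?thesis using fun_cong[OF eq, of "map Q xs"] by simp
   qed
   then show ?thesis using len(1) by (intro 1) simp
  qed
  ultimately show ?thesis using g g' by simp
 qed
 show "g = g'"
 proof
  fix bs show "g bs = g' bs"
   using e[of bs] multilinear_maps_zero[OF M(1), of bs] multilinear_maps_zero[OF M(2), of bs]
   by (cases "bs \<in> tuples (slot n) (rel_length n)") simp_all
 qed
qed

lemma inv_rel_restrict:
 "f \<in> Ml n ==> inv_into (rel_cochains E A act n) (rel_restrict E A n) f = rext n f"
 by (intro inv_into_f_eq rel_restrict_inj rext_rel_cochains rel_restrict_rext)

end


section \<open>The action on Hochschild cochains\<close>

context module_alg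
begin

text \<open>The value of \<open>\<phi>\<close> at \<open>w\<cdot>(a1 \<otimes> ... \<otimes> an)\<close>.\<close>

primrec dia :: "('a list => ('k, 'a, 'e) tensor) => 'e => 'a list => ('k, 'a, 'e) tensor" where
 "dia \<phi> w [] = fscale (eps w) (\<phi> [])"
| "dia \<phi> w (a # as) = sw (%w1 w2. dia (%xs. \<phi> (al w1 a # xs)) w2 as) w"

lemma lin_dia_fun: "(\<And>as. lin s fscale (%x. G x as)) ==> lin s fscale (%x. dia (G x) w as)"
proof (induction as arbitrary: G w)
 case Nil then show ?case unfolding dia.simps by (intro lin_intros)
next
 case (Cons a as)
 have "lin s fscale (%x. dia (%xs. G x (al v a # xs)) w as)" for v w
  by (rule Cons.IH) (rule Cons.prems)
 then show ?case unfolding dia.simps by (intro lin_sw_fun vs_fscale)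
qed

lemma lin_dia: "mlin sA \<phi> ==> lin s sE f ==> lin s fscale (%x. dia \<phi> (f x) as)"
proof (cases as)
 case Nil
 assume "lin s sE f"
 then show ?thesis unfolding Nil dia.simps by (intro lin_intros)
next
 case (Cons a as')
 assume ml: "mlin sA \<phi>" and f: "lin s sE f"
 show ?thesis unfolding Cons dia.simps
  by (intro lin_sw_arg lin_dia_fun mlin_hd[OF ml] lin_al1 lin_ident vs_fscale f)
qed

lemma mlin_dia: "mlin sA \<phi> ==> mlin sA (dia \<phi> w)"
 unfolding mlin_def[of sA "dia \<phi> w"]
proof (intro allI)
 fix us vs assume "mlin sA \<phi>"
 then show "lin sA fscale (%x. dia \<phi> w (us @ x # vs))"
 proof (induction us arbitrary: \<phi> w)
  case Nil
  have "lin sA fscale (%x. sw (%w1 w2. dia (%xs. \<phi> (al w1 x # xs)) w2 vs) w)"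
   by (intro lin_sw_fun lin_dia_fun mlin_hd[OF Nil] lin_intros)
  then show ?case by simp
 next
  case (Cons b us)
  have "lin sA fscale (%x. dia (%xs. \<phi> (al v b # xs)) w (us @ x # vs))" for v w
   by (rule Cons.IH) (rule mlin_Cons[OF Cons.prems])
  then show ?case unfolding append_Cons dia.simps by (intro lin_sw_fun vs_fscale)
 qed
qed

lemma dia_P [simp]: "dia \<phi> (P w) as = dia \<phi> w as"
 by (cases as) simp_all

text \<open>\<open>eval_diag\<close> at \<open>h = v\<eta>\<close>, with the coproduct of the double
  written out: \<open>rsh \<eta> e\<close> and \<open>cf e\<close> are the parts of the coproduct of
  \<open>\<eta>\<close>.\<close>

primrec EV :: "(('k, 'a, 'e) tensor list => ('k, 'a, 'e) tensor) => 'e => ('e => 'k) =>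
  ('k, 'a, 'e) tensor list => ('k, 'a, 'e) tensor" where
 "EV f v \<eta> [] = fscale (eps v * \<eta> one) (f [])"
| "EV f v \<eta> (x # xs) = sw (%v1 v2. \<Sum>e\<in>bas. EV (%ys. f (da v1 (rsh \<eta> e) x # ys)) v2 (cf e) xs) v"

lemma EV_P: "EV f (P v) \<eta> xs = EV f v \<eta> xs"
 by (cases xs) simp_all

lemma lin_EV_fun: "(\<And>ys. lin s fscale (%x. G x ys)) ==> lin s fscale (%x. EV (G x) v \<eta> xs)"
proof (induction xs arbitrary: G v \<eta>)
 case Nil then show ?case unfolding EV.simps by (intro lin_intros)
next
 case (Cons b bs)
 have "lin s fscale (%x. EV (%ys. G x (c # ys)) w \<zeta> bs)" for c w \<zeta>
  by (rule Cons.IH) (rule Cons.prems)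
 then show ?case unfolding EV.simps by (intro lin_sw_fun lin_sum_fun vs_fscale)
qed

lemma lin_EV_hd: "mlin fscale f ==> lin s fscale g ==> lin s fscale (%x. EV (%ys. f (g x # ys)) v \<eta> xs)"
 by (rule lin_EV_fun) (rule mlin_hd)

lemma lin_rsh_apply: "lin fscale (*) (%\<eta>. rsh \<eta> e y)"
 unfolding rsh_def by (rule lin_apply)

lemma lin_EV1: "mlin fscale f ==> lin sE fscale (%v. EV f v \<eta> xs)"
proof (cases xs)
 case Nil show ?thesis unfolding Nil EV.simps by (intro lin_intros)
next
 case (Cons b bs)
 assume "mlin fscale f"
 then show ?thesis unfolding Cons EV.simps by (intro lin_sw_arg lin_sum_fun lin_EV_hd lin_intros)
qed

lemma lin_EV2: "mlin fscale f ==> lin fscale fscale (%\<eta>. EV f v \<eta> xs)"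
proof (cases xs)
 case Nil show ?thesis unfolding Nil EV.simps by (intro lin_intros)
next
 case (Cons b bs)
 assume "mlin fscale f"
 then show ?thesis unfolding Cons EV.simps
  by (intro lin_sw_fun lin_sum_fun lin_EV_hd lin_da2 lin_rsh_apply vs_fscale)
qed

lemma EV_cong: "(\<And>x. x \<in> carrier E ==> \<xi> x = \<eta> x) ==> EV f v \<xi> xs = EV f v \<eta> xs"
proof (cases xs)
 case (Cons b bs)
 assume "\<And>x. x \<in> carrier E ==> \<xi> x = \<eta> x"
 then have "rsh \<xi> = rsh \<eta>" by (simp add: rsh_def fun_eq_iff)
 then show ?thesis by (simp add: Cons)
qed simp

abbreviation dact where "dact \<equiv> smash_dact E A act"

text \<open>The linear extension of \<open>EV\<close> from \<open>te v \<eta>\<close> to the whole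
  double.\<close>

definition LV where "LV f xs h = lift E E' (%v \<eta>. EV f v \<eta> xs) h"

lemma EV_bilinear: "mlin fscale f ==> bilinear_on E E' (amb fscale) (%v \<eta>. EV f v \<eta> xs)"
 by (rule bilinear_on_lin; (unfold dual_simps)?; intro lin_EV1 lin_EV2; assumption)

lemma LV_te: "mlin fscale f ==> lin sE (*) \<xi> ==> LV f xs (te v \<xi>) = EV f v \<xi> xs"
 unfolding LV_def
 by (subst lift_te[OF vs_fscale refl EV_bilinear EV_cong]) (simp_all add: EV_P)

lemma LV_linear: "mlin fscale f ==> linear_on ED (amb fscale) (LV f xs)"
 unfolding LV_def[abs_def] by (rule lift_linear_amb[OF vs_fscale EV_bilinear]) simp_all

lemma lift_DD: "lift D D = lift ED ED"
 by (simp add: tens_D)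

lemma lift_comult_D_linear:
 assumes "bilinear_on ED ED (amb fscale) \<phi>"
 shows "linear_on ED (amb fscale) (%h. lift ED ED \<phi> (comult D h))"
 by (rule linear_on_compose[OF comult_D_linear lift_linear_amb[OF vs_fscale assms]]) simp_all

lemma linear_on_ED_eqI:
 assumes "linear_on ED (amb u) f" "linear_on ED (amb u) g" "\<And>w \<xi>. lin sE (*) \<xi> ==> f (te w \<xi>) = g (te w \<xi>)"
  "h \<in> tens_carrier E E'"
 shows "f h = g h"
 using assms(4)
proof (induction h rule: te_induct)
 case (pure w \<xi>) then show ?case by (rule assms(3))
next
 case (add s t)
 have "f (s + t) = f s + f t" "g (s + t) = g s + g t"
  using assms(1,2) add(1,2) unfolding linear_on_def tens_space_simps by blast+
 then show ?case using add(3,4) by (simp only:)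
qed

text \<open>In the induction step both sides are linear in \<open>h\<close>, so it suffices to
  compare them at \<open>te w \<xi>\<close>, where the coproduct of the double is explicit.\<close>

lemma eval_diag_LV:
 assumes "mlin fscale f" "set xs \<subseteq> tens_carrier A E" "h \<in> tens_carrier E E'"
 shows "eval_diag D B dact f h xs = LV f xs h"
 using assms
proof (induction xs arbitrary: f h)
 case Nil
 have "linear_on ED (amb fscale) (%h. fscale (counit D h) (f []))"
  using counit_D_linear by (simp add: linear_on_def vector_space_add_left[OF vs_fscale] vector_space_mult[OF vs_fscale])
 then have "fscale (counit D h) (f []) = LV f [] h"
  by (rule linear_on_ED_eqI[OF _ LV_linear[OF Nil(1)] _ Nil(3)]) (simp add: LV_te Nil counit_D_te)
 then show ?case by simp
next
 case (Cons x xs)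
 let ?\<phi> = "%h1 h2. LV (%ys. f (dact h1 x # ys)) xs h2"
 have x: "x \<in> tens_carrier A E" using Cons.prems(2) by simp
 have eq: "eval_diag D B dact f h (x # xs) = lift ED ED ?\<phi> (comult D h)"
  unfolding eval_diag.simps lift_DD using Cons.prems
  by (intro lift_cong Cons.IH mlin_Cons) auto
 have b: "bilinear_on ED ED (amb fscale) ?\<phi>"
  unfolding bilinear_on_def
 proof (intro conjI ballI)
  fix h1 show "linear_on ED (amb fscale) (?\<phi> h1)"
   by (rule LV_linear) (rule mlin_Cons[OF Cons.prems(1)])
 next
  fix h2 assume h: "h2 \<in> carrier ED"
  show "linear_on ED (amb fscale) (%h1. ?\<phi> h1 h2)"
   unfolding LV_def
  proof (rule linear_on_lift_param[where V = E and W = E' and X = ED])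
   show "bilinear_on E E' (amb fscale) (%v \<eta>. EV (%ys. f (dact h1 x # ys)) v \<eta> xs)" for h1
    by (rule EV_bilinear) (rule mlin_Cons[OF Cons.prems(1)])
   show "linear_on ED (amb fscale) (%h1. EV (%ys. f (dact h1 x # ys)) v \<eta> xs)" for v \<eta>
   proof (rule linear_on_compose[OF smash_dact_linear[OF x]])
    show "linear_on TB (amb fscale) (%b. EV (%ys. f (b # ys)) v \<eta> xs)"
     by (rule linear_on_lin) (simp add: lin_EV_hd[OF Cons.prems(1) lin_ident])
   qed
  qed (use h in \<open>simp_all add: vec_space_amb\<close>)
 qed
 have "lift ED ED ?\<phi> (comult D h) = LV f (x # xs) h"
 proof (rule linear_on_ED_eqI[OF lift_comult_D_linear[OF b] LV_linear[OF Cons.prems(1)] _ Cons.prems(3)])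
  fix w \<xi> assume xi: "lin sE (*) \<xi>"
  have "lift ED ED ?\<phi> (comult D (te w \<xi>)) = sw (%w1 w2. \<Sum>b\<in>bas. ?\<phi> (te w1 (rsh \<xi> b)) (te w2 (cf b))) w"
   by (rule lift_comult_D[OF vs_fscale b xi])
  also have "... = EV f w \<xi> (x # xs)"
   using x xi by (simp add: LV_te mlin_Cons[OF Cons.prems(1)] smash_dact_te lin_rsh)
  finally show "lift ED ED ?\<phi> (comult D (te w \<xi>)) = LV f (x # xs) (te w \<xi>)"
   by (simp only: LV_te[OF Cons.prems(1) xi])
 qed
 then show ?case using eq by simp
qed

lemma EV_lf: "EV (%ys. lf (%a w. G a w ys) c) v \<eta> xs = lf (%a w. EV (G a w) v \<eta> xs) c"
proof (induction xs arbitrary: G v \<eta>)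
 case Nil
 show ?case unfolding EV.simps by (rule lin_of_lf[OF lin_scale_right[OF vs_fscale lin_ident]])
next
 case (Cons x xs)
 show ?case unfolding EV.simps Cons.IH lf_sw_swap lf_sum ..
qed

text \<open>What remains when \<open>v\<close> acts on a list over \<open>A\<close> that has
  \<open>u\<close> on its left: \<open>u S(v1)\<close> travels through the list, its part
  \<open>x1\<close> acting on the arguments, and \<open>x2 v2\<close> comes out on the
  right.\<close>

definition GG where "GG g u v = sw (%v1 v2. sw (%x1 x2. mB (g x1) (jj (m x2 v2))) (m u (S v1))) v"

lemma lin_GG: "lin sE fscale g ==> lin s sE f ==> lin s fscale (%u. GG g (f u) v)"
 "(\<And>x. lin s fscale (%u. G u x)) ==> lin s fscale (%u. GG (G u) w v)"
 "lin sE fscale g ==> lin s sE f ==> lin s fscale (%v. GG g u (f v))"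
proof -
 show "lin s fscale (%u. GG (G u) w v)" if "\<And>x. lin s fscale (%u. G u x)"
  unfolding GG_def by (intro lin_intros that)
 assume g: "lin sE fscale g" and f: "lin s sE f"
 note l = lin_intros lin_compose[OF g] f
 show "lin s fscale (%u. GG g (f u) v)" "lin s fscale (%v. GG g u (f v))"
  unfolding GG_def by (intro l)+
qed

text \<open>The induction step of the next computation: \<open>q S(r)\<close> cancels.\<close>

lemma GG_collapse:
 assumes K: "\<And>y z. lin sE fscale (%x. K x y z)" "\<And>x z. lin sE fscale (%y. K x y z)" "\<And>x y. lin sE fscale (%z. K x y z)"
 shows "sw (%v1 v2. sw (%p q. sw (%x1 x2.
   sw (%r s. sw (%y1 y2. K x1 y1 (m y2 s)) (m (m x2 q) (S r))) v2) (m u (S p))) v1) v =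
  sw (%p t. sw (%x y. sw (%x1 x2. K x1 x2 (m y t)) x) (m u (S p))) v"
proof -
 note l = lin_intros lin_compose[OF K(1)] lin_compose[OF K(2)] lin_compose[OF K(3)]
 define Z where "Z x1 x s = sw (%y1 y2. K x1 y1 (m y2 s)) x" for x1 x s
 have Z: "lin sE fscale (%x1. Z x1 x s)" "lin sE fscale (%x. Z x1 x s)" "lin sE fscale (%s. Z x1 x s)" for x1 x s
  unfolding Z_def by (intro l)+
 note ll = lin_intros lin_compose[OF Z(1)] lin_compose[OF Z(2)] lin_compose[OF Z(3)]
 have c: "sw (%q v2. sw (%r s. Z x1 (m (m x q) (S r)) s) v2) t = Z x1 x (P t)" if "x \<in> carrier E" for x1 x t
 proof -
  have "sw (%q v2. sw (%r s. Z x1 (m (m x q) (S r)) s) v2) t =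
   sw (%t' s. sw (%q r. Z x1 (m (m x q) (S r)) s) t') t"
   by (rule sw_coassoc[symmetric, OF vs_fscale]) (intro ll)+
  also have "... = sw (%t' s. fscale (eps t') (Z x1 (m x one) s)) t"
  proof -
   have "sw (%q r. Z x1 (m x (m q (S r))) s) t' = fscale (eps t') (Z x1 (m x one) s)" for t' s
    by (rule sw_antipode_right[where f = "%q. Z x1 (m x q) s"]) (intro ll)
   then show ?thesis by (simp add: m_assoc)
  qed
  also have "... = Z x1 x (P t)"
   using that by simp (rule sw_counit_left, intro ll)
  finally show ?thesis .
 qed
 have "sw (%v1 v2. sw (%p q. sw (%x1 x2. sw (%r s. Z x1 (m (m x2 q) (S r)) s) v2) (m u (S p))) v1) v =
   sw (%p t. sw (%q v2. sw (%x1 x2. sw (%r s. Z x1 (m (m x2 q) (S r)) s) v2) (m u (S p))) t) v"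
  by (rule sw_coassoc[OF vs_fscale]) (intro ll)+
 also have "... = sw (%p t. sw (%x1 x2. sw (%q v2. sw (%r s. Z x1 (m (m x2 q) (S r)) s) v2) t) (m u (S p))) v"
  by (subst sw_swap) (rule refl)
 also have "... = sw (%p t. sw (%x1 x2. Z x1 x2 t) (m u (S p))) v"
  by (intro sw_cong) (simp add: c)
 also have "... = sw (%p t. sw (%x y. sw (%x1 x2. K x1 x2 (m y t)) x) (m u (S p))) v"
  unfolding Z_def by (subst sw_coassoc[OF vs_fscale, symmetric]) (intro l refl)+
 finally show ?thesis unfolding Z_def .
qed

text \<open>\<open>\<eta>\<close> contributes only the scalar \<open>\<eta> one\<close>, because
  \<open>A\<close> is coinvariant. The factor of \<open>E\<close> between two arguments has the form
  \<open>q S(r)\<close> and cancels by \<open>GG_collapse\<close>.\<close>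

lemma EV_ex:
 "mlin sA \<phi> ==> lin sE (*) \<eta> ==> EV (ex \<phi> u) v \<eta> (map ii as) = fscale (\<eta> one) (GG (%x. dia \<phi> x as) u v)"
proof (induction as arbitrary: \<phi> u v \<eta>)
 case Nil
 have 1: "sw (%x1 x2. mB (fscale (eps x1) (\<phi> [])) (jj (m x2 v2))) z = mB (\<phi> []) (jj (m (P z) v2))" for z v2
  unfolding lin_scale[OF lin_mB1[OF lin_ident]]
  by (rule sw_counit_left[where f = "%y. mB (\<phi> []) (jj (m y v2))"]) (intro lin_intros)
 have "GG (%x. dia \<phi> x []) u v = sw (%v1 v2. mB (\<phi> []) (jj (m u (m (S v1) v2)))) v"
  by (simp add: GG_def 1 m_assoc)
 also have "... = fscale (eps v) (mB (\<phi> []) (jj (m u one)))"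
  by (rule sw_antipode_left) (intro lin_intros)
 finally show ?case by (simp add: vector_space_mult[OF vs_fscale] mult.commute)
next
 case (Cons a as)
 note ml = Cons.prems(1) and eta = Cons.prems(2)
 define H where "H c v2 = lf (%b w. GG (%x. dia (%xs. \<phi> (b # xs)) x as) w v2) c" for c v2
 have gl: "lin sE fscale (%x. dia (%xs. \<phi> (b # xs)) x as)" for b
  by (intro lin_dia mlin_Cons ml lin_ident)
 have gl2: "lin s sA f ==> lin s fscale (%b. dia (%xs. \<phi> (f b # xs)) x as)" for s f x
  by (intro lin_dia_fun mlin_hd[OF ml])
 have Hl: "lin s fscale f ==> lin s fscale (%x. H (f x) v2)" for s f v2
  unfolding H_def by (intro lin_lf_arg vs_fscale lin_GG(2) gl2 lin_ident)
 have Htt: "H (tt b w) v2 = GG (%x. dia (%xs. \<phi> (Q b # xs)) x as) (P w) v2" for b w v2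
  unfolding H_def by (rule lf_tt[OF vs_fscale]) (intro lin_GG gl gl2 lin_ident)+
 have EH: "EV (%ys. ex \<phi> u (b # ys)) v2 \<zeta> (map ii as) = fscale (\<zeta> one) (H (mB (jj u) b) v2)" if "lin sE (*) \<zeta>" for b v2 \<zeta>
  unfolding ex.simps EV_lf H_def Cons.IH[OF mlin_Cons[OF ml] that]
  by (rule lin_of_lf[symmetric, OF lin_scale_right[OF vs_fscale lin_ident]])
 \<comment> \<open>The adjoint action of \<open>w\<close> on \<open>ii a\<close>; the functional
   only adds the scalar \<open>\<zeta> one\<close>.\<close>
 define c where "c w = sw (%p q. mB (mB (jj (S p)) (ii a)) (jj q)) w" for w
 have da: "da w \<zeta> (ii a) = fscale (\<zeta> one) (c w)" if "lin sE (*) \<zeta>" for w \<zeta>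
  unfolding da_def c_def tri_ii[OF that] lin_scale[OF lin_mB2[OF lin_ident]] lin_scale[OF lin_mB1[OF lin_ident]]
  by (rule lin_of_sw[symmetric, OF lin_scale_right[OF vs_fscale lin_ident]])
 \<comment> \<open>The scalars \<open>cf e one\<close> pick \<open>\<eta> one\<close> out of the
   coproduct of \<open>\<eta>\<close>.\<close>
 have cf1: "(\<Sum>e\<in>bas. cf e one * \<eta> e) = \<eta> one"
 proof -
  have "\<eta> one = \<eta> (\<Sum>e\<in>bas. sE (cf e one) e)" by (simp add: basis_expand)
  then show ?thesis by (simp add: lin_sum[OF eta] lin_scale[OF eta])
 qed
 have "EV (ex \<phi> u) v \<eta> (map ii (a # as)) =
   sw (%v1 v2. \<Sum>e\<in>bas. fscale (cf e one) (H (mB (jj u) (fscale (\<eta> e) (c v1))) v2)) v"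
  using eta by (simp add: EH da lin_rsh del: ex.simps) (simp add: rsh_def)
 also have "... = sw (%v1 v2. fscale (\<eta> one) (H (mB (jj u) (c v1)) v2)) v"
 proof -
  have "(\<Sum>e\<in>bas. fscale (cf e one) (H (mB (jj u) (fscale (\<eta> e) (c v1))) v2)) =
    (\<Sum>e\<in>bas. fscale (cf e one * \<eta> e) (H (mB (jj u) (c v1)) v2))" for v1 v2
   unfolding lin_scale[OF lin_mB2[OF lin_ident]] lin_scale[OF Hl[OF lin_ident]]
   by (simp add: vector_space_mult[OF vs_fscale])
  also have "... v1 v2 = fscale (\<Sum>e\<in>bas. cf e one * \<eta> e) (H (mB (jj u) (c v1)) v2)" for v1 v2
   by (rule lin_sum[symmetric, OF lin_scale_left[OF vs_fscale lin_ident]])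
  finally show ?thesis by (simp add: cf1)
 qed
 also have "... = fscale (\<eta> one) (sw (%v1 v2. H (mB (jj u) (c v1)) v2) v)"
  by (rule lin_of_sw[symmetric, OF lin_scale_right[OF vs_fscale lin_ident]])
 also have "(%v1 v2. H (mB (jj u) (c v1)) v2) = (%v1 v2. sw (%p q. sw (%x1 x2.
   GG (%x. dia (%xs. \<phi> (al x1 a # xs)) x as) (m x2 q) v2) (m u (S p))) v1)"
 proof (rule ext, rule ext)
  fix v1 v2
  have "mB (jj u) (mB (mB (jj (S p)) (ii a)) (jj q)) = sw (%x1 x2. tt (al x1 a) (m x2 q)) (m u (S p))" for p q
  proof -
   have "mB (jj u) (mB (mB (jj (S p)) (ii a)) (jj q)) = mB (mB (jj (m u (S p))) (ii a)) (jj q)"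
    by (simp add: mB_assoc jj_jj[symmetric])
   then show ?thesis unfolding jj_ii lin_of_sw[OF lin_mB1[OF lin_ident]] by (simp add: ii_jj tt_jj)
  qed
  then have "mB (jj u) (c v1) = sw (%p q. sw (%x1 x2. tt (al x1 a) (m x2 q)) (m u (S p))) v1"
   unfolding c_def lin_of_sw[OF lin_mB2[OF lin_ident]] by simp
  then show "H (mB (jj u) (c v1)) v2 = sw (%p q. sw (%x1 x2.
   GG (%x. dia (%xs. \<phi> (al x1 a # xs)) x as) (m x2 q) v2) (m u (S p))) v1"
   by (simp add: lin_of_sw[OF Hl[OF lin_ident]] Htt)
 qed
 also have "sw (%v1 v2. sw (%p q. sw (%x1 x2. GG (%x. dia (%xs. \<phi> (al x1 a # xs)) x as) (m x2 q) v2)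
   (m u (S p))) v1) v = GG (%x. dia \<phi> x (a # as)) u v"
  unfolding GG_def dia.simps lin_of_sw[OF lin_mB1[OF lin_ident]]
  by (rule GG_collapse[where K = "%x y z. mB (dia (%xs. \<phi> (al x a # xs)) y as) (jj z)"])
   (intro lin_intros gl gl2)+
 finally show ?case .
qed

end


section \<open>The closed formula for the action on cochains\<close>

context module_alg
begin

lemma linear_on_sw3:
 assumes f: "linear_on V W f" "vec_space V" and c: "\<And>x y z. \<phi> x y z \<in> carrier V"
 shows "f (sw3 \<phi> z) = sw3 (%x y z. f (\<phi> x y z)) z"
proof -
 have "f (sw (%b c. \<phi> a b c) r) = sw (%b c. f (\<phi> a b c)) r" for a r
  by (rule linear_on_sw[OF f c])
 moreover have "f (sw (%a r. sw (%b c. \<phi> a b c) r) z) = sw (%a r. f (sw (%b c. \<phi> a b c) r)) z"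
  by (rule linear_on_sw[OF f]) (simp add: sw_def vec_space_sum_closed[OF f(2)] c)
 ultimately show ?thesis by (simp add: sw3_def)
qed

text \<open>\<open>GG\<close> with nothing on the left, after the coproduct of \<open>S(v1)\<close>
  has been expanded and reversed.\<close>

definition KK where "KK g v = sw3 (%a b c. mB (g (S b)) (jj (m (S a) c))) v"

lemma lin_KK1: "lin sE fscale g ==> lin s sE f ==> lin s fscale (%v. KK g (f v))"
proof -
 assume g: "lin sE fscale g" and f: "lin s sE f"
 show ?thesis unfolding KK_def by (intro lin_intros lin_compose[OF g] f)
qed

lemma KK_closed [simp]: "KK g v \<in> tens_carrier A E"
 unfolding KK_def sw3_def sw_def by (intro tens_carrier_sum mB_closed)

lemma GG_one:
 assumes g: "lin sE fscale g" shows "GG g one v = KK g v"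
proof -
 note l = lin_intros lin_compose[OF g]
 have "GG g one v = sw (%v1 c. sw (%a b. mB (g (S b)) (jj (m (S a) c))) v1) v"
  unfolding GG_def m_one sw_P by (subst sw_S[OF vs_fscale]) (intro l refl)+
 also have "... = KK g v"
  unfolding KK_def by (rule sw3_left[symmetric, OF vs_fscale]) (intro l)+
 finally show ?thesis .
qed

text \<open>The unit of \<open>B\<close> spans a trivial module. This is used in degree zero, where
  the argument of a relative cochain is \<open>1 \<in> E\<close>.\<close>

lemma da_one_basis: "dact h oneB = fscale (counit D h) oneB" if "h \<in> tens_carrier E E'"
proof (rule linear_on_ED_eqI[where u = fscale, OF _ _ _ that])
 show "linear_on ED (amb fscale) (%h. dact h oneB)"
  using linear_on_amb[OF smash_dact_linear[of oneB]] by simp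
 show "linear_on ED (amb fscale) (%h. fscale (counit D h) oneB)"
  using counit_D_linear by (simp add: linear_on_def vector_space_add_left[OF vs_fscale] vector_space_mult[OF vs_fscale])
 fix w \<xi> assume xi: "lin sE (*) \<xi>"
 have "da w \<xi> (ii oneA) = sw (%p q. fscale (\<xi> one) (jj (m (S p) q))) w"
  unfolding da_def tri_ii[OF xi] lin_scale[OF lin_mB2[OF lin_ident]] lin_scale[OF lin_mB1[OF lin_ident]]
  by (simp add: ii_one jj_jj)
 also have "... = fscale (eps w) (fscale (\<xi> one) (jj one))"
  by (rule sw_antipode_left) (intro lin_intros)
 finally show "dact (te w \<xi>) oneB = fscale (counit D (te w \<xi>)) oneB"
  by (simp add: smash_dact_te xi counit_D_te ii_one jj_one vector_space_mult[OF vs_fscale])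
qed

abbreviation dlist :: "nat => 'a list => ('k, 'a, 'e) tensor list" where
 "dlist n as \<equiv> if n = 0 then [incl_E E A (unity E)] else map (incl_A E A) as"

definition WW where "WW g h = lift E E' (%v \<eta>. fscale (\<eta> one) (KK g v)) h"

lemma WW_bilinear: "lin sE fscale g ==> bilinear_on E E' TB (%v \<eta>. fscale (\<eta> one) (KK g v))"
proof -
 assume g: "lin sE fscale g"
 have "lin sE fscale (%v. fscale (\<eta> one) (KK g v))" "lin fscale fscale (%\<eta>. fscale (\<eta> one) (KK g v))" for v \<eta>
  by (intro lin_intros lin_KK1 g)+
 then show ?thesis unfolding bilinear_on_def
  using vec_space_scale_closed[OF vec_space_B] by (auto intro!: linear_on_of_lin)
qed

lemma WW_linear: "lin sE fscale g ==> linear_on ED TB (WW g)"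
 unfolding WW_def[abs_def] by (intro lift_linear WW_bilinear) simp_all

lemma KK_P [simp]: "KK g (P v) = KK g v"
 by (simp add: KK_def)

lemma WW_te: "lin sE fscale g ==> lin sE (*) \<xi> ==> WW g (te v \<xi>) = fscale (\<xi> one) (KK g v)"
 unfolding WW_def
 by (subst lift_te[OF vs_fscale refl bilinear_on_amb[OF WW_bilinear, simplified]]) simp_all

lemma lin_dia_hat: "f \<in> Ml n ==> lin s sE g ==> lin s fscale (%x. dia (hat f) (g x) as)"
 by (rule lin_dia[OF mlin_hat])

text \<open>In positive degree this combines \<open>eval_diag_LV\<close> and \<open>EV_ex\<close>.
  In degree zero the argument is the unit, which is invariant, and both sides reduce to
  counits.\<close>

lemma eval_rext:
 assumes f: "f \<in> Ml n" and as: "as \<in> tuples A n" and h: "h \<in> tens_carrier E E'"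
 shows "eval_diag D B dact (rext n f) h (dlist n as) = WW (%x. dia (hat f) x as) h"
proof (cases "n = 0")
 case True
 have as0: "as = []" using as True by (simp add: tuples_simps)
 have f0: "f [] \<in> tens_carrier A E" using multilinear_maps_closed[OF f as] as0 by simp
 have r: "rext 0 f [fscale c oneB] = fscale c (f [])" for c
 proof -
  have "fscale c oneB = jj (sE c one)" using lin_scale[OF lin_jj[OF lin_ident]] by (simp add: jj_one)
  then have "[fscale c oneB] \<in> tuples (slot 0) 1"
   using vec_space_scale_closed[OF vec_space_E one_closed] by (auto simp: tuples_simps slot_simps)
  then show ?thesis using f0 by (simp add: rext_def rel_length_def lin_scale[OF lin_mB2[OF lin_ident]])
 qed
 let ?\<phi> = "%h1 h2. fscale (counit D h2 * counit D h1) (f [])"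
 have b: "bilinear_on ED ED (amb fscale) ?\<phi>"
  using counit_D_linear by (simp add: bilinear_on_def linear_on_def vector_space_mult[OF vs_fscale]
   vector_space_add_left[OF vs_fscale, symmetric] algebra_simps)
 have "eval_diag D B dact (rext 0 f) h [oneB] = lift ED ED (%h1 h2. fscale (counit D h2) (rext 0 f [dact h1 oneB])) (comult D h)"
  by simp
 also have "... = lift ED ED ?\<phi> (comult D h)"
  by (intro lift_cong) (simp add: da_one_basis r vector_space_mult[OF vs_fscale])
 also have "... = WW (%x. dia (hat f) x as) h"
 proof (rule linear_on_ED_eqI[where u = fscale, OF lift_comult_D_linear[OF b] _ _ h])
  show "linear_on ED (amb fscale) (WW (%x. dia (hat f) x as))"
   using linear_on_amb[OF WW_linear[OF lin_dia_hat[OF f lin_ident]]] by simp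
  fix w \<xi> assume xi: "lin sE (*) \<xi>"
  have "lift ED ED ?\<phi> (comult D (te w \<xi>)) = sw (%w1 w2. \<Sum>b\<in>bas. ?\<phi> (te w1 (rsh \<xi> b)) (te w2 (cf b))) w"
   by (rule lift_comult_D[OF vs_fscale b xi])
  also have "... = sw (%w1 w2. fscale (eps w1) (fscale (eps w2) (fscale (\<xi> one) (f [])))) w"
  proof -
   have "(\<Sum>b\<in>bas. fscale (eps w2 * cf b one * (eps w1 * \<xi> b)) (f [])) = fscale (eps w1) (fscale (eps w2) (fscale (\<xi> one) (f [])))" for w1 w2
   proof -
    have "\<xi> one = \<xi> (\<Sum>b\<in>bas. sE (cf b one) b)" by (simp add: basis_expand)
    also have "... = (\<Sum>b\<in>bas. cf b one * \<xi> b)" by (simp add: lin_sum[OF xi] lin_scale[OF xi])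
    finally have "eps w1 * (eps w2 * \<xi> one) = (\<Sum>b\<in>bas. eps w2 * cf b one * (eps w1 * \<xi> b))"
     by (simp add: sum_distrib_left mult_ac)
    then show ?thesis
     by (simp add: vector_space_mult[OF vs_fscale] lin_sum[OF lin_scale_left[OF vs_fscale lin_ident]])
   qed
   then show ?thesis using xi by (simp add: counit_D_te lin_rsh) (simp add: rsh_def)
  qed
  also have "... = fscale (eps (P w)) (fscale (\<xi> one) (f []))"
   by (rule sw_counit_left) (intro lin_intros)
  also have "... = WW (%x. dia (hat f) x as) (te w \<xi>)"
  proof -
   \<comment> \<open>\<open>EV_ex\<close> for the empty list, with \<open>eps\<close> as the
     functional, evaluates \<open>KK\<close> in degree zero.\<close>
   have "GG (%x. dia (hat f) x []) one w = EV (ex (hat f) one) w eps (map ii [])"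
    by (subst EV_ex[OF mlin_hat[OF f] lin_eps]) (simp add: vector_space_one[OF vs_fscale])
   also have "... = fscale (eps w) (f [])" using f0 by (simp add: jj_one hat_def)
   finally have "KK (%x. dia (hat f) x []) w = fscale (eps w) (f [])"
    by (simp only: GG_one[OF lin_dia_hat[OF f lin_ident]])
   then show ?thesis using as0 xi
    by (simp only: WW_te[OF lin_dia_hat[OF f lin_ident]] P_absorb vector_space_mult[OF vs_fscale] mult.commute)
  qed
  finally show "lift ED ED ?\<phi> (comult D (te w \<xi>)) = WW (%x. dia (hat f) x as) (te w \<xi>)" .
 qed
 finally show ?thesis using True by (simp add: incl_E_eq jj_one flip: one_def)
next
 case False
 have as': "set as \<subseteq> carrier A" "length as = n" using as by (auto simp: tuples_simps)
 \<comment> \<open>\<open>rext n f\<close> and \<open>ex (hat f) one\<close> agree on tuples over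
   \<open>B\<close>, and the diagonal action does not leave these.\<close>
 have ed: "eval_diag D B dact g h' xs = eval_diag D B dact g' h' xs"
  if "\<And>ys. length ys = length xs ==> set ys \<subseteq> tens_carrier A E ==> g ys = g' ys" "set xs \<subseteq> tens_carrier A E" for g g' h' xs
  using that
 proof (induction xs arbitrary: g g' h')
  case (Cons x xs)
  have "eval_diag D B dact (%ys. g (dact h1 x # ys)) h2 xs = eval_diag D B dact (%ys. g' (dact h1 x # ys)) h2 xs"
   if "h1 \<in> carrier D" for h1 h2
  proof (rule Cons.IH)
   have "dact h1 x \<in> tens_carrier A E" using smash_dact_linear[of x] Cons.prems(2) that by (simp add: linear_on_def)
   then show "g (dact h1 x # ys) = g' (dact h1 x # ys)" if "length ys = length xs" "set ys \<subseteq> tens_carrier A E" for ys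
    using that by (intro Cons.prems(1)) simp_all
   show "set xs \<subseteq> tens_carrier A E" using Cons.prems(2) by simp
  qed
  then show ?case unfolding eval_diag.simps by (intro lift_cong)
 qed simp
 have 1: "map (incl_A E A) as = map ii as" using as' by (auto simp: incl_A_eq)
 have "eval_diag D B dact (rext n f) h (map ii as) = eval_diag D B dact (ex (hat f) one) h (map ii as)"
  using as' False by (intro ed) (auto simp: rext_def rel_length_def tuples_simps slot_simps)
 also have "... = LV (ex (hat f) one) (map ii as) h"
  by (rule eval_diag_LV[OF mlin_ex[OF mlin_hat[OF f]] _ h]) auto
 also have "... = WW (%x. dia (hat f) x as) h"
 proof (rule linear_on_ED_eqI[where u = fscale, OF LV_linear[OF mlin_ex[OF mlin_hat[OF f]]] _ _ h])
  show "linear_on ED (amb fscale) (WW (%x. dia (hat f) x as))"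
   using linear_on_amb[OF WW_linear[OF lin_dia_hat[OF f lin_ident]]] by simp
  fix w \<xi> assume xi: "lin sE (*) \<xi>"
  show "LV (ex (hat f) one) (map ii as) (te w \<xi>) = WW (%x. dia (hat f) x as) (te w \<xi>)"
   unfolding LV_te[OF mlin_ex[OF mlin_hat[OF f]] xi] EV_ex[OF mlin_hat[OF f] xi] WW_te[OF lin_dia_hat[OF f lin_ident] xi]
   by (simp only: GG_one[OF lin_dia_hat[OF f lin_ident]])
 qed
 finally show ?thesis using False by (simp only: 1 if_False)
qed

lemma hoch_dact_raw:
 assumes f: "f \<in> Ml n" and as: "as \<in> tuples A n"
 shows "hoch_dact E A act n h f as =
  lift ED ED (%h1 h2. dact h1 (WW (%x. dia (hat f) x as) (antipode D h2))) (comult D h)"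
proof -
 have t: "dlist n as \<in> tuples (slot n) (rel_length n)"
  using as by (auto simp: tuples_simps rel_length_def slot_simps incl_E_eq incl_A_eq subset_iff simp flip: one_def)
 have r: "rel_restrict E A n G as = G (dlist n as)" for G
  by (simp only: rel_restrict_def restr_apply[OF as])
 have "hoch_dact E A act n h f as = lift D D (%h1 h2. dact h1 (eval_diag D B dact (rext n f) (antipode D h2) (dlist n as))) (comult D h)"
  unfolding hoch_dact_def inv_rel_restrict[OF f] r rel_dact_def Let_def restr_apply[OF t] D_def B_def ..
 also have "... = lift ED ED (%h1 h2. dact h1 (WW (%x. dia (hat f) x as) (antipode D h2))) (comult D h)"
  unfolding lift_DD
 proof (intro lift_cong)
  fix h1 h2 assume "h2 \<in> carrier ED"
  then have "antipode D h2 \<in> tens_carrier E E'" using antipode_D_linear by (simp add: linear_on_def)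
  then show "dact h1 (eval_diag D B dact (rext n f) (antipode D h2) (dlist n as)) =
   dact h1 (WW (%x. dia (hat f) x as) (antipode D h2))"
   using eval_rext[OF f as] by simp
 qed
 finally show ?thesis .
qed

lemma dact_bilinear: "bilinear_on ED TB TB dact"
proof -
 have "linear_on TB TB (dact h)" if h: "h \<in> tens_carrier E E'" for h
 proof -
  have "linear_on TB TB (%b. lift E E' (%w \<xi>. da w \<xi> b) h)"
   by (rule linear_on_lift_param[OF _ _ _ _ h]) (simp_all add: da_bilinear linear_on_of_lin lin_da3 lin_ident)
  then show ?thesis by (auto simp: linear_on_def smash_dact_eq vec_space_add_closed[OF vec_space_B, simplified]
   vec_space_scale_closed[OF vec_space_B, simplified])
 qed
 then show ?thesis using smash_dact_linear by (simp add: bilinear_on_def)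
qed

definition conj where "conj w b = sw (%p q. mB (mB (jj (S p)) b) (jj q)) w"

lemma lin_conj: "lin s fscale f ==> lin s fscale (%x. conj w (f x))"
 unfolding conj_def by (intro lin_intros)

lemma da_conj: "da w \<xi> b = conj w (tri \<xi> b)"
 by (simp add: da_def conj_def)

text \<open>The inverse antipode reverses coproducts just as \<open>S\<close> does.\<close>

lemma sw3_Si:
 assumes l: "\<And>b c. lin sE fscale (%a. \<phi> a b c)" "\<And>a c. lin sE fscale (%b. \<phi> a b c)" "\<And>a b. lin sE fscale (%c. \<phi> a b c)"
 shows "sw3 \<phi> (Si w) = sw3 (%a b c. \<phi> (Si c) (Si b) (Si a)) w"
proof -
 note ll = lin_intros lin_compose[OF l(1)] lin_compose[OF l(2)] lin_compose[OF l(3)]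
 have "sw3 \<phi> (Si w) = sw (%a b. sw (%x y. \<phi> (Si b) x y) (Si a)) w"
  unfolding sw3_def by (rule sw_Si[OF vs_fscale]) (intro ll)+
 also have "... = sw (%a b. sw (%c d. \<phi> (Si b) (Si d) (Si c)) a) w"
  by (subst sw_Si[OF vs_fscale]) (intro ll refl)+
 also have "... = sw3 (%a b c. \<phi> (Si c) (Si b) (Si a)) w"
  by (rule sw3_left[symmetric, OF vs_fscale]) (intro ll)+
 finally show ?thesis .
qed

text \<open>\<open>KK g (Si v)\<close> is the sum of \<open>g(v2) v3 Si(v1)\<close>, as the inverse
  antipode undoes each \<open>S\<close>. Conjugation by \<open>w1\<close> puts a part
  \<open>q\<close> of \<open>w1\<close> behind \<open>Si(v1)\<close>, and the two cancel by
  \<open>sw_Si_cancel\<close>.\<close>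

lemma conj_KK_Si:
 assumes g: "lin sE fscale g"
 shows "sw (%w1 w2. conj w1 (KK g (Si w2))) w = sw3 (%a b c. mB (mB (jj (S a)) (g b)) (jj c)) w"
proof -
 define X where "X p z b c = mB (mB (jj (S p)) (g b)) (jj (m c z))" for p z b c
 note l = lin_intros lin_compose[OF g]
 have X: "lin sE fscale (%p. X p z b c)" "lin sE fscale (%z. X p z b c)" "lin sE fscale (%b. X p z b c)"
  "lin sE fscale (%c. X p z b c)" for p z b c
  unfolding X_def by (intro l)+
 note lX = lin_intros lin_compose[OF X(1)] lin_compose[OF X(2)] lin_compose[OF X(3)] lin_compose[OF X(4)]
 have K: "KK g (Si v) = sw (%a r. sw (%b c. mB (g b) (jj (m c (Si a)))) r) v" for v
 proof -
  have "KK g (Si v) = sw3 (%a b c. mB (g (S (Si b))) (jj (m (S (Si c)) (Si a)))) v"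
   unfolding KK_def by (rule sw3_Si) (intro l)+
  also have "... = sw3 (%a b c. mB (g b) (jj (m c (Si a)))) v"
   by (rule sw3_cong) simp
  finally show ?thesis by (simp add: sw3_def)
 qed
 have "sw (%w1 w2. conj w1 (KK g (Si w2))) w =
   sw (%w1 w2. sw (%p q. sw (%a r. sw (%b c. X p (m (Si a) q) b c) r) w2) w1) w"
  unfolding conj_def K lin_of_sw[OF lin_mB2[OF lin_ident]] lin_of_sw[OF lin_mB1[OF lin_ident]]
  by (simp add: X_def mB_assoc jj_jj m_assoc)
 also have "... = sw (%p t. sw (%q w2. sw (%a r. sw (%b c. X p (m (Si a) q) b c) r) w2) t) w"
  by (rule sw_coassoc[OF vs_fscale]) (intro lX)+
 also have "... = sw (%p t. sw (%b c. X p one b c) t) w"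
 proof -
  have "sw (%q w2. sw (%a r. sw (%b c. X p (m (Si a) q) b c) r) w2) t = sw (%b c. X p one b c) t" for p t
  proof -
   have "sw (%q w2. sw (%a r. sw (%b c. X p (m (Si a) q) b c) r) w2) t =
    sw (%s r. sw (%q a. sw (%b c. X p (m (Si a) q) b c) r) s) t"
    by (rule sw_coassoc[symmetric, OF vs_fscale]) (intro lX)+
   also have "... = sw (%s r. fscale (eps s) (sw (%b c. X p one b c) r)) t"
   proof -
    have "sw (%q a. sw (%b c. X p (m (Si a) q) b c) r) s = fscale (eps s) (sw (%b c. X p one b c) r)" for r s
     by (rule sw_Si_cancel[where f = "%z. sw (%b c. X p z b c) r"]) (intro lX)
    then show ?thesis by simp
   qed
   also have "... = sw (%b c. X p one b c) (P t)"
    by (rule sw_counit_left) (intro lX)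
   finally show ?thesis by simp
  qed
  then show ?thesis by simp
 qed
 finally show ?thesis by (simp add: sw3_def X_def)
qed

text \<open>In the antipode of the double, the commutation rule shifts the functional by
  \<open>S(S(v1) v3)\<close>. The factor \<open>S(a) c\<close> in \<open>KK\<close> has a coaction
  that shifts it in the opposite sense, so \<open>\<xi>\<close> reaches the values of
  \<open>g\<close> unshifted.\<close>

lemma tri_KK:
 assumes g: "lin sE fscale g" and xi: "lin sE (*) \<xi>"
 shows "sw3 (%v1 v2 v3. tri (rsh \<xi> (S (m (S v1) v3))) (KK g v2)) v = KK (%x. tri \<xi> (g x)) v"
proof -
 define T where "T z b x = mB (tri (rsh \<xi> z) (g (S b))) (jj x)" for z b x
 have rl: "lin s sE f ==> lin s (*) (%z. rsh \<xi> (f z) y)" for s f y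
  unfolding rsh_def by (rule lin_compose[OF xi]) (intro lin_intros)
 note l = lin_intros lin_compose[OF g] rl
 have T: "lin sE fscale (%z. T z b x)" "lin sE fscale (%b. T z b x)" "lin sE fscale (%x. T z b x)" for z b x
  unfolding T_def by (intro l)+
 note lT = lin_intros lin_compose[OF T(1)] lin_compose[OF T(2)] lin_compose[OF T(3)]
 have rr: "rsh (rsh \<xi> y) z = rsh \<xi> (m z y)" for y z by (simp add: rsh_def m_assoc)
 \<comment> \<open>The antipode law first removes \<open>c2 S(v3)\<close> and then
   \<open>S(v1) a1\<close>, which brings the shift down to \<open>one\<close>.\<close>
 define F where "F v1 a b c v3 = sw (%a1 a2. sw (%c1 c2.
  T (m (m (S a1) (m c2 (S v3))) (S (S v1))) b (m (S a2) c1)) c) a" for v1 a b c v3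
 have 1: "tri (rsh \<xi> (S (m (S v1) v3))) (mB (g (S b)) (jj (m (S a) c))) = F v1 a b c v3" for v1 a b c v3
 proof -
  let ?y = "S (m (S v1) v3)"
  have "tri (rsh \<xi> ?y) (mB (g (S b)) (jj (m (S a) c))) = sw (%x1 x2. T (m x2 ?y) b x1) (m (S a) c)"
   unfolding tri_jj_right[OF lin_rsh[OF xi]] rr T_def ..
  also have "... = sw (%p q. sw (%c1 c2. T (m (m q c2) ?y) b (m p c1)) c) (S a)"
   by (rule sw_m[OF vs_fscale]) (intro lT)+
  also have "... = sw (%a1 a2. sw (%c1 c2. T (m (m (S a1) c2) ?y) b (m (S a2) c1)) c) a"
   by (rule sw_S[OF vs_fscale]) (intro lT)+
  finally show ?thesis by (simp add: F_def S_m m_assoc)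
 qed
 have Fl: "lin sE fscale (%v1. F v1 a b c v3)" "lin sE fscale (%a. F v1 a b c v3)" "lin sE fscale (%b. F v1 a b c v3)"
  "lin sE fscale (%c. F v1 a b c v3)" "lin sE fscale (%v3. F v1 a b c v3)" for v1 a b c v3
  unfolding F_def by (intro lT)+
 have 2: "sw (%c v3. F v1 a b c v3) y = sw (%a1 a2. T (S (m (S v1) a1)) b (m (S a2) y)) a" for v1 a b y
 proof -
  have "sw (%c v3. sw (%c1 c2. T (m (m (S a1) (m c2 (S v3))) (S (S v1))) b (m (S a2) c1)) c) y =
   T (S (m (S v1) a1)) b (m (S a2) y)" for a1 a2
  proof -
   have "sw (%c v3. sw (%c1 c2. T (m (m (S a1) (m c2 (S v3))) (S (S v1))) b (m (S a2) c1)) c) y =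
    sw (%c1 s. sw (%c2 v3. T (m (m (S a1) (m c2 (S v3))) (S (S v1))) b (m (S a2) c1)) s) y"
    by (rule sw_coassoc[OF vs_fscale]) (intro lT)+
   also have "... = sw (%c1 s. fscale (eps s) (T (m (m (S a1) one) (S (S v1))) b (m (S a2) c1))) y"
   proof -
    have "sw (%c2 v3. T (m (m (S a1) (m c2 (S v3))) (S (S v1))) b (m (S a2) c1)) s =
     fscale (eps s) (T (m (m (S a1) one) (S (S v1))) b (m (S a2) c1))" for c1 s
     by (rule sw_antipode_right[where f = "%q. T (m (m (S a1) q) (S (S v1))) b (m (S a2) c1)"]) (intro lT)
    then show ?thesis by simp
   qed
   also have "... = T (m (m (S a1) one) (S (S v1))) b (m (S a2) (P y))"
    by (rule sw_counit_right) (intro lT)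
   finally show ?thesis by (simp add: S_m)
  qed
  moreover have "sw (%c v3. F v1 a b c v3) y = sw (%a1 a2. sw (%c v3. sw (%c1 c2.
   T (m (m (S a1) (m c2 (S v3))) (S (S v1))) b (m (S a2) c1)) c) y) a"
   unfolding F_def by (rule sw_swap)
  ultimately show ?thesis by simp
 qed
 have 3: "sw (%v1 a. sw (%c v3. F v1 a b c v3) y) x = T one b (m (S x) y)" for b x y
 proof -
  have "sw (%v1 a. sw (%a1 a2. T (S (m (S v1) a1)) b (m (S a2) y)) a) x =
   sw (%t a2. sw (%v1 a1. T (S (m (S v1) a1)) b (m (S a2) y)) t) x"
   by (rule sw_coassoc[symmetric, OF vs_fscale]) (intro lT)+
  also have "... = sw (%t a2. fscale (eps t) (T (S one) b (m (S a2) y))) x"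
  proof -
   have "sw (%v1 a1. T (S (m (S v1) a1)) b (m (S a2) y)) t = fscale (eps t) (T (S one) b (m (S a2) y))" for a2 t
    by (rule sw_antipode_left[where f = "%q. T (S q) b (m (S a2) y)"]) (intro lT)
   then show ?thesis by simp
  qed
  also have "... = T (S one) b (m (S (P x)) y)" by (rule sw_counit_left) (intro lT)
  finally show ?thesis by (simp add: 2)
 qed
 have "sw3 (%v1 v2 v3. tri (rsh \<xi> (S (m (S v1) v3))) (KK g v2)) v = sw3 (%v1 v2 v3. sw3 (%a b c. F v1 a b c v3) v2) v"
  unfolding KK_def lin_of_sw3[OF lin_tri[OF lin_ident]] 1 ..
 also have "... = sw3 (%x b y. sw (%v1 a. sw (%c v3. F v1 a b c v3) y) x) v"
  by (rule sw5[symmetric, OF vs_fscale]) (rule Fl)+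
 also have "... = sw3 (%x b y. T one b (m (S x) y)) v" by (simp add: 3)
 also have "tri (rsh \<xi> one) = tri \<xi>" by (rule tri_cong) (simp add: rsh_def)
 then have "sw3 (%x b y. T one b (m (S x) y)) v = KK (%x. tri \<xi> (g x)) v" by (simp add: KK_def T_def)
 finally show ?thesis .
qed

text \<open>The action of \<open>w\<xi>\<close> on a cochain at fixed arguments, with
  \<open>g x\<close> the value of the cochain when \<open>x\<close> is applied to these
  arguments.\<close>

definition AA where "AA w \<xi> g = sw3 (%a b c. mB (mB (jj (S a)) (tri \<xi> (g b))) (jj c)) w"

lemma hoch_raw_bilinear:
 assumes g: "lin sE fscale g"
 shows "bilinear_on ED ED TB (%h1 h2. dact h1 (WW g (antipode D h2)))"
 by (rule bilinear_on_compose_right[OF dact_bilinear linear_on_compose[OF antipode_D_linear WW_linear[OF g]]])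

text \<open>The sum of \<open>h1\<cdot>f(S(h2)\<cdot>_)\<close> for \<open>h = w\<xi>\<close>:
  \<open>tri_KK\<close> deals with the functional and \<open>conj_KK_Si\<close> with
  \<open>w\<close>.\<close>

lemma hoch_dact_te:
 assumes f: "f \<in> Ml n" and as: "as \<in> tuples A n" and xi: "lin sE (*) \<xi>"
 shows "hoch_dact E A act n (te w \<xi>) f as = AA w \<xi> (%x. dia (hat f) x as)"
proof -
 define g where "g x = dia (hat f) x as" for x
 have g: "lin sE fscale g" unfolding g_def by (rule lin_dia_hat[OF f lin_ident])
 \<comment> \<open>The antipode of a product \<open>v\<xi>\<close> is brought back to normal form by
   \<open>dm\<close>; \<open>WW\<close> then evaluates the resulting functional at
   \<open>one\<close>.\<close>
 have 1: "WW g (antipode D (te v (cf b))) = sw3 (%v1 v2 v3. fscale (cf b (S (m (S v1) v3))) (KK g v2)) (Si v)" for v b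
 proof -
  have z: "lin sE (*) (%x. cf b (S x))" by (intro lin_intros)
  have "WW g (sw3 (%v1 v2 v3. te (m v2 one) (cv (ad (%x. cf b (S x)) v1 v3) eps)) (Si v)) =
   sw3 (%v1 v2 v3. WW g (te (m v2 one) (cv (ad (%x. cf b (S x)) v1 v3) eps))) (Si v)"
   by (rule linear_on_sw3[OF WW_linear[OF g]]) simp_all
  moreover have "WW g (te (m v2 one) (cv (ad (%x. cf b (S x)) v1 v3) eps)) = fscale (cf b (S (m (S v1) v3))) (KK g v2)" for v1 v2 v3
  proof -
   have "cv (ad (%x. cf b (S x)) v1 v3) eps one = cf b (S (m (S v1) v3))"
    by (simp add: cv_eps_right[OF lin_ad(4)[OF z]]) (simp add: ad_def)
   then show ?thesis
    by (subst WW_te[OF g lin_cv3[OF lin_ad(4)[OF z] lin_ident]]) simp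
  qed
  ultimately show ?thesis by (simp add: antipode_D_te dm_sw3)
 qed
 \<comment> \<open>The basis sum of the coproduct of \<open>\<xi>\<close> has its second factor
   evaluated at \<open>y\<close>, which leaves a shift by \<open>y\<close>.\<close>
 have 2: "(\<Sum>b\<in>bas. tri (rsh \<xi> b) (fscale (cf b y) c)) = tri (rsh \<xi> y) c" if "y \<in> carrier E" for y c
 proof -
  have l: "lin sE fscale (%z. tri (rsh \<xi> z) c)"
   unfolding rsh_def by (intro lin_tri_fun lin_compose[OF xi] lin_m2 lin_ident)
  have "tri (rsh \<xi> y) c = tri (rsh \<xi> (\<Sum>b\<in>bas. sE (cf b y) b)) c" using that by (simp add: basis_expand)
  also have "... = (\<Sum>b\<in>bas. fscale (cf b y) (tri (rsh \<xi> b) c))" by (simp add: lin_sum[OF l] lin_scale[OF l])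
  finally show ?thesis by (simp add: lin_scale[OF lin_tri[OF lin_ident]])
 qed
 have "hoch_dact E A act n (te w \<xi>) f as = sw (%w1 w2. \<Sum>b\<in>bas. dact (te w1 (rsh \<xi> b)) (WW g (antipode D (te w2 (cf b))))) w"
  unfolding hoch_dact_raw[OF f as] g_def[symmetric]
  using bilinear_on_amb[OF hoch_raw_bilinear[OF g]] by (intro lift_comult_D[OF vs_fscale _ xi]) simp
 also have "... = sw (%w1 w2. conj w1 (KK (%x. tri \<xi> (g x)) (Si w2))) w"
 proof -
  have "(\<Sum>b\<in>bas. dact (te w1 (rsh \<xi> b)) (WW g (antipode D (te w2 (cf b))))) = conj w1 (KK (%x. tri \<xi> (g x)) (Si w2))" for w1 w2
  proof -
   have c: "WW g (antipode D (te w2 (cf b))) \<in> tens_carrier A E" for b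
    using linear_on_compose[OF antipode_D_linear WW_linear[OF g]] by (simp add: linear_on_def)
   have "(\<Sum>b\<in>bas. dact (te w1 (rsh \<xi> b)) (WW g (antipode D (te w2 (cf b))))) =
    conj w1 (\<Sum>b\<in>bas. tri (rsh \<xi> b) (WW g (antipode D (te w2 (cf b)))))"
    by (simp add: smash_dact_te[OF c lin_rsh[OF xi]] da_conj lin_sum[OF lin_conj[OF lin_ident]])
   also have "(\<Sum>b\<in>bas. tri (rsh \<xi> b) (WW g (antipode D (te w2 (cf b))))) =
    sw3 (%v1 v2 v3. \<Sum>b\<in>bas. tri (rsh \<xi> b) (fscale (cf b (S (m (S v1) v3))) (KK g v2))) (Si w2)"
    unfolding 1 lin_of_sw3[OF lin_tri[OF lin_ident]] by (simp only: sw3_def sw_sum)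
   also have "... = KK (%x. tri \<xi> (g x)) (Si w2)"
    by (simp add: 2 tri_KK[OF g xi])
   finally show ?thesis .
  qed
  then show ?thesis by simp
 qed
 also have "... = AA w \<xi> g"
  unfolding AA_def by (rule conj_KK_Si) (intro lin_tri g)
 finally show ?thesis by (simp add: g_def[abs_def])
qed

lemma hoch_dact_outside: "as \<notin> tuples A n ==> hoch_dact E A act n h f as = 0"
 by (simp add: hoch_dact_def rel_restrict_def restr_def)

lemma hoch_dact_linear:
 assumes f: "f \<in> Ml n" and as: "as \<in> tuples A n"
 shows "linear_on ED TB (%h. hoch_dact E A act n h f as)"
 unfolding hoch_dact_raw[OF f as]
 by (rule linear_on_compose[OF comult_D_linear lift_linear[OF hoch_raw_bilinear[OF lin_dia_hat[OF f lin_ident]]]]) simp_all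

end


section \<open>Compatibility of the formula with the double, the differential and cup
  products\<close>

context module_alg
begin

abbreviation sF :: "'k => ('a list => ('k, 'a, 'e) tensor) => 'a list => ('k, 'a, 'e) tensor" where
 "sF \<equiv> %c f as. fscale c (f as)"

lemma lin_sF_apply: "lin sF fscale (%\<phi>. \<phi> as)"
 by (simp add: lin_def)

lemma lin_AA: "lin sE fscale g ==> lin s sE f ==> lin s fscale (%x. AA (f x) \<xi> g)"
 "(\<And>y. lin s (*) (%x. X x y)) ==> lin s fscale (%x. AA w (X x) g)"
 "(\<And>y. lin s fscale (%x. G x y)) ==> lin s fscale (%x. AA w \<xi> (G x))"
proof -
 show "lin s fscale (%x. AA w (X x) g)" if "\<And>y. lin s (*) (%x. X x y)"
  unfolding AA_def by (intro lin_sw3_fun lin_mB1 lin_mB2 lin_tri_fun that vs_fscale)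
 show "lin s fscale (%x. AA w \<xi> (G x))" if "\<And>y. lin s fscale (%x. G x y)"
  unfolding AA_def by (intro lin_sw3_fun lin_mB1 lin_mB2 lin_tri that vs_fscale)
 assume g: "lin sE fscale g" and f: "lin s sE f"
 show "lin s fscale (%x. AA (f x) \<xi> g)"
  unfolding AA_def by (intro lin_intros g lin_compose[OF g] f)
qed

lemma AA_closed [simp]: "AA w \<xi> g \<in> tens_carrier A E"
 unfolding AA_def sw3_def sw_def by (intro tens_carrier_sum mB_closed)

lemma AA_one:
 assumes g: "lin sE fscale g" shows "AA one \<xi> g = tri \<xi> (g one)"
proof -
 note l = lin_intros lin_compose[OF g]
 have 1: "sw (%b c. mB (mB (jj (S a)) (tri \<xi> (g b))) (jj c)) one = mB (mB (jj (S a)) (tri \<xi> (g one))) (jj one)" for a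
  by (rule sw_one[OF vs_fscale]) (intro l)+
 have "sw (%a r. sw (%b c. mB (mB (jj (S a)) (tri \<xi> (g b))) (jj c)) r) one =
   sw (%b c. mB (mB (jj (S one)) (tri \<xi> (g b))) (jj c)) one"
  by (rule sw_one[OF vs_fscale]) (intro l)+
 then show ?thesis unfolding AA_def sw3_def 1 by (simp add: jj_one)
qed

lemma dia_lin: "lin sF fscale (%\<phi>. dia \<phi> w as)"
 by (rule lin_dia_fun) (rule lin_sF_apply)

lemma dia_sw: "dia (%xs. sw (%x y. G x y xs) z) w as = sw (%x y. dia (G x y) w as) z"
proof -
 have "(%xs. sw (%x y. G x y xs) z) = sw G z" by (simp add: sw_def fun_eq_iff sum_fun_apply)
 then show ?thesis using lin_of_sw[OF dia_lin, of G z w as] by simp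
qed

lemma dia_add: "dia (%xs. \<phi> xs + \<psi> xs) w as = dia \<phi> w as + dia \<psi> w as"
 using lin_add[OF dia_lin, of \<phi> \<psi> w as] by (simp add: plus_fun_def)

lemma dia_scale: "dia (%xs. fscale c (\<phi> xs)) w as = fscale c (dia \<phi> w as)"
 using lin_scale[OF dia_lin, of c \<phi> w as] by simp

lemma dia_cong: "(\<And>xs. length xs = length as ==> set xs \<subseteq> carrier A ==> \<phi> xs = \<psi> xs) ==> dia \<phi> w as = dia \<psi> w as"
proof (induction as arbitrary: \<phi> \<psi> w)
 case (Cons a as)
 have "dia (%xs. \<phi> (al u a # xs)) v as = dia (%xs. \<psi> (al u a # xs)) v as" for u v
  by (rule Cons.IH) (simp add: Cons.prems)
 then show ?case by simp
qed simp

lemma dia_mB_left: "dia (%xs. mB c (\<phi> xs)) w as = mB c (dia \<phi> w as)"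
 by (induction as arbitrary: \<phi> w)
  (simp_all add: lin_scale[OF lin_mB2[OF lin_ident]] lin_of_sw[OF lin_mB2[OF lin_ident]])

lemma dia_mB_right: "dia (%xs. mB (\<phi> xs) c) w as = mB (dia \<phi> w as) c"
 by (induction as arbitrary: \<phi> w)
  (simp_all add: lin_scale[OF lin_mB1[OF lin_ident]] lin_of_sw[OF lin_mB1[OF lin_ident]])

lemma dia_tri: "dia (%xs. tri \<xi> (\<phi> xs)) w as = tri \<xi> (dia \<phi> w as)"
 by (induction as arbitrary: \<phi> w)
  (simp_all add: lin_scale[OF lin_tri[OF lin_ident]] lin_of_sw[OF lin_tri[OF lin_ident]])

lemma dia_AA: "dia (%xs. AA v \<eta> (%y. G y xs)) x as = AA v \<eta> (%y. dia (G y) x as)"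
 by (simp only: AA_def sw3_def dia_sw dia_mB_left dia_mB_right dia_tri)

lemma dia_one: "mlin sA \<phi> ==> dia \<phi> one as = \<phi> (map Q as)"
proof (induction as arbitrary: \<phi>)
 case Nil then show ?case by (simp add: vector_space_one[OF vs_fscale])
next
 case (Cons a as)
 have "dia \<phi> one (a # as) = dia (%xs. \<phi> (al one a # xs)) one as"
  unfolding dia.simps
  by (rule sw_one[OF vs_fscale])
   (intro lin_dia_fun mlin_hd[OF Cons.prems] lin_al1 lin_dia mlin_Cons Cons.prems lin_ident)+
 then show ?case using Cons.IH[OF mlin_Cons[OF Cons.prems], of "Q a"] by simp
qed

text \<open>\<open>x\<close> acts on the arguments first and \<open>y\<close> next, so the product
  is \<open>yx\<close>; on cochains this is a right action.\<close>

lemma dia_dia: "mlin sA \<phi> ==> dia (dia \<phi> y) x as = dia \<phi> (m y x) as"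
proof (induction as arbitrary: \<phi> y x)
 case Nil then show ?case by (simp add: vector_space_mult[OF vs_fscale] mult.commute)
next
 case (Cons a as)
 have IH: "dia (%xs. dia (%zs. \<phi> (c # zs)) y' xs) x' as = dia (%zs. \<phi> (c # zs)) (m y' x') as" for c y' x'
  by (rule Cons.IH) (rule mlin_Cons[OF Cons.prems])
 have "dia (dia \<phi> y) x (a # as) = sw (%x1 x2. sw (%y1 y2. dia (%xs. \<phi> (al (m y1 x1) a # xs)) (m y2 x2) as) y) x"
  by (simp add: dia_sw IH al_m)
 also have "... = sw (%y1 y2. sw (%x1 x2. dia (%xs. \<phi> (al (m y1 x1) a # xs)) (m y2 x2) as) x) y"
  by (rule sw_swap)
 also have "... = dia \<phi> (m y x) (a # as)"
  unfolding dia.simps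
  by (rule sw_m[symmetric, OF vs_fscale])
   (intro lin_dia_fun mlin_hd[OF Cons.prems] lin_al1 lin_dia mlin_Cons Cons.prems lin_ident)+
 finally show ?case .
qed

lemma mlin_dia_right: "mlin sA \<phi> ==> mlin sA (%xs. dia (%ys. \<phi> (xs @ ys)) w vs)"
 unfolding mlin_def[of sA "%xs. dia (%ys. \<phi> (xs @ ys)) w vs"]
proof (intro allI lin_dia_fun)
 fix us zs ys assume "mlin sA \<phi>"
 then show "lin sA fscale (%x. \<phi> ((us @ x # zs) @ ys))" using mlin_slot[of sA \<phi> us "zs @ ys"] by simp
qed

lemma mlin_append: "mlin s \<phi> ==> mlin s (%as. \<phi> (us @ as))"
 using mlin_slot[of s \<phi> "us @ vs" for vs] by (simp add: mlin_def)

lemma dia_append: "mlin sA \<phi> ==>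
  dia \<phi> w (us @ vs) = sw (%w1 w2. dia (%xs. dia (%ys. \<phi> (xs @ ys)) w2 vs) w1 us) w"
proof (induction us arbitrary: \<phi> w)
 case Nil
 have "sw (%w1 w2. fscale (eps w1) (dia \<phi> w2 vs)) w = dia \<phi> (P w) vs"
  by (rule sw_counit_left) (intro lin_dia Nil lin_ident)
 then show ?case by simp
next
 case (Cons a us)
 have IH: "dia (%xs. \<phi> (c # xs)) t (us @ vs) =
  sw (%w1 w2. dia (%xs. dia (%ys. \<phi> (c # xs @ ys)) w2 vs) w1 us) t" for c t
  by (rule Cons.IH) (rule mlin_Cons[OF Cons.prems])
 have ml: "mlin sA (%xs. dia (%ys. \<phi> (c # xs @ ys)) w vs)" for c w
  using mlin_dia_right[OF mlin_Cons[OF Cons.prems]] by simp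
 have ml2: "mlin sA (%ys. \<phi> (c # xs @ ys))" for c xs
  by (rule mlin_append[OF mlin_Cons[OF Cons.prems]])
 show ?case
  unfolding append_Cons dia.simps IH
  by (rule sw_coassoc[symmetric, OF vs_fscale])
   (intro lin_dia[OF ml] lin_dia_fun lin_dia[OF ml2] mlin_hd[OF Cons.prems] lin_al1 lin_ident)+
qed

text \<open>The commutation rule of the double as it occurs in \<open>B\<close>: the coactions of
  \<open>S(x)\<close> and \<open>y\<close> surround the argument of \<open>\<xi>\<close>, which
  gives \<open>ad \<xi> p s\<close>.\<close>

lemma tri_sandwich:
 assumes xi: "lin sE (*) \<xi>" and eta: "lin sE (*) \<eta>"
 shows "tri \<xi> (mB (mB (jj (S x)) (tri \<eta> d)) (jj y)) =
  sw (%p q. sw (%r s. mB (mB (jj (S q)) (tri (cv (ad \<xi> p s) \<eta>) d)) (jj r)) y) x"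
proof -
 have rl: "lin t sE f ==> lin t (*) (%z. \<xi> (f z))" for t f by (rule lin_compose[OF xi])
 have 1: "tri (rsh \<xi> s) (mB (jj (S x)) (tri \<eta> d)) = sw (%p q. mB (jj (S q)) (tri (cv (ad \<xi> p s) \<eta>) d)) x" for s
 proof -
  have "tri (rsh \<xi> s) (mB (jj (S x)) (tri \<eta> d)) =
   sw (%x1 x2. mB (jj x1) (tri (%z. rsh \<xi> s (m x2 z)) (tri \<eta> d))) (S x)"
   by (rule tri_jj_left[OF lin_rsh[OF xi]])
  also have "... = sw (%p q. mB (jj (S q)) (tri (%z. rsh \<xi> s (m (S p) z)) (tri \<eta> d))) x"
   unfolding rsh_def by (rule sw_S[OF vs_fscale]) (intro lin_intros rl)+
  also have "... = sw (%p q. mB (jj (S q)) (tri (ad \<xi> p s) (tri \<eta> d))) x"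
   by (simp add: rsh_def ad_def)
  finally show ?thesis by (simp only: tri_tri[OF lin_ad(4)[OF xi] eta])
 qed
 have "tri \<xi> (mB (mB (jj (S x)) (tri \<eta> d)) (jj y)) =
   sw (%r s. sw (%p q. mB (mB (jj (S q)) (tri (cv (ad \<xi> p s) \<eta>) d)) (jj r)) x) y"
  unfolding tri_jj_right[OF xi] 1 lin_of_sw[OF lin_mB1[OF lin_ident]] ..
 also have "... = sw (%p q. sw (%r s. mB (mB (jj (S q)) (tri (cv (ad \<xi> p s) \<eta>) d)) (jj r)) y) x"
  by (rule sw_swap)
 finally show ?thesis .
qed

text \<open>The element \<open>v\<close> falls into five parts: the two outer ones surround the
  argument of \<open>\<xi>\<close>, and the inner three multiply the parts of \<open>w\<close>. By
  \<open>sw5\<close> and \<open>sw3_m\<close> this is the product \<open>dm\<close> of the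
  double.\<close>

lemma AA_mult:
 assumes xi: "lin sE (*) \<xi>" and eta: "lin sE (*) \<eta>" and g: "lin sE fscale g"
 shows "AA w \<xi> (%x. AA v \<eta> (%y. g (m y x))) = sw3 (%v1 v2 v3. AA (m v2 w) (cv (ad \<xi> v1 v3) \<eta>) g) v"
proof -
 define K where "K p s a b c = mB (mB (jj (S a)) (tri (cv (ad \<xi> p s) \<eta>) (g b))) (jj c)" for p s a b c
 note l = lin_intros lin_compose[OF g] lin_ad[OF xi]
 have K: "lin sE fscale (%p. K p s a b c)" "lin sE fscale (%s. K p s a b c)" "lin sE fscale (%a. K p s a b c)"
  "lin sE fscale (%b. K p s a b c)" "lin sE fscale (%c. K p s a b c)" for p s a b c
  unfolding K_def by (intro l)+
 note lK = lin_intros lin_compose[OF K(1)] lin_compose[OF K(2)] lin_compose[OF K(3)] lin_compose[OF K(4)] lin_compose[OF K(5)]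
 have 1: "mB (mB (jj (S a)) (tri \<xi> (AA v \<eta> (%y. g (m y b))))) (jj c) =
   sw3 (%p t s. sw3 (%q e r. K p s (m q a) (m e b) (m r c)) t) v" for a b c
 proof -
  have "mB (mB (jj (S a)) (tri \<xi> (AA v \<eta> (%y. g (m y b))))) (jj c) =
    sw3 (%x e y. sw (%p q. sw (%r s. K p s (m q a) (m e b) (m r c)) y) x) v"
   unfolding AA_def lin_of_sw3[OF lin_tri[OF lin_ident]] tri_sandwich[OF xi eta]
    lin_of_sw3[OF lin_mB1[OF lin_ident]] lin_of_sw3[OF lin_mB2[OF lin_ident]]
    lin_of_sw[OF lin_mB1[OF lin_ident]] lin_of_sw[OF lin_mB2[OF lin_ident]] K_def
   by (simp add: mB_assoc jj_jj[symmetric] S_m)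
  also have "... = sw3 (%p t s. sw3 (%q e r. K p s (m q a) (m e b) (m r c)) t) v"
   by (rule sw5[OF vs_fscale]) (intro lK)+
  finally show ?thesis .
 qed
 have "AA w \<xi> (%x. AA v \<eta> (%y. g (m y x))) =
   sw3 (%a b c. sw3 (%p t s. sw3 (%q e r. K p s (m q a) (m e b) (m r c)) t) v) w"
  unfolding AA_def[of w] 1 ..
 also have "... = sw3 (%p t s. sw3 (%a b c. sw3 (%q e r. K p s (m q a) (m e b) (m r c)) t) w) v"
  by (rule sw3_swap)
 also have "... = sw3 (%p t s. sw3 (%q e r. sw3 (%a b c. K p s (m q a) (m e b) (m r c)) w) t) v"
  by (subst sw3_swap) (rule refl)
 also have "... = sw3 (%p t s. sw3 (K p s) (m t w)) v"
  by (subst sw3_m[OF vs_fscale]) (intro lK refl)+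
 finally show ?thesis by (simp add: AA_def K_def[abs_def])
qed

text \<open>\<open>hT\<close> for coefficients in \<open>B\<close>, with total operations. Adding a
  multiple by \<open>-1\<close>, in place of a difference, lets \<open>lin_plus\<close> and
  \<open>lin_scale_right\<close> show linearity.\<close>

fun tT :: "('a list => ('k, 'a, 'e) tensor) => 'a list => ('k, 'a, 'e) tensor" where
 "tT \<phi> [] = 0"
| "tT \<phi> [a] = mB (\<phi> []) (ii a)"
| "tT \<phi> (a # b # as) = \<phi> (mu a b # as) + fscale (-1) (tT (%xs. \<phi> (a # xs)) (b # as))"

lemma lin_tT_fun: "(\<And>as. lin s fscale (%x. G x as)) ==> lin s fscale (%x. tT (G x) (a # as))"
proof (induction as arbitrary: G a)
 case Nil then show ?case unfolding tT.simps by (intro lin_intros)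
next
 case (Cons b as)
 have "lin s fscale (%x. tT (%xs. G x (a # xs)) (b # as))"
  by (rule Cons.IH) (rule Cons.prems)
 then show ?case unfolding tT.simps by (intro lin_plus lin_scale_right Cons.prems vs_fscale)
qed

lemma lin_tT_hd:
 assumes ml: "mlin sA \<phi>" and f: "lin s sA f" shows "lin s fscale (%x. tT \<phi> (f x # as))"
proof (cases as)
 case Nil show ?thesis unfolding Nil tT.simps by (intro lin_intros f)
next
 case (Cons b bs)
 show ?thesis unfolding Cons tT.simps
  by (intro lin_plus lin_scale_right mlin_hd[OF ml] lin_mu1 lin_tT_fun f vs_fscale)
qed

lemma tT_sw: "tT (%xs. sw (%x y. G x y xs) z) (a # as) = sw (%x y. tT (G x y) (a # as)) z"
proof -
 have "(%xs. sw (%x y. G x y xs) z) = sw G z" by (simp add: sw_def fun_eq_iff sum_fun_apply)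
 then show ?thesis
  using lin_of_sw[OF lin_tT_fun[where G = "%\<phi>. \<phi>" and a = a and as = as, OF lin_sF_apply], where \<phi> = G and z = z] by simp
qed

lemma tT_mB_left: "tT (%xs. mB c (\<phi> xs)) as = mB c (tT \<phi> as)"
proof (induction \<phi> as rule: tT.induct)
 case 1 show ?case unfolding tT.simps by (rule lin_zero[symmetric, OF lin_mB2[OF lin_ident]])
next
 case 2 show ?case by (simp add: mB_assoc)
next
 case (3 \<phi> a b as)
 show ?case unfolding tT.simps 3 lin_add[OF lin_mB2[OF lin_ident]] lin_scale[OF lin_mB2[OF lin_ident]] ..
qed

text \<open>By the module algebra law, acting on the merged argument \<open>ab\<close> is the same
  as acting on \<open>a\<close> and \<open>b\<close> before they are merged.\<close>

lemma dia_tT: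
 assumes ml: "mlin sA \<phi>"
 shows "dia (tT \<phi>) x (a # b # as) =
  dia \<phi> x (mu a b # as) + fscale (-1) (sw (%x1 x2. dia (tT (%xs. \<phi> (al x1 a # xs))) x2 (b # as)) x)"
proof -
 have "dia \<phi> x (mu a b # as) = sw (%t x4. sw (%x1 x3. dia (%xs. \<phi> (mu (al x1 a) (al x3 b) # xs)) x4 as) t) x"
 proof -
  have "dia (%xs. \<phi> (al t (mu a b) # xs)) x4 as = sw (%x1 x3. dia (%xs. \<phi> (mu (al x1 a) (al x3 b) # xs)) x4 as) t" for t x4
   unfolding al_mu
   by (rule lin_of_sw[OF lin_dia_fun[OF mlin_hd[OF ml lin_ident]]])
  then show ?thesis by simp
 qed
 also have "... = sw (%x1 x2. sw (%x3 x4. dia (%xs. \<phi> (mu (al x1 a) (al x3 b) # xs)) x4 as) x2) x"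
  by (rule sw_coassoc[OF vs_fscale])
   (intro lin_dia_fun mlin_hd[OF ml] lin_mu1 lin_mu2 lin_al1 lin_ident lin_dia mlin_Cons ml)+
 finally have 1: "dia \<phi> x (mu a b # as) = ..." .
 have 2: "sw (%p q. G p q + G' p q) z = sw G z + sw G' z" for G G' :: "'e => 'e => ('k, 'a, 'e) tensor" and z
  by (simp add: sw_def sum.distrib)
 have "dia (tT \<phi>) x (a # b # as) = sw (%x1 x2. sw (%x3 x4. dia (%xs. \<phi> (mu (al x1 a) (al x3 b) # xs)) x4 as) x2) x +
   fscale (-1) (sw (%x1 x2. dia (tT (%xs. \<phi> (al x1 a # xs))) x2 (b # as)) x)"
  unfolding dia.simps tT.simps dia_add dia_scale 2 lin_of_sw[OF lin_scale_right[OF vs_fscale lin_ident]] ..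
 then show ?thesis by (simp only: 1)
qed

text \<open>\<open>AA\<close> without its left factor \<open>S(a)\<close>. The terms of
  \<open>tT\<close> multiply values only from the right, so they commute with \<open>RR\<close>; the
  left factor has to be moved only for the leading term of the differential.\<close>

definition RR where "RR \<xi> g w = sw (%b c. mB (tri \<xi> (g b)) (jj c)) w"

lemma AA_RR: "AA w \<xi> g = sw (%a r. mB (jj (S a)) (RR \<xi> g r)) w"
 unfolding AA_def RR_def sw3_def lin_of_sw[OF lin_mB2[OF lin_ident]] mB_assoc ..

lemma lin_RR: "lin sE fscale g ==> lin s sE f ==> lin s fscale (%x. RR \<xi> g (f x))"
 "(\<And>y. lin s fscale (%x. G x y)) ==> lin s fscale (%x. RR \<xi> (G x) w)"
proof -
 show "lin s fscale (%x. RR \<xi> (G x) w)" if "\<And>y. lin s fscale (%x. G x y)"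
  unfolding RR_def by (intro lin_sw_fun lin_mB1 lin_tri that vs_fscale)
 assume g: "lin sE fscale g" and f: "lin s sE f"
 show "lin s fscale (%x. RR \<xi> g (f x))"
  unfolding RR_def by (intro lin_intros g lin_compose[OF g] f)
qed

lemma RR_add: "RR \<xi> (%x. g x + fscale c (g' x)) w = RR \<xi> g w + fscale c (RR \<xi> g' w)"
 by (simp add: RR_def lin_add[OF lin_tri[OF lin_ident]] lin_add[OF lin_mB1[OF lin_ident]]
  lin_scale[OF lin_tri[OF lin_ident]] lin_scale[OF lin_mB1[OF lin_ident]] sw_def sum.distrib vector_space_sum[OF vs_fscale])

lemma RR_sw:
 assumes G: "\<And>y. lin sE fscale (%x. G x y)" "\<And>x. lin sE fscale (G x)"
 shows "RR \<xi> (%x. sw G x) w = sw (%x1 t. RR \<xi> (G x1) t) w"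
proof -
 have "RR \<xi> (%x. sw G x) w = sw (%x c. sw (%x1 x2. mB (tri \<xi> (G x1 x2)) (jj c)) x) w"
  unfolding RR_def lin_of_sw[OF lin_tri[OF lin_ident]] lin_of_sw[OF lin_mB1[OF lin_ident]] ..
 also have "... = sw (%x1 t. sw (%x2 c. mB (tri \<xi> (G x1 x2)) (jj c)) t) w"
  by (rule sw_coassoc[OF vs_fscale]) (intro lin_mB1 lin_mB2 lin_tri lin_jj lin_ident G)+
 finally show ?thesis by (simp add: RR_def)
qed

lemma RR_tT:
 assumes xi: "lin sE (*) \<xi>"
 shows "mlin sA \<phi> ==> RR \<xi> (%x. dia (tT \<phi>) x (a # as)) w = tT (%xs. RR \<xi> (%x. dia \<phi> x xs) w) (a # as)"
proof (induction as arbitrary: \<phi> a w)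
 case Nil
 have 1: "dia (tT \<phi>) x [a] = mB (\<phi> []) (ii (al x a))" for x
 proof -
  have "dia (tT \<phi>) x [a] = mB (\<phi> []) (ii (al (P x) a))"
   unfolding dia.simps tT.simps by (rule sw_counit_right) (intro lin_intros)
  then show ?thesis by simp
 qed
 have 2: "RR \<xi> (%x. dia \<phi> x []) w = mB (tri \<xi> (\<phi> [])) (jj w)"
 proof -
  have "RR \<xi> (%x. dia \<phi> x []) w = sw (%b c. fscale (eps b) (mB (tri \<xi> (\<phi> [])) (jj c))) w"
   by (simp add: RR_def lin_scale[OF lin_tri[OF lin_ident]] lin_scale[OF lin_mB1[OF lin_ident]])
  also have "... = mB (tri \<xi> (\<phi> [])) (jj (P w))" by (rule sw_counit_left) (intro lin_intros)
  finally show ?thesis by simp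
 qed
 \<comment> \<open>For the last term of the differential, the part acting on \<open>a\<close> and
   the remaining factor \<open>c\<close> recombine to \<open>w a\<close> by the commutation
   relation.\<close>
 have "RR \<xi> (%x. dia (tT \<phi>) x [a]) w = sw (%b c. mB (tri \<xi> (\<phi> [])) (mB (ii (al b a)) (jj c))) w"
  unfolding 1 RR_def tri_ii_right[OF xi] mB_assoc ..
 also have "... = mB (tri \<xi> (\<phi> [])) (mB (jj w) (ii a))"
  unfolding jj_ii by (rule lin_of_sw[symmetric, OF lin_mB2[OF lin_ident]])
 finally show ?case by (simp only: tT.simps 2 mB_assoc)
next
 case (Cons b as)
 note ml = Cons.prems
 have G: "lin sE fscale (%x. dia (tT (%xs. \<phi> (al x a # xs))) y (b # as))"
  "lin sE fscale (%y. dia (tT (%xs. \<phi> (al x a # xs))) y (b # as))" for x y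
 proof -
  show "lin sE fscale (%x. dia (tT (%xs. \<phi> (al x a # xs))) y (b # as))"
   unfolding dia.simps
   by (intro lin_sw_fun lin_dia_fun lin_tT_fun mlin_hd[OF ml] lin_al1 lin_ident vs_fscale)
  show "lin sE fscale (%y. dia (tT (%xs. \<phi> (al x a # xs))) y (b # as))"
   unfolding dia.simps
   by (intro lin_sw_arg lin_dia_fun lin_tT_hd mlin_Cons[OF ml] lin_al1 lin_ident vs_fscale)
 qed
 have IH: "RR \<xi> (%x. dia (tT (%xs. \<phi> (c # xs))) x (b # as)) t = tT (%xs. RR \<xi> (%x. dia (%zs. \<phi> (c # zs)) x xs) t) (b # as)" for c t
  by (rule Cons.IH) (rule mlin_Cons[OF ml])
 have 1: "RR \<xi> (%x. dia \<phi> x (a # xs)) w = sw (%x1 t. RR \<xi> (%x. dia (%zs. \<phi> (al x1 a # zs)) x xs) t) w" for xs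
  unfolding dia.simps
  by (rule RR_sw) (intro lin_dia_fun mlin_hd[OF ml] lin_al1 lin_ident lin_dia mlin_Cons ml)+
 have "RR \<xi> (%x. dia (tT \<phi>) x (a # b # as)) w = RR \<xi> (%x. dia \<phi> x (mu a b # as)) w +
   fscale (-1) (sw (%x1 t. RR \<xi> (%x. dia (tT (%xs. \<phi> (al x1 a # xs))) x (b # as)) t) w)"
  unfolding dia_tT[OF ml] RR_add
  by (subst RR_sw[where G = "%x1 x2. dia (tT (%xs. \<phi> (al x1 a # xs))) x2 (b # as)"]) (intro G refl)+
 also have "sw (%x1 t. RR \<xi> (%x. dia (tT (%xs. \<phi> (al x1 a # xs))) x (b # as)) t) w =
   tT (%xs. RR \<xi> (%x. dia \<phi> x (a # xs)) w) (b # as)"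
  unfolding IH 1 tT_sw ..
 finally show ?case by (simp only: tT.simps)
qed

text \<open>The Hochschild differential in all degrees at once, as the list determines the
  degree.\<close>

primrec tdd :: "('a list => ('k, 'a, 'e) tensor) => 'a list => ('k, 'a, 'e) tensor" where
 "tdd \<phi> [] = 0"
| "tdd \<phi> (a # as) = mB (ii a) (\<phi> as) + fscale (-1) (tT \<phi> (a # as))"

text \<open>Moving \<open>S(x)\<close> to the right of \<open>y\<cdot>a\<close> makes
  \<open>S(x2) y\<close> act on \<open>a\<close>, and this cancels. It settles the leading term of
  the differential.\<close>

lemma jj_S_ii: "sw (%x y. mB (jj (S x)) (ii (al y a))) w = mB (ii a) (jj (S w))"
proof -
 have 1: "mB (jj (S x)) (ii (al y a)) = sw (%x1 x2. mB (ii (al (m (S x2) y) a)) (jj (S x1))) x" for x y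
 proof -
  have "mB (jj (S x)) (ii (al y a)) = sw (%p q. mB (ii (al p (al y a))) (jj q)) (S x)" by (rule jj_ii)
  also have "... = sw (%x1 x2. mB (ii (al (S x2) (al y a))) (jj (S x1))) x"
   by (rule sw_S[OF vs_fscale]) (intro lin_intros)+
  finally show ?thesis by (simp add: al_m)
 qed
 have "sw (%x y. sw (%x1 x2. mB (ii (al (m (S x2) y) a)) (jj (S x1))) x) w =
   sw (%x1 t. sw (%x2 y. mB (ii (al (m (S x2) y) a)) (jj (S x1))) t) w"
  by (rule sw_coassoc[OF vs_fscale]) (intro lin_intros)+
 also have "... = sw (%x1 t. fscale (eps t) (mB (ii (al one a)) (jj (S x1)))) w"
 proof -
  have "sw (%x2 y. mB (ii (al (m (S x2) y) a)) (jj (S x1))) t = fscale (eps t) (mB (ii (al one a)) (jj (S x1)))" for x1 t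
   by (rule sw_antipode_left[where f = "%z. mB (ii (al z a)) (jj (S x1))"]) (intro lin_intros)
  then show ?thesis by simp
 qed
 also have "... = mB (ii (al one a)) (jj (S (P w)))"
  by (rule sw_counit_right) (intro lin_intros)
 finally show ?thesis unfolding 1 by simp
qed

text \<open>The leading term passes \<open>S(p)\<close> by \<open>jj_S_ii\<close>, the other terms
  are covered by \<open>RR_tT\<close>. Both parts use that \<open>E*\<close> acts linearly over
  \<open>A\<close>.\<close>

lemma AA_tdd:
 assumes xi: "lin sE (*) \<xi>" and ml: "mlin sA \<phi>"
 shows "AA w \<xi> (%x. dia (tdd \<phi>) x (a # as)) = tdd (%xs. AA w \<xi> (%x. dia \<phi> x xs)) (a # as)"
proof -
 define D where "D x = dia \<phi> x as" for x
 have D: "lin sE fscale D" unfolding D_def[abs_def] by (intro lin_dia ml lin_ident)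
 have sp: "sw (%p q. G p q + G' p q) z = sw G z + sw G' z" for G G' :: "'e => 'e => ('k, 'a, 'e) tensor" and z
  by (simp add: sw_def sum.distrib)
 have 1: "dia (tdd \<phi>) x (a # as) = sw (%x1 x2. mB (ii (al x1 a)) (D x2)) x + fscale (-1) (dia (tT \<phi>) x (a # as))" for x
  unfolding dia.simps tdd.simps dia_add dia_scale dia_mB_left sp D_def
   lin_of_sw[OF lin_scale_right[OF vs_fscale lin_ident]] ..
 have 2: "RR \<xi> (%x. sw (%x1 x2. mB (ii (al x1 a)) (D x2)) x) r = sw (%x1 t. mB (ii (al x1 a)) (RR \<xi> D t)) r" for r
 proof -
  have "RR \<xi> (%x. mB (ii c) (D x)) t = mB (ii c) (RR \<xi> D t)" for c t
   unfolding RR_def tri_ii_left[OF xi] mB_assoc lin_of_sw[OF lin_mB2[OF lin_ident]] ..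
  then have e: "RR \<xi> (%x. mB (ii c) (D x)) = (%t. mB (ii c) (RR \<xi> D t))" for c
   by (rule ext)
  have "RR \<xi> (%x. sw (%x1 x2. mB (ii (al x1 a)) (D x2)) x) r = sw (%x1 t. RR \<xi> (%x2. mB (ii (al x1 a)) (D x2)) t) r"
   by (rule RR_sw) (intro lin_intros lin_compose[OF D])+
  then show ?thesis by (simp only: e)
 qed
 have 3: "sw (%p r. mB (jj (S p)) (sw (%x1 t. mB (ii (al x1 a)) (RR \<xi> D t)) r)) w = mB (ii a) (AA w \<xi> D)"
 proof -
  have "sw (%p r. mB (jj (S p)) (sw (%x1 t. mB (ii (al x1 a)) (RR \<xi> D t)) r)) w =
    sw (%p r. sw (%x1 t. mB (mB (jj (S p)) (ii (al x1 a))) (RR \<xi> D t)) r) w"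
   unfolding lin_of_sw[OF lin_mB2[OF lin_ident]] mB_assoc ..
  also have "... = sw (%q t. sw (%p x1. mB (mB (jj (S p)) (ii (al x1 a))) (RR \<xi> D t)) q) w"
   by (rule sw_coassoc[symmetric, OF vs_fscale]) (intro lin_intros lin_RR D)+
  also have "... = sw (%q t. mB (mB (ii a) (jj (S q))) (RR \<xi> D t)) w"
   unfolding jj_S_ii[symmetric] lin_of_sw[OF lin_mB1[OF lin_ident]] ..
  finally show ?thesis unfolding AA_RR lin_of_sw[OF lin_mB2[OF lin_ident]] mB_assoc .
 qed
 have 4: "sw (%p r. mB (jj (S p)) (tT (%xs. RR \<xi> (%x. dia \<phi> x xs) r) (a # as))) w =
   tT (%xs. AA w \<xi> (%x. dia \<phi> x xs)) (a # as)"
  unfolding AA_RR tT_sw tT_mB_left ..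
 have "AA w \<xi> (%x. dia (tdd \<phi>) x (a # as)) =
   sw (%p r. mB (jj (S p)) (sw (%x1 t. mB (ii (al x1 a)) (RR \<xi> D t)) r)) w +
   fscale (-1) (sw (%p r. mB (jj (S p)) (tT (%xs. RR \<xi> (%x. dia \<phi> x xs) r) (a # as))) w)"
  unfolding AA_RR 1 RR_add 2 RR_tT[OF xi ml] lin_add[OF lin_mB2[OF lin_ident]] lin_scale[OF lin_mB2[OF lin_ident]] sp
   lin_of_sw[OF lin_scale_right[OF vs_fscale lin_ident]] ..
 then show ?thesis unfolding 3 4 tdd.simps D_def .
qed

text \<open>On the left, \<open>tri_mB\<close> distributes \<open>\<xi>\<close> over the product. On
  the right, the last factor \<open>c\<close> of the first formula meets the first factor
  \<open>S(d)\<close> of the second one and cancels.\<close>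

lemma AA_cup:
 assumes xi: "lin sE (*) \<xi>" and g: "lin sE fscale g" and g': "lin sE fscale g'"
 shows "AA w \<xi> (%x. sw (%x1 x2. mB (g x1) (g' x2)) x) =
  sw (%w1 w2. \<Sum>b\<in>bas. mB (AA w1 (rsh \<xi> b) g) (AA w2 (cf b) g')) w"
proof -
 \<comment> \<open>\<open>z\<close> is the factor between the two values: \<open>one\<close> on the
   left side, \<open>c S(d)\<close> on the right side.\<close>
 define K where "K a b z e f = (\<Sum>i\<in>bas. mB (mB (mB (mB (jj (S a)) (tri (rsh \<xi> i) (g b))) (jj z)) (tri (cf i) (g' e))) (jj f))" for a b z e f
 note l = lin_intros lin_compose[OF g] lin_compose[OF g']
 have K: "lin sE fscale (%a. K a b z e f)" "lin sE fscale (%b. K a b z e f)" "lin sE fscale (%z. K a b z e f)"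
  "lin sE fscale (%e. K a b z e f)" "lin sE fscale (%f. K a b z e f)" for a b z e f
  unfolding K_def by (intro l)+
 note lK = lin_intros lin_compose[OF K(1)] lin_compose[OF K(2)] lin_compose[OF K(3)] lin_compose[OF K(4)] lin_compose[OF K(5)]
 define V where "V r z s = sw (%a b. sw (%e f. K a b z e f) s) r" for r z s
 have V: "lin sE fscale (%r. V r z s)" "lin sE fscale (%z. V r z s)" "lin sE fscale (%s. V r z s)" for r z s
  unfolding V_def by (intro lK)+
 note lV = lin_intros lin_compose[OF V(1)] lin_compose[OF V(2)] lin_compose[OF V(3)]
 have "AA w \<xi> (%x. sw (%x1 x2. mB (g x1) (g' x2)) x) = sw (%a y. sw (%x f. sw (%b e. K a b one e f) x) y) w"
  unfolding AA_def sw3_def lin_of_sw[OF lin_tri[OF lin_ident]] tri_mB[OF xi]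
   lin_of_sw[OF lin_mB1[OF lin_ident]] lin_of_sw[OF lin_mB2[OF lin_ident]]
   lin_sum[OF lin_mB1[OF lin_ident]] lin_sum[OF lin_mB2[OF lin_ident]]
  by (simp add: K_def jj_one mB_assoc)
 also have "... = sw (%a y. sw (%b s. sw (%e f. K a b one e f) s) y) w"
  by (subst sw_coassoc[OF vs_fscale]) (intro lK refl)+
 also have "... = sw (%r s. sw (%a b. sw (%e f. K a b one e f) s) r) w"
  by (rule sw_coassoc[symmetric, OF vs_fscale]) (intro lK)+
 finally have L: "AA w \<xi> (%x. sw (%x1 x2. mB (g x1) (g' x2)) x) = ..." .
 have A1: "AA w1 \<zeta> g = sw (%r c. sw (%a b. mB (mB (jj (S a)) (tri \<zeta> (g b))) (jj c)) r) w1" for w1 \<zeta>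
  unfolding AA_def by (rule sw3_left[OF vs_fscale]) (intro l)+
 have A2: "AA w2 \<zeta> g' = sw (%d s. sw (%e f. mB (mB (jj (S d)) (tri \<zeta> (g' e))) (jj f)) s) w2" for w2 \<zeta>
  unfolding AA_def sw3_def ..
 have ss: "(\<Sum>b\<in>bas. sw (%x y. G b x y) z) = sw (%x y. \<Sum>b\<in>bas. G b x y) z" for G :: "'e => 'e => 'e => ('k, 'a, 'e) tensor" and z
  by (rule sw_sum[symmetric])
 have "sw (%w1 w2. \<Sum>b\<in>bas. mB (AA w1 (rsh \<xi> b) g) (AA w2 (cf b) g')) w =
   sw (%w1 w2. sw (%r c. sw (%a b. sw (%d s. sw (%e f. K a b (m c (S d)) e f) s) w2) r) w1) w"
  unfolding A1 A2 lin_of_sw[OF lin_mB1[OF lin_ident]]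
  unfolding lin_of_sw[OF lin_mB2[OF lin_ident]] ss K_def
  by (simp add: mB_assoc jj_jj[symmetric])
 also have "... = sw (%w1 w2. sw (%r c. sw (%d s. V r (m c (S d)) s) w2) w1) w"
 proof -
  have "sw (%a b. sw (%d s. sw (%e f. K a b (m c (S d)) e f) s) w2) r = sw (%d s. V r (m c (S d)) s) w2" for c r w2
   unfolding V_def by (rule sw_swap)
  then show ?thesis by (simp only:)
 qed
 also have "... = sw (%r t. sw (%c w2. sw (%d s. V r (m c (S d)) s) w2) t) w"
  by (rule sw_coassoc[OF vs_fscale]) (intro lV)+
 also have "... = sw (%r t. V r one t) w"
 proof -
  have "sw (%c w2. sw (%d s. V r (m c (S d)) s) w2) t = V r one t" for r t
  proof -
   have "sw (%c w2. sw (%d s. V r (m c (S d)) s) w2) t = sw (%t' s. sw (%c d. V r (m c (S d)) s) t') t"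
    by (rule sw_coassoc[symmetric, OF vs_fscale]) (intro lV)+
   also have "... = sw (%t' s. fscale (eps t') (V r one s)) t"
   proof -
    have "sw (%c d. V r (m c (S d)) s) t' = fscale (eps t') (V r one s)" for s t'
     by (rule sw_antipode_right[where f = "%z. V r z s"]) (rule V)
    then show ?thesis by (simp only:)
   qed
   also have "... = V r one (P t)"
    by (rule sw_counit_left) (rule V)
   also have "... = V r one t" by (simp add: V_def)
   finally show ?thesis .
  qed
  then show ?thesis by (simp only:)
 qed
 finally show ?thesis unfolding L V_def by (rule sym)
qed

end


section \<open>The twisted dg module algebra\<close>

lemma fun_plusI: "(\<And>x. f x = g x + h x) ==> f = g + h"
 by (simp add: fun_eq_iff)

section \<open>Cochains with values in the smash product as a dg module algebra over the
  double\<close>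

context module_alg
begin

lemma fscale_minus: "fscale (-1) x = - x"
 by (simp add: fscale_def fun_eq_iff)

lemma incl_A_linear: "linear_on A B (incl_A E A)"
 using lin_add[OF lin_ii[OF lin_ident]] lin_scale[OF lin_ii[OF lin_ident]]
 by (simp add: linear_on_def incl_A_eq vec_space_add_closed[OF vec_space_A] vec_space_scale_closed[OF vec_space_A])

lemma hochschild_B: "hochschild A B (incl_A E A)"
proof (rule hochschild.intro[OF alg_A alg_B incl_A_linear])
 fix a b assume "a \<in> carrier A" "b \<in> carrier A"
 then show "incl_A E A (mult A a b) = mult B (incl_A E A a) (incl_A E A b)"
  by (simp add: mu_eq incl_A_eq mB_eq ii_ii)
qed

interpretation hB: hochschild A B "incl_A E A" by (rule hochschild_B)

lemma hT_tT:
 assumes "\<And>xs. set xs \<subseteq> carrier A ==> Suc (length xs) = length as ==> f xs = \<phi> xs \<and> \<phi> xs \<in> tens_carrier A E"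
  and "set as \<subseteq> carrier A"
 shows "hT A B (incl_A E A) f as = tT \<phi> as"
 using assms
proof (induction \<phi> as arbitrary: f rule: tT.induct)
 case 1 show ?case unfolding tT.simps hT.simps ..
next
 case (2 \<phi> a) then show ?case by (simp add: incl_A_eq mB_eq)
next
 case (3 \<phi> a b as)
 have IH: "hT A B (incl_A E A) (%xs. f (a # xs)) (b # as) = tT (%xs. \<phi> (a # xs)) (b # as)"
  using 3(2,3) by (intro 3(1)) auto
 have "f (mult A a b # as) = \<phi> (mu a b # as)"
  using 3(2)[of "mu a b # as"] 3(3) by (simp add: mu_eq)
 then show ?case unfolding hT.simps tT.simps IH fscale_minus by simp
qed

abbreviation hact where "hact \<equiv> hoch_dact E A act"

lemma hact_add: "f \<in> Ml n ==> h \<in> tens_carrier E E' ==> k \<in> tens_carrier E E' ==> hact n (h + k) f = hact n h f + hact n k f"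
 and hact_scale: "f \<in> Ml n ==> h \<in> tens_carrier E E' ==> hact n (fscale c h) f = sF c (hact n h f)"
proof -
 assume f: "f \<in> Ml n" and h: "h \<in> tens_carrier E E'"
 have 1: "hact n (h + k) f as = hact n h f as + hact n k f as" if k: "k \<in> tens_carrier E E'" for as
  using hoch_dact_linear[OF f, of as] h k hoch_dact_outside[of as n]
  by (cases "as \<in> tuples A n") (simp_all add: linear_on_def)
 have 2: "hact n (fscale c h) f as = fscale c (hact n h f as)" for as
  using hoch_dact_linear[OF f, of as] h hoch_dact_outside[of as n]
  by (cases "as \<in> tuples A n") (simp_all add: linear_on_def vector_space_zero[OF vs_fscale])
 show "hact n (h + k) f = hact n h f + hact n k f" if "k \<in> tens_carrier E E'"
  by (rule ext) (simp only: 1[OF that] plus_fun_apply)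
 show "hact n (fscale c h) f = sF c (hact n h f)" by (rule ext) (rule 2)
qed

lemma hact_closed:
 assumes f: "f \<in> Ml n" and h: "h \<in> tens_carrier E E'" shows "hact n h f \<in> Ml n"
 using h
proof (induction h rule: te_induct)
 case (pure w \<xi>)
 show ?case
 proof (rule multilinear_mapsI)
  fix us vs assume *: "set us \<subseteq> carrier A" "set vs \<subseteq> carrier A" "Suc (length us + length vs) = n"
  have "hact n (te w \<xi>) f (us @ x # vs) = AA w \<xi> (%y. dia (hat f) y (us @ x # vs))" if "x \<in> carrier A" for x
   using * that by (intro hoch_dact_te[OF f _ pure]) (auto simp: tuples_simps)
  moreover have "lin sA fscale (%x. AA w \<xi> (%y. dia (hat f) y (us @ x # vs)))"
   by (intro lin_AA(3) mlin_slot[OF mlin_dia[OF mlin_hat[OF f]]])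
  ultimately show "linear_on A B (%x. hact n (te w \<xi>) f (us @ x # vs))"
   by (simp add: linear_on_def lin_def vec_space_add_closed[OF vec_space_A] vec_space_scale_closed[OF vec_space_A])
 qed (rule hoch_dact_outside, assumption, simp add: hoch_dact_te[OF f _ pure])
next
 case (add s t) then show ?case by (simp only: hact_add[OF f] hB.Mul_add)
qed

lemma vector_space_sF: "vector_space sF"
 by unfold_locales (simp_all add: fun_eq_iff fscale_def algebra_simps)

abbreviation MM :: "nat => ('k, 'a list => ('k, 'a, 'e) tensor) vspace" where
 "MM n \<equiv> \<lparr>carrier = Ml n, scale = sF\<rparr>"

lemma vec_space_MM [simp]: "vec_space (MM n)"
 by (rule vec_spaceI) (use hB.Mul_scale in \<open>simp_all add: vector_space_sF hB.Mul_zero hB.Mul_add\<close>)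

lemma hact_linear_fun:
 assumes h: "h \<in> tens_carrier E E'" shows "linear_on (MM n) (MM n) (hact n h)"
proof -
 have l: "lin sF fscale (%f. AA w \<xi> (%x. dia (hat f) x as))" for w \<xi> as
  unfolding hat_def[abs_def] by (intro lin_AA(3) lin_dia_fun lin_sF_apply)
 have sc: "sF c f \<in> Ml n" if "f \<in> Ml n" for c f using hB.Mul_scale[OF that] by simp
 have "hact n h (f + g) = hact n h f + hact n h g" if fg: "f \<in> Ml n" "g \<in> Ml n" for f g
  using h
 proof (induction h rule: te_induct)
  case (pure w \<xi>)
  have "hact n (te w \<xi>) (f + g) as = hact n (te w \<xi>) f as + hact n (te w \<xi>) g as" for as
  proof (cases "as \<in> tuples A n")
   case True
   show ?thesis
    unfolding hoch_dact_te[OF hB.Mul_add[OF fg] True pure] hoch_dact_te[OF fg(1) True pure] hoch_dact_te[OF fg(2) True pure]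
    by (rule lin_add[OF l])
  next
   case False show ?thesis by (simp only: hoch_dact_outside[OF False] add_0)
  qed
  then show ?case by (rule fun_plusI)
 next
  case (add s t)
  then show ?case by (simp only: hact_add[OF fg(1)] hact_add[OF fg(2)] hact_add[OF hB.Mul_add[OF fg]] add_ac)
 qed
 moreover have "hact n h (sF c f) = sF c (hact n h f)" if f: "f \<in> Ml n" for f c
  using h
 proof (induction h rule: te_induct)
  case (pure w \<xi>)
  have "hact n (te w \<xi>) (sF c f) as = fscale c (hact n (te w \<xi>) f as)" for as
  proof (cases "as \<in> tuples A n")
   case True
   show ?thesis
    unfolding hoch_dact_te[OF sc[OF f] True pure] hoch_dact_te[OF f True pure]
    by (rule lin_scale[OF l])
  next
   case False show ?thesis by (simp only: hoch_dact_outside[OF False] vector_space_zero[OF vs_fscale])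
  qed
  then show ?case by (rule ext)
 next
  case (add s t)
  then show ?case
   by (simp only: hact_add[OF f] hact_add[OF sc[OF f]] vector_space_add[OF vector_space_sF])
 qed
 ultimately show ?thesis using hact_closed h by (simp add: linear_on_def)
qed

lemma hact_bilinear: "bilinear_on ED (MM n) (MM n) (hact n)"
proof -
 have "linear_on ED (MM n) (%h. hact n h f)" if "f \<in> Ml n" for f
  using that by (simp add: linear_on_def hact_add hact_scale hact_closed)
 then show ?thesis by (simp add: bilinear_on_def hact_linear_fun)
qed

lemma hact_linear: "f \<in> Ml n ==> linear_on ED (MM n) (%h. hact n h f)"
 using hact_bilinear by (simp add: bilinear_on_def)

lemma hact_linear_amb: "f \<in> Ml n ==> linear_on ED (amb sF) (%h. hact n h f)"
 using linear_on_amb[OF hact_linear] by simp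

text \<open>By bilinearity only \<open>te w \<xi>\<close> and \<open>te v \<eta>\<close> have to be
  considered. There \<open>AA_mult\<close> applies, its argument \<open>m y x\<close> coming from
  \<open>dia_dia\<close>.\<close>

lemma hact_mult:
 assumes f: "f \<in> Ml n" and h: "h \<in> tens_carrier E E'" and k: "k \<in> tens_carrier E E'"
 shows "hact n (Dm h k) f = hact n h (hact n k f)"
proof -
 have bD: "bilinear_on ED ED ED Dm"
  using algebra_bilinear[OF alg_D] by (subst bilinear_on_cong_space[of ED D ED D ED D]) auto
 have c: "Dm p q \<in> tens_carrier E E'" if "p \<in> tens_carrier E E'" "q \<in> tens_carrier E E'" for p q
  using bilinear_on_closed[OF bD] that by simp
 have pp: "hact n (Dm (te w \<xi>) (te v \<eta>)) f = hact n (te w \<xi>) (hact n (te v \<eta>) f)"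
  if xi: "lin sE (*) \<xi>" and eta: "lin sE (*) \<eta>" for w v \<xi> \<eta>
 proof (rule ext)
  fix as
  show "hact n (Dm (te w \<xi>) (te v \<eta>)) f as = hact n (te w \<xi>) (hact n (te v \<eta>) f) as"
  proof (cases "as \<in> tuples A n")
   case True
   define g where "g x = dia (hat f) x as" for x
   have g: "lin sE fscale g" unfolding g_def[abs_def] by (rule lin_dia_hat[OF f lin_ident])
   have hc: "hact n (te v \<eta>) f \<in> Ml n" by (rule hact_closed[OF f]) simp
   have "hact n (Dm (te w \<xi>) (te v \<eta>)) f as =
     sw3 (%v1 v2 v3. hact n (te (m v2 w) (cv (ad \<xi> v1 v3) \<eta>)) f as) v"
    unfolding Dm_te[OF xi eta] dm_sw3
    by (rule linear_on_sw3[OF hoch_dact_linear[OF f True]]) simp_all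
   also have "... = sw3 (%v1 v2 v3. AA (m v2 w) (cv (ad \<xi> v1 v3) \<eta>) g) v"
    unfolding g_def by (simp only: hoch_dact_te[OF f True lin_cv3[OF lin_ad(4)[OF xi] lin_ident]])
   also have "... = AA w \<xi> (%x. AA v \<eta> (%y. g (m y x)))"
    by (rule AA_mult[symmetric, OF xi eta g])
   \<comment> \<open>The inner action, evaluated after \<open>x\<close> has been applied to the
     arguments.\<close>
   also have "(%x. AA v \<eta> (%y. g (m y x))) = (%x. dia (hat (hact n (te v \<eta>) f)) x as)"
   proof (rule ext)
    fix x
    have "dia (hat (hact n (te v \<eta>) f)) x as = dia (%xs. AA v \<eta> (%y. dia (hat f) y xs)) x as"
    proof (rule dia_cong)
     fix xs assume "length xs = length as" "set xs \<subseteq> carrier A"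
     then have "hat (hact n (te v \<eta>) f) xs = hact n (te v \<eta>) f xs" "xs \<in> tuples A n"
      using True by (simp_all add: hat_eq tuples_simps)
     then show "hat (hact n (te v \<eta>) f) xs = AA v \<eta> (%y. dia (hat f) y xs)"
      by (simp only: hoch_dact_te[OF f _ eta])
    qed
    also have "... = AA v \<eta> (%y. g (m y x))"
     unfolding dia_AA g_def by (simp only: dia_dia[OF mlin_hat[OF f]])
    finally show "AA v \<eta> (%y. g (m y x)) = dia (hat (hact n (te v \<eta>) f)) x as" by (rule sym)
   qed
   finally show ?thesis by (simp only: hoch_dact_te[OF hc True xi])
  next
   case False show ?thesis by (simp only: hoch_dact_outside[OF False])
  qed
 qed
 have p: "hact n (Dm (te w \<xi>) k) f = hact n (te w \<xi>) (hact n k f)" if xi: "lin sE (*) \<xi>" for w \<xi>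
 proof (rule linear_on_ED_eqI[where u = sF and f = "%k. hact n (Dm (te w \<xi>) k) f"
    and g = "%k. hact n (te w \<xi>) (hact n k f)", OF _ _ _ k])
  show "hact n (Dm (te w \<xi>) (te v \<eta>)) f = hact n (te w \<xi>) (hact n (te v \<eta>) f)" if "lin sE (*) \<eta>" for v \<eta>
   by (rule pp[OF xi that])
  show "linear_on ED (amb sF) (%k. hact n (Dm (te w \<xi>) k) f)"
   using bD by (intro linear_on_compose[OF _ hact_linear_amb[OF f]]) (simp add: bilinear_on_def)
  show "linear_on ED (amb sF) (%k. hact n (te w \<xi>) (hact n k f))"
   using linear_on_amb[OF linear_on_compose[OF hact_linear[OF f] hact_linear_fun[OF te_closed, of n w \<xi>]]] by simp
 qed
 show ?thesis
 proof (rule linear_on_ED_eqI[where u = sF and f = "%h. hact n (Dm h k) f"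
    and g = "%h. hact n h (hact n k f)", OF _ _ _ h])
  show "hact n (Dm (te w \<xi>) k) f = hact n (te w \<xi>) (hact n k f)" if "lin sE (*) \<xi>" for w \<xi>
   by (rule p[OF that])
  show "linear_on ED (amb sF) (%h. hact n (Dm h k) f)"
   using bD k by (intro linear_on_compose[OF _ hact_linear_amb[OF f]]) (simp add: bilinear_on_def)
  show "linear_on ED (amb sF) (%h. hact n h (hact n k f))"
   by (rule hact_linear_amb[OF hact_closed[OF f k]])
 qed
qed

text \<open>For \<open>w = one\<close> all its parts are \<open>one\<close>, and only the action on
  the values remains.\<close>

lemma hact_te_one:
 assumes f: "f \<in> Ml n" and as: "as \<in> tuples A n" and xi: "lin sE (*) \<xi>"
 shows "hact n (te one \<xi>) f as = tri \<xi> (f as)"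
proof -
 have "map Q as = as" using as by (intro map_idI) (auto simp: tuples_simps)
 then show ?thesis
  using as unfolding hoch_dact_te[OF f as xi] AA_one[OF lin_dia_hat[OF f lin_ident]] dia_one[OF mlin_hat[OF f]]
  by (simp add: hat_eq tuples_simps)
qed

lemma hact_dual:
 assumes f: "f \<in> Ml n" and as: "as \<in> tuples A n" and xi: "\<xi> \<in> carrier E'"
 shows "hact n (te one \<xi>) f as = tri \<xi> (f as)"
proof -
 have "te one \<xi> = te one (%x. \<xi> (P x))" by (rule te_cong) simp
 then have "hact n (te one \<xi>) f as = tri (%x. \<xi> (P x)) (f as)"
  by (simp only: hact_te_one[OF f as lin_dual[OF xi]])
 also have "tri (%x. \<xi> (P x)) = tri \<xi>" by (rule tri_cong) simp
 finally show ?thesis .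
qed

lemma hact_one:
 assumes f: "f \<in> Ml n" shows "hact n (te one eps) f = f"
proof (rule ext)
 fix as show "hact n (te one eps) f as = f as"
 proof (cases "as \<in> tuples A n")
  case True
  then show ?thesis using multilinear_maps_closed[OF f True] by (simp add: hact_te_one[OF f True lin_eps] tri_eps)
 next
  case False show ?thesis by (simp only: hoch_dact_outside[OF False] multilinear_maps_zero[OF f False])
 qed
qed

lemma hact_diff:
 assumes f: "f \<in> Ml n" and h: "h \<in> tens_carrier E E'"
 shows "hB.dd n (hact n h f) = hact (Suc n) h (hB.dd n f)"
 using h
proof (induction h rule: te_induct)
 case (pure w \<xi>)
 note xi = pure and df = hB.diff_closed[OF f]
 have hc: "hact n (te w \<xi>) f \<in> Ml n" by (rule hact_closed[OF f]) simp
 define \<psi> where "\<psi> xs = AA w \<xi> (%x. dia (hat f) x xs)" for xs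
 have td: "hB.dd n g (a # as) = tdd \<phi> (a # as)"
  if as: "a # as \<in> tuples A (Suc n)" and g: "\<And>xs. xs \<in> tuples A n ==> g xs = \<phi> xs \<and> \<phi> xs \<in> tens_carrier A E" for g \<phi> a as
 proof -
  have a: "a \<in> carrier A" "as \<in> tuples A n" using as by (auto simp: tuples_simps)
  have "hT A B (incl_A E A) g (a # as) = tT \<phi> (a # as)"
   using as by (intro hT_tT g) (auto simp: tuples_simps)
  then have "hB.dd n g (a # as) = mB (ii a) (\<phi> as) - tT \<phi> (a # as)"
   using a g[OF a(2)] by (simp add: hB.diff_apply[OF as] incl_A_eq mB_eq)
  then show ?thesis by (simp add: fscale_minus)
 qed
 show ?case
 proof (rule ext)
  fix as show "hB.dd n (hact n (te w \<xi>) f) as = hact (Suc n) (te w \<xi>) (hB.dd n f) as"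
  proof (cases "as \<in> tuples A (Suc n)")
   case True
   then obtain a as' where as: "as = a # as'" by (cases as) (auto simp: tuples_simps)
   have t: "a # as' \<in> tuples A (Suc n)" using True as by simp
   have "hB.dd n (hact n (te w \<xi>) f) (a # as') = tdd \<psi> (a # as')"
    by (rule td[OF t]) (simp add: hoch_dact_te[OF f _ xi] \<psi>_def)
   also have "... = AA w \<xi> (%x. dia (tdd (hat f)) x (a # as'))"
    unfolding \<psi>_def[abs_def] by (rule AA_tdd[symmetric, OF xi mlin_hat[OF f]])
   also have "(%x. dia (tdd (hat f)) x (a # as')) = (%x. dia (hat (hB.dd n f)) x (a # as'))"
   proof (rule ext, rule dia_cong)
    fix xs assume xs: "length xs = length (a # as')" "set xs \<subseteq> carrier A"
    then obtain b bs where b: "xs = b # bs" by (cases xs) auto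
    have "b # bs \<in> tuples A (Suc n)" using xs b t by (simp add: tuples_simps)
    then have "hB.dd n f (b # bs) = tdd (hat f) (b # bs)"
    proof (rule td)
     fix xs assume "xs \<in> tuples A n"
     then show "f xs = hat f xs \<and> hat f xs \<in> tens_carrier A E"
      using multilinear_maps_closed[OF f, of xs] by (simp add: hat_eq tuples_simps)
    qed
    then have "hB.dd n f xs = tdd (hat f) xs" by (simp only: b)
    then show "tdd (hat f) xs = hat (hB.dd n f) xs" by (simp only: hat_eq[OF xs(2)])
   qed
   finally show ?thesis using True unfolding as by (simp only: hoch_dact_te[OF df _ xi])
  next
   case False show ?thesis by (simp only: hoch_dact_outside[OF False] hB.diff_outside[OF False])
  qed
 qed
next
 case (add s t)
 then show ?case
  by (simp only: hact_add[OF f] hact_add[OF hB.diff_closed[OF f]] hB.diff_add[OF hact_closed[OF f] hact_closed[OF f]])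
qed

lemma hact_unit:
 assumes h: "h \<in> tens_carrier E E'"
 shows "hact 0 h (restr (tuples A 0) (%_. oneB)) = sF (counit D h) (restr (tuples A 0) (%_. oneB))"
proof (rule ext)
 let ?u = "restr (tuples A 0) (%_. oneB)"
 have u: "?u \<in> Ml 0" using hB.unit_closed by simp
 have t0: "as \<in> tuples A 0 \<longleftrightarrow> as = []" for as by (auto simp: tuples_simps)
 have te: "AA w \<xi> (%x. dia (hat ?u) x []) = fscale (eps w * \<xi> one) oneB" if xi: "lin sE (*) \<xi>" for w \<xi>
 proof -
  have 1: "tri \<xi> (jj one) = fscale (\<xi> one) (jj one)" using tri_ii[OF xi, of oneA] by (simp add: ii_one jj_one)
  have "AA w \<xi> (%x. dia (hat ?u) x []) = sw (%a r. sw (%b c. fscale (eps b) (fscale (\<xi> one) (jj (m (S a) c)))) r) w"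
   by (simp add: AA_def sw3_def hat_def t0 1 lin_scale[OF lin_tri[OF lin_ident]] lin_scale[OF lin_mB2[OF lin_ident]]
    lin_scale[OF lin_mB1[OF lin_ident]] jj_one[symmetric] jj_jj)
  also have "... = sw (%a r. fscale (\<xi> one) (jj (m (S a) r))) w"
  proof -
   have "sw (%b c. fscale (eps b) (fscale (\<xi> one) (jj (m (S a) c)))) r = fscale (\<xi> one) (jj (m (S a) (P r)))" for a r
    by (rule sw_counit_left) (intro lin_intros)
   then show ?thesis by simp
  qed
  also have "... = fscale (eps w) (fscale (\<xi> one) (jj one))" by (rule sw_antipode_left) (intro lin_intros)
  finally show ?thesis by (simp add: jj_one vector_space_mult[OF vs_fscale])
 qed
 fix as show "hact 0 h ?u as = fscale (counit D h) (?u as)"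
 proof (cases "as = []")
  case True
  have t: "[] \<in> tuples A 0" by (simp add: t0)
  have "hact 0 h ?u [] = fscale (counit D h) oneB"
  proof (rule linear_on_ED_eqI[where u = fscale, OF _ _ _ h])
   show "linear_on ED (amb fscale) (%h. hact 0 h ?u [])"
    using linear_on_amb[OF hoch_dact_linear[OF u t]] by simp
   show "linear_on ED (amb fscale) (%h. fscale (counit D h) oneB)"
    using counit_D_linear by (simp add: linear_on_def vector_space_add_left[OF vs_fscale] vector_space_mult[OF vs_fscale])
   show "hact 0 (te w \<xi>) ?u [] = fscale (counit D (te w \<xi>)) oneB" if xi: "lin sE (*) \<xi>" for w \<xi>
    unfolding hoch_dact_te[OF u t xi] te[OF xi] counit_D_te[OF xi] ..
  qed
  then show ?thesis using True t by simp
 next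
  case False
  then have "as \<notin> tuples A 0" by (simp add: t0)
  then show ?thesis by (simp add: hoch_dact_outside restr_def vector_space_zero[OF vs_fscale])
 qed
qed

lemma cup_bilinear: "bilinear_on (MM k) (MM n) (MM (k + n)) (hB.cp k n)"
proof -
 note d = hB.is_dg_algebra_hoch_alg[unfolded is_dg_algebra_def hB.hoch_alg_simps]
 show ?thesis
  unfolding bilinear_on_def linear_on_def using d by simp
qed

lemma cup_hact_bilinear:
 "f \<in> Ml k ==> g \<in> Ml n ==> bilinear_on ED ED (MM (k + n)) (%p q. hB.cp k n (hact k p f) (hact n q g))"
 by (rule bilinear_on_compose_right[OF bilinear_on_compose_left[OF cup_bilinear hact_linear] hact_linear])

lemma hact_cup:
 assumes f: "f \<in> Ml k" and g: "g \<in> Ml n" and h: "h \<in> tens_carrier E E'"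
 shows "hact (k + n) h (hB.cp k n f g) = lift ED ED (%p q. hB.cp k n (hact k p f) (hact n q g)) (comult D h)"
proof (rule linear_on_ED_eqI[where u = sF and f = "%h. hact (k + n) h (hB.cp k n f g)"
   and g = "%h. lift ED ED (%p q. hB.cp k n (hact k p f) (hact n q g)) (comult D h)", OF _ _ _ h])
 note cl = hB.cup_closed[OF f g]
 have b: "bilinear_on ED ED (amb sF) (%p q. hB.cp k n (hact k p f) (hact n q g))"
  using bilinear_on_amb[OF cup_hact_bilinear[OF f g]] by simp
 show "linear_on ED (amb sF) (%h. hact (k + n) h (hB.cp k n f g))" by (rule hact_linear_amb[OF cl])
 show "linear_on ED (amb sF) (%h. lift ED ED (%p q. hB.cp k n (hact k p f) (hact n q g)) (comult D h))"
  by (rule linear_on_compose[OF comult_D_linear lift_linear_amb[OF vector_space_sF b]]) simp_all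
 fix w \<xi> assume xi: "lin sE (*) \<xi>"
 have "hact (k + n) (te w \<xi>) (hB.cp k n f g) as =
  sw (%w1 w2. \<Sum>b\<in>bas. hB.cp k n (hact k (te w1 (rsh \<xi> b)) f) (hact n (te w2 (cf b)) g)) w as" for as
 proof (cases "as \<in> tuples A (k + n)")
  case True
  let ?us = "take k as" and ?vs = "drop k as"
  note us = hB.tuples_take[OF True] and vs = hB.tuples_drop[OF True]
  have D: "dia (hat (hB.cp k n f g)) x as = sw (%x1 x2. mB (dia (hat f) x1 ?us) (dia (hat g) x2 ?vs)) x" for x
  proof -
   have "dia (hat (hB.cp k n f g)) x (?us @ ?vs) =
     sw (%x1 x2. dia (%xs. dia (%ys. hat (hB.cp k n f g) (xs @ ys)) x2 ?vs) x1 ?us) x"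
    by (rule dia_append[OF mlin_hat[OF cl]])
   also have "... = sw (%x1 x2. dia (%xs. dia (%ys. mB (hat f xs) (hat g ys)) x2 ?vs) x1 ?us) x"
   proof -
    have "dia (%xs. dia (%ys. hat (hB.cp k n f g) (xs @ ys)) x2 ?vs) x1 ?us =
     dia (%xs. dia (%ys. mB (hat f xs) (hat g ys)) x2 ?vs) x1 ?us" for x1 x2
    proof (rule dia_cong, rule dia_cong)
     fix xs ys assume "length xs = length ?us" "set xs \<subseteq> carrier A" "length ys = length ?vs" "set ys \<subseteq> carrier A"
     then have xs: "xs \<in> tuples A k" "ys \<in> tuples A n" using us vs by (simp_all add: tuples_simps)
     then have "xs @ ys \<in> tuples A (k + n)" by (simp add: tuples_simps)
     then show "hat (hB.cp k n f g) (xs @ ys) = mB (hat f xs) (hat g ys)"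
      using xs multilinear_maps_closed[OF f xs(1)] multilinear_maps_closed[OF g xs(2)]
      by (simp add: hat_eq hB.cup_apply tuples_simps mB_eq)
    qed
    then show ?thesis by (simp only:)
   qed
   finally show ?thesis by (simp only: dia_mB_left dia_mB_right append_take_drop_id)
  qed
  have "hact (k + n) (te w \<xi>) (hB.cp k n f g) as = AA w \<xi> (%x. sw (%x1 x2. mB (dia (hat f) x1 ?us) (dia (hat g) x2 ?vs)) x)"
   by (simp only: hoch_dact_te[OF cl True xi] D)
  also have "... = sw (%w1 w2. \<Sum>b\<in>bas. mB (AA w1 (rsh \<xi> b) (%x. dia (hat f) x ?us)) (AA w2 (cf b) (%x. dia (hat g) x ?vs))) w"
   by (rule AA_cup[OF xi lin_dia_hat[OF f lin_ident] lin_dia_hat[OF g lin_ident]])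
  also have "... = sw (%w1 w2. \<Sum>b\<in>bas. hB.cp k n (hact k (te w1 (rsh \<xi> b)) f) (hact n (te w2 (cf b)) g) as) w"
   by (simp add: hB.cup_apply[OF True] hoch_dact_te[OF f us] hoch_dact_te[OF g vs] lin_rsh[OF xi] mB_eq)
  also have "... = sw (%w1 w2. \<Sum>b\<in>bas. hB.cp k n (hact k (te w1 (rsh \<xi> b)) f) (hact n (te w2 (cf b)) g)) w as"
   unfolding sw_def sum_fun_apply ..
  finally show ?thesis .
 next
  case False
  have "sw (%w1 w2. \<Sum>b\<in>bas. hB.cp k n (hact k (te w1 (rsh \<xi> b)) f) (hact n (te w2 (cf b)) g)) w as = 0"
   unfolding sw_def sum_fun_apply hB.cup_outside[OF False] by (simp add: fun_eq_iff)
  then show ?thesis by (simp only: hoch_dact_outside[OF False])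
 qed
 then show "hact (k + n) (te w \<xi>) (hB.cp k n f g) =
   lift ED ED (%p q. hB.cp k n (hact k p f) (hact n q g)) (comult D (te w \<xi>))"
  unfolding lift_comult_D[OF vector_space_sF b xi] by (rule ext)
qed

text \<open>\<open>f\<close> and \<open>g\<close> multiplied after the action of \<open>t \<in> D \<otimes> D\<close>.\<close>

definition Phi where "Phi k n f g t = lift ED ED (%p q. cup A (mult B) k n (hact k p f) (hact n q g)) t"

lemma Phi_linear: "f \<in> Ml k ==> g \<in> Ml n ==> linear_on (tens_space ED ED) (MM (k + n)) (Phi k n f g)"
 unfolding Phi_def[abs_def] by (intro lift_linear cup_hact_bilinear) simp_all

lemma Phi_tens: "f \<in> Ml k ==> g \<in> Ml n ==> p \<in> tens_carrier E E' ==> q \<in> tens_carrier E E' ==>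
  Phi k n f g (tens ED ED p q) = hB.cp k n (hact k p f) (hact n q g)"
 unfolding Phi_def using bilinear_on_amb[OF cup_hact_bilinear]
 by (subst lift_tens[OF vector_space_sF]) simp_all

lemma Phi_bilinear:
 assumes t: "t \<in> tens_carrier ED ED"
 shows "bilinear_on (MM k) (MM n) (MM (k + n)) (%f g. Phi k n f g t)"
 unfolding bilinear_on_def Phi_def
proof (intro conjI ballI)
 fix f assume f: "f \<in> carrier (MM k)"
 show "linear_on (MM n) (MM (k + n)) (%g. lift ED ED (%p q. hB.cp k n (hact k p f) (hact n q g)) t)"
 proof (rule linear_on_lift_param[OF _ _ _ _ t])
  fix p q assume *: "p \<in> carrier ED" "q \<in> carrier ED"
  then have "hact k p f \<in> Ml k" using f hact_closed by simp
  then show "linear_on (MM n) (MM (k + n)) (%g. hB.cp k n (hact k p f) (hact n q g))"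
   using cup_bilinear * by (intro linear_on_compose[OF hact_linear_fun]) (simp_all add: bilinear_on_def)
 qed (use f cup_hact_bilinear in simp_all)
next
 fix g assume g: "g \<in> carrier (MM n)"
 show "linear_on (MM k) (MM (k + n)) (%f. lift ED ED (%p q. hB.cp k n (hact k p f) (hact n q g)) t)"
 proof (rule linear_on_lift_param[OF _ _ _ _ t])
  fix p q assume *: "p \<in> carrier ED" "q \<in> carrier ED"
  then have "hact n q g \<in> Ml n" using g hact_closed by simp
  then show "linear_on (MM k) (MM (k + n)) (%f. hB.cp k n (hact k p f) (hact n q g))"
   using cup_bilinear[of k n] * by (intro linear_on_compose[OF hact_linear_fun]) (simp_all add: bilinear_on_def)
 qed (use g cup_hact_bilinear in simp_all)
qed

lemma Phi_hact_bilinear: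
 assumes f: "f \<in> Ml k" and g: "g \<in> Ml n" and s: "s \<in> tens_carrier ED ED"
 shows "bilinear_on ED ED (MM (k + n)) (%p q. Phi k n (hact k p f) (hact n q g) s)"
 by (rule bilinear_on_compose_right[OF bilinear_on_compose_left[OF Phi_bilinear[OF s] hact_linear[OF f]] hact_linear[OF g]])

text \<open>Pairs of cochains carry an action of \<open>D \<otimes> D\<close>: acting by
  \<open>t\<close> and then by \<open>s\<close> is acting by the product \<open>s t\<close>.\<close>

lemma Phi_mult:
 assumes f: "f \<in> Ml k" and g: "g \<in> Ml n" and s: "s \<in> tens_carrier ED ED" and t: "t \<in> tens_carrier ED ED"
 shows "lift ED ED (%p q. Phi k n (hact k p f) (hact n q g) s) t = Phi k n f g (mult D2 s t)"
proof -
 let ?D = "tens_space ED ED"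
 have bD: "bilinear_on ?D ?D ?D (mult D2)"
  using algebra_bilinear[OF alg_D2] by (subst bilinear_on_cong_space[of ?D D2 ?D D2 ?D D2]) auto
 have dm: "mult D2 (tens ED ED a b) (tens ED ED p q) = tens ED ED (Dm a p) (Dm b q)"
  if "a \<in> tens_carrier E E'" "b \<in> tens_carrier E E'" "p \<in> tens_carrier E E'" "q \<in> tens_carrier E E'" for a b p q
  using that tens_alg_mult[OF vec_space_D vec_space_D algebra_bilinear[OF alg_D] algebra_bilinear[OF alg_D], of a p b q] by simp
 have Dc: "Dm p q \<in> tens_carrier E E'" if "p \<in> tens_carrier E E'" "q \<in> tens_carrier E E'" for p q
  using bilinear_on_closed[OF algebra_bilinear[OF alg_D]] that by simp
 have 1: "Phi k n (hact k p f) (hact n q g) s = Phi k n f g (mult D2 s (tens ED ED p q))"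
  if *: "p \<in> carrier ED" "q \<in> carrier ED" for p q
 proof (rule linear_on_tens_eqI[where f = "Phi k n (hact k p f) (hact n q g)"
    and g = "%s. Phi k n f g (mult D2 s (tens ED ED p q))", OF _ _ _ _ _ s])
  have c: "hact k p f \<in> Ml k" "hact n q g \<in> Ml n" using * f g hact_closed by simp_all
  show "linear_on ?D (MM (k + n)) (Phi k n (hact k p f) (hact n q g))" by (rule Phi_linear[OF c])
  show "linear_on ?D (MM (k + n)) (%s. Phi k n f g (mult D2 s (tens ED ED p q)))"
   using bD * by (intro linear_on_compose[OF _ Phi_linear[OF f g]]) (simp add: bilinear_on_def tens_in_carrier)
  show "Phi k n (hact k p f) (hact n q g) (tens ED ED a b) = Phi k n f g (mult D2 (tens ED ED a b) (tens ED ED p q))"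
   if "a \<in> carrier ED" "b \<in> carrier ED" for a b
   using that * by (simp add: Phi_tens c f g dm Dc hact_mult)
 qed simp_all
 show ?thesis
 proof (rule linear_on_tens_eqI[where f = "lift ED ED (%p q. Phi k n (hact k p f) (hact n q g) s)"
    and g = "%t. Phi k n f g (mult D2 s t)", OF _ _ _ _ _ t])
  note b = Phi_hact_bilinear[OF f g s]
  show "linear_on ?D (MM (k + n)) (lift ED ED (%p q. Phi k n (hact k p f) (hact n q g) s))"
   by (rule lift_linear[OF b]) simp_all
  show "linear_on ?D (MM (k + n)) (%t. Phi k n f g (mult D2 s t))"
   using bD s by (intro linear_on_compose[OF _ Phi_linear[OF f g]]) (simp add: bilinear_on_def)
  show "lift ED ED (%p q. Phi k n (hact k p f) (hact n q g) s) (tens ED ED p q) = Phi k n f g (mult D2 s (tens ED ED p q))"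
   if "p \<in> carrier ED" "q \<in> carrier ED" for p q
   using lift_tens[OF vector_space_sF _ that, of "%p q. Phi k n (hact k p f) (hact n q g) s"] bilinear_on_amb[OF b] 1[OF that] by simp
 qed simp_all
qed

text \<open>Formulated for any \<open>H\<close> and \<open>X\<close> with these operations, as it is
  applied to the double with coefficients in \<open>B\<close> and to the twisted double with twisted
  coefficients. The two differentials agree on cochains, which is why \<open>gdiff\<close> is
  compared there only.\<close>

lemma is_dg_module_hact:
 assumes H: "carrier H = tens_carrier E E'" "scale H = fscale" "mult H = Dm" "unity H = te one eps"
  and X: "gcar X = Ml" "gadd X = (%n. (+))" "gscale X = (%n. sF)" "\<And>n f. f \<in> Ml n ==> gdiff X n f = hB.dd n f"
  and c: "is_complex X"
 shows "is_dg_module H X hact"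
proof -
 have l: "hact n h (f + g) = hact n h f + hact n h g" "hact n h (sF a f) = sF a (hact n h f)"
  if "h \<in> tens_carrier E E'" "f \<in> Ml n" "g \<in> Ml n" for h f g n a
  using hact_linear_fun[OF that(1), of n] that by (simp_all add: linear_on_def)
 show ?thesis
  unfolding is_dg_module_def H X(1-3)
  using c by (simp add: hact_closed l hact_add hact_mult hact_scale hact_one X(4) hB.diff_closed hact_diff)
qed

end


section \<open>Passage to cohomology\<close>

context additive_complex
begin

lemma class_closed: "U \<in> gcar (coh X) n ==> p \<in> U ==> p \<in> C n"
proof -
 assume "U \<in> gcar (coh X) n" "p \<in> U"
 then obtain x where x: "x \<in> Z n" "p \<in> cl n x" unfolding coh_gcar by blast
 then obtain b where "b \<in> Bd n" "p = x + b" using class_of_mem by blast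
 then show "p \<in> C n" using C_add[OF Z_C[OF x(1)] Z_C[OF Bd_Z]] by simp
qed

text \<open>Cocycles and coboundaries only involve the differential of cochains. Differentials that
  agree there give the same \<open>coh\<close>, even if they differ as functions.\<close>

lemma cohomology_cong:
 assumes Y: "gcar Y = gcar X" "gadd Y = gadd X" "gzero Y = gzero X" "gscale Y = gscale X"
  and d: "\<And>n x. x \<in> C n ==> gdiff Y n x = d n x"
 shows "cocycles Y = Z" "class_of Y = cl" "coh Y = coh X"
proof -
 show z: "cocycles Y = Z" by (rule ext) (auto simp: cocycles_def Y d)
 have b: "coboundaries Y n = Bd n" for n
  by (cases n) (auto simp: coboundaries_def Y d image_iff)
 show c: "class_of Y = cl" by (rule ext, rule ext) (simp add: class_of_def Y b)
 show "coh Y = coh X" by (simp add: coh_def Y z c)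
qed

end

context additive_dg_module
begin

text \<open>By \<open>twisted_product_class\<close> the twisted product of classes is the class of
  the twisted product of cocycles, so the equality of dg algebras descends.\<close>

lemma dg_twist_coh:
 assumes H: "vec_space H" and t: "t \<in> tens_carrier H H" and eq: "dgalg_eq (dg_twist H t X act) Y"
  and Y: "gcar Y = gcar X" "gadd Y = gadd X" "gzero Y = gzero X" "gscale Y = gscale X"
  and alg: "is_dg_algebra Y"
 shows "dgalg_eq (dg_twist H t (coh_alg X) (coh_act X act)) (coh_alg Y)"
proof -
 interpret Y: additive_dg_algebra Y
  by unfold_locales (simp_all only: Y gadd gzero vector_space.vector_space_assms[OF vs] alg alg[unfolded is_dg_algebra_def, THEN conjunct1])
 have d: "gdiff Y n x = d n x" if "x \<in> C n" for n x
  using eq that by (simp add: dgalg_eq_def cpx_eq_def dg_twist_def)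
 note c = cohomology_cong[OF Y d]
 have mul: "twisted_product (+) 0 H t (mul m n) (act m) (act n) x y = gmult Y m n x y"
  if "x \<in> C m" "y \<in> C n" for m n x y
  using eq that by (simp add: dgalg_eq_def dg_twist_def gadd gzero)
 have "twisted_product (gadd (coh X) (m + n)) (gzero (coh X) (m + n)) H t (gmult (coh_alg X) m n)
   (coh_act X act m) (coh_act X act n) (cl m x) (cl n y) = gmult (coh_alg Y) m n (cl m x) (cl n y)"
  if "x \<in> Z m" "y \<in> Z n" for m n x y
  using that Y.coh_mul[of x m y n] by (simp add: twisted_product_class[OF H t] mul Z_C c del: coh_alg_simps)
 then have m: "twisted_product (gadd (coh X) (m + n)) (gzero (coh X) (m + n)) H t (gmult (coh_alg X) m n)
   (coh_act X act m) (coh_act X act n) U V = gmult (coh_alg Y) m n U V"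
  if "U \<in> gcar (coh X) m" "V \<in> gcar (coh X) n" for U V m n
  using that unfolding coh_gcar by (elim imageE; hypsubst) simp
 have u: "gunit X = gunit Y" using eq by (simp add: dgalg_eq_def dg_twist_def)
 show ?thesis
  unfolding dgalg_eq_def cpx_eq_def dg_twist_def
  using m by (simp add: c u del: coh_alg_simps(7))
qed

end

text \<open>The unions in \<open>coh_bimod\<close> run over the elements of cosets. By
  \<open>b\<close> and \<open>r\<close> these are cochains, where the actions agree.\<close>

lemma dgbimod_eq_coh:
 fixes X Y :: "('k, 'r, 'c) dgbimod"
 assumes eq: "dgbimod_eq R X Y" and c: "class_of X = class_of Y" "coh X = coh Y"
  and b: "\<And>n U p. U \<in> gcar (coh Y) n ==> p \<in> U ==> p \<in> gcar Y n"
  and r: "\<And>n U p. U \<in> gcar R' n ==> p \<in> U ==> p \<in> gcar R n"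
 shows "dgbimod_eq R' (coh_bimod X) (coh_bimod Y)"
proof -
 have [simp]: "gcar X = gcar Y" using eq by (auto simp: dgbimod_eq_def cpx_eq_def)
 have a: "lact X m n r x = lact Y m n r x" "ract X m n r x = ract Y m n r x"
  if "r \<in> gcar R m" "x \<in> gcar Y n" for m n r x
  using eq that by (simp_all add: dgbimod_eq_def)
 show ?thesis
  unfolding dgbimod_eq_def cpx_eq_def coh_bimod_simps c
  by (intro conjI allI ballI refl SUP_cong arg_cong2[where f = "class_of Y"]) (simp_all add: a[OF r b])
qed

lemma hoch_bimod_simps:
 "gcar (hoch_bimod A M \<iota>) = multilinear_maps A M" "gadd (hoch_bimod A M \<iota>) = (%n. (+))"
 "gzero (hoch_bimod A M \<iota>) = (%n. 0)" "gscale (hoch_bimod A M \<iota>) = (%n c f as. scale M c (f as))"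
 "gdiff (hoch_bimod A M \<iota>) = hoch_diff A M \<iota>"
 "lact (hoch_bimod A M \<iota>) = (%m n g f. cup A (%a x. \<iota> a \<cdot>\<^bsub>M\<^esub> x) m n g f)"
 "ract (hoch_bimod A M \<iota>) = (%m n g f. cup A (%x a. x \<cdot>\<^bsub>M\<^esub> \<iota> a) n m f g)"
 by (simp_all add: hoch_bimod_def hoch_cpx_def cpx.defs dgbimod.defs)

context hochschild
begin

lemma vector_space_cochains: "vector_space (%c (f :: 'a list => 'm) as. sM c (f as))"
proof unfold_locales
 fix a b :: 'k and x y :: "'a list => 'm"
 show "(%as. sM a ((x + y) as)) = (%as. sM a (x as)) + (%as. sM a (y as))"
  by (rule fun_plusI) (simp only: plus_fun_apply vector_space_add[OF vM])
 show "(%as. sM (a + b) (x as)) = (%as. sM a (x as)) + (%as. sM b (x as))"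
  by (rule fun_plusI) (rule vector_space_add_left[OF vM])
 show "(%as. sM a (sM b (x as))) = (%as. sM (a * b) (x as))"
  by (rule ext) (rule vector_space_mult[OF vM])
 show "(%as. sM 1 (x as)) = x"
  by (rule ext) (rule vector_space_one[OF vM])
qed

lemma additive_complex_hoch_bimod: "additive_complex (hoch_bimod A M \<iota>)"
proof (rule additive_complex.intro)
 show "is_complex (hoch_bimod A M \<iota>)"
  by (rule is_complex_cong[OF _ _ _ _ _ is_complex_hoch_cpx]) (simp_all only: hoch_cpx_simps hoch_bimod_simps)
qed (simp_all only: hoch_bimod_simps vector_space_cochains)

lemma additive_dg_algebra_hoch_alg: "additive_dg_algebra (hoch_alg A M \<iota>)"
 by (intro additive_dg_algebra.intro additive_complex.intro additive_dg_algebra_axioms.intro is_dg_algebra_hoch_alg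
  is_complex_hoch_alg) (simp_all only: hoch_alg_simps vector_space_cochains)

end

lemma twist_hopf_comult: "comult (twist_hopf H F) h =
  mult (tens_alg H H) (mult (tens_alg H H) (THE K. inverse_in (tens_alg H H) F K) (comult H h)) F"
 by (simp add: twist_hopf_def Let_def)

section \<open>Comparison of the twisted and the untwisted structures\<close>

context twisted_alg
begin

interpretation hB: hochschild A B "incl_A E A" by (rule hochschild_B)

lemma hochschild_BJ: "hochschild A BJ (incl_A E A)"
proof (rule hochschild.intro[OF alg_A alg_BJ])
 show "linear_on A BJ (incl_A E A)" using incl_A_linear by (simp add: linear_on_def)
 fix a b assume "a \<in> carrier A" "b \<in> carrier A"
 then show "incl_A E A (mult A a b) = mult BJ (incl_A E A a) (incl_A E A b)"
  by (simp add: mu_eq incl_A_eq mJ_eq mJ_ii_left ii_ii)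
qed

interpretation hJ: hochschild A BJ "incl_A E A" by (rule hochschild_BJ)

lemma Ml_BJ: "multilinear_maps A BJ = Ml"
 by (rule ext) (simp add: multilinear_maps_def linear_on_def)

lemma mult_BJ_ii:
 assumes "a \<in> carrier A" "b \<in> tens_carrier A E"
 shows "mult BJ (incl_A E A a) b = mult B (incl_A E A a) b" "mult BJ b (incl_A E A a) = mult B b (incl_A E A a)"
 using assms by (simp_all add: incl_A_eq mJ_eq mB_eq mJ_ii_left mJ_ii_right)

text \<open>The product of the coefficients occurs only in the first and the last term of the
  differential, each time with a factor from \<open>A\<close>.\<close>

lemma diff_BJ:
 assumes f: "f \<in> Ml n" shows "hJ.dd n f = hB.dd n f"
proof (rule ext)
 fix as show "hJ.dd n f as = hB.dd n f as"
 proof (cases "as \<in> tuples A (Suc n)")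
  case True
  then have t: "hd as \<in> carrier A" "last as \<in> carrier A" "tl as \<in> tuples A n" "butlast as \<in> tuples A n"
   by (cases as; auto simp: tuples_simps dest: in_set_butlastD)+
  show ?thesis
   using multilinear_maps_closed[OF f t(3)] multilinear_maps_closed[OF f t(4)]
   by (simp add: hoch_diff_def True mult_BJ_ii t)
 next
  case False show ?thesis by (simp only: hB.diff_outside[OF False] hJ.diff_outside[OF False])
 qed
qed

text \<open>\<open>F\<close> comes from \<open>E*\<close>, which acts on values by
  \<open>hact_dual\<close>, so the sum over the parts of \<open>J\<close> can be taken at each list
  of arguments.\<close>

lemma cup_BJ:
 assumes f: "f \<in> Ml k" and g: "g \<in> Ml n"
 shows "hJ.cp k n f g = Phi k n f g F"
proof (rule ext)
 fix as
 have "Phi k n f g F = (\<Sum>i\<in>nJ. hB.cp k n (hact k (te one (jl i)) f) (hact n (te one (jr i)) g))"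
  unfolding Phi_def using bilinear_on_amb[OF cup_hact_bilinear[OF f g]] by (intro lift_F[OF vector_space_sF]) simp
 then have 1: "Phi k n f g F as = (\<Sum>i\<in>nJ. hB.cp k n (hact k (te one (jl i)) f) (hact n (te one (jr i)) g) as)"
  by (simp only: sum_fun_apply)
 show "hJ.cp k n f g as = Phi k n f g F as"
 proof (cases "as \<in> tuples A (k + n)")
  case True
  note us = hB.tuples_take[OF True] and vs = hB.tuples_drop[OF True]
  show ?thesis
   unfolding 1 hB.cup_apply[OF True] hact_dual[OF f us jl_closed] hact_dual[OF g vs jr_closed]
   using multilinear_maps_closed[OF f us] multilinear_maps_closed[OF g vs]
   by (simp add: mB_eq mJ_eq mJ_sum)
 next
  case False show ?thesis unfolding 1 hB.cup_outside[OF False] by (simp only: sum.neutral_const)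
 qed
qed

abbreviation Tw where "Tw \<equiv> twist_hopf D F"

lemma twist_simps: "carrier Tw = tens_carrier E E'" "scale Tw = fscale" "mult Tw = Dm" "unity Tw = te one eps"
 "counit Tw = counit D"
 by (simp_all add: twist_hopf_def Let_def)

text \<open>Twisting changes the coproduct and the antipode but not the algebra.\<close>

lemma alg_Tw: "algebra Tw"
proof -
 have "algebra Tw = algebra D"
  unfolding algebra_def vec_space_def bilinear_on_def linear_on_def twist_simps D_simps ..
 then show ?thesis using alg_D by simp
qed

lemma Tw_tensor: "tens_carrier Tw Tw = tens_carrier ED ED" "lift Tw Tw = lift ED ED"
 by (rule tens_carrier_congr; simp add: twist_simps) (simp add: lift_def lift_into_congr[of Tw ED Tw ED] twist_simps)

lemma comult_D_closed: "h \<in> tens_carrier E E' ==> comult D h \<in> tens_carrier ED ED"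
 using comult_D_linear by (simp add: linear_on_def)

lemma comult_Tw:
 assumes h: "h \<in> tens_carrier E E'"
 shows "comult Tw h \<in> tens_carrier ED ED" "mult D2 F (comult Tw h) = mult D2 (comult D h) F"
proof -
 obtain J' where J': "inverse_in K2 J J'"
  using J by (auto simp: invertible_dual_cocycle_def Let_def)
 note i = the_inverse_embed_dual2[OF J_closed J', folded F_def]
 define K where "K = embed_dual2 E J'"
 have K: "comult Tw h = mult D2 (mult D2 K (comult D h)) F"
  unfolding twist_hopf_comult i(1) K_def ..
 note Kc = i(2)[folded K_def, unfolded inverse_in_def, THEN conjunct1]
  i(2)[folded K_def, unfolded inverse_in_def, THEN conjunct2, THEN conjunct1]
 note cl = bilinear_on_closed[OF algebra_bilinear[OF alg_D2]]
 have F: "F \<in> carrier D2" and d: "comult D h \<in> carrier D2"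
  using F_closed comult_D_closed[OF h] by simp_all
 have "comult Tw h \<in> carrier D2" unfolding K by (rule cl[OF cl[OF Kc(1) d] F])
 then show "comult Tw h \<in> tens_carrier ED ED" by simp
 have 1: "mult D2 F (mult D2 (mult D2 K (comult D h)) F) = mult D2 (mult D2 F (mult D2 K (comult D h))) F"
  by (rule algebra_assoc[OF alg_D2 F cl[OF Kc(1) d] F, symmetric])
 have 2: "mult D2 F (mult D2 K (comult D h)) = mult D2 (mult D2 F K) (comult D h)"
  by (rule algebra_assoc[OF alg_D2 F Kc(1) d, symmetric])
 show "mult D2 F (comult Tw h) = mult D2 (comult D h) F"
  unfolding K 1 2 Kc(2) algebra_unity_left[OF alg_D2 d] ..
qed

text \<open>\<open>Phi_mult\<close> reads the left side as \<open>Phi\<close> at the product of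
  \<open>comult D h\<close> and \<open>F\<close>, and the right side as \<open>Phi\<close> at the
  product of \<open>F\<close> and \<open>comult Tw h\<close>. These are equal by
  \<open>comult_Tw\<close>.\<close>

lemma hact_cup_BJ:
 assumes f: "f \<in> Ml k" and g: "g \<in> Ml n" and h: "h \<in> tens_carrier E E'"
 shows "hact (k + n) h (hJ.cp k n f g) = lift ED ED (%p q. hJ.cp k n (hact k p f) (hact n q g)) (comult Tw h)"
proof -
 have "hact (k + n) h (Phi k n f g F) = lift ED ED (%p q. hact (k + n) h (hB.cp k n (hact k p f) (hact n q g))) F"
  unfolding Phi_def
  by (rule linear_on_lift[OF hact_linear_fun[OF h] cup_hact_bilinear[OF f g] _ _ _ _ F_closed]) simp_all
 also have "... = lift ED ED (%p q. Phi k n (hact k p f) (hact n q g) (comult D h)) F"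
  unfolding Phi_def by (rule lift_cong, rule hact_cup) (simp_all add: hact_closed f g h)
 also have "... = Phi k n f g (mult D2 F (comult Tw h))"
  unfolding comult_Tw(2)[OF h] by (rule Phi_mult[OF f g comult_D_closed[OF h] F_closed])
 also have "... = lift ED ED (%p q. Phi k n (hact k p f) (hact n q g) F) (comult Tw h)"
  by (rule Phi_mult[symmetric, OF f g F_closed comult_Tw(1)[OF h]])
 also have "... = lift ED ED (%p q. hJ.cp k n (hact k p f) (hact n q g)) (comult Tw h)"
  by (rule lift_cong, rule cup_BJ[symmetric]) (simp_all add: hact_closed f g)
 finally show ?thesis by (simp only: cup_BJ[OF f g])
qed

lemma twisted_algebra:
 defines "CA \<equiv> hoch_alg A A (%a. a)" and "CB \<equiv> hoch_alg A B (incl_A E A)" and "CJ \<equiv> hoch_alg A BJ (incl_A E A)"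
 shows "dgbimod_eq CA (hoch_bimod A BJ (incl_A E A)) (hoch_bimod A B (incl_A E A))"
  and "dgbimod_eq (coh_alg CA) (coh_bimod (hoch_bimod A BJ (incl_A E A))) (coh_bimod (hoch_bimod A B (incl_A E A)))"
  and "dgalg_eq (dg_twist D F CB hact) CJ"
  and "dgalg_eq (dg_twist D F (coh_alg CB) (coh_act CB hact)) (coh_alg CJ)"
  and "is_dg_module_algebra Tw (coh_alg CJ) (coh_act CB hact)"
proof -
 interpret hA: hochschild A A "%a. a"
  by (rule hochschild.intro[OF alg_A alg_A]) (simp_all add: linear_on_def)
 interpret CA: additive_dg_algebra "hoch_alg A A (%a. a)" by (rule hA.additive_dg_algebra_hoch_alg)
 interpret MB: additive_complex "hoch_bimod A B (incl_A E A)" by (rule hB.additive_complex_hoch_bimod)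
 have "is_complex (hoch_alg A B (incl_A E A))" by (rule hB.is_complex_hoch_alg)
 then have mB': "is_dg_module D (hoch_alg A B (incl_A E A)) hact"
  by (intro is_dg_module_hact) (simp_all only: D_simps hB.hoch_alg_simps B_simps)
 have "is_complex (hoch_alg A BJ (incl_A E A))" by (rule hJ.is_complex_hoch_alg)
 then have mJ': "is_dg_module Tw (hoch_alg A BJ (incl_A E A)) hact"
  by (intro is_dg_module_hact) (simp_all only: twist_simps hJ.hoch_alg_simps BJ_simps Ml_BJ diff_BJ)
 interpret CB: additive_dg_module "hoch_alg A B (incl_A E A)" D hact
  by (intro additive_dg_module.intro additive_dg_module_axioms.intro hB.additive_dg_algebra_hoch_alg mB')
 interpret CJ: additive_dg_module "hoch_alg A BJ (incl_A E A)" Tw hact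
  by (intro additive_dg_module.intro additive_dg_module_axioms.intro hJ.additive_dg_algebra_hoch_alg mJ')
 show bim: "dgbimod_eq CA (hoch_bimod A BJ (incl_A E A)) (hoch_bimod A B (incl_A E A))"
 proof -
  have c: "cup A (%a x. mult BJ (incl_A E A a) x) k n r x as = cup A (%a x. mult B (incl_A E A a) x) k n r x as"
   "cup A (%x a. mult BJ x (incl_A E A a)) n k x r as = cup A (%x a. mult B x (incl_A E A a)) n k x r as"
   if r: "r \<in> multilinear_maps A A k" and x: "x \<in> Ml n" for k n r x as
  proof -
   show "cup A (%a x. mult BJ (incl_A E A a) x) k n r x as = cup A (%a x. mult B (incl_A E A a) x) k n r x as"
   proof (cases "as \<in> tuples A (k + n)")
    case True
    show ?thesis
     unfolding hB.cup_apply[OF True]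
     using multilinear_maps_closed[OF r hB.tuples_take[OF True]] multilinear_maps_closed[OF x hB.tuples_drop[OF True]]
     by (intro mult_BJ_ii(1)) simp_all
   next
    case False show ?thesis by (simp only: hB.cup_outside[OF False])
   qed
   show "cup A (%x a. mult BJ x (incl_A E A a)) n k x r as = cup A (%x a. mult B x (incl_A E A a)) n k x r as"
   proof (cases "as \<in> tuples A (n + k)")
    case True
    show ?thesis
     unfolding hB.cup_apply[OF True]
     using multilinear_maps_closed[OF x hB.tuples_take[OF True]] multilinear_maps_closed[OF r hB.tuples_drop[OF True]]
     by (intro mult_BJ_ii(2)) simp_all
   next
    case False show ?thesis by (simp only: hB.cup_outside[OF False])
   qed
  qed
  show ?thesis
   unfolding dgbimod_eq_def cpx_eq_def hoch_bimod_simps CA_def hA.hoch_alg_simps Ml_BJ BJ_simps B_simps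
   by (intro conjI allI ballI refl diff_BJ; (rule ext, rule c; assumption)?)
 qed
 have cong: "class_of (hoch_bimod A BJ (incl_A E A)) = class_of (hoch_bimod A B (incl_A E A))"
  "coh (hoch_bimod A BJ (incl_A E A)) = coh (hoch_bimod A B (incl_A E A))"
  by (rule MB.cohomology_cong; simp only: hoch_bimod_simps Ml_BJ BJ_simps B_simps diff_BJ)+
 show "dgbimod_eq (coh_alg CA) (coh_bimod (hoch_bimod A BJ (incl_A E A))) (coh_bimod (hoch_bimod A B (incl_A E A)))"
 proof (rule dgbimod_eq_coh[OF bim cong MB.class_closed])
  fix n U p assume "U \<in> gcar (coh_alg CA) n" "p \<in> U"
  then show "p \<in> gcar CA n" unfolding CA_def coh_alg_simps by (rule CA.class_closed)
 qed
 have tp: "twisted_product (+) 0 D F (hB.cp k n) (hact k) (hact n) f g = hJ.cp k n f g"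
  if "f \<in> Ml k" "g \<in> Ml n" for k n f g
  using cup_BJ[OF that] by (simp add: twisted_product_def Phi_def flip: lift_def)
 show eq: "dgalg_eq (dg_twist D F CB hact) CJ"
  unfolding dgalg_eq_def cpx_eq_def dg_twist_def CB_def CJ_def dgalg.simps cpx.simps
   hB.hoch_alg_simps hJ.hoch_alg_simps Ml_BJ BJ_simps B_simps
  by (simp add: tp diff_BJ hB.hoch_alg_simps)
 show "dgalg_eq (dg_twist D F (coh_alg CB) (coh_act CB hact)) (coh_alg CJ)"
  unfolding CB_def CJ_def
  by (rule CB.dg_twist_coh[OF vec_space_D _ eq[unfolded CB_def CJ_def]])
   (simp_all add: F_closed hB.hoch_alg_simps hJ.hoch_alg_simps Ml_BJ hJ.is_dg_algebra_hoch_alg)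
 \<comment> \<open>The action on cohomology is stated with classes of \<open>CB\<close>, whereas the
   module algebra is obtained over \<open>CJ\<close>. The classes coincide, as the differentials
   agree on cochains.\<close>
 have act: "coh_act CB hact = coh_act CJ hact"
 proof -
  have "class_of CB = class_of CJ"
   unfolding CB_def CJ_def
   by (rule CB.cohomology_cong(2)[symmetric])
    (simp_all only: hB.hoch_alg_simps hJ.hoch_alg_simps Ml_BJ BJ_simps B_simps diff_BJ)
  then show ?thesis by (simp add: coh_act_def fun_eq_iff)
 qed
 have "is_dg_module_algebra Tw (hoch_alg A BJ (incl_A E A)) hact"
  unfolding is_dg_module_algebra_def hJ.hoch_alg_simps
 proof (intro conjI allI ballI mJ' hJ.is_dg_algebra_hoch_alg)
  fix h assume "h \<in> carrier Tw"
  then show "hact 0 h (restr (tuples A 0) (%_. unity BJ)) =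
   (%as. scale BJ (counit Tw h) (restr (tuples A 0) (%_. unity BJ) as))"
   unfolding twist_simps BJ_simps by (rule hact_unit)
 next
  fix k n h f g assume "h \<in> carrier Tw" "f \<in> multilinear_maps A BJ k" "g \<in> multilinear_maps A BJ n"
  then show "hact (k + n) h (hJ.cp k n f g) = twisted_product (+) 0 Tw (comult Tw h) (hJ.cp k n) (hact k) (hact n) f g"
   unfolding twisted_product_def lift_def[symmetric] Tw_tensor twist_simps Ml_BJ by (intro hact_cup_BJ)
 qed
 then show "is_dg_module_algebra Tw (coh_alg CJ) (coh_act CB hact)"
  unfolding act unfolding CJ_def
  by (rule CJ.is_dg_module_algebra_coh[OF _ alg_Tw]) (simp add: twist_simps Tw_tensor comult_Tw)
qed

end

theorem proposition4p10:
  fixes E :: "('k::field, 'e::ab_group_add) hopf"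
    and A :: "('k, 'a::ab_group_add) alg"
    and act :: "'e \<Rightarrow> 'a \<Rightarrow> 'a"
    and J :: "('k, 'e \<Rightarrow> 'k, 'e \<Rightarrow> 'k) tensor"
  assumes "hopf_algebra E" and "finite_dim E"
    and "module_algebra E A act"
    and "invertible_dual_cocycle (dual_hopf E) J"
  shows "let B = smash E A act; B\<^sub>J = smash_twist E A act J; \<iota> = incl_A E A;
             CA = hoch_alg A A (\<lambda>a. a); CB = hoch_alg A B \<iota>; CBJ = hoch_alg A B\<^sub>J \<iota>;
             D = drinfeld_double E; F = embed_dual2 E J; dact = hoch_dact E A act
         in (dgbimod_eq CA (hoch_bimod A B\<^sub>J \<iota>) (hoch_bimod A B \<iota>) \<and>
             dgbimod_eq (coh_alg CA) (coh_bimod (hoch_bimod A B\<^sub>J \<iota>)) (coh_bimod (hoch_bimod A B \<iota>))) \<and>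
            (dgalg_eq (dg_twist D F CB dact) CBJ \<and>
             dgalg_eq (dg_twist D F (coh_alg CB) (coh_act CB dact)) (coh_alg CBJ)) \<and>
            is_dg_module_algebra (twist_hopf D F) (coh_alg CBJ) (coh_act CB dact)"
proof -
  interpret twisted_alg E A act J
    by unfold_locales (rule assms)+
  show ?thesis
    unfolding Let_def
    using twisted_algebra[unfolded B_def BJ_def D_def F_def] by blast
qed

end
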